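(* Let $d\ge 1$ and $1<p\le \min\{2,\,1+\tfrac{2}{d}\}$. Let $u\in C([0,\infty);L^2_{y,x}(\mathbb{R}^d\times\mathbb{T}))$ be a global solution of $$i\partial_t u+\Delta_{\mathbb{R}^d\times\mathbb{T}}u=|u|^{p-1}u .$$ Then for every nonzero $h\in L^2_{y,x}(\mathbb{R}^d\times\mathbb{T})$, $$\big\|u(t)-e^{it\Delta_{\mathbb{R}^d\times\mathbb{T}}}h\big\|_{L^2_{y,x}(\mathbb{R}^d\times\mathbb{T})}\not\to 0\quad\text{as } t\to\infty .$$ In other words, the only solution that is asymptotically free in $L^2$ is the zero solution; solutions do not scatter in $L^2_{y,x}$.
   Context: $\mathbb{T}=\mathbb{R}/(2\pi\mathbb{Z})$. Points of $\mathbb{R}^d\times\mathbb{T}$ are written $(y,x)$ with $y\in\mathbb{R}^d$, $x\in\mathbb{T}$, and $\Delta_{\mathbb{R}^d\times\mathbb{T}}=\Delta_y+\partial_x^2$. The operator $e^{it\Delta_{\mathbb{R}^d\times\mathbb{T}}}$ is the free Schrödinger propagator, which is unitary on $L^2_{y,x}$. *)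

theory Defs
  imports "HOL-Analysis.Analysis"
begin

definition dpart :: "'a::real_normed_vector \<Rightarrow> ('a \<Rightarrow> complex) \<Rightarrow> 'a \<Rightarrow> complex" where
  "dpart v f z = vector_derivative (\<lambda>s::real. f (z + s *\<^sub>R v)) (at 0)"

definition smooth_fun :: "('a::euclidean_space \<Rightarrow> complex) \<Rightarrow> bool" where
  "smooth_fun f \<longleftrightarrow>
     (\<forall>vs. continuous_on UNIV (fold dpart vs f) \<and>
           (\<forall>v z. (\<lambda>s::real. fold dpart vs f (z + s *\<^sub>R v)) differentiable (at 0)))"

section \<open>The space R^d x T, with T = R/(2 pi Z) realised by the fundamental domain [0,2pi)\<close>

definition fund_dom :: "((real^'d::finite) \<times> real) set" where
  "fund_dom = UNIV \<times> {0..<2*pi}"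

definition L2 :: "((real^'d::finite) \<times> real \<Rightarrow> complex) set" where
  "L2 = {f. f \<in> borel_measurable lborel \<and>
            set_integrable lborel fund_dom (\<lambda>z. (cmod (f z))\<^sup>2)}"

definition L2norm :: "((real^'d::finite) \<times> real \<Rightarrow> complex) \<Rightarrow> real" where
  "L2norm f = sqrt (LINT z:fund_dom|lborel. (cmod (f z))\<^sup>2)"

definition lap :: "((real^'d::finite) \<times> real \<Rightarrow> complex) \<Rightarrow> (real^'d) \<times> real \<Rightarrow> complex" where
  "lap f z = (\<Sum>b\<in>Basis. dpart b (dpart b f) z)"

definition test_fun :: "((real^'d::finite) \<times> real \<Rightarrow> complex) \<Rightarrow> bool" where
  "test_fun \<psi> \<longleftrightarrow> smooth_fun \<psi> \<and> (\<forall>y x. \<psi> (y, x + 2*pi) = \<psi> (y, x)) \<and>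
     (\<exists>R. \<forall>y x. norm y > R \<longrightarrow> \<psi> (y, x) = 0)"

definition st_test_fun :: "(real \<times> ((real^'d::finite) \<times> real) \<Rightarrow> complex) \<Rightarrow> bool" where
  "st_test_fun \<phi> \<longleftrightarrow> smooth_fun \<phi> \<and> (\<forall>t y x. \<phi> (t, (y, x + 2*pi)) = \<phi> (t, (y, x))) \<and>
     (\<exists>T0 T1 R. 0 < T0 \<and> (\<forall>t y x. (t < T0 \<or> t > T1 \<or> norm y > R) \<longrightarrow> \<phi> (t, (y, x)) = 0))"

definition fourier :: "((real^'d::finite) \<times> real \<Rightarrow> complex) \<Rightarrow> real^'d \<Rightarrow> int \<Rightarrow> complex" where
  "fourier \<psi> \<xi> k = (LINT z:fund_dom|lborel.
      exp (- \<i> * complex_of_real (fst z \<bullet> \<xi> + of_int k * snd z)) * \<psi> z)"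

text \<open>\<open>e^{is\<Delta>}\<close> on test functions, via the Fourier multiplier \<open>e^{-is(|\<xi>|^2+k^2)}\<close>
  (absolutely convergent for test functions).\<close>
definition schrod_test :: "real \<Rightarrow> ((real^'d::finite) \<times> real \<Rightarrow> complex) \<Rightarrow> (real^'d) \<times> real \<Rightarrow> complex" where
  "schrod_test s \<psi> z = complex_of_real (1 / (2*pi) ^ (CARD('d) + 1)) *
     (\<Sum>\<^sub>\<infinity>k::int. LINT \<xi>|lborel.
        exp (\<i> * complex_of_real (fst z \<bullet> \<xi> + of_int k * snd z)) *
        exp (- \<i> * complex_of_real (s * ((norm \<xi>)\<^sup>2 + (of_int k)\<^sup>2))) * fourier \<psi> \<xi> k)"

text \<open>\<open>g = e^{it\<Delta>}h\<close> for \<open>h \<in> L^2\<close>, defined by duality: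
  \<open>\<langle>g,\<psi>\<rangle> = \<langle>h, e^{-it\<Delta>}\<psi>\<rangle>\<close> for all test functions \<open>\<psi>\<close>.\<close>
definition is_free_evol :: "real \<Rightarrow> ((real^'d::finite) \<times> real \<Rightarrow> complex) \<Rightarrow> ((real^'d) \<times> real \<Rightarrow> complex) \<Rightarrow> bool" where
  "is_free_evol t h g \<longleftrightarrow> g \<in> L2 \<and>
     (\<forall>\<psi>. test_fun \<psi> \<longrightarrow>
        (LINT z:fund_dom|lborel. g z * cnj (\<psi> z)) =
        (LINT z:fund_dom|lborel. h z * cnj (schrod_test (- t) \<psi> z)))"

text \<open>The free propagator \<open>e^{it\<Delta>}h\<close> (determined up to a.e. equality; any representative).\<close>
definition free_prop :: "real \<Rightarrow> ((real^'d::finite) \<times> real \<Rightarrow> complex) \<Rightarrow> (real^'d) \<times> real \<Rightarrow> complex" where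
  "free_prop t h = (SOME g. is_free_evol t h g)"

text \<open>\<open>u \<in> C([0,\<infinity>); L^2)\<close> and u solves \<open>i u_t + \<Delta>u = |u|^{p-1}u\<close> in the sense of
  distributions on \<open>(0,\<infinity>) \<times> R^d \<times> T\<close>.\<close>
definition global_solution :: "real \<Rightarrow> (real \<Rightarrow> (real^'d::finite) \<times> real \<Rightarrow> complex) \<Rightarrow> bool" where
  "global_solution p u \<longleftrightarrow>
     (\<forall>t\<ge>0. u t \<in> L2) \<and>
     (\<forall>t0\<ge>0. ((\<lambda>t. L2norm (\<lambda>z. u t z - u t0 z)) \<longlongrightarrow> 0) (at t0 within {0..})) \<and>
     (\<lambda>w. u (fst w) (snd w)) \<in> borel_measurable lborel \<and>
     (\<forall>\<phi>. st_test_fun \<phi> \<longrightarrow>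
        (LINT w:({0<..} \<times> fund_dom)|lborel.
           u (fst w) (snd w) * (- \<i> * dpart (1, 0) \<phi> w +
             (\<Sum>b\<in>Basis. dpart (0, b) (dpart (0, b) \<phi>) w))) =
        (LINT w:({0<..} \<times> fund_dom)|lborel.
           complex_of_real (cmod (u (fst w) (snd w)) powr (p - 1)) * u (fst w) (snd w) * \<phi> w))"

end

theory Submission
  imports Defs "HOL-Probability.Probability" "HOL-Real_Asymp.Real_Asymp"
begin

text \<open>Suppose that \<open>u\<close> is asymptotic to the free evolution of \<open>h\<close>. Approximate \<open>h\<close> by finite
  combinations of coherent states (Gaussian in \<open>y\<close>, exponential in \<open>x\<close>), whose free evolution is explicit, and
  test the equation with \<open>\<theta>(t/T)\<close> times a coherent state. The linear terms telescope and are small, because the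
  pairing of two free waves is constant. In the variable \<open>\<xi> = y/2t\<close> the nonlinear term is \<open>(2t)\<^sup>-\<^sup>\<delta>\<close>, with
  \<open>\<delta> = d(p - 1)/2 \<le> 1\<close>, times an asymptotically \<open>2\<pi>\<close>-periodic function of \<open>t\<close>; its integral over \<open>[T, 2T]\<close> does
  not decay, so the mean of the periodic function is zero. In the limit, the profile \<open>H(\<xi>, t, x)\<close> of \<open>h\<close>, which for each
  \<open>\<xi>\<close> is a superposition of the waves \<open>exp (i(kx - k\<^sup>2t))\<close>, has \<open>|H|^(p-1) H\<close> orthogonal to all of these waves. The
  periodic \<open>L\<^sup>4\<close> Strichartz estimate puts \<open>|H|^(p-1) H\<close> in \<open>L\<^sup>2\<close>, so it is orthogonal to \<open>H\<close> itself, and \<open>H = 0\<close>.\<close>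

section \<open>Square-integrable functions\<close>

text \<open>Both conditions on \<open>p\<close> are power counting. A coherent state has size
  \<open>t powr (- d / 2)\<close>; tested against it, replacing \<open>u\<close> by an approximation
  with L2 error \<epsilon> changes the nonlinear term by at most a multiple of
  \<open>t powr - \<delta>\<close> times \<epsilon>, with the same power of \<open>t\<close> as the
  main term. Over [T, 2T] both carry T^(1 - \<delta>), while the linear error is of order
  \<epsilon>; the comparison succeeds because \<delta> <= 1, that is p <= 1 + 2/d. The bound p <= 2
  keeps the nonlinearity below 1 + |z|^2, so that it can be tested for functions merely in L2. The
  obstacle is uniformity: how fast a combination approaches its profile depends on the combination.
  Hence T tends to infinity first, for a fixed combination, and the remaining error must be
  \<epsilon> times a constant that is the same for all combinations of bounded norm. Gaussians are
  chosen because their evolution, Fourier transform, rescaled limit and pairings are explicit. The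
  waves exp (i (k x - k^2 t)) are not all the characters of the torus, so orthogonality to them
  alone does not force a function to vanish; this is why \<open>H\<close> must be paired with its
  own nonlinearity.\<close>

definition l2 :: "'a measure \<Rightarrow> ('a \<Rightarrow> complex) set" where
  "l2 M = {f. f \<in> borel_measurable M \<and> integrable M (\<lambda>x. (cmod (f x))\<^sup>2)}"

definition nrm :: "'a measure \<Rightarrow> ('a \<Rightarrow> complex) \<Rightarrow> real" where
  "nrm M f = sqrt (\<integral>x. (cmod (f x))\<^sup>2 \<partial>M)"

definition ip :: "'a measure \<Rightarrow> ('a \<Rightarrow> complex) \<Rightarrow> ('a \<Rightarrow> complex) \<Rightarrow> complex" where
  "ip M f g = (\<integral>x. f x * cnj (g x) \<partial>M)"

lemma l2_meas: "f \<in> l2 M \<Longrightarrow> f \<in> borel_measurable M"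
  by (simp add: l2_def)

lemma l2_int: "f \<in> l2 M \<Longrightarrow> integrable M (\<lambda>x. (cmod (f x))\<^sup>2)"
  by (simp add: l2_def)

lemma l2I: "f \<in> borel_measurable M \<Longrightarrow> integrable M (\<lambda>x. (cmod (f x))\<^sup>2) \<Longrightarrow> f \<in> l2 M"
  by (simp add: l2_def)

lemma nrm_nonneg [simp]: "0 \<le> nrm M f"
  by (simp add: nrm_def)

lemma nrm_sq: "(nrm M f)\<^sup>2 = (\<integral>x. (cmod (f x))\<^sup>2 \<partial>M)"
  by (simp add: nrm_def)

lemma norm_add_sq_le: "(norm (a + b))\<^sup>2 \<le> 2 * (norm a)\<^sup>2 + 2 * (norm (b::'a::real_normed_vector))\<^sup>2"
proof -
  have "(norm (a + b))\<^sup>2 \<le> (norm a + norm b)\<^sup>2"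
    by (intro power_mono norm_triangle_ineq) simp
  also have "\<dots> \<le> 2 * (norm a)\<^sup>2 + 2 * (norm b)\<^sup>2"
    using sum_squares_bound[of "norm a" "norm b"] by (simp add: power2_sum)
  finally show ?thesis .
qed

lemma l2_add: assumes "f \<in> l2 M" "g \<in> l2 M" shows "(\<lambda>x. f x + g x) \<in> l2 M"
proof (rule l2I)
  show [measurable]: "(\<lambda>x. f x + g x) \<in> borel_measurable M"
    using assms[THEN l2_meas] by measurable
  have "integrable M (\<lambda>x. 2 * (cmod (f x))\<^sup>2 + 2 * (cmod (g x))\<^sup>2)"
    by (intro Bochner_Integration.integrable_add integrable_mult_right assms[THEN l2_int])
  then show "integrable M (\<lambda>x. (cmod (f x + g x))\<^sup>2)"
    by (rule Bochner_Integration.integrable_bound) (simp_all add: norm_add_sq_le)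
qed

lemma l2_cmult: assumes "f \<in> l2 M" shows "(\<lambda>x. c * f x) \<in> l2 M"
  using assms by (auto simp: l2_def norm_mult power_mult_distrib)

lemma l2_uminus: "f \<in> l2 M \<Longrightarrow> (\<lambda>x. - f x) \<in> l2 M"
  by (auto simp: l2_def)

lemma l2_diff: assumes "f \<in> l2 M" "g \<in> l2 M" shows "(\<lambda>x. f x - g x) \<in> l2 M"
  using l2_add[OF assms(1) l2_uminus[OF assms(2)]] by simp

lemma l2_cnj: "f \<in> l2 M \<Longrightarrow> (\<lambda>x. cnj (f x)) \<in> l2 M"
  unfolding l2_def
  using measurable_comp[of f M borel cnj borel] borel_measurable_continuous_onI[of cnj]
  by (simp add: o_def continuous_on_cnj[OF continuous_on_id])

lemma l2_zero [simp]: "(\<lambda>x. 0) \<in> l2 M"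
  by (auto simp: l2_def)

lemma l2_mult_integrable:
  assumes "f \<in> l2 M" "g \<in> l2 M"
  shows "integrable M (\<lambda>x. cmod (f x) * cmod (g x))" "integrable M (\<lambda>x. f x * cnj (g x))" "integrable M (\<lambda>x. f x * g x)"
proof -
  note [measurable] = assms[THEN l2_meas] l2_cnj[OF assms(2), THEN l2_meas]
  have i: "integrable M (\<lambda>x. (cmod (f x))\<^sup>2 + (cmod (g x))\<^sup>2)"
    by (intro Bochner_Integration.integrable_add assms[THEN l2_int])
  have b: "cmod (f x) * cmod (g x) \<le> (cmod (f x))\<^sup>2 + (cmod (g x))\<^sup>2" for x
  proof -
    have "0 \<le> cmod (f x) * cmod (g x)" by simp
    with sum_squares_bound[of "cmod (f x)" "cmod (g x)"] show ?thesis by linarith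
  qed
  show "integrable M (\<lambda>x. cmod (f x) * cmod (g x))"
    by (rule Bochner_Integration.integrable_bound[OF i]) (auto intro!: AE_I2 simp: norm_mult b)
  show "integrable M (\<lambda>x. f x * cnj (g x))"
    by (rule Bochner_Integration.integrable_bound[OF i]) (auto intro!: AE_I2 simp: norm_mult b)
  show "integrable M (\<lambda>x. f x * g x)"
    by (rule Bochner_Integration.integrable_bound[OF i]) (auto intro!: AE_I2 simp: norm_mult b)
qed

text \<open>Integrates 2xy <= s x^2 + y^2 / s with the balancing weight
  \<open>s = (b + e) / (a + e)\<close>. The shift \<open>e\<close> keeps the weight defined and
  positive when a norm vanishes; it tends to 0 at the end.\<close>

lemma l2_CS:
  assumes "f \<in> l2 M" "g \<in> l2 M"
  shows "(\<integral>x. cmod (f x) * cmod (g x) \<partial>M) \<le> nrm M f * nrm M g"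
proof -
  define F where "F = (\<integral>x. cmod (f x) * cmod (g x) \<partial>M)"
  define a b where "a = nrm M f" and "b = nrm M g"
  have a0: "0 \<le> a" and b0: "0 \<le> b" by (simp_all add: a_def b_def)
  have main: "F \<le> (a + e) * (b + e)" if e: "e > 0" for e
  proof -
    define s where "s = (b + e) / (a + e)"
    have s: "s > 0" using a0 b0 e by (auto simp: s_def intro!: divide_pos_pos)
    have "2 * F = (\<integral>x. 2 * (cmod (f x) * cmod (g x)) \<partial>M)"
      by (simp add: F_def)
    also have "\<dots> \<le> (\<integral>x. s * (cmod (f x))\<^sup>2 + (1 / s) * (cmod (g x))\<^sup>2 \<partial>M)"
    proof (rule integral_mono)
      show "integrable M (\<lambda>x. 2 * (cmod (f x) * cmod (g x)))"
        using l2_mult_integrable[OF assms] by simp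
      show "integrable M (\<lambda>x. s * (cmod (f x))\<^sup>2 + 1 / s * (cmod (g x))\<^sup>2)"
        using assms[THEN l2_int] by simp
      fix x
      have "0 \<le> (sqrt s * cmod (f x) - cmod (g x) / sqrt s)\<^sup>2" by simp
      also have "\<dots> = s * (cmod (f x))\<^sup>2 + (1 / s) * (cmod (g x))\<^sup>2 - 2 * (cmod (f x) * cmod (g x))"
        using s by (simp add: power2_diff power_mult_distrib power_divide)
      finally show "2 * (cmod (f x) * cmod (g x)) \<le> s * (cmod (f x))\<^sup>2 + 1 / s * (cmod (g x))\<^sup>2" by simp
    qed
    also have "\<dots> = s * a\<^sup>2 + (1 / s) * b\<^sup>2"
      using assms[THEN l2_int] by (simp add: a_def b_def nrm_sq)
    also have "s * a\<^sup>2 \<le> s * (a + e)\<^sup>2"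
      using a0 e s by (intro mult_left_mono power_mono) auto
    also have "s * (a + e)\<^sup>2 = (a + e) * (b + e)"
      using a0 e by (simp add: s_def power2_eq_square)
    also have "(1 / s) * b\<^sup>2 \<le> (1 / s) * (b + e)\<^sup>2"
      using b0 e s by (intro mult_left_mono power_mono) auto
    also have "(1 / s) * (b + e)\<^sup>2 = (a + e) * (b + e)"
      using b0 e by (simp add: s_def power2_eq_square)
    finally show ?thesis by simp
  qed
  have "((\<lambda>e. (a + e) * (b + e)) \<longlongrightarrow> (a + 0) * (b + 0)) (at_right 0)"
    by (intro tendsto_intros)
  then have "F \<le> (a + 0) * (b + 0)"
    by (rule tendsto_lowerbound) (auto simp: eventually_at_right_less eventually_at_filter main)
  then show ?thesis by (simp add: F_def a_def b_def)
qed

lemma ip_le: 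
  assumes "f \<in> l2 M" "g \<in> l2 M"
  shows "cmod (ip M f g) \<le> nrm M f * nrm M g"
proof -
  have "cmod (ip M f g) \<le> (\<integral>x. cmod (f x * cnj (g x)) \<partial>M)"
    unfolding ip_def by (rule integral_norm_bound)
  also have "\<dots> \<le> nrm M f * nrm M g"
    using l2_CS[OF assms] by (simp add: norm_mult)
  finally show ?thesis .
qed

lemma nrm_triangle:
  assumes "f \<in> l2 M" "g \<in> l2 M"
  shows "nrm M (\<lambda>x. f x + g x) \<le> nrm M f + nrm M g"
proof (rule power2_le_imp_le)
  have "(nrm M (\<lambda>x. f x + g x))\<^sup>2 \<le> (\<integral>x. (cmod (f x))\<^sup>2 + 2 * (cmod (f x) * cmod (g x)) + (cmod (g x))\<^sup>2 \<partial>M)"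
    unfolding nrm_sq
  proof (rule integral_mono)
    show "integrable M (\<lambda>x. (cmod (f x + g x))\<^sup>2)"
      using l2_add[OF assms] by (rule l2_int)
    show "integrable M (\<lambda>x. (cmod (f x))\<^sup>2 + 2 * (cmod (f x) * cmod (g x)) + (cmod (g x))\<^sup>2)"
      using assms[THEN l2_int] l2_mult_integrable[OF assms] by simp
    fix x
    have "(cmod (f x + g x))\<^sup>2 \<le> (cmod (f x) + cmod (g x))\<^sup>2"
      by (intro power_mono norm_triangle_ineq) simp
    then show "(cmod (f x + g x))\<^sup>2 \<le> (cmod (f x))\<^sup>2 + 2 * (cmod (f x) * cmod (g x)) + (cmod (g x))\<^sup>2"
      by (simp add: power2_sum algebra_simps)
  qed
  also have "\<dots> = (nrm M f)\<^sup>2 + 2 * (\<integral>x. cmod (f x) * cmod (g x) \<partial>M) + (nrm M g)\<^sup>2"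
    using assms[THEN l2_int] l2_mult_integrable[OF assms] by (simp add: nrm_sq)
  also have "\<dots> \<le> (nrm M f + nrm M g)\<^sup>2"
    using l2_CS[OF assms] by (simp add: power2_sum algebra_simps)
  finally show "(nrm M (\<lambda>x. f x + g x))\<^sup>2 \<le> (nrm M f + nrm M g)\<^sup>2" .
qed simp

lemma nrm_cmult: "nrm M (\<lambda>x. c * f x) = cmod c * nrm M f"
  by (simp add: nrm_def norm_mult power_mult_distrib real_sqrt_mult)

lemma nrm_uminus: "nrm M (\<lambda>x. - f x) = nrm M f"
  by (simp add: nrm_def)

lemma nrm_triangle_minus:
  assumes "f \<in> l2 M" "g \<in> l2 M"
  shows "nrm M (\<lambda>x. f x - g x) \<le> nrm M f + nrm M g"
  using nrm_triangle[OF assms(1) l2_uminus[OF assms(2)]] by (simp add: nrm_uminus)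

lemma nrm_commute: "nrm M (\<lambda>x. f x - g x) = nrm M (\<lambda>x. g x - f x)"
  by (simp add: nrm_def norm_minus_commute)

lemma nrm_triangle_diff:
  assumes "f \<in> l2 M" "g \<in> l2 M" "h \<in> l2 M"
  shows "nrm M (\<lambda>x. f x - h x) \<le> nrm M (\<lambda>x. f x - g x) + nrm M (\<lambda>x. g x - h x)"
  using nrm_triangle[OF l2_diff[OF assms(1,2)] l2_diff[OF assms(2,3)]] by simp

lemma nrm_le_diff:
  assumes "f \<in> l2 M" "g \<in> l2 M"
  shows "nrm M f \<le> nrm M g + nrm M (\<lambda>x. f x - g x)"
  using nrm_triangle[OF assms(2) l2_diff[OF assms]] by simp

lemma nrm_tendsto:
  assumes "\<And>n. f n \<in> l2 M" "g \<in> l2 M" "(\<lambda>n. nrm M (\<lambda>x. f n x - g x)) \<longlonglongrightarrow> 0"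
  shows "(\<lambda>n. nrm M (f n)) \<longlonglongrightarrow> nrm M g"
proof (rule LIM_zero_cancel, rule tendsto_rabs_zero_cancel, rule tendsto_sandwich[OF _ _ tendsto_const assms(3)])
  have "\<bar>nrm M (f n) - nrm M g\<bar> \<le> nrm M (\<lambda>x. f n x - g x)" for n
    using nrm_le_diff[OF assms(1)[of n] assms(2)] nrm_le_diff[OF assms(2) assms(1)[of n]]
    by (simp add: nrm_commute[of M g])
  then show "\<forall>\<^sub>F n in sequentially. \<bar>nrm M (f n) - nrm M g\<bar> \<le> nrm M (\<lambda>x. f n x - g x)" by simp
qed simp

lemma ip_self: "f \<in> l2 M \<Longrightarrow> ip M f f = of_real ((nrm M f)\<^sup>2)"
  by (simp add: ip_def nrm_sq complex_norm_square[symmetric] del: of_real_power)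

lemma ip_cnj: "ip M g f = cnj (ip M f g)"
  unfolding ip_def by (simp add: mult.commute flip: Bochner_Integration.integral_cnj)

lemma ip_add_left: "f \<in> l2 M \<Longrightarrow> g \<in> l2 M \<Longrightarrow> h \<in> l2 M \<Longrightarrow> ip M (\<lambda>x. f x + g x) h = ip M f h + ip M g h"
  unfolding ip_def by (simp add: l2_mult_integrable distrib_right)

lemma ip_diff_left: "f \<in> l2 M \<Longrightarrow> g \<in> l2 M \<Longrightarrow> h \<in> l2 M \<Longrightarrow> ip M (\<lambda>x. f x - g x) h = ip M f h - ip M g h"
  unfolding ip_def by (simp add: l2_mult_integrable left_diff_distrib)

lemma ip_cmult_left: "ip M (\<lambda>x. c * f x) h = c * ip M f h"
  unfolding ip_def by (simp add: mult.assoc)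

lemma ip_diff_right: "f \<in> l2 M \<Longrightarrow> g \<in> l2 M \<Longrightarrow> h \<in> l2 M \<Longrightarrow> ip M h (\<lambda>x. f x - g x) = ip M h f - ip M h g"
  unfolding ip_def by (simp add: l2_mult_integrable right_diff_distrib)

lemma ip_add_right: "f \<in> l2 M \<Longrightarrow> g \<in> l2 M \<Longrightarrow> h \<in> l2 M \<Longrightarrow> ip M h (\<lambda>x. f x + g x) = ip M h f + ip M h g"
  unfolding ip_def by (simp add: l2_mult_integrable distrib_left)

lemma ip_cmult_right: "ip M h (\<lambda>x. c * f x) = cnj c * ip M h f"
  unfolding ip_def by (simp add: mult.left_commute)

lemma ip_tendsto:
  assumes "\<And>n. f n \<in> l2 M" "g \<in> l2 M" "h \<in> l2 M" "(\<lambda>n. nrm M (\<lambda>x. f n x - g x)) \<longlonglongrightarrow> 0"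
  shows "(\<lambda>n. ip M (f n) h) \<longlonglongrightarrow> ip M g h"
proof (rule LIM_zero_cancel, rule tendsto_norm_zero_cancel, rule tendsto_sandwich[OF _ _ tendsto_const])
  show "\<forall>\<^sub>F n in sequentially. norm (ip M (f n) h - ip M g h) \<le> nrm M (\<lambda>x. f n x - g x) * nrm M h"
    using ip_le[OF l2_diff[OF assms(1,2)] assms(3)] by (simp add: ip_diff_left assms)
  show "(\<lambda>n. nrm M (\<lambda>x. f n x - g x) * nrm M h) \<longlonglongrightarrow> 0"
    using tendsto_mult[OF assms(4) tendsto_const[of "nrm M h"]] by simp
qed auto

lemma nrm_eq_0_AE:
  assumes "f \<in> l2 M" "nrm M f = 0" shows "AE x in M. f x = 0"
proof -
  have "(\<integral>x. (cmod (f x))\<^sup>2 \<partial>M) = 0"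
    using assms(2) by (simp add: nrm_def)
  then have "AE x in M. (cmod (f x))\<^sup>2 = 0"
    using integral_nonneg_eq_0_iff_AE[OF l2_int[OF assms(1)]] by simp
  then show ?thesis by simp
qed

text \<open>Multiplication by the positive square-integrable weight \<open>w\<close> turns an L2
  Cauchy sequence into an L1 Cauchy sequence, by Cauchy-Schwarz, and so yields an a.e. convergent
  subsequence even when \<open>M\<close> is infinite. Dividing by \<open>w\<close> and applying
  Fatou gives the L2 limit. The subsequence is kept in the conclusion because the L^4 bound on the
  torus is later carried to the limit along it.\<close>

lemma l2_complete:
  fixes f :: "nat \<Rightarrow> 'a \<Rightarrow> complex" and w :: "'a \<Rightarrow> real"
  assumes f: "\<And>n. f n \<in> l2 M"
    and cau: "\<And>e. e > 0 \<Longrightarrow> \<exists>N. \<forall>i\<ge>N. \<forall>j\<ge>N. nrm M (\<lambda>x. f i x - f j x) < e"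
    and w: "w \<in> borel_measurable M" "\<And>x. 0 < w x" "integrable M (\<lambda>x. (w x)\<^sup>2)"
  shows "\<exists>g\<in>l2 M. (\<lambda>n. nrm M (\<lambda>x. f n x - g x)) \<longlonglongrightarrow> 0 \<and>
           (\<exists>r. strict_mono r \<and> (AE x in M. (\<lambda>n. f (r n) x) \<longlonglongrightarrow> g x))"
proof -
  note [measurable] = f[THEN l2_meas] w(1)
  have W: "(\<lambda>x. complex_of_real (w x)) \<in> l2 M"
    using w by (auto simp: l2_def)
  define s where "s n x = complex_of_real (w x) * f n x" for n x
  have 1: "integrable M (s n)" for n
    unfolding s_def by (rule l2_mult_integrable[OF W f])
  have 2: "\<exists>N. \<forall>i\<ge>N. \<forall>j\<ge>N. (\<integral>x. norm (s i x - s j x) \<partial>M) < e" if e: "e > 0" for e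
  proof -
    define e' where "e' = e / (nrm M (\<lambda>x. complex_of_real (w x)) + 1)"
    have pos: "nrm M (\<lambda>x. complex_of_real (w x)) + 1 > 0" by (rule add_nonneg_pos) simp_all
    have "e' > 0" using e pos by (simp add: e'_def)
    from cau[OF this] obtain N where N: "\<And>i j. i \<ge> N \<Longrightarrow> j \<ge> N \<Longrightarrow> nrm M (\<lambda>x. f i x - f j x) < e'"
      by blast
    have "(\<integral>x. norm (s i x - s j x) \<partial>M) < e" if "i \<ge> N" "j \<ge> N" for i j
    proof -
      have "(\<integral>x. norm (s i x - s j x) \<partial>M) = (\<integral>x. cmod (complex_of_real (w x)) * cmod (f i x - f j x) \<partial>M)"
        by (intro Bochner_Integration.integral_cong) (auto simp: s_def norm_mult right_diff_distrib[symmetric])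
      also have "\<dots> \<le> nrm M (\<lambda>x. complex_of_real (w x)) * nrm M (\<lambda>x. f i x - f j x)"
        by (rule l2_CS[OF W l2_diff[OF f f]])
      also have "\<dots> \<le> nrm M (\<lambda>x. complex_of_real (w x)) * e'"
        using N[OF that] by (intro mult_left_mono) auto
      also have "\<dots> < (nrm M (\<lambda>x. complex_of_real (w x)) + 1) * e'"
        using \<open>e' > 0\<close> by simp
      also have "\<dots> = e" using pos by (simp add: e'_def)
      finally show ?thesis .
    qed
    then show ?thesis by blast
  qed
  from cauchy_L1_AE_cauchy_subseq[OF 1 2] obtain r where r: "strict_mono r"
    and rc: "AE x in M. Cauchy (\<lambda>i. s (r i) x)" by blast
  define g where "g x = lim (\<lambda>i. f (r i) x)" for x
  have gm[measurable]: "g \<in> borel_measurable M" unfolding g_def by measurable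
  have conv: "AE x in M. (\<lambda>i. f (r i) x) \<longlonglongrightarrow> g x"
    using rc
  proof eventually_elim
    case (elim x)
    then have "convergent (\<lambda>i. s (r i) x)" by (rule Cauchy_convergent)
    then obtain l where "(\<lambda>i. s (r i) x) \<longlonglongrightarrow> l" by (auto simp: convergent_def)
    then have "(\<lambda>i. s (r i) x / complex_of_real (w x)) \<longlonglongrightarrow> l / complex_of_real (w x)"
      using w(2)[of x] by (intro tendsto_intros) auto
    then have "(\<lambda>i. f (r i) x) \<longlonglongrightarrow> l / complex_of_real (w x)"
      using w(2)[of x] by (simp add: s_def less_imp_neq[symmetric])
    then show ?case unfolding g_def by (simp add: limI)
  qed
  \<comment> \<open>The Cauchy bound at index \<open>n\<close> against late members of the
    subsequence passes to the a.e. limit; \<open>r i >= i\<close> places these members beyond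
    \<open>N\<close>.\<close>
  have fatou: "(\<integral>\<^sup>+x. ennreal ((cmod (f n x - g x))\<^sup>2) \<partial>M) \<le> ennreal (e\<^sup>2)"
    if N: "\<And>i. i \<ge> N \<Longrightarrow> nrm M (\<lambda>x. f n x - f i x) \<le> e" and e: "e > 0" for n N e
  proof -
    have "(\<integral>\<^sup>+x. ennreal ((cmod (f n x - g x))\<^sup>2) \<partial>M)
        = (\<integral>\<^sup>+x. liminf (\<lambda>i. ennreal ((cmod (f n x - f (r i) x))\<^sup>2)) \<partial>M)"
    proof (rule nn_integral_cong_AE)
      show "AE x in M. ennreal ((cmod (f n x - g x))\<^sup>2) = liminf (\<lambda>i. ennreal ((cmod (f n x - f (r i) x))\<^sup>2))"
        using conv
      proof eventually_elim
        case (elim x)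
        have "(\<lambda>i. ennreal ((cmod (f n x - f (r i) x))\<^sup>2)) \<longlonglongrightarrow> ennreal ((cmod (f n x - g x))\<^sup>2)"
          by (intro tendsto_ennrealI tendsto_intros elim)
        then show ?case by (intro lim_imp_Liminf[symmetric]) auto
      qed
    qed
    also have "\<dots> \<le> liminf (\<lambda>i. \<integral>\<^sup>+x. ennreal ((cmod (f n x - f (r i) x))\<^sup>2) \<partial>M)"
      by (rule nn_integral_liminf) measurable
    also have "\<dots> \<le> ennreal (e\<^sup>2)"
    proof (rule Liminf_le[OF sequentially_bot])
      show "\<forall>\<^sub>F i in sequentially. (\<integral>\<^sup>+x. ennreal ((cmod (f n x - f (r i) x))\<^sup>2) \<partial>M) \<le> ennreal (e\<^sup>2)"
      proof (rule eventually_sequentiallyI[of N])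
        fix i assume "i \<ge> N"
        then have "r i \<ge> N" using seq_suble[OF r, of i] by simp
        have "(\<integral>\<^sup>+x. ennreal ((cmod (f n x - f (r i) x))\<^sup>2) \<partial>M) = ennreal ((nrm M (\<lambda>x. f n x - f (r i) x))\<^sup>2)"
          unfolding nrm_sq using l2_int[OF l2_diff[OF f f]] by (intro nn_integral_eq_integral) auto
        also have "\<dots> \<le> ennreal (e\<^sup>2)"
          using N[OF \<open>r i \<ge> N\<close>] by (intro ennreal_leI power_mono) auto
        finally show "(\<integral>\<^sup>+x. ennreal ((cmod (f n x - f (r i) x))\<^sup>2) \<partial>M) \<le> ennreal (e\<^sup>2)" .
      qed
    qed
    finally show ?thesis .
  qed
  have main: "\<exists>N. \<forall>n\<ge>N. (\<lambda>x. f n x - g x) \<in> l2 M \<and> nrm M (\<lambda>x. f n x - g x) \<le> e" if e: "e > 0" for e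
  proof -
    from cau[OF e] obtain N where N: "\<And>i j. i \<ge> N \<Longrightarrow> j \<ge> N \<Longrightarrow> nrm M (\<lambda>x. f i x - f j x) < e"
      by blast
    have "(\<lambda>x. f n x - g x) \<in> l2 M \<and> nrm M (\<lambda>x. f n x - g x) \<le> e" if n: "n \<ge> N" for n
    proof
      have le: "(\<integral>\<^sup>+x. ennreal ((cmod (f n x - g x))\<^sup>2) \<partial>M) \<le> ennreal (e\<^sup>2)"
        by (rule fatou[of N]) (use N n e in \<open>auto intro: less_imp_le\<close>)
      show l: "(\<lambda>x. f n x - g x) \<in> l2 M"
      proof (rule l2I)
        show "integrable M (\<lambda>x. (cmod (f n x - g x))\<^sup>2)"
          using le by (intro integrableI_bounded) (auto intro: le_less_trans)
      qed measurable
      have "ennreal ((nrm M (\<lambda>x. f n x - g x))\<^sup>2) \<le> ennreal (e\<^sup>2)"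
        unfolding nrm_sq using le nn_integral_eq_integral[OF l2_int[OF l]] by simp
      then have "(nrm M (\<lambda>x. f n x - g x))\<^sup>2 \<le> e\<^sup>2" by simp
      then show "nrm M (\<lambda>x. f n x - g x) \<le> e" using e by (rule power2_le_imp_le[OF _ less_imp_le])
    qed
    then show ?thesis by blast
  qed
  have "g \<in> l2 M"
  proof -
    from main[of 1] obtain N where "(\<lambda>x. f N x - g x) \<in> l2 M" by auto
    from l2_diff[OF f[of N] this] show ?thesis by simp
  qed
  moreover have "(\<lambda>n. nrm M (\<lambda>x. f n x - g x)) \<longlonglongrightarrow> 0"
  proof (rule LIMSEQ_I)
    fix e :: real assume "e > 0"
    then obtain N where "\<forall>n\<ge>N. nrm M (\<lambda>x. f n x - g x) \<le> e / 2" using main[of "e/2"] by auto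
    with \<open>e > 0\<close> show "\<exists>N. \<forall>n\<ge>N. norm (nrm M (\<lambda>x. f n x - g x) - 0) < e"
      by (intro exI[of _ N]) (fastforce)
  qed
  ultimately show ?thesis using r conv by blast
qed

lemma nrm_diff_sq:
  assumes "f \<in> l2 M" "g \<in> l2 M"
  shows "(nrm M (\<lambda>x. f x - g x))\<^sup>2 = (nrm M f)\<^sup>2 - 2 * Re (ip M f g) + (nrm M g)\<^sup>2"
proof -
  have "complex_of_real ((nrm M (\<lambda>x. f x - g x))\<^sup>2) = ip M f f - ip M f g - (ip M g f - ip M g g)"
    unfolding ip_self[OF l2_diff[OF assms], symmetric]
    by (simp add: ip_diff_left ip_diff_right assms l2_diff)
  also have "\<dots> = of_real ((nrm M f)\<^sup>2) - (ip M f g + cnj (ip M f g)) + of_real ((nrm M g)\<^sup>2)"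
    by (simp add: ip_self assms ip_cnj[of M g f] del: of_real_power)
  also have "\<dots> = of_real ((nrm M f)\<^sup>2 - 2 * Re (ip M f g) + (nrm M g)\<^sup>2)"
    by (simp add: complex_add_cnj del: of_real_power)
  finally show ?thesis unfolding of_real_eq_iff .
qed

lemma nrm_parallelogram:
  assumes "f \<in> l2 M" "g \<in> l2 M"
  shows "(nrm M (\<lambda>x. f x - g x))\<^sup>2 + (nrm M (\<lambda>x. f x + g x))\<^sup>2 = 2 * (nrm M f)\<^sup>2 + 2 * (nrm M g)\<^sup>2"
proof -
  have "(nrm M (\<lambda>x. f x + g x))\<^sup>2 = (nrm M (\<lambda>x. f x - - g x))\<^sup>2" by simp
  also have "\<dots> = (nrm M f)\<^sup>2 - 2 * Re (ip M f (\<lambda>x. - g x)) + (nrm M g)\<^sup>2"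
    by (subst nrm_diff_sq) (simp_all add: assms l2_uminus nrm_uminus)
  also have "ip M f (\<lambda>x. - g x) = - ip M f g" by (simp add: ip_def)
  finally show ?thesis by (simp add: nrm_diff_sq assms)
qed

text \<open>The projection argument: a minimising sequence is Cauchy by the parallelogram identity,
  and the residual at the minimum is orthogonal to \<open>V\<close>, hence null by
  \<open>orth\<close>. The weight \<open>w\<close> is there for completeness.\<close>

lemma l2_dense:
  fixes V :: "('a \<Rightarrow> complex) set" and w :: "'a \<Rightarrow> real"
  assumes V: "V \<subseteq> l2 M" and V0: "(\<lambda>x. 0) \<in> V"
    and Vadd: "\<And>v v'. v \<in> V \<Longrightarrow> v' \<in> V \<Longrightarrow> (\<lambda>x. v x + v' x) \<in> V"
    and Vmult: "\<And>c v. v \<in> V \<Longrightarrow> (\<lambda>x. c * v x) \<in> V"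
    and orth: "\<And>r. r \<in> l2 M \<Longrightarrow> (\<And>v. v \<in> V \<Longrightarrow> ip M r v = 0) \<Longrightarrow> nrm M r = 0"
    and w: "w \<in> borel_measurable M" "\<And>x. 0 < w x" "integrable M (\<lambda>x. (w x)\<^sup>2)"
    and f: "f \<in> l2 M" and e: "e > 0"
  shows "\<exists>v\<in>V. nrm M (\<lambda>x. f x - v x) < e"
proof -
  define D where "D = (\<lambda>v. nrm M (\<lambda>x. f x - v x)) ` V"
  define d where "d = Inf D"
  have D: "D \<noteq> {}" "bdd_below D" using V0 by (auto simp: D_def intro!: bdd_belowI[of _ 0])
  have dle: "d \<le> nrm M (\<lambda>x. f x - v x)" if "v \<in> V" for v
    unfolding d_def using that D by (intro cInf_lower) (auto simp: D_def)
  have d0: "0 \<le> d" unfolding d_def using D by (intro cInf_greatest) (auto simp: D_def)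
  have "\<exists>v\<in>V. nrm M (\<lambda>x. f x - v x) < d + 1 / real (Suc n)" for n
  proof -
    have "Inf D < d + 1 / real (Suc n)" by (simp add: d_def)
    then show ?thesis using cInf_less_iff[OF D] by (auto simp: D_def)
  qed
  then obtain v where vV: "\<And>n. v n \<in> V" and v: "\<And>n. nrm M (\<lambda>x. f x - v n x) < d + 1 / real (Suc n)"
    by metis
  have vl: "v n \<in> l2 M" for n using V vV by auto
  have pl: "(nrm M (\<lambda>x. v i x - v j x))\<^sup>2 \<le> 2 * (d + 1 / real (Suc i))\<^sup>2 + 2 * (d + 1 / real (Suc j))\<^sup>2 - 4 * d\<^sup>2" for i j
  proof -
    let ?a = "\<lambda>x. f x - v j x" and ?b = "\<lambda>x. f x - v i x"
    \<comment> \<open>The midpoint of two members of \<open>V\<close> cannot be closer to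
      \<open>f\<close> than \<open>d\<close>, which bounds the sum in the parallelogram identity
      from below.\<close>
    have "(\<lambda>x. (1/2) * (v i x + v j x)) \<in> V" by (intro Vmult Vadd vV)
    from dle[OF this] have "d \<le> nrm M (\<lambda>x. (1/2) * (?a x + ?b x))" by (simp add: algebra_simps)
    then have "2 * d \<le> nrm M (\<lambda>x. ?a x + ?b x)" unfolding nrm_cmult by simp
    then have "(2 * d)\<^sup>2 \<le> (nrm M (\<lambda>x. ?a x + ?b x))\<^sup>2" using d0 by (intro power_mono) auto
    moreover have "(nrm M (\<lambda>x. ?a x - ?b x))\<^sup>2 + (nrm M (\<lambda>x. ?a x + ?b x))\<^sup>2 = 2 * (nrm M ?a)\<^sup>2 + 2 * (nrm M ?b)\<^sup>2"
      by (rule nrm_parallelogram) (intro l2_diff f vl)+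
    moreover have "(nrm M ?a)\<^sup>2 \<le> (d + 1 / real (Suc j))\<^sup>2" "(nrm M ?b)\<^sup>2 \<le> (d + 1 / real (Suc i))\<^sup>2"
      using v[of i] v[of j] by (auto intro!: power_mono)
    moreover have "(\<lambda>x. ?a x - ?b x) = (\<lambda>x. v i x - v j x)" by auto
    ultimately show ?thesis by (simp add: power_mult_distrib)
  qed
  have cau: "\<exists>N. \<forall>i\<ge>N. \<forall>j\<ge>N. nrm M (\<lambda>x. v i x - v j x) < e" if e: "e > 0" for e
  proof -
    have "(\<lambda>n. (4 * (d + 1 / real (Suc n))\<^sup>2 - 4 * d\<^sup>2)) \<longlonglongrightarrow> (4 * (d + 0)\<^sup>2 - 4 * d\<^sup>2)"
      by (intro tendsto_intros LIMSEQ_Suc lim_1_over_n)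
    then have "(\<lambda>n. (4 * (d + 1 / real (Suc n))\<^sup>2 - 4 * d\<^sup>2)) \<longlonglongrightarrow> 0" by simp
    from order_tendstoD(2)[OF this, of "e\<^sup>2"] e
    obtain N where N: "4 * (d + 1 / real (Suc N))\<^sup>2 - 4 * d\<^sup>2 < e\<^sup>2"
      by (auto simp: eventually_sequentially)
    have "nrm M (\<lambda>x. v i x - v j x) < e" if "i \<ge> N" "j \<ge> N" for i j
    proof -
      have "(d + 1 / real (Suc i))\<^sup>2 \<le> (d + 1 / real (Suc N))\<^sup>2" "(d + 1 / real (Suc j))\<^sup>2 \<le> (d + 1 / real (Suc N))\<^sup>2"
        using that d0 by (auto intro!: power_mono add_left_mono divide_left_mono)
      with pl[of i j] N have "(nrm M (\<lambda>x. v i x - v j x))\<^sup>2 < e\<^sup>2" by linarith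
      then show ?thesis by (rule power2_less_imp_less) (use e in simp)
    qed
    then show ?thesis by blast
  qed
  from l2_complete[OF vl cau w] obtain g where g: "g \<in> l2 M" and lim: "(\<lambda>n. nrm M (\<lambda>x. v n x - g x)) \<longlonglongrightarrow> 0"
    by blast
  define r where "r = (\<lambda>x. f x - g x)"
  have rl: "r \<in> l2 M" unfolding r_def by (intro l2_diff f g)
  have rd: "nrm M r \<le> d"
  proof (rule LIMSEQ_le_const)
    show "(\<lambda>n. (d + 1 / real (Suc n)) + nrm M (\<lambda>x. v n x - g x)) \<longlonglongrightarrow> d"
      using tendsto_add[OF tendsto_add[OF tendsto_const[of d] LIMSEQ_Suc[OF lim_1_over_n]] lim] by simp
    show "\<exists>N. \<forall>n\<ge>N. nrm M r \<le> d + 1 / real (Suc n) + nrm M (\<lambda>x. v n x - g x)"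
      using nrm_triangle_diff[OF f vl g] v by (force simp: r_def intro: order_trans[OF _ add_right_mono] less_imp_le)
  qed
  have dr: "d \<le> nrm M (\<lambda>x. r x - u x)" if u: "u \<in> V" for u
  proof (rule LIMSEQ_le_const)
    have ul: "u \<in> l2 M" using u V by auto
    show "(\<lambda>n. nrm M (\<lambda>x. r x - u x) + nrm M (\<lambda>x. v n x - g x)) \<longlonglongrightarrow> nrm M (\<lambda>x. r x - u x)"
      using tendsto_add[OF tendsto_const lim] by simp
    show "\<exists>N. \<forall>n\<ge>N. d \<le> nrm M (\<lambda>x. r x - u x) + nrm M (\<lambda>x. v n x - g x)"
    proof (intro exI[of _ 0] allI impI)
      fix n
      have "d \<le> nrm M (\<lambda>x. f x - (u x + v n x))" by (intro dle Vadd u vV)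
      also have "(\<lambda>x. f x - (u x + v n x)) = (\<lambda>x. (r x - u x) - (v n x - g x))" by (auto simp: r_def)
      also have "nrm M \<dots> \<le> nrm M (\<lambda>x. r x - u x) + nrm M (\<lambda>x. v n x - g x)"
        by (rule nrm_triangle_minus[OF l2_diff[OF rl ul] l2_diff[OF vl g]])
      finally show "d \<le> nrm M (\<lambda>x. r x - u x) + nrm M (\<lambda>x. v n x - g x)" .
    qed
  qed
  have ort: "ip M r u = 0" if u: "u \<in> V" for u
  proof (rule ccontr)
    assume nz: "ip M r u \<noteq> 0"
    have ul: "u \<in> l2 M" using u V by auto
    define z where "z = ip M r u"
    \<comment> \<open>Moving the residual by \<open>s * z\<close> times \<open>u\<close> cannot
      shorten it, so the gain linear in \<open>s\<close> is at most the quadratic cost.\<close>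
    have ineq: "2 * s * (cmod z)\<^sup>2 \<le> s\<^sup>2 * (cmod z)\<^sup>2 * (nrm M u)\<^sup>2" if "s > 0" for s :: real
    proof -
      have "(nrm M r)\<^sup>2 \<le> (nrm M (\<lambda>x. r x - (of_real s * z) * u x))\<^sup>2"
        using dr[OF Vmult[OF u]] rd by (intro power_mono) (auto intro: order_trans)
      also have "\<dots> = (nrm M r)\<^sup>2 - 2 * Re (ip M r (\<lambda>x. (of_real s * z) * u x)) + (nrm M (\<lambda>x. (of_real s * z) * u x))\<^sup>2"
        by (rule nrm_diff_sq[OF rl l2_cmult[OF ul]])
      also have "ip M r (\<lambda>x. (of_real s * z) * u x) = of_real (s * (cmod z)\<^sup>2)"
        unfolding ip_cmult_right z_def[symmetric] by (simp add: complex_norm_square mult.commute del: of_real_power)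
      also have "nrm M (\<lambda>x. (of_real s * z) * u x) = s * cmod z * nrm M u"
        unfolding nrm_cmult using that by (simp add: norm_mult)
      finally show ?thesis by (simp add: power_mult_distrib)
    qed
    have zp: "(cmod z)\<^sup>2 > 0" using nz by (simp add: z_def)
    \<comment> \<open>Chosen so that \<open>s\<close> times the squared norm of \<open>u\<close> is
      at most 1; the quadratic cost is then at most half of the linear gain.\<close>
    define s where "s = 1 / ((nrm M u)\<^sup>2 + 1)"
    have s: "s > 0" unfolding s_def by (intro divide_pos_pos add_nonneg_pos) auto
    have "2 * s * (cmod z)\<^sup>2 \<le> (s * (nrm M u)\<^sup>2) * (s * (cmod z)\<^sup>2)"
      using ineq[OF s] by (simp add: power2_eq_square algebra_simps)
    also have "s * (nrm M u)\<^sup>2 \<le> 1" unfolding s_def by (simp add: divide_le_eq_1 add_nonneg_pos)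
    then have "(s * (nrm M u)\<^sup>2) * (s * (cmod z)\<^sup>2) \<le> 1 * (s * (cmod z)\<^sup>2)"
      using s by (intro mult_right_mono) auto
    finally show False using s zp by (simp add: mult_le_0_iff)
  qed
  have r0: "nrm M r = 0" by (rule orth[OF rl ort])
  have "nrm M (\<lambda>x. f x - v n x) \<le> nrm M (\<lambda>x. v n x - g x)" for n
    using nrm_triangle_diff[OF f g vl[of n]] r0 nrm_commute[of M g "v n"] by (simp add: r_def)
  moreover obtain n where "nrm M (\<lambda>x. v n x - g x) < e"
    using order_tendstoD(2)[OF lim e] by (auto simp: eventually_sequentially)
  ultimately show ?thesis using vV by (meson le_less_trans)
qed

section \<open>Gaussian integrals\<close>

lemma integrable_real_gaussian:
  assumes "0 < (c::real)"
  shows "integrable lborel (\<lambda>x::real. exp (- c * x\<^sup>2))"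
proof -
  define s where "s = 1 / sqrt (2 * c)"
  have s: "s > 0" "2 * s\<^sup>2 = 1 / c" using assms by (auto simp: s_def power_divide)
  have "integrable lborel (\<lambda>x. sqrt (2 * pi * s\<^sup>2) * normal_density 0 s x)"
    by (intro integrable_mult_right integrable_normal_density s)
  also have "(\<lambda>x. sqrt (2 * pi * s\<^sup>2) * normal_density 0 s x) = (\<lambda>x. exp (- c * x\<^sup>2))"
    using s assms by (auto simp: normal_density_def fun_eq_iff)
  finally show ?thesis .
qed

lemma DERIV_exp_neg_square_half:
  fixes w :: "complex \<Rightarrow> complex"
  assumes "(w has_field_derivative w') (at z)"
  shows "((\<lambda>z. exp (- (w z)\<^sup>2 / 2)) has_field_derivative (exp (- (w z)\<^sup>2 / 2) * (- w z * w'))) (at z)"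
  by (rule derivative_eq_intros assms refl | simp)+

text \<open>The contour of the Gaussian integral is deformed along the affine path from
  \<open>(1, 0)\<close> to \<open>(\<alpha>, \<beta>)\<close>; the derivative along the path is an exact \<open>\<xi>\<close>-derivative.\<close>

lemma gaussian_contour:
  fixes \<alpha> \<beta> :: complex
  assumes \<alpha>: "\<bar>Im \<alpha>\<bar> < Re \<alpha>"
  shows "integrable lborel (\<lambda>x::real. exp (- (\<alpha> * of_real x + \<beta>)\<^sup>2 / 2))"
    and "\<alpha> * (\<integral>x. exp (- (\<alpha> * of_real x + \<beta>)\<^sup>2 / 2) \<partial>lborel) = of_real (sqrt (2 * pi))"
proof -
  define a where "a s = 1 + of_real s * (\<alpha> - 1)" for s :: real
  define b where "b s = of_real s * \<beta>" for s :: real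
  define E where "E s x = exp (- (a s * of_real x + b s)\<^sup>2 / 2)" for s x :: real
  \<comment> \<open>The cone Re > |Im| is convex and contains both 1 and \<alpha>; \<open>m\<close>
    bounds Re - |Im| from below along the whole path and so makes the Gaussian decay uniform in
    \<open>s\<close>.\<close>
  define m where "m = min 1 (Re \<alpha> - \<bar>Im \<alpha>\<bar>)"
  have m: "m > 0" using \<alpha> by (simp add: m_def)
  define c where "c = (1 + cmod \<alpha>) * cmod \<beta>"
  define K where "K = exp (c\<^sup>2 / m\<^sup>2 + (cmod \<beta>)\<^sup>2 / 2)"
  have Ebound: "cmod (E s x) \<le> K * exp (- (m\<^sup>2 / 4) * x\<^sup>2)" if s: "0 \<le> s" "s \<le> 1" for s x
  proof -
    have re: "Re (a s) = (1 - s) + s * Re \<alpha>" "Im (a s) = s * Im \<alpha>"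
      by (simp_all add: a_def algebra_simps)
    have "(1 - s) * m + s * m \<le> (1 - s) * 1 + s * (Re \<alpha> - \<bar>Im \<alpha>\<bar>)"
      using s by (intro add_mono mult_left_mono) (auto simp: m_def)
    then have ms: "m \<le> Re (a s) - \<bar>Im (a s)\<bar>"
      using s by (simp add: re abs_mult algebra_simps)
    have "m\<^sup>2 \<le> (Re (a s) - \<bar>Im (a s)\<bar>) * (Re (a s) + \<bar>Im (a s)\<bar>)"
      unfolding power2_eq_square using m ms by (intro mult_mono) auto
    also have "\<dots> = Re ((a s)\<^sup>2)" by (simp add: Re_power2 algebra_simps power2_eq_square)
    finally have m2: "m\<^sup>2 \<le> Re ((a s)\<^sup>2)" .
    have na: "cmod (a s) \<le> 1 + cmod \<alpha>"
    proof -
      have "a s = of_real (1 - s) + of_real s * \<alpha>" by (simp add: a_def algebra_simps)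
      also have "cmod \<dots> \<le> (1 - s) + s * cmod \<alpha>"
        using s by (intro order_trans[OF norm_triangle_ineq]) (simp add: norm_mult del: of_real_diff)
      also have "\<dots> \<le> 1 + cmod \<alpha>"
        using s mult_right_mono[of s 1 "cmod \<alpha>"] by simp
      finally show ?thesis .
    qed
    have nb: "cmod (b s) \<le> cmod \<beta>" using s mult_right_mono[of s 1 "cmod \<beta>"] by (simp add: b_def norm_mult)
    have "(a s * of_real x + b s)\<^sup>2 = (a s)\<^sup>2 * of_real (x\<^sup>2) + 2 * (a s * b s * of_real x) + (b s)\<^sup>2"
      by (simp add: power2_eq_square algebra_simps)
    then have "Re ((a s * of_real x + b s)\<^sup>2) = Re ((a s)\<^sup>2) * x\<^sup>2 + 2 * Re (a s * b s * of_real x) + Re ((b s)\<^sup>2)"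
      by (simp del: of_real_power)
    moreover have "- Re (a s * b s * of_real x) \<le> c * \<bar>x\<bar>"
    proof -
      have "- Re (a s * b s * of_real x) \<le> cmod (a s * b s * of_real x)"
        using abs_Re_le_cmod[of "a s * b s * of_real x"] by linarith
      also have "\<dots> \<le> (1 + cmod \<alpha>) * cmod \<beta> * \<bar>x\<bar>"
        unfolding norm_mult using na nb by (intro mult_mono) auto
      finally show ?thesis by (simp add: c_def)
    qed
    moreover have "- Re ((b s)\<^sup>2) \<le> (cmod \<beta>)\<^sup>2"
    proof -
      have "- Re ((b s)\<^sup>2) \<le> cmod ((b s)\<^sup>2)" using abs_Re_le_cmod[of "(b s)\<^sup>2"] by linarith
      also have "\<dots> \<le> (cmod \<beta>)\<^sup>2" using nb by (simp add: norm_power power_mono)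
      finally show ?thesis .
    qed
    moreover have "m\<^sup>2 * x\<^sup>2 \<le> Re ((a s)\<^sup>2) * x\<^sup>2" using m2 by (rule mult_right_mono) simp
    \<comment> \<open>Young's inequality: the linear term consumes half of the available decay rate
      m^2 / 2, and m^2 / 4 remains.\<close>
    moreover have "c * \<bar>x\<bar> \<le> m\<^sup>2 / 4 * x\<^sup>2 + c\<^sup>2 / m\<^sup>2"
    proof -
      have "0 \<le> (m / 2 * \<bar>x\<bar> - c / m)\<^sup>2" by simp
      also have "\<dots> = m\<^sup>2 / 4 * x\<^sup>2 + c\<^sup>2 / m\<^sup>2 - c * \<bar>x\<bar>"
        using m by (simp add: power2_diff power_mult_distrib power_divide)
      finally show ?thesis by simp
    qed
    ultimately have "Re (- (a s * of_real x + b s)\<^sup>2 / 2) \<le> (c\<^sup>2 / m\<^sup>2 + (cmod \<beta>)\<^sup>2 / 2) + - (m\<^sup>2 / 4) * x\<^sup>2"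
      unfolding minus_divide_left[symmetric] uminus_complex.sel Re_divide_numeral by argo
    then show ?thesis unfolding E_def K_def norm_exp_eq_Re exp_add[symmetric] by simp
  qed
  have Em: "E s \<in> borel_measurable borel" for s
    unfolding E_def by (intro borel_measurable_continuous_onI continuous_intros) auto
  have Bint: "integrable lborel (\<lambda>x. K * exp (- (m\<^sup>2 / 4) * x\<^sup>2))"
    using m by (intro integrable_mult_right integrable_real_gaussian) simp
  have Eint: "integrable lborel (E s)" if "0 \<le> s" "s \<le> 1" for s
    by (rule Bochner_Integration.integrable_bound[OF Bint])
       (use Em Ebound[OF that] in \<open>auto intro!: AE_I2 order_trans[OF _ abs_ge_self]\<close>)
  \<comment> \<open>Truncation to [-n, n] permits differentiation under the integral. The
    \<open>s\<close>-derivative is then a difference of two boundary values of \<open>q\<close>,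
    which tends to 0 by \<open>Ebound\<close>.\<close>
  define J where "J n s = integral {-real n..real n} (\<lambda>x. a s * E s x)" for n s
  define q where "q s x = ((\<alpha> - 1) * of_real x + \<beta>) * E s x" for s x :: real
  define Q where "Q s x = ((\<alpha> - 1) * E s x + ((\<alpha> - 1) * of_real x + \<beta>) * (E s x * (- (a s * of_real x + b s) * a s)))" for s x :: real
  have qd: "(q s has_vector_derivative Q s x) (at x within S)" for s x S
  proof -
    have "((\<lambda>z. ((\<alpha> - 1) * z + \<beta>) * exp (- (a s * z + b s)\<^sup>2 / 2)) has_field_derivative Q s x) (at (of_real x))"
      unfolding Q_def E_def
      by (rule DERIV_cong[OF DERIV_mult[OF _ DERIV_exp_neg_square_half]])
         (rule derivative_eq_intros refl | simp)+
    from has_vector_derivative_real_field[OF this] show ?thesis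
      unfolding q_def E_def by (rule has_vector_derivative_at_within)
  qed
  have rd: "((\<lambda>s. a s * E s x) has_vector_derivative Q s x) (at s within S)" for s x S
  proof -
    have "((\<lambda>z. (1 + z * (\<alpha> - 1)) * exp (- ((1 + z * (\<alpha> - 1)) * of_real x + z * \<beta>)\<^sup>2 / 2)) has_field_derivative Q s x) (at (of_real s))"
      unfolding Q_def E_def a_def b_def
      by (rule DERIV_cong[OF DERIV_mult[OF _ DERIV_exp_neg_square_half]])
         (rule derivative_eq_intros refl | simp add: algebra_simps)+
    from has_vector_derivative_real_field[OF this] show ?thesis
      unfolding E_def a_def b_def by (rule has_vector_derivative_at_within)
  qed
  have contQ: "continuous_on S (\<lambda>(s, x). Q s x)" for S
  proof -
    have "continuous_on UNIV (\<lambda>p. Q (fst p) (snd p))"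
      unfolding Q_def E_def a_def b_def by (intro continuous_intros) auto
    then show ?thesis by (auto simp: case_prod_unfold intro: continuous_on_subset)
  qed
  have Jd: "(J n has_vector_derivative (q s (real n) - q s (- real n))) (at s within {0..1})" if "s \<in> {0..1}" for n s
  proof -
    have "(J n has_vector_derivative integral (cbox (-real n) (real n)) (Q s)) (at s within {0..1})"
      unfolding J_def cbox_interval[of "- real n" "real n", symmetric]
    proof (rule leibniz_rule_vector_derivative[where U = "{0..1}"])
      fix s :: real
      show "(\<lambda>x. a s * E s x) integrable_on cbox (- real n) (real n)"
        unfolding E_def by (intro integrable_continuous continuous_intros) auto
    qed (use that rd contQ in auto)
    also have "integral (cbox (-real n) (real n)) (Q s) = q s (real n) - q s (- real n)"
      unfolding cbox_interval by (intro integral_unique fundamental_theorem_of_calculus qd) auto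
    finally show ?thesis .
  qed
  define D where "D n = 2 * ((cmod (\<alpha> - 1) * real n + cmod \<beta>) * (K * exp (- (m\<^sup>2 / 4) * (real n)\<^sup>2)))" for n
  have Jdiff: "cmod (J n 1 - J n 0) \<le> D n" for n
  proof -
    have "cmod (J n 1 - J n 0) \<le> D n * norm (1 - 0 :: real)"
    proof (rule differentiable_bound[of "{0..1}" "J n" "\<lambda>s h. h *\<^sub>R (q s (real n) - q s (- real n))"])
      fix s :: real assume s: "s \<in> {0..1}"
      show "(J n has_derivative (\<lambda>h. h *\<^sub>R (q s (real n) - q s (- real n)))) (at s within {0..1})"
        using Jd[OF s] by (simp add: has_vector_derivative_def)
      have qb: "cmod (q s x) \<le> D n / 2" if "\<bar>x\<bar> = real n" for x
      proof -
        have x2: "x\<^sup>2 = (real n)\<^sup>2" using that by (metis power2_abs)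
        have "cmod ((\<alpha> - 1) * of_real x + \<beta>) \<le> cmod (\<alpha> - 1) * real n + cmod \<beta>"
          using that by (intro order_trans[OF norm_triangle_ineq]) (simp add: norm_mult)
        moreover have "cmod (E s x) \<le> K * exp (- (m\<^sup>2 / 4) * (real n)\<^sup>2)"
          using Ebound[of s x] s x2 by simp
        ultimately show ?thesis unfolding q_def norm_mult D_def by (simp add: mult_mono)
      qed
      have "norm (h *\<^sub>R (q s (real n) - q s (- real n))) \<le> norm h * D n" for h
        using qb[of "real n"] qb[of "- real n"] norm_triangle_ineq4[of "q s (real n)" "q s (- real n)"]
        by (auto intro!: mult_left_mono)
      then show "onorm (\<lambda>h. h *\<^sub>R (q s (real n) - q s (- real n))) \<le> D n"
        by (intro onorm_le) (simp add: mult.commute)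
    qed auto
    then show ?thesis by simp
  qed
  have "(\<lambda>n. 2 * ((k * real n + l) * (K * exp (- (m\<^sup>2 / 4) * (real n)\<^sup>2)))) \<longlonglongrightarrow> 0" for k l
    using m by real_asymp
  then have D0: "D \<longlonglongrightarrow> 0" unfolding D_def .
  have Jlim: "(\<lambda>n. J n s) \<longlonglongrightarrow> a s * (\<integral>x. E s x \<partial>lborel)" if s: "0 \<le> s" "s \<le> 1" for s
  proof -
    have "(\<lambda>n. \<integral>x. indicator {-real n..real n} x *\<^sub>R (a s * E s x) \<partial>lborel) \<longlonglongrightarrow> (\<integral>x. a s * E s x \<partial>lborel)"
    proof (rule integral_dominated_convergence[where w = "\<lambda>x. cmod (a s * E s x)"])
      show "integrable lborel (\<lambda>x. cmod (a s * E s x))"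
        using Eint[OF s] by simp
      show "AE x in lborel. (\<lambda>n. indicator {-real n..real n} x *\<^sub>R (a s * E s x)) \<longlonglongrightarrow> a s * E s x"
      proof (rule AE_I2, rule tendsto_eventually)
        fix x :: real
        obtain N where "\<bar>x\<bar> \<le> real N" using real_arch_simple by blast
        then show "\<forall>\<^sub>F n in sequentially. indicator {-real n..real n} x *\<^sub>R (a s * E s x) = a s * E s x"
          by (intro eventually_sequentiallyI[of N]) (auto simp: indicator_def)
      qed
    qed (use Em in \<open>auto simp: indicator_def\<close>)
    moreover have "(\<integral>x. indicator {-real n..real n} x *\<^sub>R (a s * E s x) \<partial>lborel) = J n s" for n
    proof -
      have "set_integrable lborel {-real n..real n} (\<lambda>x. a s * E s x)"
        unfolding set_integrable_def using Eint[OF s] by (intro integrable_mult_indicator integrable_mult_right) auto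
      from set_borel_integral_eq_integral(2)[OF this] show ?thesis
        unfolding set_lebesgue_integral_def J_def .
    qed
    ultimately show ?thesis using Eint[OF s] by simp
  qed
  have "(\<lambda>n. J n 1 - J n 0) \<longlonglongrightarrow> a 1 * (\<integral>x. E 1 x \<partial>lborel) - a 0 * (\<integral>x. E 0 x \<partial>lborel)"
    by (intro tendsto_diff Jlim) auto
  moreover have "(\<lambda>n. J n 1 - J n 0) \<longlonglongrightarrow> 0"
    by (rule Lim_null_comparison[OF _ D0]) (simp add: Jdiff)
  ultimately have eq: "a 1 * (\<integral>x. E 1 x \<partial>lborel) = a 0 * (\<integral>x. E 0 x \<partial>lborel)"
    using LIMSEQ_unique by fastforce
  have E1: "E 1 = (\<lambda>x. exp (- (\<alpha> * of_real x + \<beta>)\<^sup>2 / 2))" "a 1 = \<alpha>" by (simp_all add: E_def a_def b_def fun_eq_iff)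
  have "(\<integral>x. E 0 x \<partial>lborel) = (\<integral>x. complex_of_real (sqrt (2 * pi) * normal_density 0 1 x) \<partial>lborel)"
    by (intro Bochner_Integration.integral_cong) (simp_all add: E_def a_def b_def normal_density_def real_sqrt_mult exp_of_real[symmetric])
  also have "\<dots> = of_real (sqrt (2 * pi) * 1)"
    unfolding integral_complex_of_real by simp
  finally show "\<alpha> * (\<integral>x. exp (- (\<alpha> * of_real x + \<beta>)\<^sup>2 / 2) \<partial>lborel) = of_real (sqrt (2 * pi))"
    using eq unfolding E1 by (simp add: a_def)
  show "integrable lborel (\<lambda>x::real. exp (- (\<alpha> * of_real x + \<beta>)\<^sup>2 / 2))"
    using Eint[of 1] unfolding E1 by simp
qed

lemma csqrt_Im_less_Re:
  assumes "0 < Re A" shows "\<bar>Im (csqrt A)\<bar> < Re (csqrt A)"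
proof -
  have "(Re (csqrt A))\<^sup>2 - (Im (csqrt A))\<^sup>2 > 0"
    using assms Re_power2[of "csqrt A"] by simp
  then have "\<bar>Im (csqrt A)\<bar>\<^sup>2 < (Re (csqrt A))\<^sup>2" by simp
  then show ?thesis by (rule power2_less_imp_less) (use assms in \<open>simp add: add_nonneg_nonneg\<close>)
qed

lemma gaussian_fourier_1:
  fixes y :: real
  assumes A: "0 < Re A"
  shows "integrable lborel (\<lambda>x::real. exp (\<i> * of_real (y * x) - A * of_real (x\<^sup>2) / 2))"
    and "(\<integral>x. exp (\<i> * of_real (y * x) - A * of_real (x\<^sup>2) / 2) \<partial>lborel)
          = of_real (sqrt (2 * pi)) / csqrt A * exp (- of_real (y\<^sup>2) / (2 * A))"
proof -
  define \<alpha> where "\<alpha> = csqrt A"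
  have A0: "A \<noteq> 0" using A by auto
  have \<alpha>2: "\<alpha> * \<alpha> = A" "\<alpha> \<noteq> 0" using A0 by (auto simp: \<alpha>_def power2_eq_square[symmetric])
  have eq: "exp (\<i> * of_real (y * x) - A * of_real (x\<^sup>2) / 2)
     = exp (- of_real (y\<^sup>2) / (2 * A)) * exp (- (\<alpha> * of_real x + (- \<i> * of_real y / \<alpha>))\<^sup>2 / 2)" for x
  proof -
    have "(\<alpha> * of_real x + (- \<i> * of_real y / \<alpha>))\<^sup>2 = A * of_real (x\<^sup>2) - 2 * (\<i> * of_real (y * x)) - of_real (y\<^sup>2) / A"
      using \<alpha>2 by (simp add: power2_diff power_mult_distrib power_divide power2_eq_square[of \<alpha>])
    then show ?thesis unfolding exp_add[symmetric]
      by (intro arg_cong[of _ _ exp]) (simp add: diff_divide_distrib add_divide_distrib)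
  qed
  \<comment> \<open>Completing the square with slope \<open>\<alpha> = csqrt A\<close> leaves the
    complex offset \<open>- \<i> * y / \<alpha>\<close>, which the contour lemma allows.\<close>
  note G = gaussian_contour[OF csqrt_Im_less_Re[OF A], of "- \<i> * of_real y / \<alpha>", folded \<alpha>_def]
  show "integrable lborel (\<lambda>x::real. exp (\<i> * of_real (y * x) - A * of_real (x\<^sup>2) / 2))"
    unfolding eq using G(1) by simp
  show "(\<integral>x. exp (\<i> * of_real (y * x) - A * of_real (x\<^sup>2) / 2) \<partial>lborel)
          = of_real (sqrt (2 * pi)) / csqrt A * exp (- of_real (y\<^sup>2) / (2 * A))"
    unfolding eq using G(2) \<alpha>2 by (simp add: \<alpha>_def[symmetric] field_simps)
qed

lemma lborel_integral_prod:
  fixes f :: "'a::euclidean_space \<Rightarrow> real \<Rightarrow> 'b::{real_normed_field,banach,second_countable_topology}"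
  assumes f: "\<And>b. b \<in> Basis \<Longrightarrow> integrable lborel (f b)"
  shows "integrable lborel (\<lambda>x::'a. \<Prod>b\<in>Basis. f b (x \<bullet> b))"
    and "(\<integral>x. (\<Prod>b\<in>Basis. f b (x \<bullet> b)) \<partial>(lborel :: 'a measure)) = (\<Prod>b\<in>Basis. \<integral>x. f b x \<partial>lborel)"
proof -
  interpret product_sigma_finite "\<lambda>b::'a. lborel :: real measure" ..
  let ?T = "\<lambda>f. \<Sum>b\<in>(Basis::'a set). f b *\<^sub>R b"
  have T[measurable]: "?T \<in> measurable (\<Pi>\<^sub>M b\<in>(Basis::'a set). lborel) borel" by measurable
  have [measurable]: "\<And>b. b \<in> Basis \<Longrightarrow> f b \<in> borel_measurable borel"
    using f by (auto dest: borel_measurable_integrable)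
  have m: "(\<lambda>x::'a. \<Prod>b\<in>Basis. f b (x \<bullet> b)) \<in> borel_measurable borel" by measurable
  have eq: "(\<Prod>b\<in>Basis. f b (?T g \<bullet> b)) = (\<Prod>b\<in>Basis. f b (g b))" for g
    by (intro prod.cong refl) (simp add: inner_sum_left inner_Basis if_distrib cong: if_cong)
  show "integrable lborel (\<lambda>x::'a. \<Prod>b\<in>Basis. f b (x \<bullet> b))"
    by (subst lborel_eq, subst integrable_distr_eq[OF T m])
       (simp only: eq, intro product_integrable_prod f, auto)
  show "(\<integral>x. (\<Prod>b\<in>Basis. f b (x \<bullet> b)) \<partial>(lborel :: 'a measure)) = (\<Prod>b\<in>Basis. \<integral>x. f b x \<partial>lborel)"
    by (subst lborel_eq, subst integral_distr[OF T m])
       (simp only: eq, intro product_integral_prod f, auto)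
qed

lemma gaussian_fourier:
  fixes y :: "'a::euclidean_space"
  assumes A: "0 < Re A"
  shows "integrable lborel (\<lambda>x::'a. exp (\<i> * of_real (y \<bullet> x) - A * of_real ((norm x)\<^sup>2) / 2))"
    and "(\<integral>x. exp (\<i> * of_real (y \<bullet> x) - A * of_real ((norm x)\<^sup>2) / 2) \<partial>lborel)
          = (of_real (sqrt (2 * pi)) / csqrt A) ^ DIM('a) * exp (- of_real ((norm y)\<^sup>2) / (2 * A))"
proof -
  have nsq: "(norm x)\<^sup>2 = (\<Sum>b\<in>Basis. (x \<bullet> b)\<^sup>2)" for x :: 'a
    unfolding power2_norm_eq_inner by (subst euclidean_inner) (simp add: power2_eq_square)
  have eq: "exp (\<i> * of_real (y \<bullet> x) - A * of_real ((norm x)\<^sup>2) / 2)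
    = (\<Prod>b\<in>Basis. exp (\<i> * of_real ((y \<bullet> b) * (x \<bullet> b)) - A * of_real ((x \<bullet> b)\<^sup>2) / 2))" for x
    unfolding nsq by (subst euclidean_inner[of y x])
      (simp add: exp_sum[symmetric] sum_subtractf sum_distrib_left sum_divide_distrib)
  note I = lborel_integral_prod[of "\<lambda>b x. exp (\<i> * of_real ((y \<bullet> b) * x) - A * of_real (x\<^sup>2) / 2)", OF gaussian_fourier_1(1)[OF A]]
  show "integrable lborel (\<lambda>x::'a. exp (\<i> * of_real (y \<bullet> x) - A * of_real ((norm x)\<^sup>2) / 2))"
    unfolding eq by (rule I(1))
  have "(\<integral>x. exp (\<i> * of_real (y \<bullet> x) - A * of_real ((norm x)\<^sup>2) / 2) \<partial>lborel)
     = (\<Prod>b\<in>Basis. of_real (sqrt (2 * pi)) / csqrt A * exp (- of_real ((y \<bullet> b)\<^sup>2) / (2 * A)))"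
    unfolding eq I(2) gaussian_fourier_1(2)[OF A] ..
  also have "\<dots> = (of_real (sqrt (2 * pi)) / csqrt A) ^ DIM('a) * exp (- of_real ((norm y)\<^sup>2) / (2 * A))"
  proof -
    have "(\<Prod>b\<in>Basis. exp (- of_real ((y \<bullet> b)\<^sup>2) / (2 * A))) = exp (- of_real ((norm y)\<^sup>2) / (2 * A))"
      unfolding nsq by (simp add: exp_sum[symmetric] sum_divide_distrib sum_negf)
    then show ?thesis by (simp only: prod.distrib prod_constant)
  qed
  finally show "(\<integral>x. exp (\<i> * of_real (y \<bullet> x) - A * of_real ((norm x)\<^sup>2) / 2) \<partial>lborel)
          = (of_real (sqrt (2 * pi)) / csqrt A) ^ DIM('a) * exp (- of_real ((norm y)\<^sup>2) / (2 * A))" .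
qed

section \<open>Uniqueness from Gaussian and Fourier data\<close>

lemma integrable_prod_mult:
  fixes f :: "'a \<Rightarrow> 'c::{real_normed_field,banach,second_countable_topology}" and g :: "'b \<Rightarrow> 'c"
  assumes "sigma_finite_measure M" "sigma_finite_measure N" and f: "integrable M f" and g: "integrable N g"
  shows "integrable (M \<Otimes>\<^sub>M N) (\<lambda>z. f (fst z) * g (snd z))"
    and "(\<integral>z. f (fst z) * g (snd z) \<partial>(M \<Otimes>\<^sub>M N)) = (\<integral>x. f x \<partial>M) * (\<integral>y. g y \<partial>N)"
proof -
  interpret pair_sigma_finite M N using assms by (simp add: pair_sigma_finite_def)
  note [measurable] = borel_measurable_integrable[OF f] borel_measurable_integrable[OF g]
  show i: "integrable (M \<Otimes>\<^sub>M N) (\<lambda>z. f (fst z) * g (snd z))"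
    by (rule Fubini_integrable) (use f g in \<open>auto simp: norm_mult\<close>)
  show "(\<integral>z. f (fst z) * g (snd z) \<partial>(M \<Otimes>\<^sub>M N)) = (\<integral>x. f x \<partial>M) * (\<integral>y. g y \<partial>N)"
    using integral_fst'[OF i] f g by simp
qed

lemma lborel_integral_affine:
  fixes f :: "'a::euclidean_space \<Rightarrow> 'b::{banach, second_countable_topology}"
  assumes c: "c \<noteq> 0" and f[measurable]: "f \<in> borel_measurable borel"
  shows "(\<integral>x. f x \<partial>lborel) = \<bar>c\<bar> ^ DIM('a) *\<^sub>R (\<integral>x. f (t + c *\<^sub>R x) \<partial>lborel)"
    and "integrable lborel f \<longleftrightarrow> integrable lborel (\<lambda>x. f (t + c *\<^sub>R x))"
proof -
  have T[measurable]: "(\<lambda>x::'a. t + c *\<^sub>R x) \<in> lborel \<rightarrow>\<^sub>M borel" by measurable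
  have e: "ennreal (\<bar>c\<bar>) ^ DIM('a) = ennreal (\<bar>c\<bar> ^ DIM('a))" by (simp add: ennreal_power)
  show "(\<integral>x. f x \<partial>lborel) = \<bar>c\<bar> ^ DIM('a) *\<^sub>R (\<integral>x. f (t + c *\<^sub>R x) \<partial>lborel)"
    by (subst lborel_affine[OF c, of t], subst integral_density) (auto simp: integral_distr e)
  show "integrable lborel f \<longleftrightarrow> integrable lborel (\<lambda>x. f (t + c *\<^sub>R x))"
  proof -
    have "integrable lborel f \<longleftrightarrow> integrable lborel (\<lambda>x. (\<bar>c\<bar> ^ DIM('a)) *\<^sub>R f (t + c *\<^sub>R x))"
      by (subst lborel_affine[OF c, of t], subst integrable_density) (auto simp: integrable_distr_eq e)
    also have "\<dots> \<longleftrightarrow> integrable lborel (\<lambda>x. f (t + c *\<^sub>R x))"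
      using c integrable_scaleR_right[of "1 / \<bar>c\<bar> ^ DIM('a)" lborel "\<lambda>x. (\<bar>c\<bar> ^ DIM('a)) *\<^sub>R f (t + c *\<^sub>R x)"]
      by auto
    finally show ?thesis .
  qed
qed

text \<open>Open boxes form an intersection-stable generator of the Borel sets, so the vanishing
  spreads to all Borel sets by Dynkin induction. The complement step uses the total integral, which
  is 0 by exhausting the space with boxes.\<close>

lemma AE_zero_if_box_integrals_zero:
  fixes F :: "'a::euclidean_space \<Rightarrow> complex"
  assumes F: "integrable lborel F"
    and box0: "\<And>l u. (\<integral>x. indicator (box l u) x *\<^sub>R F x \<partial>lborel) = 0"
  shows "AE x in lborel. F x = 0"
proof (rule sigma_finite_measure.density_zero[OF sigma_finite_lborel F])
  fix A :: "'a set" assume "A \<in> sets lborel"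
  note [measurable] = borel_measurable_integrable[OF F]
  let ?G = "range (\<lambda> (a, b). box a b :: 'a set)"
  have si: "set_integrable lborel B F" if "B \<in> sets borel" for B
    unfolding set_integrable_def using that F by (intro integrable_mult_indicator) auto
  have tot: "(\<integral>x. F x \<partial>lborel) = 0"
  proof -
    have "(\<lambda>n. \<integral>x. indicator (box (- real n *\<^sub>R One) (real n *\<^sub>R One)) x *\<^sub>R F x \<partial>lborel) \<longlonglongrightarrow> (\<integral>x. F x \<partial>lborel)"
    proof (rule integral_dominated_convergence[where w = "\<lambda>x. norm (F x)"])
      show "AE x in lborel. (\<lambda>n. indicator (box (- real n *\<^sub>R One) (real n *\<^sub>R One)) x *\<^sub>R F x) \<longlonglongrightarrow> F x"
      proof (rule AE_I2, rule tendsto_eventually)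
        fix x :: 'a
        obtain N where "norm x < real N" using reals_Archimedean2 by blast
        then have "x \<in> box (- real n *\<^sub>R One) (real n *\<^sub>R One)" if "n \<ge> N" for n
          using that Basis_le_norm[of _ x] unfolding box_def by (auto simp: inner_simps) (smt (verit) of_nat_le_iff)+
        then show "\<forall>\<^sub>F n in sequentially. indicator (box (- real n *\<^sub>R One) (real n *\<^sub>R One)) x *\<^sub>R F x = F x"
          by (intro eventually_sequentiallyI[of N]) (auto simp: indicator_def)
      qed
    qed (use F in \<open>auto simp: indicator_def\<close>)
    then show ?thesis unfolding box0 by (simp add: LIMSEQ_const_iff)
  qed
  have st: "Int_stable ?G" by (auto simp: Int_stable_def box_Int_box)
  have "A \<in> sigma_sets UNIV ?G"
    using \<open>A \<in> sets lborel\<close> by (simp add: borel_eq_box)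
  with st subset_UNIV[of ?G, folded Pow_UNIV] show "set_lebesgue_integral lborel A F = 0"
  proof (induction rule: sigma_sets_induct_disjoint)
    case (basic A)
    then show ?case using box0 by (auto simp: set_lebesgue_integral_def)
  next
    case (compl A)
    then have A: "A \<in> sets borel" by (simp add: borel_eq_box)
    have "set_lebesgue_integral lborel (UNIV - A) F = (\<integral>x. F x - indicator A x *\<^sub>R F x \<partial>lborel)"
      unfolding set_lebesgue_integral_def by (intro Bochner_Integration.integral_cong) (auto simp: indicator_def)
    also have "\<dots> = (\<integral>x. F x \<partial>lborel) - set_lebesgue_integral lborel A F"
      using F si[OF A] unfolding set_lebesgue_integral_def set_integrable_def by simp
    finally show ?case using compl tot by simp
  next
    case (union A)
    then have A: "A i \<in> sets borel" for i by (auto simp: borel_eq_box)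
    have "set_lebesgue_integral lborel (\<Union>i. A i) F = (\<Sum>i. set_lebesgue_integral lborel (A i) F)"
      using union(1) A by (intro lebesgue_integral_countable_add si) (auto simp: disjoint_family_on_def)
    then show ?case using union by simp
  qed (auto simp: set_lebesgue_integral_def)
qed

lemma gaussian_integrable:
  assumes "0 < (c::real)"
  shows "integrable lborel (\<lambda>x::'a::euclidean_space. exp (- c * (norm x)\<^sup>2))"
proof -
  have "integrable lborel (\<lambda>x::'a. exp (\<i> * of_real (0 \<bullet> x) - of_real (2 * c) * of_real ((norm x)\<^sup>2) / 2))"
    by (rule gaussian_fourier) (use assms in simp)
  then have "integrable lborel (\<lambda>x::'a. norm (exp (\<i> * of_real (0 \<bullet> x) - of_real (2 * c) * of_real ((norm x)\<^sup>2) / 2)))"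
    by (rule integrable_norm)
  then show ?thesis by (simp del: of_real_power)
qed

lemma gaussian_shift_integrable:
  assumes "0 < (c::real)"
  shows "integrable lborel (\<lambda>x::'a::euclidean_space. exp (- c * (norm (x - b))\<^sup>2))"
proof -
  have "(\<lambda>x::'a. exp (- c * (norm (x - b))\<^sup>2)) \<in> borel_measurable borel" by measurable
  from lborel_integral_affine(2)[of 1, OF _ this, of b] gaussian_integrable[OF assms, where 'a = 'a]
  show ?thesis by simp
qed

text \<open>Integrating the hypothesis over all centres \<open>b\<close> in a box pairs
  \<open>F\<close> with the box indicator smoothed by a Gaussian. As the Gaussian narrows, this
  tends to the indicator, up to the constant \<open>C\<close>, everywhere off the boundary of the
  box, which is a null set.\<close>

lemma AE_zero_if_gaussian_integrals_zero:
  fixes F :: "'a::euclidean_space \<Rightarrow> complex"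
  assumes F: "integrable lborel F"
    and G: "\<And>a b. 0 < a \<Longrightarrow> (\<integral>x. F x * of_real (exp (- a / 2 * (norm (x - b))\<^sup>2)) \<partial>lborel) = 0"
  shows "AE x in lborel. F x = 0"
proof (rule AE_zero_if_box_integrals_zero[OF F])
  fix l u :: 'a
  note [measurable] = borel_measurable_integrable[OF F]
  let ?B = "box l u"
  \<comment> \<open>The width belonging to the parameter \<open>a = n + 1\<close>: since
    \<open>a\<close> times its square is 1, the substitution b = y + s z normalises the
    Gaussian.\<close>
  define s where "s n = 1 / sqrt (real (Suc n))" for n
  have s: "s n > 0" for n by (simp add: s_def)
  have s2: "(s n)\<^sup>2 = 1 / real (Suc n)" for n by (simp add: s_def power_divide)
  define g where "g n y = (\<integral>z. indicator ?B (y + s n *\<^sub>R z) * exp (- (1/2) * (norm z)\<^sup>2) \<partial>(lborel::'a measure))" for n and y :: 'a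
  define C where "C = (\<integral>z. exp (- (1/2) * (norm z)\<^sup>2) \<partial>(lborel::'a measure))"
  have gi: "integrable lborel (\<lambda>z::'a. exp (- (1/2) * (norm z)\<^sup>2))" by (rule gaussian_integrable) simp
  have gm[measurable]: "g n \<in> borel_measurable borel" for n
    unfolding g_def by measurable
  have C0: "C > 0"
  proof -
    have "C \<noteq> 0"
    proof
      assume "C = 0"
      then have "AE z in lborel. exp (- (1/2) * (norm (z::'a))\<^sup>2) = 0"
        using integral_nonneg_eq_0_iff_AE[OF gi] unfolding C_def by simp
      then have "AE z in (lborel::'a measure). False" by simp
      then show False by (simp add: eventually_False ae_filter_eq_bot_iff)
    qed
    moreover have "C \<ge> 0" unfolding C_def by simp
    ultimately show ?thesis by simp
  qed
  have gle: "\<bar>g n y\<bar> \<le> C" for n y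
  proof -
    have "\<bar>g n y\<bar> \<le> (\<integral>z. \<bar>indicator ?B (y + s n *\<^sub>R z) * exp (- (1/2) * (norm z)\<^sup>2)\<bar> \<partial>(lborel::'a measure))"
      unfolding g_def by (rule integral_abs_bound)
    also have "\<dots> \<le> C" unfolding C_def
      by (rule integral_mono'[OF gi]) (auto simp: abs_mult indicator_def)
    finally show ?thesis .
  qed
  have Fg: "(\<integral>y. F y * of_real (g n y) \<partial>lborel) = 0" for n
  proof -
    define a where "a = real (Suc n)"
    have a: "a > 0" by (simp add: a_def)
    define K where "K y b = (indicator ?B b * exp (- a / 2 * (norm (y - b))\<^sup>2) :: real)" for y b
    have [measurable]: "case_prod K \<in> borel_measurable (borel \<Otimes>\<^sub>M borel)" unfolding K_def by measurable
    have gK: "(\<integral>b. K y b \<partial>lborel) = s n ^ DIM('a) * g n y" for y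
    proof -
      have "(\<integral>b. K y b \<partial>lborel) = \<bar>s n\<bar> ^ DIM('a) *\<^sub>R (\<integral>z. K y (y + s n *\<^sub>R z) \<partial>lborel)"
        by (rule lborel_integral_affine) (use s[of n] in \<open>auto simp: K_def\<close>)
      also have "(\<integral>z. K y (y + s n *\<^sub>R z) \<partial>lborel) = g n y"
      proof -
        have "- a / 2 * (norm (y - (y + s n *\<^sub>R z)))\<^sup>2 = - (1/2) * (norm z)\<^sup>2" for z
        proof -
          have "- a / 2 * (norm (y - (y + s n *\<^sub>R z)))\<^sup>2 = - (1/2) * ((a * (s n)\<^sup>2) * (norm z)\<^sup>2)"
            by (simp add: power_mult_distrib)
          also have "a * (s n)\<^sup>2 = 1" unfolding s2 a_def by simp
          finally show ?thesis by simp
        qed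
        then show ?thesis unfolding g_def K_def by simp
      qed
      finally show ?thesis using s[of n] by simp
    qed
    have ib: "integrable lborel (indicator ?B :: 'a \<Rightarrow> real)"
      using emeasure_lborel_box_finite[of l u] by (intro integrable_real_indicator) auto
    have "integrable (lborel \<Otimes>\<^sub>M lborel) (\<lambda>z::'a \<times> 'a. F (fst z) * of_real (indicator ?B (snd z)))"
      by (rule integrable_prod_mult) (use F ib in \<open>auto intro: lborel.sigma_finite_measure_axioms\<close>)
    then have int: "integrable (lborel \<Otimes>\<^sub>M lborel) (\<lambda>(y, b). F y * of_real (K y b))"
      by (rule Bochner_Integration.integrable_bound)
         (use a in \<open>auto intro!: AE_I2 mult_left_le simp: norm_mult K_def split_beta indicator_def\<close>)
    have "(\<integral>y. (\<integral>b. F y * of_real (K y b) \<partial>lborel) \<partial>lborel) = (\<integral>b. (\<integral>y. F y * of_real (K y b) \<partial>lborel) \<partial>lborel)"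
      by (rule lborel_pair.Fubini_integral[symmetric, OF int])
    also have "(\<lambda>b. \<integral>y. F y * of_real (K y b) \<partial>lborel) = (\<lambda>b. 0)"
    proof
      fix b
      have "(\<integral>y. F y * of_real (K y b) \<partial>lborel) = of_real (indicator ?B b) * (\<integral>y. F y * of_real (exp (- a / 2 * (norm (y - b))\<^sup>2)) \<partial>lborel)"
        unfolding K_def by (subst integral_mult_right_zero[symmetric]) (simp add: mult_ac)
      then show "(\<integral>y. F y * of_real (K y b) \<partial>lborel) = 0" using G[OF a] by simp
    qed
    finally have "(\<integral>y. F y * of_real (s n ^ DIM('a) * g n y) \<partial>lborel) = 0"
      by (simp add: gK[symmetric] del: of_real_mult of_real_power)
    then have "of_real (s n ^ DIM('a)) * (\<integral>y. F y * of_real (g n y) \<partial>lborel) = 0"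
      by (subst integral_mult_right_zero[symmetric]) (simp add: mult_ac)
    then show ?thesis using s[of n] by simp
  qed
  have s0: "s \<longlonglongrightarrow> 0" unfolding s_def by real_asymp
  have glim: "(\<lambda>n. g n y) \<longlonglongrightarrow> indicator ?B y * C" if y: "y \<notin> cbox l u - box l u" for y
  proof -
    have "(\<lambda>n. g n y) \<longlonglongrightarrow> (\<integral>z. indicator ?B y * exp (- (1/2) * (norm z)\<^sup>2) \<partial>(lborel::'a measure))"
      unfolding g_def
    proof (rule integral_dominated_convergence[where w = "\<lambda>z. exp (- (1/2) * (norm z)\<^sup>2)"])
      show "AE z in lborel. (\<lambda>n. indicator ?B (y + s n *\<^sub>R z) * exp (- (1/2) * (norm z)\<^sup>2)) \<longlonglongrightarrow> indicator ?B y * exp (- (1/2) * (norm (z::'a))\<^sup>2)"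
      proof (rule AE_I2)
        fix z :: 'a
        have lim: "(\<lambda>n. y + s n *\<^sub>R z) \<longlonglongrightarrow> y" using tendsto_add[OF tendsto_const tendsto_scaleR[OF s0 tendsto_const]] by simp
        have "\<forall>\<^sub>F n in sequentially. indicator ?B (y + s n *\<^sub>R z) = (indicator ?B y :: real)"
        proof (cases "y \<in> ?B")
          case True
          from topological_tendstoD[OF lim open_box True] show ?thesis
            by eventually_elim (use True in simp)
        next
          case False
          then have "y \<in> - cbox l u" using y by auto
          from topological_tendstoD[OF lim _ this] have "\<forall>\<^sub>F n in sequentially. y + s n *\<^sub>R z \<in> - cbox l u" 
            by (simp add: open_Compl closed_cbox)
          then show ?thesis by eventually_elim (use False box_subset_cbox[of l u] in \<open>auto simp: indicator_def\<close>)
        qed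
        then show "(\<lambda>n. indicator ?B (y + s n *\<^sub>R z) * exp (- (1/2) * (norm z)\<^sup>2)) \<longlonglongrightarrow> indicator ?B y * exp (- (1/2) * (norm z)\<^sup>2)"
          by (intro tendsto_eventually) (auto elim: eventually_mono)
      qed
    qed (use gi in \<open>auto simp: indicator_def\<close>)
    then show ?thesis unfolding C_def by simp
  qed
  have "(\<lambda>n. \<integral>y. F y * of_real (g n y) \<partial>lborel) \<longlonglongrightarrow> (\<integral>y. F y * of_real (indicator ?B y * C) \<partial>lborel)"
  proof (rule integral_dominated_convergence[where w = "\<lambda>y. norm (F y) * C"])
    have "AE y in lborel. y \<notin> cbox l u - box l u"
      by (rule AE_not_in[OF null_sets_cbox_Diff_box])
    then show "AE y in lborel. (\<lambda>n. F y * of_real (g n y)) \<longlonglongrightarrow> F y * of_real (indicator ?B y * C)"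
      by eventually_elim (intro tendsto_intros glim)
    show "AE x in lborel. norm (F x * of_real (g n x)) \<le> norm (F x) * C" for n
      using gle[of n] by (auto intro!: AE_I2 mult_left_mono simp: norm_mult)
  qed (use F in auto)
  then have "(\<integral>y. F y * of_real (indicator ?B y * C) \<partial>lborel) = 0"
    unfolding Fg by (simp add: LIMSEQ_const_iff)
  moreover have "(\<integral>y. F y * of_real (indicator ?B y * C) \<partial>lborel) = of_real C * (\<integral>x. indicator ?B x *\<^sub>R F x \<partial>lborel)"
    by (subst integral_mult_right_zero[symmetric]) (simp add: mult_ac scaleR_conv_of_real)
  ultimately show "(\<integral>x. indicator ?B x *\<^sub>R F x \<partial>lborel) = 0" using C0 by simp
qed

text \<open>A Gaussian centred at \<open>e\<close> is itself a superposition of characters with an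
  integrable Gaussian density, so Fubini reduces the claim to vanishing Gaussian integrals.\<close>

lemma AE_zero_if_fourier_zero:
  fixes F :: "'a::euclidean_space \<Rightarrow> complex"
  assumes F: "integrable lborel F"
    and FT: "\<And>b. (\<integral>x. F x * exp (\<i> * of_real (b \<bullet> x)) \<partial>lborel) = 0"
  shows "AE x in lborel. F x = 0"
proof (rule AE_zero_if_gaussian_integrals_zero[OF F])
  fix a :: real and e :: 'a assume a: "0 < a"
  note [measurable] = borel_measurable_integrable[OF F]
  define A where "A = complex_of_real (1 / a)"
  have A: "Re A > 0" "A \<noteq> 0" using a by (auto simp: A_def)
  define c where "c = (of_real (sqrt (2 * pi)) / csqrt A) ^ DIM('a)"
  have c: "c \<noteq> 0" using A by (auto simp: c_def)
  define g where "g b = exp (\<i> * of_real (0 \<bullet> b) - A * of_real ((norm (b::'a))\<^sup>2) / 2)" for b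
  have gi: "integrable lborel g" unfolding g_def by (rule gaussian_fourier(1)[OF A(1)])
  have [measurable]: "g \<in> borel_measurable borel" using gi by (auto dest: borel_measurable_integrable)
  have rep: "c * of_real (exp (- a / 2 * (norm (x - e))\<^sup>2)) = (\<integral>b. g b * exp (\<i> * of_real ((x - e) \<bullet> b)) \<partial>lborel)" for x
  proof -
    have "(\<integral>b. g b * exp (\<i> * of_real ((x - e) \<bullet> b)) \<partial>lborel) = (\<integral>b. exp (\<i> * of_real ((x - e) \<bullet> b) - A * of_real ((norm b)\<^sup>2) / 2) \<partial>lborel)"
      unfolding g_def by (intro Bochner_Integration.integral_cong) (auto simp: exp_add[symmetric] exp_diff)
    also have "\<dots> = c * exp (- of_real ((norm (x - e))\<^sup>2) / (2 * A))"
      unfolding c_def by (rule gaussian_fourier(2)[OF A(1)])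
    also have "- of_real ((norm (x - e))\<^sup>2) / (2 * A) = complex_of_real (- a / 2 * (norm (x - e))\<^sup>2)"
      using a by (simp add: A_def)
    finally show ?thesis by (simp add: exp_of_real del: of_real_mult of_real_minus of_real_divide)
  qed
  have "integrable (lborel \<Otimes>\<^sub>M lborel) (\<lambda>z::'a \<times> 'a. F (fst z) * g (snd z))"
    by (rule integrable_prod_mult) (use F gi in \<open>auto intro: lborel.sigma_finite_measure_axioms\<close>)
  then have int: "integrable (lborel \<Otimes>\<^sub>M lborel) (\<lambda>(x, b). F x * (g b * exp (\<i> * of_real ((x - e) \<bullet> b))))"
    by (rule Bochner_Integration.integrable_bound) (auto intro!: AE_I2 simp: norm_mult split_beta)
  have "c * (\<integral>x. F x * of_real (exp (- a / 2 * (norm (x - e))\<^sup>2)) \<partial>lborel)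
      = (\<integral>x. F x * (c * of_real (exp (- a / 2 * (norm (x - e))\<^sup>2))) \<partial>lborel)"
    by (subst integral_mult_right_zero[symmetric]) (simp add: mult_ac)
  also have "\<dots> = (\<integral>x. (\<integral>b. F x * (g b * exp (\<i> * of_real ((x - e) \<bullet> b))) \<partial>lborel) \<partial>lborel)"
    unfolding rep by simp
  also have "\<dots> = (\<integral>b. (\<integral>x. F x * (g b * exp (\<i> * of_real ((x - e) \<bullet> b))) \<partial>lborel) \<partial>lborel)"
    by (rule lborel_pair.Fubini_integral[symmetric, OF int])
  also have "\<dots> = (\<integral>b. (g b * exp (- \<i> * of_real (e \<bullet> b))) * (\<integral>x. F x * exp (\<i> * of_real (b \<bullet> x)) \<partial>lborel) \<partial>lborel)"
  proof (rule Bochner_Integration.integral_cong[OF refl])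
    fix b
    have "exp (\<i> * of_real ((x - e) \<bullet> b)) = exp (- \<i> * of_real (e \<bullet> b)) * exp (\<i> * of_real (b \<bullet> x))" for x
      by (simp add: exp_add[symmetric] inner_diff_left inner_commute algebra_simps)
    then show "(\<integral>x. F x * (g b * exp (\<i> * of_real ((x - e) \<bullet> b))) \<partial>lborel)
        = (g b * exp (- \<i> * of_real (e \<bullet> b))) * (\<integral>x. F x * exp (\<i> * of_real (b \<bullet> x)) \<partial>lborel)"
      by (subst integral_mult_right_zero[symmetric]) (simp add: mult_ac)
  qed
  also have "\<dots> = 0" unfolding FT by simp
  finally show "(\<integral>x. F x * of_real (exp (- a / 2 * (norm (x - e))\<^sup>2)) \<partial>lborel) = 0" using c by simp
qed

section \<open>The circle and uniqueness for Fourier series\<close>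

definition mT :: "real measure" where
  "mT = density lborel (indicator {0..<2*pi})"

lemma sets_mT [measurable_cong, simp]: "sets mT = sets borel"
  by (simp add: mT_def)

lemma space_mT [simp]: "space mT = UNIV"
  by (simp add: mT_def)

lemma emeasure_mT: "emeasure mT UNIV = ennreal (2 * pi)"
  by (simp add: mT_def emeasure_density)

lemma finite_measure_mT: "finite_measure mT"
  by (rule finite_measureI) (simp add: emeasure_mT)

interpretation mT: finite_measure mT by (rule finite_measure_mT)

lemma integral_mT:
  fixes f :: "real \<Rightarrow> 'b::{banach,second_countable_topology}"
  assumes "f \<in> borel_measurable borel"
  shows "(\<integral>x. f x \<partial>mT) = (\<integral>x. indicator {0..<2*pi} x *\<^sub>R f x \<partial>lborel)"
    and "integrable mT f \<longleftrightarrow> integrable lborel (\<lambda>x. indicator {0..<2*pi} x *\<^sub>R f x)"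
proof -
  have eq: "mT = density lborel (\<lambda>x. ennreal (indicator {0..<2*pi} x))"
    by (auto simp: mT_def ennreal_indicator)
  show "(\<integral>x. f x \<partial>mT) = (\<integral>x. indicator {0..<2*pi} x *\<^sub>R f x \<partial>lborel)"
    unfolding eq using assms by (subst integral_density) auto
  show "integrable mT f \<longleftrightarrow> integrable lborel (\<lambda>x. indicator {0..<2*pi} x *\<^sub>R f x)"
    unfolding eq using assms by (subst integrable_density) auto
qed

lemma AE_mT: "(AE x in mT. P x) \<longleftrightarrow> (AE x in lborel. x \<in> {0..<2*pi} \<longrightarrow> P x)"
  unfolding mT_def by (subst AE_density) (auto simp: indicator_def)

text \<open>A real-linear function of \<open>cis x\<close> is a combination of exp (i x) and exp (-
  i x), so multiplying by it only shifts \<open>k\<close> by 1 either way. A product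
  \<open>f * g\<close> is handled by replacing \<open>r\<close> with \<open>r * f\<close>, which is
  why \<open>r\<close> is generalised in the induction and integrability is carried along.\<close>

lemma real_polynomial_cis_integral_zero:
  assumes "real_polynomial_function g"
    and "integrable mT r" "\<And>k::int. (\<integral>x. r x * exp (\<i> * of_real (of_int k * x)) \<partial>mT) = 0"
  shows "integrable mT (\<lambda>x. r x * of_real (g (cis x))) \<and> (\<forall>k::int. (\<integral>x. r x * of_real (g (cis x)) * exp (\<i> * of_real (of_int k * x)) \<partial>mT) = 0)"
  using assms
proof (induction arbitrary: r)
  case (linear f)
  then interpret f: bounded_linear f by simp
  note [measurable] = borel_measurable_integrable[OF linear(2)]
  have fc: "f (cis x) = cos x * f 1 + sin x * f \<i>" for x
  proof -
    have "cis x = cos x *\<^sub>R 1 + sin x *\<^sub>R \<i>" by (auto simp: complex_eq_iff)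
    then show ?thesis by (simp add: f.add f.scaleR)
  qed
  have e: "complex_of_real (f (cis x)) = (of_real (f 1) / 2 + of_real (f \<i>) / (2 * \<i>)) * exp (\<i> * of_real x) + (of_real (f 1) / 2 - of_real (f \<i>) / (2 * \<i>)) * exp (- (\<i> * of_real x))" for x
    unfolding fc of_real_add of_real_mult cos_of_real[symmetric] sin_of_real[symmetric] cos_exp_eq sin_exp_eq
    by (simp add: field_simps)
  define c1 c2 where "c1 = of_real (f 1) / 2 + of_real (f \<i>) / (2 * \<i>)" and "c2 = of_real (f 1) / 2 - of_real (f \<i>) / (2 * \<i>)"
  have ie: "integrable mT (\<lambda>x. r x * exp (\<i> * of_real (of_int k * x)))" for k
    by (rule Bochner_Integration.integrable_bound[OF linear(2)]) (auto simp: norm_mult)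
  have eq: "r x * of_real (f (cis x)) * exp (\<i> * of_real (of_int k * x))
     = c1 * (r x * exp (\<i> * of_real (of_int (k + 1) * x))) + c2 * (r x * exp (\<i> * of_real (of_int (k - 1) * x)))" for x k
    unfolding e c1_def[symmetric] c2_def[symmetric]
    by (simp add: algebra_simps exp_add exp_diff exp_minus divide_inverse)
  have "integrable mT (\<lambda>x. r x * of_real (f (cis x)) * exp (\<i> * of_real (of_int k * x)))" for k
    unfolding eq by (intro Bochner_Integration.integrable_add integrable_mult_right ie)
  from this[of 0] have 1: "integrable mT (\<lambda>x. r x * of_real (f (cis x)))" by simp
  have "(\<integral>x. r x * of_real (f (cis x)) * exp (\<i> * of_real (of_int k * x)) \<partial>mT) = 0" for k
    unfolding eq by (subst Bochner_Integration.integral_add) (intro integrable_mult_right ie, intro integrable_mult_right ie, simp only: integral_mult_right_zero linear(3), simp)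
  with 1 show ?case by blast
next
  case (const c)
  then show ?case by (auto simp: mult_ac)
next
  case (add f g)
  note [measurable] = borel_measurable_integrable[OF add(5)]
  note F = add(3)[OF add(5,6)] and G = add(4)[OF add(5,6)]
  have ie: "integrable mT (\<lambda>x. r x * of_real (f (cis x)) * exp (\<i> * of_real (of_int k * x)))"
      "integrable mT (\<lambda>x. r x * of_real (g (cis x)) * exp (\<i> * of_real (of_int k * x)))" for k
    using F G by (auto intro: Bochner_Integration.integrable_bound[OF conjunct1[OF F]] Bochner_Integration.integrable_bound[OF conjunct1[OF G]] simp: norm_mult borel_measurable_integrable)
  show ?case using F G ie by (simp add: distrib_left distrib_right)
next
  case (mult f g)
  have F: "integrable mT (\<lambda>x. r x * of_real (f (cis x)))" "\<And>k::int. (\<integral>x. r x * of_real (f (cis x)) * exp (\<i> * of_real (of_int k * x)) \<partial>mT) = 0"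
    using mult(3)[OF mult(5,6)] by auto
  from mult(4)[OF F] show ?case by (simp add: mult.assoc)
qed

text \<open>Exhibits the open interval (\<alpha>, \<beta>) of the fundamental domain as the
  complement of a compact subset of the circle, so that it can be approached by continuous functions
  of \<open>cis x\<close>.\<close>

lemma cis_in_image_iff:
  assumes "0 \<le> \<alpha>" "\<beta> \<le> 2 * pi" "0 \<le> x" "x < 2 * pi"
  shows "cis x \<in> cis ` ({0..\<alpha>} \<union> {\<beta>..2*pi}) \<longleftrightarrow> \<not> (\<alpha> < x \<and> x < \<beta>)"
proof
  assume "cis x \<in> cis ` ({0..\<alpha>} \<union> {\<beta>..2*pi})"
  then obtain y where y: "y \<in> {0..\<alpha>} \<union> {\<beta>..2*pi}" "cis x = cis y" by blast
  show "\<not> (\<alpha> < x \<and> x < \<beta>)"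
  proof
    assume x: "\<alpha> < x \<and> x < \<beta>"
    \<comment> \<open>The parameters 0 and \<open>2 * pi\<close> give the same point of the circle;
      \<open>Arg2pi\<close> returns the representative below \<open>2 * pi\<close>.\<close>
    define y' where "y' = (if y \<ge> 2 * pi then 0 else y)"
    have "cis y' = cis y" using y x assms by (auto simp: y'_def complex_eq_iff)
    have y0: "0 \<le> y'" "y' < 2 * pi" using y x assms by (auto simp: y'_def)
    have "Arg2pi (cis x) = x" by (rule Arg2pi_unique[of 1]) (use assms in \<open>auto simp: cis_conv_exp\<close>)
    moreover have "Arg2pi (cis x) = y'" by (rule Arg2pi_unique[of 1]) (use y0 \<open>cis y' = cis y\<close> y in \<open>auto simp: cis_conv_exp\<close>)
    ultimately show False using y x assms by (auto simp: y'_def split: if_splits)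
  qed
qed (use assms in auto)

text \<open>Stone-Weierstrass on the unit circle extends the hypothesis from exponentials to
  continuous functions of \<open>cis x\<close>, with an error controlled by the L1 norm of
  \<open>r\<close>. Indicators of intervals are then pointwise limits of such functions.\<close>

lemma AE_zero_if_fourier_series_zero:
  assumes r: "integrable mT r" and r0: "\<And>k::int. (\<integral>x. r x * exp (\<i> * of_real (of_int k * x)) \<partial>mT) = 0"
  shows "AE x in mT. r x = 0"
proof -
  note [measurable] = borel_measurable_integrable[OF r]
  have [measurable]: "r \<in> borel_measurable borel" using borel_measurable_integrable[OF r] by simp
  have cont0: "(\<integral>x. r x * of_real (q (cis x)) \<partial>mT) = 0" if q: "continuous_on UNIV q" and qb: "\<And>z. \<bar>q z\<bar> \<le> 1" for q :: "complex \<Rightarrow> real"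
  proof -
    have qm[measurable]: "q \<in> borel_measurable borel" using q by (rule borel_measurable_continuous_onI)
    have [measurable]: "cis \<in> borel_measurable borel" by (intro borel_measurable_continuous_onI continuous_intros)
    have iq: "integrable mT (\<lambda>x. r x * of_real (q (cis x)))"
      by (rule Bochner_Integration.integrable_bound[OF r]) (use qb in \<open>auto simp: norm_mult intro!: mult_left_le\<close>)
    have "cmod (\<integral>x. r x * of_real (q (cis x)) \<partial>mT) \<le> e * (\<integral>x. cmod (r x) \<partial>mT)" if e: "e > 0" for e
    proof -
      obtain g where g: "real_polynomial_function g" "\<And>z. z \<in> sphere 0 1 \<Longrightarrow> \<bar>q z - g z\<bar> < e"
        using Stone_Weierstrass_real_polynomial_function[OF compact_sphere continuous_on_subset[OF q] e] by blast
      note G = real_polynomial_cis_integral_zero[OF g(1) r r0]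
      have g0: "(\<integral>x. r x * of_real (g (cis x)) \<partial>mT) = 0" using G by (auto dest: spec[of _ 0])
      have "(\<integral>x. r x * of_real (q (cis x)) \<partial>mT) = (\<integral>x. r x * of_real (q (cis x)) - r x * of_real (g (cis x)) \<partial>mT)"
        using iq G g0 by simp
      also have "cmod \<dots> \<le> (\<integral>x. cmod (r x * of_real (q (cis x)) - r x * of_real (g (cis x))) \<partial>mT)"
        by (rule integral_norm_bound)
      also have "\<dots> \<le> (\<integral>x. e * cmod (r x) \<partial>mT)"
      proof (rule integral_mono)
        fix x
        have "cmod (r x * of_real (q (cis x)) - r x * of_real (g (cis x))) = cmod (r x) * \<bar>q (cis x) - g (cis x)\<bar>"
          by (simp add: right_diff_distrib[symmetric] norm_mult flip: of_real_diff)
        also have "\<dots> \<le> cmod (r x) * e" using g(2)[of "cis x"] by (intro mult_left_mono) auto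
        finally show "cmod (r x * of_real (q (cis x)) - r x * of_real (g (cis x))) \<le> e * cmod (r x)" by (simp add: mult.commute)
      qed (use iq G r in auto)
      finally show ?thesis by simp
    qed
    note le = this
    have "((\<lambda>e. e * (\<integral>x. cmod (r x) \<partial>mT)) \<longlongrightarrow> 0 * (\<integral>x. cmod (r x) \<partial>mT)) (at_right 0)" by (intro tendsto_intros)
    then have "cmod (\<integral>x. r x * of_real (q (cis x)) \<partial>mT) \<le> 0 * (\<integral>x. cmod (r x) \<partial>mT)"
      by (rule tendsto_lowerbound) (auto simp: eventually_at_filter le)
    then show ?thesis by simp
  qed
  define F where "F x = indicator {0..<2*pi} x *\<^sub>R r x" for x
  have F: "integrable lborel F" using r integral_mT(2)[of r] unfolding F_def by simp
  have "AE x in lborel. F x = 0"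
  proof (rule AE_zero_if_box_integrals_zero[OF F])
    fix l u :: real
    define \<alpha> \<beta> where "\<alpha> = max 0 l" and "\<beta> = min (2 * pi) u"
    define C where "C = cis ` ({0..\<alpha>} \<union> {\<beta>..2*pi})"
    have C: "closed C" "C \<noteq> {}" unfolding C_def
      by (auto intro!: compact_imp_closed compact_continuous_image continuous_intros compact_Un simp: \<alpha>_def)
    \<comment> \<open>Truncated multiples of the distance to the closed set \<open>C\<close> are
      continuous on the circle and increase to the indicator of its complement.\<close>
    define q where "q n z = min 1 (real n * infdist z C)" for n z
    have "(\<lambda>n. \<integral>x. r x * of_real (q n (cis x)) \<partial>mT) \<longlonglongrightarrow> (\<integral>x. r x * of_real (indicator {\<alpha><..<\<beta>} x) \<partial>mT)"
    proof (rule integral_dominated_convergence[where w = "\<lambda>x. cmod (r x)"])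
      have "(\<lambda>n. q n (cis x)) \<longlonglongrightarrow> indicator {\<alpha><..<\<beta>} x" if x: "x \<in> {0..<2*pi}" for x
      proof (rule tendsto_eventually)
        have iff: "cis x \<in> C \<longleftrightarrow> \<not> (\<alpha> < x \<and> x < \<beta>)"
          unfolding C_def by (rule cis_in_image_iff) (use x in \<open>auto simp: \<alpha>_def \<beta>_def\<close>)
        show "\<forall>\<^sub>F n in sequentially. q n (cis x) = indicator {\<alpha><..<\<beta>} x"
        proof (cases "cis x \<in> C")
          case True
          then show ?thesis using iff by (auto simp: q_def)
        next
          case False
          then have pos: "infdist (cis x) C > 0" using C infdist_pos_not_in_closed by blast
          obtain N where "1 < real N * infdist (cis x) C" using ex_less_of_nat_mult[OF pos] by blast
          then have "1 \<le> real n * infdist (cis x) C" if "n \<ge> N" for n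
            using that pos mult_right_mono[of "real N" "real n" "infdist (cis x) C"] by linarith
          then show ?thesis using iff False by (intro eventually_sequentiallyI[of N]) (auto simp: q_def min_def)
        qed
      qed
      then show "AE x in mT. (\<lambda>n. r x * of_real (q n (cis x))) \<longlonglongrightarrow> r x * of_real (indicator {\<alpha><..<\<beta>} x)"
        unfolding AE_mT by (intro AE_I2 impI tendsto_intros)
      show "(\<lambda>x. r x * of_real (q n (cis x))) \<in> borel_measurable mT" for n
      proof -
        have "continuous_on UNIV (\<lambda>x. q n (cis x))" unfolding q_def by (intro continuous_intros)
        then have [measurable]: "(\<lambda>x. q n (cis x)) \<in> borel_measurable borel" by (rule borel_measurable_continuous_onI)
        show ?thesis by measurable
      qed
      show "AE x in mT. cmod (r x * of_real (q n (cis x))) \<le> cmod (r x)" for n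
        by (intro AE_I2) (auto simp: norm_mult q_def infdist_nonneg intro!: mult_left_le)
    qed (use r in auto)
    moreover have "(\<integral>x. r x * of_real (q n (cis x)) \<partial>mT) = 0" for n
      by (rule cont0) (auto simp: q_def infdist_nonneg intro!: continuous_intros)
    ultimately have z: "(\<integral>x. r x * of_real (indicator {\<alpha><..<\<beta>} x) \<partial>mT) = 0"
      by (simp add: LIMSEQ_const_iff)
    have "(\<integral>x. indicator (box l u) x *\<^sub>R F x \<partial>lborel) = (\<integral>x. indicator {0..<2*pi} x *\<^sub>R (r x * of_real (indicator {\<alpha><..<\<beta>} x)) \<partial>lborel)"
    proof (rule integral_cong_AE)
      \<comment> \<open>The two integrands can differ only at 0, which belongs to the half-open
        fundamental domain but never to the open interval (\<alpha>, \<beta>).\<close>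
      have "AE x in lborel. x \<noteq> (0::real)" by (rule AE_lborel_singleton)
      then show "AE x in lborel. indicator (box l u) x *\<^sub>R F x = indicator {0..<2*pi} x *\<^sub>R (r x * of_real (indicator {\<alpha><..<\<beta>} x))"
        by eventually_elim (auto simp: F_def indicator_def \<alpha>_def \<beta>_def box_real)
    qed (auto simp: F_def)
    also have "\<dots> = 0" using z by (subst (asm) integral_mT) auto
    finally show "(\<integral>x. indicator (box l u) x *\<^sub>R F x \<partial>lborel) = 0" .
  qed
  then show ?thesis unfolding AE_mT by eventually_elim (auto simp: F_def)
qed

lemma sigma_finite_mT: "sigma_finite_measure mT"
  by (rule mT.sigma_finite_measure_axioms)

interpretation lT: pair_sigma_finite "lborel :: 'a::euclidean_space measure" mT
  by (simp add: pair_sigma_finite_def sigma_finite_lborel sigma_finite_mT)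

section \<open>The product measure on R^d x T and completeness of Gaussian modes\<close>

definition mX :: "('a::euclidean_space \<times> real) measure" where
  "mX = lborel \<Otimes>\<^sub>M mT"

lemma sets_mX [measurable_cong, simp]: "sets (mX :: ('a::euclidean_space \<times> real) measure) = sets borel"
  unfolding mX_def borel_prod[symmetric] by (intro sets_pair_measure_cong) simp_all

lemma space_mX [simp]: "space (mX :: ('a::euclidean_space \<times> real) measure) = UNIV"
  by (simp add: mX_def space_pair_measure)

lemma sigma_finite_mX: "sigma_finite_measure (mX :: ('a::euclidean_space \<times> real) measure)"
  unfolding mX_def by (rule lT.P.sigma_finite_measure_axioms)

lemma mX_density: "(mX :: ('a::euclidean_space \<times> real) measure) = density lborel (indicator (UNIV \<times> {0..<2*pi}))"
proof -
  have "(mX :: ('a \<times> real) measure) = density lborel (\<lambda>_. 1) \<Otimes>\<^sub>M density lborel (indicator {0..<2*pi})"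
    by (simp add: mX_def mT_def density_1)
  also have "\<dots> = density (lborel \<Otimes>\<^sub>M lborel) (\<lambda>(x, y). 1 * indicator {0..<2*pi} y)"
    by (rule pair_measure_density) (auto simp: sigma_finite_lborel mT_def[symmetric] sigma_finite_mT)
  also have "(\<lambda>(x, y). 1 * indicator {0..<2*pi} y) = (indicator (UNIV \<times> {0..<2*pi}) :: 'a \<times> real \<Rightarrow> ennreal)"
    by (auto simp: indicator_def fun_eq_iff)
  finally show ?thesis by (simp add: lborel_prod)
qed

lemma integral_mX:
  fixes f :: "(real^'d::finite) \<times> real \<Rightarrow> 'b::{banach,second_countable_topology}"
  assumes f: "f \<in> borel_measurable borel"
  shows "(LINT z:fund_dom|lborel. f z) = (\<integral>z. f z \<partial>mX)"
    and "set_integrable lborel fund_dom f \<longleftrightarrow> integrable mX f"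
proof -
  have eq: "mX = density lborel (\<lambda>z. ennreal (indicator (fund_dom :: ((real^'d) \<times> real) set) z))"
    by (simp add: mX_density fund_dom_def ennreal_indicator)
  have [measurable]: "(fund_dom :: ((real^'d) \<times> real) set) \<in> sets borel"
    unfolding fund_dom_def borel_prod[symmetric] by (intro pair_measureI) auto
  show "(LINT z:fund_dom|lborel. f z) = (\<integral>z. f z \<partial>mX)"
    unfolding eq set_lebesgue_integral_def using f by (subst integral_density) auto
  show "set_integrable lborel fund_dom f \<longleftrightarrow> integrable mX f"
    unfolding eq set_integrable_def using f by (subst integrable_density) auto
qed

text \<open>Completing the square: the unit Gaussian weight times a Gaussian of parameter
  \<open>a\<close> is a multiple of a recentred Gaussian of parameter \<open>1 + a\<close>. An
  integrability weight can thereby be absorbed into the test family.\<close>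

lemma gaussian_product:
  fixes y b :: "'a::real_inner"
  assumes "0 < a"
  shows "exp (- (norm y)\<^sup>2 / 2) * exp (- a / 2 * (norm (y - b))\<^sup>2)
    = exp (- a / (2 * (1 + a)) * (norm b)\<^sup>2) * exp (- (1 + a) / 2 * (norm (y - (a / (1 + a)) *\<^sub>R b))\<^sup>2)"
proof -
  define k where "k = a / (1 + a)"
  have k: "(1 + a) * k = a" using assms by (simp add: k_def)
  have nd: "(norm (y - t *\<^sub>R b))\<^sup>2 = (norm y)\<^sup>2 - 2 * t * (y \<bullet> b) + t\<^sup>2 * (norm b)\<^sup>2" for t
    unfolding power2_norm_eq_inner by (simp add: inner_diff_left inner_diff_right inner_commute power2_eq_square algebra_simps)
  have "(1 + a) * (norm (y - k *\<^sub>R b))\<^sup>2 = (1 + a) * (norm y)\<^sup>2 - 2 * ((1 + a) * k) * (y \<bullet> b) + ((1 + a) * k) * k * (norm b)\<^sup>2"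
    unfolding nd by (simp add: algebra_simps power2_eq_square)
  moreover have "a * k = a - k" using k by (simp add: algebra_simps)
  ultimately have 1: "(1 + a) * (norm (y - k *\<^sub>R b))\<^sup>2 = (1 + a) * (norm y)\<^sup>2 - 2 * a * (y \<bullet> b) + (a - k) * (norm b)\<^sup>2"
    by (simp only: k)
  have "a * (norm (y - b))\<^sup>2 = a * ((norm y)\<^sup>2 - 2 * (y \<bullet> b) + (norm b)\<^sup>2)" using nd[of 1] by simp
  with 1 have *: "(norm y)\<^sup>2 + a * (norm (y - b))\<^sup>2 = k * (norm b)\<^sup>2 + (1 + a) * (norm (y - k *\<^sub>R b))\<^sup>2"
    unfolding 1 by (simp add: algebra_simps)
  have k2: "- a / (2 * (1 + a)) = - k / 2" by (simp add: k_def)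
  have "- Y / 2 + - a / 2 * X = - k / 2 * B + - (1 + a) / 2 * Z" if "Y + a * X = k * B + (1 + a) * Z" for X Y B Z
    using that by (simp add: field_simps)
  from this[OF *] show ?thesis unfolding exp_add[symmetric] k_def[symmetric] k2 by simp
qed

text \<open>Completeness of the coherent family on \<open>\<real>\<^sup>d \<times> \<T>\<close>: \<open>r\<close> may grow, it is only assumed integrable against a Gaussian.\<close>

lemma AE_zero_if_orthogonal_to_gaussians:
  fixes r :: "'a::euclidean_space \<times> real \<Rightarrow> complex"
  assumes rm: "r \<in> borel_measurable borel"
    and ri: "integrable mX (\<lambda>z. r z * of_real (exp (- (norm (fst z))\<^sup>2 / 2)))"
    and r0: "\<And>a b k. 0 < a \<Longrightarrow> (\<integral>z. r z * of_real (exp (- a / 2 * (norm (fst z - b))\<^sup>2)) * exp (\<i> * of_real (of_int k * snd z)) \<partial>mX) = 0"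
  shows "AE z in mX. r z = 0"
proof -
  note [measurable] = rm
  have rm'[measurable]: "r \<in> borel_measurable (lborel \<Otimes>\<^sub>M mT)" using rm unfolding mX_def[symmetric] by (simp cong: measurable_cong_sets)
  \<comment> \<open>The Gaussian weight is what makes the Fourier coefficients of \<open>r\<close>
    in \<open>x\<close> integrable in \<open>y\<close>.\<close>
  define F where "F k y = (\<integral>x. r (y, x) * exp (\<i> * of_real (of_int k * x)) \<partial>mT) * of_real (exp (- (norm y)\<^sup>2 / 2))" for k :: int and y
  define R where "R k z = r z * of_real (exp (- (norm (fst z))\<^sup>2 / 2)) * exp (\<i> * of_real (of_int k * snd z))" for k :: int and z
  have Rm[measurable]: "R k \<in> borel_measurable (lborel \<Otimes>\<^sub>M mT)" for k unfolding R_def by measurable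
  have Ri: "integrable (lborel \<Otimes>\<^sub>M mT) (R k)" for k
    using ri unfolding mX_def by (rule Bochner_Integration.integrable_bound) (auto simp: R_def norm_mult)
  have FR: "F k y = (\<integral>x. R k (y, x) \<partial>mT)" for k y
    unfolding F_def R_def by (subst integral_mult_left_zero[symmetric]) (simp add: mult_ac)
  have Fi: "integrable lborel (F k)" for k
    unfolding FR by (rule lT.integrable_fst'[OF Ri])
  have "AE y in lborel. F k y = 0" for k
  proof (rule AE_zero_if_gaussian_integrals_zero[OF Fi])
    fix a :: real and b :: 'a assume a: "0 < a"
    define c where "c = exp (- a / (2 * (1 + a)) * (norm b)\<^sup>2)"
    define b' where "b' = (a / (1 + a)) *\<^sub>R b"
    have int: "integrable (lborel \<Otimes>\<^sub>M mT) (\<lambda>z. R k z * of_real (exp (- a / 2 * (norm (fst z - b))\<^sup>2)))"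
      by (rule Bochner_Integration.integrable_bound[OF Ri[of k]]) (use a in \<open>auto simp: norm_mult intro!: AE_I2 mult_left_le\<close>)
    have "(\<integral>y. F k y * of_real (exp (- a / 2 * (norm (y - b))\<^sup>2)) \<partial>lborel)
      = (\<integral>y. (\<integral>x. R k (y, x) * of_real (exp (- a / 2 * (norm (y - b))\<^sup>2)) \<partial>mT) \<partial>lborel)"
      unfolding FR by (subst integral_mult_left_zero[symmetric]) simp
    also have "\<dots> = (\<integral>z. R k z * of_real (exp (- a / 2 * (norm (fst z - b))\<^sup>2)) \<partial>(lborel \<Otimes>\<^sub>M mT))"
      using lT.integral_fst'[OF int] by simp
    also have "\<dots> = (\<integral>z. of_real c * (r z * of_real (exp (- (1 + a) / 2 * (norm (fst z - b'))\<^sup>2)) * exp (\<i> * of_real (of_int k * snd z))) \<partial>(lborel \<Otimes>\<^sub>M mT))"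
    proof (rule Bochner_Integration.integral_cong[OF refl])
      fix z :: "'a \<times> real"
      have *: "r * X * E * Y = C * (r * Z * E)" if "X * Y = C * Z" for r X E Y C Z :: complex
      proof -
        have "r * X * E * Y = r * E * (X * Y)" by (simp only: mult_ac)
        then show ?thesis unfolding that by (simp only: mult_ac)
      qed
      have "complex_of_real (exp (- (norm (fst z))\<^sup>2 / 2)) * of_real (exp (- a / 2 * (norm (fst z - b))\<^sup>2)) = of_real c * of_real (exp (- (1 + a) / 2 * (norm (fst z - b'))\<^sup>2))"
        unfolding of_real_mult[symmetric] c_def b'_def using gaussian_product[OF a, of "fst z" b] by simp
      then show "R k z * of_real (exp (- a / 2 * (norm (fst z - b))\<^sup>2)) = of_real c * (r z * of_real (exp (- (1 + a) / 2 * (norm (fst z - b'))\<^sup>2)) * exp (\<i> * of_real (of_int k * snd z)))"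
        unfolding R_def by (rule *)
    qed
    also have "\<dots> = 0" unfolding mX_def[symmetric] using r0[of "1 + a" b' k] a by simp
    finally show "(\<integral>y. F k y * of_real (exp (- a / 2 * (norm (y - b))\<^sup>2)) \<partial>lborel) = 0" .
  qed
  then have "AE y in lborel. \<forall>k. F k y = 0" by (simp add: AE_all_countable)
  moreover have "AE y in lborel. integrable mT (\<lambda>x. R 0 (y, x))" by (rule lT.AE_integrable_fst'[OF Ri])
  ultimately have "AE y in lborel. AE x in mT. r (y, x) = 0"
  proof eventually_elim
    case (elim y)
    \<comment> \<open>At fixed \<open>y\<close> the weight is a nonzero constant and can be divided
      out of the slice.\<close>
    have "integrable mT (\<lambda>x. R 0 (y, x) * of_real (exp ((norm y)\<^sup>2 / 2)))" using elim by simp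
    then have i: "integrable mT (\<lambda>x. r (y, x))"
      unfolding R_def by (simp add: mult.assoc flip: of_real_mult exp_add)
    show ?case by (rule AE_zero_if_fourier_series_zero[OF i]) (use elim in \<open>auto simp: F_def\<close>)
  qed
  moreover have "{z \<in> space (lborel \<Otimes>\<^sub>M mT). r z = 0} \<in> sets (lborel \<Otimes>\<^sub>M mT)" by measurable
  ultimately show ?thesis unfolding mX_def by (intro lT.AE_pair_measure)
qed

section \<open>Smooth functions and bumps\<close>

text \<open>The index makes the family closed under differentiation: the derivative of
  \<open>bump n\<close> is a linear combination of \<open>bump (n + 1)\<close> and
  \<open>bump (n + 2)\<close>. Smoothness of cutoffs then needs a single derivative rule.\<close>

definition bump :: "nat \<Rightarrow> real \<Rightarrow> real" where
  "bump n s = (if 0 < s then exp (- 1 / s) / s ^ n else 0)"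

lemma bump_pos: "0 < s \<Longrightarrow> 0 < bump n s" and bump_zero: "s \<le> 0 \<Longrightarrow> bump n s = 0" and bump_nonneg: "0 \<le> bump n s"
  by (auto simp: bump_def)

lemma bump_tendsto_0: "(bump n \<longlongrightarrow> 0) (at_right 0)"
proof -
  have "((\<lambda>s. (inverse s) ^ n / exp (inverse s)) \<longlongrightarrow> 0) (at_right (0::real))"
    by (rule filterlim_compose[OF tendsto_power_div_exp_0 filterlim_inverse_at_top_right])
  moreover have "\<forall>\<^sub>F s in at_right 0. (inverse s) ^ n / exp (inverse s) = bump n s"
    by (auto simp: eventually_at_filter bump_def exp_minus field_simps power_inverse)
  ultimately show ?thesis by (rule Lim_transform_eventually)
qed

lemma DERIV_bmp: "(bump n has_real_derivative (bump (n + 2) s - real n * bump (n + 1) s)) (at s)"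
proof -
  consider "s > 0" | "s < 0" | "s = 0" by linarith
  then show ?thesis
  proof cases
    case 1
    have "((\<lambda>s. exp (- 1 / s) / s ^ n) has_real_derivative (bump (n + 2) s - real n * bump (n + 1) s)) (at s)"
    proof (rule DERIV_cong)
      show "((\<lambda>s. exp (- 1 / s) / s ^ n) has_real_derivative ((exp (- 1 / s) * (1 / s ^ 2)) * s ^ n - exp (- 1 / s) * (real n * s ^ (n - 1))) / (s ^ n * s ^ n)) (at s)"
        using 1 by (auto intro!: derivative_eq_intros simp: power2_eq_square)
      show "((exp (- 1 / s) * (1 / s ^ 2)) * s ^ n - exp (- 1 / s) * (real n * s ^ (n - 1))) / (s ^ n * s ^ n) = bump (n + 2) s - real n * bump (n + 1) s"
        using 1 by (cases n) (auto simp: bump_def field_simps power2_eq_square)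
    qed
    moreover have "\<forall>\<^sub>F t in nhds s. bump n t = exp (- 1 / t) / t ^ n"
      using eventually_nhds_in_open[of "{0<..}" s] 1 by (auto elim!: eventually_mono simp: bump_def)
    ultimately show ?thesis by (simp add: DERIV_cong_ev)
  next
    case 2
    have "\<forall>\<^sub>F t in nhds s. bump n t = 0"
      using eventually_nhds_in_open[of "{..<0}" s] 2 by (auto elim!: eventually_mono simp: bump_def)
    moreover have "((\<lambda>t. 0::real) has_real_derivative (bump (n + 2) s - real n * bump (n + 1) s)) (at s)"
      using 2 by (simp add: bump_zero)
    ultimately show ?thesis by (subst DERIV_cong_ev[OF refl _ refl])
  next
    case 3
    have "((\<lambda>h. bump n h / h) \<longlongrightarrow> 0) (at 0)"
      unfolding filterlim_at_split
    proof
      have "\<forall>\<^sub>F h in at_left (0::real). 0 = bump n h / h"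
        by (auto simp: eventually_at_filter bump_def)
      then show "((\<lambda>h. bump n h / h) \<longlongrightarrow> 0) (at_left 0)"
        by (rule Lim_transform_eventually[OF tendsto_const])
      \<comment> \<open>To the right of 0 the difference quotient of \<open>bump n\<close> is
        \<open>bump (Suc n)\<close>, so flatness at 0 is inherited within the family.\<close>
      have "\<forall>\<^sub>F h in at_right (0::real). bump (Suc n) h = bump n h / h"
        by (auto simp: eventually_at_filter bump_def)
      then show "((\<lambda>h. bump n h / h) \<longlongrightarrow> 0) (at_right 0)"
        by (rule Lim_transform_eventually[OF bump_tendsto_0])
    qed
    then show ?thesis using 3 by (simp add: DERIV_def bump_zero)
  qed
qed

lemma continuous_bmp: "continuous_on UNIV (bump n)"
  using DERIV_bmp by (meson DERIV_isCont continuous_at_imp_continuous_on)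

definition has_dpart :: "('a::real_normed_vector \<Rightarrow> complex) \<Rightarrow> 'a \<Rightarrow> ('a \<Rightarrow> complex) \<Rightarrow> bool" where
  "has_dpart f v f' \<longleftrightarrow> (\<forall>z. ((\<lambda>s::real. f (z + s *\<^sub>R v)) has_vector_derivative f' z) (at 0))"

lemma has_dpart_dpart: "has_dpart f v f' \<Longrightarrow> dpart v f = f'"
  by (auto simp: has_dpart_def dpart_def fun_eq_iff intro: vector_derivative_at)

lemma has_dpart_const: "has_dpart (\<lambda>_. c) v (\<lambda>_. 0)"
  by (simp add: has_dpart_def)

lemma has_dpart_lin:
  assumes "bounded_linear f" shows "has_dpart f v (\<lambda>_. f v)"
proof -
  interpret bounded_linear f by fact
  show ?thesis unfolding has_dpart_def add scaleR
    by (auto intro!: derivative_eq_intros)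
qed

lemma has_dpart_add: "has_dpart f v f' \<Longrightarrow> has_dpart g v g' \<Longrightarrow> has_dpart (\<lambda>z. f z + g z) v (\<lambda>z. f' z + g' z)"
  unfolding has_dpart_def by (auto intro: has_vector_derivative_add)

lemma has_dpart_mult: "has_dpart f v f' \<Longrightarrow> has_dpart g v g' \<Longrightarrow> has_dpart (\<lambda>z. f z * g z) v (\<lambda>z. f z * g' z + f' z * g z)"
  unfolding has_dpart_def using has_vector_derivative_mult[of "\<lambda>s. f (_ + s *\<^sub>R v)" _ 0 UNIV "\<lambda>s. g (_ + s *\<^sub>R v)"] by force

lemma has_dpart_field:
  assumes "has_dpart f v f'" "\<And>z. (F has_field_derivative F' z) (at (f z))"
  shows "has_dpart (\<lambda>z. F (f z)) v (\<lambda>z. f' z * F' z)"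
  unfolding has_dpart_def
proof
  fix z
  have "((F \<circ> (\<lambda>s. f (z + s *\<^sub>R v))) has_vector_derivative (f' z * F' z)) (at 0)"
    using assms(1) assms(2)[of z] by (intro field_vector_diff_chain_at) (auto simp: has_dpart_def)
  then show "((\<lambda>s. F (f (z + s *\<^sub>R v))) has_vector_derivative f' z * F' z) (at 0)" by (simp add: o_def)
qed

lemma has_dpart_exp: "has_dpart f v f' \<Longrightarrow> has_dpart (\<lambda>z. exp (f z)) v (\<lambda>z. f' z * exp (f z))"
  by (rule has_dpart_field) (auto intro!: derivative_eq_intros)

lemma has_dpart_inverse: "has_dpart f v f' \<Longrightarrow> (\<And>z. f z \<noteq> 0) \<Longrightarrow> has_dpart (\<lambda>z. inverse (f z)) v (\<lambda>z. f' z * (- inverse (f z) * inverse (f z)))"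
  by (rule has_dpart_field) (auto intro!: derivative_eq_intros)

lemma has_dpart_csqrt: "has_dpart f v f' \<Longrightarrow> (\<And>z. Re (f z) > 0) \<Longrightarrow> has_dpart (\<lambda>z. csqrt (f z)) v (\<lambda>z. f' z * (1/2 * inverse (csqrt (f z))))"
proof (rule has_dpart_field, assumption)
  fix z assume "\<And>z. Re (f z) > 0"
  then have "f z \<notin> \<real>\<^sub>\<le>\<^sub>0" by (force simp: complex_nonpos_Reals_iff dest: spec[of _ z])
  then show "(csqrt has_field_derivative 1 / 2 * inverse (csqrt (f z))) (at (f z))"
    using has_field_derivative_csqrt[of "f z"] by (simp add: inverse_eq_divide)
qed

lemma has_dpart_real_comp:
  assumes "has_dpart f v f'" "\<And>z. f z = of_real (g z)" "\<And>s. (F has_real_derivative F' s) (at s)"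
  shows "has_dpart (\<lambda>z. of_real (F (g z))) v (\<lambda>z. f' z * of_real (F' (g z)))"
  unfolding has_dpart_def
proof
  fix z
  have f: "((\<lambda>s. of_real (g (z + s *\<^sub>R v))) has_vector_derivative f' z) (at 0)"
    using assms(1,2) by (simp add: has_dpart_def)
  from bounded_linear.has_vector_derivative[OF bounded_linear_Re f]
  have g: "((\<lambda>s. g (z + s *\<^sub>R v)) has_real_derivative Re (f' z)) (at 0)"
    by (simp add: has_real_derivative_iff_has_vector_derivative)
  \<comment> \<open>The path is real-valued, so the imaginary part of its derivative is the
    derivative of 0; the real chain rule then applies.\<close>
  from bounded_linear.has_vector_derivative[OF bounded_linear_Im f]
  have "((\<lambda>s::real. 0::real) has_vector_derivative Im (f' z)) (at 0)" by simp
  then have "Im (f' z) = 0" by (metis has_vector_derivative_const vector_derivative_unique_at)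
  then have f': "f' z = of_real (Re (f' z))" by (simp add: complex_eq_iff)
  have "((\<lambda>s. F (g (z + s *\<^sub>R v))) has_real_derivative (F' (g (z + 0 *\<^sub>R v)) * Re (f' z))) (at 0)"
    by (rule DERIV_chain2[OF _ g]) (rule assms(3))
  from has_vector_derivative_of_real[OF this]
  show "((\<lambda>s. complex_of_real (F (g (z + s *\<^sub>R v)))) has_vector_derivative f' z * of_real (F' (g z))) (at 0)"
    by (subst f') (simp add: mult.commute flip: of_real_mult)
qed

text \<open>A syntactic class of functions built by operations whose partial derivatives stay in the
  class. Membership thus yields all iterated partial derivatives at once, and smoothness of every
  test function below is checked by following its expression. The side condition for
  \<open>csqrt\<close> keeps the argument away from the branch cut.\<close>

inductive smc :: "('a::euclidean_space \<Rightarrow> complex) \<Rightarrow> bool" where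
  smc_const: "smc (\<lambda>_. c)"
| smc_lin: "bounded_linear f \<Longrightarrow> smc f"
| smc_add: "smc f \<Longrightarrow> smc g \<Longrightarrow> smc (\<lambda>z. f z + g z)"
| smc_mult: "smc f \<Longrightarrow> smc g \<Longrightarrow> smc (\<lambda>z. f z * g z)"
| smc_exp: "smc f \<Longrightarrow> smc (\<lambda>z. exp (f z))"
| smc_inverse: "smc f \<Longrightarrow> (\<And>z. f z \<noteq> 0) \<Longrightarrow> smc (\<lambda>z. inverse (f z))"
| smc_csqrt: "smc f \<Longrightarrow> (\<And>z. Re (f z) > 0) \<Longrightarrow> smc (\<lambda>z. csqrt (f z))"
| smc_bmp: "smc f \<Longrightarrow> (\<And>z. f z = of_real (g z)) \<Longrightarrow> smc (\<lambda>z. of_real (bump n (g z)))"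

lemma smc_cmult: "smc f \<Longrightarrow> smc (\<lambda>z. c * f z)"
  by (intro smc_mult smc_const)

lemma smc_sum: "(\<And>i. i \<in> I \<Longrightarrow> smc (f i)) \<Longrightarrow> smc (\<lambda>z. \<Sum>i\<in>I. f i z)"
  by (induction I rule: infinite_finite_induct) (auto intro: smc_const smc_add)

lemma smc_power: "smc f \<Longrightarrow> smc (\<lambda>z. f z ^ n)"
  by (induction n) (auto intro: smc_const smc_mult)

lemma smc_continuous: "smc f \<Longrightarrow> continuous_on UNIV f"
proof (induction rule: smc.induct)
  case (smc_lin f)
  then show ?case by (rule bounded_linear.continuous_on[OF _ continuous_on_id])
next
  case (smc_csqrt f)
  have "f x \<notin> \<real>\<^sub>\<le>\<^sub>0" for x using smc_csqrt(2)[of x] by (auto simp: complex_nonpos_Reals_iff)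
  then show ?case using smc_csqrt(3)
    by (intro continuous_on_compose2[OF continuous_on_csqrt]) auto
next
  case (smc_bmp f g n)
  have "g = (\<lambda>z. Re (f z))" using smc_bmp by auto
  then have "continuous_on UNIV g" using smc_bmp by (auto intro: continuous_intros)
  then have "continuous_on UNIV (\<lambda>z. bump n (g z))" by (rule continuous_on_compose2[OF continuous_bmp]) auto
  then show ?case by (rule continuous_on_of_real)
qed (auto intro: continuous_intros)

lemma smc_hd: "smc f \<Longrightarrow> \<exists>f'. smc f' \<and> has_dpart f v f'"
proof (induction rule: smc.induct)
  case (smc_const c)
  show ?case by (intro exI conjI, rule smc.smc_const, rule has_dpart_const)
next
  case (smc_lin f)
  then show ?case using has_dpart_lin[of f v] smc.smc_const[of "f v"] by blast
next
  case (smc_add f g)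
  then show ?case using has_dpart_add smc.smc_add by metis
next
  case (smc_mult f g)
  then obtain f' g' where 1: "smc f'" "has_dpart f v f'" "smc g'" "has_dpart g v g'" by blast
  show ?case by (intro exI conjI, rule smc.smc_add[OF smc.smc_mult smc.smc_mult], rule smc_mult, rule 1, rule 1, rule smc_mult, rule has_dpart_mult[OF 1(2,4)])
next
  case (smc_exp f)
  then obtain f' where 1: "smc f'" "has_dpart f v f'" by blast
  show ?case by (intro exI conjI, rule smc.smc_mult[OF 1(1) smc.smc_exp], rule smc_exp, rule has_dpart_exp[OF 1(2)])
next
  case (smc_inverse f)
  then obtain f' where 1: "smc f'" "has_dpart f v f'" by blast
  have "smc (\<lambda>z. f' z * ((-1) * inverse (f z) * inverse (f z)))" using 1 smc_inverse by (intro smc.smc_const smc.smc_add smc.smc_mult smc.smc_inverse smc.smc_csqrt smc.smc_bmp) auto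
  then show ?case using has_dpart_inverse[OF 1(2)] smc_inverse by auto
next
  case (smc_csqrt f)
  then obtain f' where 1: "smc f'" "has_dpart f v f'" by blast
  have nz: "csqrt (f z) \<noteq> 0" for z using smc_csqrt(2)[of z] by auto
  have "smc (\<lambda>z. f' z * (1 / 2 * inverse (csqrt (f z))))" using 1 smc_csqrt nz by (intro smc.smc_const smc.smc_add smc.smc_mult smc.smc_inverse smc.smc_csqrt smc.smc_bmp) auto
  then show ?case using has_dpart_csqrt[OF 1(2)] smc_csqrt by auto
next
  case (smc_bmp f g n)
  then obtain f' where 1: "smc f'" "has_dpart f v f'" by blast
  have "smc (\<lambda>z. f' z * (of_real (bump (n + 2) (g z)) + (- of_real (real n)) * of_real (bump (n + 1) (g z))))"
    by (intro smc.smc_const smc.smc_add smc.smc_mult smc.smc_bmp[OF smc_bmp(1,2)] 1(1))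
  moreover have "(\<lambda>z. f' z * (of_real (bump (n + 2) (g z)) + (- of_real (real n)) * of_real (bump (n + 1) (g z)))) = (\<lambda>z. f' z * of_real (bump (n + 2) (g z) - real n * bump (n + 1) (g z)))"
    by simp
  ultimately show ?case using has_dpart_real_comp[OF 1(2) smc_bmp(2) DERIV_bmp] by metis
qed

lemma smc_dpart: "smc f \<Longrightarrow> smc (dpart v f)"
  using smc_hd has_dpart_dpart by metis

lemma smc_hd_dpart: "smc f \<Longrightarrow> has_dpart f v (dpart v f)"
  using smc_hd has_dpart_dpart by metis

lemma smc_smooth: assumes "smc f" shows "smooth_fun f"
proof -
  have "smc (fold dpart vs f)" for vs
    using assms by (induction vs arbitrary: f) (auto intro: smc_dpart)
  note S = this
  have "continuous_on UNIV (fold dpart vs f)" for vs by (rule smc_continuous[OF S])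
  moreover have "(\<lambda>s::real. fold dpart vs f (z + s *\<^sub>R v)) differentiable (at 0)" for vs v z
    using smc_hd_dpart[OF S[of vs], of v] unfolding has_dpart_def by (intro differentiableI_vector) (rule spec)
  ultimately show ?thesis unfolding smooth_fun_def by blast
qed

lemma dpart_mult: "smc f \<Longrightarrow> smc g \<Longrightarrow> dpart v (\<lambda>z. f z * g z) = (\<lambda>z. f z * dpart v g z + dpart v f z * g z)"
  by (intro has_dpart_dpart has_dpart_mult smc_hd_dpart)

lemma dpart_add: "smc f \<Longrightarrow> smc g \<Longrightarrow> dpart v (\<lambda>z. f z + g z) = (\<lambda>z. dpart v f z + dpart v g z)"
  by (intro has_dpart_dpart has_dpart_add smc_hd_dpart)

lemma dpart2_mult:
  assumes "smc f" "smc g"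
  shows "dpart v (dpart v (\<lambda>z. f z * g z)) = (\<lambda>z. f z * dpart v (dpart v g) z + 2 * (dpart v f z * dpart v g z) + dpart v (dpart v f) z * g z)"
  by (simp add: dpart_mult dpart_add smc_dpart smc_mult assms algebra_simps fun_eq_iff)

section \<open>Coherent states\<close>

lemma borel_measurable_cnj [measurable]:
  "f \<in> borel_measurable M \<Longrightarrow> (\<lambda>x. cnj (f x)) \<in> borel_measurable M"
  using measurable_comp[of f M borel cnj borel] borel_measurable_continuous_onI[of cnj]
  by (simp add: o_def continuous_on_cnj[OF continuous_on_id])

text \<open>The factor by which the free flow changes the width of a Gaussian of parameter
  \<open>a\<close>. Its real part is 1, so the principal square root is always differentiable
  there.\<close>

definition sg :: "real \<Rightarrow> real \<Rightarrow> complex" where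
  "sg a t = 1 + 2 * \<i> * of_real (a * t)"

text \<open>The free evolution of \<open>exp (- a / 2 * |y - b|^2)\<close>: the prefactor is
  \<open>sg a t\<close> to the power -d/2, taken as an integer power of the principal root.\<close>

definition gy :: "real \<Rightarrow> 'a::euclidean_space \<Rightarrow> real \<Rightarrow> 'a \<Rightarrow> complex" where
  "gy a b t y = inverse (csqrt (sg a t)) ^ DIM('a) * exp (- of_real (a / 2 * (norm (y - b))\<^sup>2) / sg a t)"

definition ek :: "int \<Rightarrow> real \<Rightarrow> real \<Rightarrow> complex" where
  "ek k t x = exp (\<i> * of_real (of_int k * x - (of_int k)\<^sup>2 * t))"

definition gm :: "real \<Rightarrow> 'a::euclidean_space \<Rightarrow> int \<Rightarrow> real \<Rightarrow> 'a \<times> real \<Rightarrow> complex" where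
  "gm a b k t z = gy a b t (fst z) * ek k t (snd z)"

text \<open>The Fourier transform of \<open>gy a b 0\<close>, normalised to be unitary; also the asymptotic profile
  of the free evolution in the variable \<open>y / 2t\<close>.\<close>
definition prof :: "real \<Rightarrow> 'a::euclidean_space \<Rightarrow> 'a \<Rightarrow> complex" where
  "prof a b \<xi> = of_real (inverse (sqrt a) ^ DIM('a)) * exp (- of_real ((norm \<xi>)\<^sup>2 / (2 * a)) - \<i> * of_real (b \<bullet> \<xi>))"

lemma Re_sg [simp]: "Re (sg a t) = 1" and Im_sg [simp]: "Im (sg a t) = 2 * a * t"
  by (simp_all add: sg_def)

lemma sg_nz [simp]: "sg a t \<noteq> 0"
  by (auto simp: complex_eq_iff)

lemma sg_pos: "1 + 4 * a\<^sup>2 * t\<^sup>2 > (0::real)"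
  by (intro add_pos_nonneg) auto

lemma sg_not_nonpos: "sg a t \<notin> \<real>\<^sub>\<le>\<^sub>0"
  by (simp add: complex_nonpos_Reals_iff)

lemma norm_gy:
  "cmod (gy a b t (y::'a::euclidean_space)) = inverse (sqrt (cmod (sg a t))) ^ DIM('a) * exp (- (a / (2 * (1 + 4 * a\<^sup>2 * t\<^sup>2))) * (norm (y - b))\<^sup>2)"
proof -
  have *: "- (a / 2 * N) * (1 / D) = - (a / (2 * D)) * N" for N D by simp
  have re: "Re (- of_real x / w) = - x * Re (inverse w)" for x w by (simp add: divide_inverse)
  have "Re (- of_real (a / 2 * (norm (y - b))\<^sup>2) / sg a t) = - (a / 2 * (norm (y - b))\<^sup>2) * Re (inverse (sg a t))"
    by (rule re)
  also have "Re (inverse (sg a t)) = 1 / (1 + 4 * a\<^sup>2 * t\<^sup>2)"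
    by (simp add: power_mult_distrib)
  finally have "Re (- of_real (a / 2 * (norm (y - b))\<^sup>2) / sg a t) = - (a / (2 * (1 + 4 * a\<^sup>2 * t\<^sup>2))) * (norm (y - b))\<^sup>2"
    by (simp only: *)
  then show ?thesis by (simp only: gy_def norm_mult norm_power norm_inverse norm_csqrt norm_exp_eq_Re)
qed

lemma norm_ek [simp]: "cmod (ek k t x) = 1"
  by (simp add: ek_def)

lemma gy_0: "gy a b 0 y = of_real (exp (- a / 2 * (norm (y - b))\<^sup>2))"
  by (simp add: gy_def sg_def exp_of_real[symmetric])

lemma ek_0: "ek k 0 x = exp (\<i> * of_real (of_int k * x))"
  by (simp add: ek_def)

lemma gy_measurable [measurable]: "gy a b t \<in> borel_measurable borel"
  unfolding gy_def[abs_def] by measurable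

lemma ek_measurable [measurable]: "ek k t \<in> borel_measurable borel"
  unfolding ek_def[abs_def] by measurable

lemma prof_measurable [measurable]: "prof a b \<in> borel_measurable borel"
  unfolding prof_def[abs_def] by measurable

lemma gm_measurable [measurable]: "gm a b k t \<in> borel_measurable borel"
  unfolding gm_def[abs_def] borel_prod[symmetric] by measurable

lemma gy_integrable: assumes "0 < a" shows "integrable lborel (gy a b t)"
proof -
  have "integrable lborel (\<lambda>y. cmod (gy a b t y))"
    unfolding norm_gy using sg_pos[of a t] assms
    by (intro integrable_mult_right gaussian_shift_integrable) auto
  then show ?thesis by (subst (asm) integrable_norm_iff) auto
qed

lemma gy_sq_integrable: assumes "0 < a" shows "integrable lborel (\<lambda>y. (cmod (gy a b t y))\<^sup>2)"
proof (rule Bochner_Integration.integrable_bound)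
  show "integrable lborel (\<lambda>y. inverse (sqrt (cmod (sg a t))) ^ DIM('a) * cmod (gy a b t y))"
    using gy_integrable[OF assms] by (intro integrable_mult_right integrable_norm)
  have "cmod (gy a b t y) \<le> inverse (sqrt (cmod (sg a t))) ^ DIM('a)" for y
    unfolding norm_gy using sg_pos[of a t] assms by (intro mult_left_le) auto
  then show "AE y in lborel. norm ((cmod (gy a b t y))\<^sup>2) \<le> norm (inverse (sqrt (cmod (sg a t))) ^ DIM('a) * cmod (gy a b t y))"
    by (intro AE_I2) (simp add: power2_eq_square norm_mult mult_right_mono)
qed measurable

lemma prof_integrable: assumes "0 < a" shows "integrable lborel (prof a b)" "integrable lborel (\<lambda>\<xi>. (cmod (prof a b \<xi>))\<^sup>2)"
proof -
  have n: "cmod (prof a b \<xi>) = inverse (sqrt a) ^ DIM('a) * exp (- (1 / (2 * a)) * (norm \<xi>)\<^sup>2)" for \<xi>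
    using assms by (simp add: prof_def norm_mult norm_exp_eq_Re norm_power norm_inverse)
  have "integrable lborel (\<lambda>y. cmod (prof a b y))"
    unfolding n using assms by (intro integrable_mult_right gaussian_integrable) auto
  then show "integrable lborel (prof a b)" by (subst (asm) integrable_norm_iff) auto
  have e: "(exp (- (1 / (2 * a)) * (norm \<xi>)\<^sup>2))\<^sup>2 = exp (- (1 / a) * (norm \<xi>)\<^sup>2)" for \<xi> :: 'a
    by (simp add: exp_double[symmetric])
  show "integrable lborel (\<lambda>\<xi>. (cmod (prof a b \<xi>))\<^sup>2)"
    unfolding n power_mult_distrib e using assms by (intro integrable_mult_right gaussian_integrable) auto
qed

lemma inverse_csqrt_scale:
  assumes "0 < a" "0 < Re A"
  shows "csqrt (of_real a * A) = of_real (sqrt a) * csqrt A"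
proof -
  have "csqrt (of_real a * A) = csqrt (of_real a) * csqrt A"
  proof (rule csqrt_mult)
    have "\<bar>Arg A\<bar> < pi / 2" using assms(2) arctan_lbound[of "Im A / Re A"] arctan_ubound[of "Im A / Re A"]
      by (simp add: arg_conv_arctan abs_less_iff)
    then show "Arg (complex_of_real a) + Arg A \<in> {- pi<..pi}"
      using assms mpi_less_Arg[of A] Arg_le_pi[of A] by (simp add: Arg_of_real)
  qed
  then show ?thesis using assms by (simp add: csqrt_of_real_nonneg)
qed

text \<open>The free phase \<open>exp (- i t |\<xi>|^2)\<close> merely adds \<open>2 i t\<close> to
  the width 1/a of the profile, giving \<open>A = sg a t / a\<close>; the evolved state is therefore
  one more complex Gaussian integral.\<close>

lemma gy_inverse_fourier:
  fixes y b :: "'a::euclidean_space"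
  assumes a: "0 < a"
  shows "(\<integral>\<xi>. exp (\<i> * of_real (y \<bullet> \<xi>)) * (exp (- \<i> * of_real (t * (norm \<xi>)\<^sup>2)) * prof a b \<xi>) \<partial>lborel)
     = of_real (sqrt (2 * pi) ^ DIM('a)) * gy a b t y"
proof -
  define A where "A = of_real (1 / a) * sg a t"
  have A: "Re A > 0" using a by (simp add: A_def)
  have A': "A = of_real (1 / a) + 2 * \<i> * of_real t" using a by (simp add: A_def sg_def algebra_simps)
  have "(\<integral>\<xi>. exp (\<i> * of_real (y \<bullet> \<xi>)) * (exp (- \<i> * of_real (t * (norm \<xi>)\<^sup>2)) * prof a b \<xi>) \<partial>lborel)
    = (\<integral>\<xi>. of_real (inverse (sqrt a) ^ DIM('a)) * exp (\<i> * of_real ((y - b) \<bullet> \<xi>) - A * of_real ((norm \<xi>)\<^sup>2) / 2) \<partial>lborel)"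
  proof (rule Bochner_Integration.integral_cong[OF refl])
    fix \<xi> :: 'a
    have "exp (\<i> * of_real (y \<bullet> \<xi>)) * (exp (- \<i> * of_real (t * (norm \<xi>)\<^sup>2)) * exp (- of_real ((norm \<xi>)\<^sup>2 / (2 * a)) - \<i> * of_real (b \<bullet> \<xi>)))
      = exp (\<i> * of_real ((y - b) \<bullet> \<xi>) - A * of_real ((norm \<xi>)\<^sup>2) / 2)"
      unfolding exp_add[symmetric] using a
      by (intro arg_cong[of _ _ exp]) (simp add: A' inner_diff_left field_simps)
    then show "exp (\<i> * of_real (y \<bullet> \<xi>)) * (exp (- \<i> * of_real (t * (norm \<xi>)\<^sup>2)) * prof a b \<xi>)
      = of_real (inverse (sqrt a) ^ DIM('a)) * exp (\<i> * of_real ((y - b) \<bullet> \<xi>) - A * of_real ((norm \<xi>)\<^sup>2) / 2)"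
      unfolding prof_def by (simp only: mult.left_commute)
  qed
  also have "\<dots> = of_real (inverse (sqrt a) ^ DIM('a)) * ((of_real (sqrt (2 * pi)) / csqrt A) ^ DIM('a) * exp (- of_real ((norm (y - b))\<^sup>2) / (2 * A)))"
    using gaussian_fourier[OF A, of "y - b"] by simp
  also have "csqrt A = of_real (sqrt (1 / a)) * csqrt (sg a t)"
    unfolding A_def by (rule inverse_csqrt_scale) (use a in auto)
  also have "- of_real ((norm (y - b))\<^sup>2) / (2 * A) = - of_real (a / 2 * (norm (y - b))\<^sup>2) / sg a t"
    using a by (simp add: A_def field_simps)
  finally show ?thesis
    unfolding gy_def using a by (simp add: power_mult_distrib power_divide real_sqrt_divide field_simps)
qed

text \<open>The transform inverts the width a / \<open>sg a t\<close> into 1/a + 2 i t, which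
  separates into the profile and the free phase; recentring at \<open>b\<close> produces the
  character in the profile.\<close>

lemma gy_fourier:
  fixes \<xi> b :: "'a::euclidean_space"
  assumes a: "0 < a"
  shows "(\<integral>y. gy a b t y * exp (- \<i> * of_real (y \<bullet> \<xi>)) \<partial>lborel)
     = of_real (sqrt (2 * pi) ^ DIM('a)) * (exp (- \<i> * of_real (t * (norm \<xi>)\<^sup>2)) * prof a b \<xi>)"
proof -
  define A where "A = of_real a * inverse (sg a t)"
  have Ri: "Re (inverse (sg a t)) > 0" using sg_pos[of a t] by (simp add: power_mult_distrib)
  have A: "Re A > 0" using a Ri unfolding A_def by simp
  have c: "csqrt (inverse (sg a t)) = inverse (csqrt (sg a t))" using csqrt_inverse[of "sg a t"] sg_not_nonpos by auto
  have "(\<integral>y. gy a b t y * exp (- \<i> * of_real (y \<bullet> \<xi>)) \<partial>lborel)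
     = (\<integral>y. gy a b t (b + 1 *\<^sub>R y) * exp (- \<i> * of_real ((b + 1 *\<^sub>R y) \<bullet> \<xi>)) \<partial>lborel)"
    by (subst lborel_integral_affine(1)[of 1 _ b]) auto
  also have "\<dots> = (\<integral>y. inverse (csqrt (sg a t)) ^ DIM('a) * exp (- \<i> * of_real (b \<bullet> \<xi>)) * exp (\<i> * of_real ((- \<xi>) \<bullet> y) - A * of_real ((norm y)\<^sup>2) / 2) \<partial>lborel)"
  proof (rule Bochner_Integration.integral_cong[OF refl])
    fix y :: 'a
    have e: "exp (- of_real (a / 2 * (norm y)\<^sup>2) / sg a t) * exp (- \<i> * of_real ((b + y) \<bullet> \<xi>))
      = exp (- \<i> * of_real (b \<bullet> \<xi>)) * exp (\<i> * of_real ((- \<xi>) \<bullet> y) - A * of_real ((norm y)\<^sup>2) / 2)"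
      unfolding exp_add[symmetric]
      by (intro arg_cong[of _ _ exp]) (simp add: A_def inner_add_left inner_commute[of \<xi> y] field_simps)
    show "gy a b t (b + 1 *\<^sub>R y) * exp (- \<i> * of_real ((b + 1 *\<^sub>R y) \<bullet> \<xi>))
      = inverse (csqrt (sg a t)) ^ DIM('a) * exp (- \<i> * of_real (b \<bullet> \<xi>)) * exp (\<i> * of_real ((- \<xi>) \<bullet> y) - A * of_real ((norm y)\<^sup>2) / 2)"
      unfolding gy_def using e by (simp only: mult.assoc scaleR_one add_diff_cancel_left')
  qed
  also have "\<dots> = inverse (csqrt (sg a t)) ^ DIM('a) * exp (- \<i> * of_real (b \<bullet> \<xi>)) * ((of_real (sqrt (2 * pi)) / csqrt A) ^ DIM('a) * exp (- of_real ((norm (- \<xi>))\<^sup>2) / (2 * A)))"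
    using gaussian_fourier[OF A, of "- \<xi>"] by simp
  also have "csqrt A = of_real (sqrt a) * inverse (csqrt (sg a t))"
    unfolding A_def c[symmetric] by (rule inverse_csqrt_scale[OF a Ri])
  also have "- of_real ((norm (- \<xi>))\<^sup>2) / (2 * A) = - \<i> * of_real (t * (norm \<xi>)\<^sup>2) + - of_real ((norm \<xi>)\<^sup>2 / (2 * a))"
    using a by (simp add: A_def sg_def field_simps)
  finally show ?thesis
    unfolding prof_def exp_add exp_diff using a by (simp add: power_mult_distrib power_divide exp_minus field_simps)
qed

text \<open>Plancherel for coherent states, proved by Fubini from the two explicit transforms. The
  times enter through \<open>t - s\<close> alone, which is the source of unitarity and of the
  constant pairing of two free waves.\<close>

lemma gy_inner:
  fixes b b' :: "'a::euclidean_space"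
  assumes a: "0 < a" "0 < a'"
  shows "(\<integral>y. gy a b t y * cnj (gy a' b' s y) \<partial>lborel)
    = (\<integral>\<xi>. exp (- \<i> * of_real ((t - s) * (norm \<xi>)\<^sup>2)) * (prof a b \<xi> * cnj (prof a' b' \<xi>)) \<partial>lborel)"
proof -
  define c where "c = complex_of_real (sqrt (2 * pi) ^ DIM('a))"
  have c: "c \<noteq> 0" "cnj c = c" by (auto simp: c_def)
  define h where "h \<xi> = cnj (exp (- \<i> * of_real (s * (norm \<xi>)\<^sup>2)) * prof a' b' \<xi>)" for \<xi> :: 'a
  have hm[measurable]: "h \<in> borel_measurable borel" unfolding h_def by measurable
  have hi: "integrable lborel h"
    by (rule Bochner_Integration.integrable_bound[OF prof_integrable(1)[OF a(2), of b']]) (auto simp: h_def norm_mult)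
  have "integrable (lborel \<Otimes>\<^sub>M lborel) (\<lambda>z::'a \<times> 'a. gy a b t (fst z) * h (snd z))"
    by (rule integrable_prod_mult) (use gy_integrable[OF a(1)] hi in \<open>auto intro: sigma_finite_lborel\<close>)
  then have int: "integrable (lborel \<Otimes>\<^sub>M lborel) (\<lambda>(y, \<xi>). gy a b t y * (exp (- \<i> * of_real (y \<bullet> \<xi>)) * h \<xi>))"
    by (rule Bochner_Integration.integrable_bound) (auto simp: norm_mult split_beta)
  have "c * (\<integral>y. gy a b t y * cnj (gy a' b' s y) \<partial>lborel) = (\<integral>y. gy a b t y * cnj (c * gy a' b' s y) \<partial>lborel)"
    by (subst integral_mult_right_zero[symmetric]) (simp add: c mult_ac)
  also have "\<dots> = (\<integral>y. (\<integral>\<xi>. gy a b t y * (exp (- \<i> * of_real (y \<bullet> \<xi>)) * h \<xi>) \<partial>lborel) \<partial>lborel)"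
    unfolding c_def gy_inverse_fourier[OF a(2), symmetric] Bochner_Integration.integral_cnj[symmetric] h_def
    by (simp add: exp_cnj)
  also have "\<dots> = (\<integral>\<xi>. (\<integral>y. gy a b t y * (exp (- \<i> * of_real (y \<bullet> \<xi>)) * h \<xi>) \<partial>lborel) \<partial>lborel)"
    by (rule lborel_pair.Fubini_integral[symmetric, OF int])
  also have "\<dots> = (\<integral>\<xi>. h \<xi> * (\<integral>y. gy a b t y * exp (- \<i> * of_real (y \<bullet> \<xi>)) \<partial>lborel) \<partial>lborel)"
    by (subst integral_mult_right_zero[symmetric]) (simp add: mult_ac)
  also have "\<dots> = (\<integral>\<xi>. c * (exp (- \<i> * of_real ((t - s) * (norm \<xi>)\<^sup>2)) * (prof a b \<xi> * cnj (prof a' b' \<xi>))) \<partial>lborel)"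
    unfolding gy_fourier[OF a(1)] c_def[symmetric]
  proof (rule Bochner_Integration.integral_cong[OF refl])
    fix \<xi> :: 'a
    have *: "(X * p') * (c * (Y * p)) = c * (Z * (p * p'))" if "X * Y = Z" for X Y Z p p' :: complex
      unfolding that[symmetric] by (simp only: mult_ac)
    have "cnj (exp (- \<i> * of_real (s * (norm \<xi>)\<^sup>2))) * exp (- \<i> * of_real (t * (norm \<xi>)\<^sup>2)) = exp (- \<i> * of_real ((t - s) * (norm \<xi>)\<^sup>2))"
      by (simp add: exp_cnj exp_add[symmetric] algebra_simps)
    then show "h \<xi> * (c * (exp (- \<i> * of_real (t * (norm \<xi>)\<^sup>2)) * prof a b \<xi>)) = c * (exp (- \<i> * of_real ((t - s) * (norm \<xi>)\<^sup>2)) * (prof a b \<xi> * cnj (prof a' b' \<xi>)))"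
      unfolding h_def complex_cnj_mult by (rule *)
  qed
  also have "\<dots> = c * (\<integral>\<xi>. exp (- \<i> * of_real ((t - s) * (norm \<xi>)\<^sup>2)) * (prof a b \<xi> * cnj (prof a' b' \<xi>)) \<partial>lborel)"
    by simp
  finally show ?thesis using c by simp
qed

lemma integral_ek: "(\<integral>x. exp (\<i> * of_real (of_int k * x)) \<partial>mT) = (if k = 0 then of_real (2 * pi) else 0)"
proof (cases "k = 0")
  case True
  then show ?thesis by (simp add: measure_def emeasure_mT scaleR_conv_of_real)
next
  case False
  have "(\<integral>x. exp (\<i> * of_real (of_int k * x)) \<partial>mT) = (\<integral>x. indicator {0..<2*pi} x *\<^sub>R exp (\<i> * of_real (of_int k * x)) \<partial>lborel)"
    by (rule integral_mT) measurable
  also have "\<dots> = (\<integral>x. indicator {0..2*pi} x *\<^sub>R exp (\<i> * of_real (of_int k * x)) \<partial>lborel)"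
  proof (rule integral_cong_AE)
    have "AE x in lborel. x \<noteq> 2 * pi" by (rule AE_lborel_singleton)
    then show "AE x in lborel. indicator {0..<2*pi} x *\<^sub>R exp (\<i> * of_real (of_int k * x)) = indicator {0..2*pi} x *\<^sub>R exp (\<i> * of_real (of_int k * x))"
      by eventually_elim (auto simp: indicator_def)
  qed measurable
  also have "\<dots> = exp (\<i> * of_real (of_int k * (2 * pi))) / (\<i> * of_int k) - exp (\<i> * of_real (of_int k * 0)) / (\<i> * of_int k)"
  proof (rule integral_FTC_Icc[where F = "\<lambda>x. exp (\<i> * of_real (of_int k * x)) / (\<i> * of_int k)"])
    show "continuous_on {0..2 * pi} (\<lambda>x. exp (\<i> * of_real (of_int k * x)))" by (intro continuous_intros)
    fix x :: real
    have "((\<lambda>z. exp (c * z) / c) has_field_derivative exp (c * of_real x)) (at (of_real x))" if "c \<noteq> 0" for c :: complex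
      using that by (auto intro!: derivative_eq_intros)
    from this[of "\<i> * of_int k"] False
    have "((\<lambda>z. exp (\<i> * (of_int k * z)) / (\<i> * of_int k)) has_field_derivative exp (\<i> * (of_int k * of_real x))) (at (of_real x))"
      by (simp add: mult.assoc)
    from has_vector_derivative_real_field[OF this]
    show "((\<lambda>x. exp (\<i> * of_real (of_int k * x)) / (\<i> * of_int k)) has_vector_derivative exp (\<i> * of_real (of_int k * x))) (at x within {0..2 * pi})"
      by (simp add: has_vector_derivative_at_within)
  qed simp
  also have "exp (\<i> * of_real (of_int k * (2 * pi))) = exp (2 * of_int k * pi * \<i>)"
    by (simp add: mult_ac)
  also have "\<dots> = 1" by (rule exp_integer_2pi) simp
  finally show ?thesis using False by simp
qed

lemma ek_inner: "(\<integral>x. ek k t x * cnj (ek k' s x) \<partial>mT) = (if k = k' then of_real (2 * pi) * exp (- \<i> * of_real ((of_int k)\<^sup>2 * (t - s))) else 0)"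
proof -
  have "ek k t x * cnj (ek k' s x) = exp (\<i> * of_real ((of_int k')\<^sup>2 * s - (of_int k)\<^sup>2 * t)) * exp (\<i> * of_real (of_int (k - k') * x))" for x
    by (simp add: ek_def exp_cnj exp_add[symmetric] algebra_simps)
  then show ?thesis using integral_ek[of "k - k'"] by (simp add: algebra_simps)
qed

lemma gm_l2: assumes "0 < a" shows "gm a b k t \<in> l2 mX"
proof (rule l2I)
  have "integrable (lborel \<Otimes>\<^sub>M mT) (\<lambda>z. (cmod (gy a b t (fst z)))\<^sup>2 * 1)"
    by (rule integrable_prod_mult) (auto simp: sigma_finite_lborel sigma_finite_mT gy_sq_integrable assms)
  then show "integrable mX (\<lambda>z. (cmod (gm a b k t z))\<^sup>2)"
    by (simp add: mX_def gm_def norm_mult)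
qed (simp cong: measurable_cong_sets)

lemma gm_inner:
  assumes "0 < a" "0 < a'"
  shows "ip mX (gm a b k t) (gm a' b' k' s)
   = (\<integral>\<xi>. exp (- \<i> * of_real ((t - s) * (norm \<xi>)\<^sup>2)) * (prof a b \<xi> * cnj (prof a' b' \<xi>)) \<partial>lborel)
     * (if k = k' then of_real (2 * pi) * exp (- \<i> * of_real ((of_int k)\<^sup>2 * (t - s))) else 0)"
proof -
  have i1: "integrable lborel (\<lambda>y. gy a b t y * cnj (gy a' b' s y))"
    by (rule l2_mult_integrable) (auto simp: l2_def gy_sq_integrable assms)
  have i2: "integrable mT (\<lambda>x. ek k t x * cnj (ek k' s x))"
    by (rule mT.integrable_const_bound[of _ 1]) (auto simp: norm_mult)
  have "ip mX (gm a b k t) (gm a' b' k' s) = (\<integral>z. (gy a b t (fst z) * cnj (gy a' b' s (fst z))) * (ek k t (snd z) * cnj (ek k' s (snd z))) \<partial>(lborel \<Otimes>\<^sub>M mT))"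
    by (simp add: ip_def gm_def mX_def mult_ac)
  also have "\<dots> = (\<integral>y. gy a b t y * cnj (gy a' b' s y) \<partial>lborel) * (\<integral>x. ek k t x * cnj (ek k' s x) \<partial>mT)"
    by (rule integrable_prod_mult(2)[OF sigma_finite_lborel sigma_finite_mT i1 i2])
  finally show ?thesis unfolding gy_inner[OF assms] ek_inner .
qed

text \<open>An entry holds the coefficient, the Gaussian parameter, the centre and the frequency in
  \<open>x\<close>. With lists, sums become concatenation and scalar multiples become a map;
  repeated modes are harmless.\<close>

type_synonym 'a modes = "(complex \<times> real \<times> 'a \<times> int) list"

definition comb :: "'a modes \<Rightarrow> real \<Rightarrow> 'a::euclidean_space \<times> real \<Rightarrow> complex" where
  "comb L t z = (\<Sum>(c, a, b, k)\<leftarrow>L. c * gm a b k t z)"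

definition valid :: "'a modes \<Rightarrow> bool" where
  "valid L \<longleftrightarrow> (\<forall>(c, a, b, k)\<in>set L. 0 < a)"

lemma comb_Nil: "comb [] t = (\<lambda>z. 0)"
  by (simp add: comb_def fun_eq_iff)

lemma comb_Cons: "comb ((c, a, b, k) # L) t = (\<lambda>z. c * gm a b k t z + comb L t z)"
  by (simp add: comb_def fun_eq_iff)

lemma comb_append: "comb (L @ L') t = (\<lambda>z. comb L t z + comb L' t z)"
  by (simp add: comb_def fun_eq_iff)

lemma comb_scale: "comb (map (\<lambda>(c, r). (d * c, r)) L) t = (\<lambda>z. d * comb L t z)"
  by (induction L) (auto simp: comb_def fun_eq_iff distrib_left)

lemma valid_simps [simp]: "valid []" "valid ((c, a, b, k) # L) \<longleftrightarrow> 0 < a \<and> valid L" "valid (L @ L') \<longleftrightarrow> valid L \<and> valid L'"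
  "valid (map (\<lambda>(c, r). (d * c, r)) L) \<longleftrightarrow> valid L"
  unfolding valid_def set_append ball_Un by auto

lemma comb_l2: "valid L \<Longrightarrow> comb L t \<in> l2 mX"
  by (induction L) (auto simp: comb_Nil comb_Cons intro!: l2_add l2_cmult gm_l2)

text \<open>Inherited from \<open>gm_inner\<close>, whose right-hand side sees the two times only
  through their difference.\<close>

lemma comb_inner1:
  assumes "valid L" "0 < a" "t - s = t' - s'"
  shows "ip mX (comb L t) (gm a b k s) = ip mX (comb L t') (gm a b k s')"
  using assms(1)
proof (induction L)
  case Nil
  then show ?case by (simp add: comb_Nil ip_def)
next
  case (Cons x L)
  obtain c a' b' k' where x: "x = (c, a', b', k')" by (cases x)
  show ?case using Cons assms(2,3) unfolding x comb_Cons
    by (simp add: ip_add_left l2_cmult gm_l2 comb_l2 ip_cmult_left gm_inner)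
qed

lemma comb_inner:
  assumes "valid L" "valid L'" "t - s = t' - s'"
  shows "ip mX (comb L t) (comb L' s) = ip mX (comb L t') (comb L' s')"
  using assms(2)
proof (induction L')
  case Nil
  then show ?case by (simp add: comb_Nil ip_def)
next
  case (Cons x L')
  obtain c a' b' k' where x: "x = (c, a', b', k')" by (cases x)
  show ?case using Cons assms(1,3) unfolding x comb_Cons
    by (simp add: ip_add_right l2_cmult gm_l2 comb_l2 ip_cmult_right comb_inner1[OF assms(1) _ assms(3)])
qed

lemma comb_nrm: assumes "valid L" shows "nrm mX (comb L t) = nrm mX (comb L 0)"
proof -
  have "complex_of_real ((nrm mX (comb L t))\<^sup>2) = of_real ((nrm mX (comb L 0))\<^sup>2)"
    unfolding ip_self[OF comb_l2[OF assms], symmetric] by (rule comb_inner) (use assms in auto)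
  then show ?thesis unfolding of_real_eq_iff by simp
qed

lemma comb_diff: "(\<lambda>z. comb L t z - comb L' t z) = comb (L @ map (\<lambda>(c, r). (- 1 * c, r)) L') t"
  unfolding comb_append comb_scale by (simp add: fun_eq_iff)

lemma comb_nrm_diff:
  assumes "valid L" "valid L'"
  shows "nrm mX (\<lambda>z. comb L t z - comb L' t z) = nrm mX (\<lambda>z. comb L 0 z - comb L' 0 z)"
  unfolding comb_diff by (rule comb_nrm) (use assms in \<open>simp only: valid_simps\<close>)

text \<open>This is the coherent state \<open>gm 1 0 0 0\<close>. It serves as the square-integrable
  weight for completeness and also as the weight in the uniqueness lemma for coherent
  states.\<close>

definition wX :: "'a::euclidean_space \<times> real \<Rightarrow> real" where
  "wX z = exp (- (norm (fst z))\<^sup>2 / 2)"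

lemma wX: "wX \<in> borel_measurable (mX :: ('a::euclidean_space \<times> real) measure)" "\<And>z::'a \<times> real. 0 < wX z"
  "integrable mX (\<lambda>z::'a \<times> real. (wX z)\<^sup>2)" "(\<lambda>z::'a \<times> real. complex_of_real (wX z)) \<in> l2 mX"
proof -
  have eq: "(\<lambda>z::'a \<times> real. complex_of_real (wX z)) = gm 1 0 0 0"
    by (simp add: wX_def fun_eq_iff gm_def gy_0 ek_0)
  show l2: "(\<lambda>z::'a \<times> real. complex_of_real (wX z)) \<in> l2 mX" unfolding eq by (rule gm_l2) simp
  have "integrable mX (\<lambda>z::'a \<times> real. (cmod (complex_of_real (wX z)))\<^sup>2)" using l2 by (rule l2_int)
  then show "integrable mX (\<lambda>z::'a \<times> real. (wX z)\<^sup>2)" by (simp del: of_real_exp)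
  show "wX \<in> borel_measurable (mX :: ('a \<times> real) measure)" using measurable_compose[OF l2_meas[OF l2] borel_measurable_Re] by simp
  show "0 < wX z" for z :: "'a \<times> real" by (simp add: wX_def)
qed

lemma orthogonal_gm_imp_zero:
  fixes r :: "'a::euclidean_space \<times> real \<Rightarrow> complex"
  assumes rm: "r \<in> borel_measurable borel" and ri: "integrable mX (\<lambda>z. r z * of_real (wX z))"
    and r0: "\<And>a b k. 0 < a \<Longrightarrow> ip mX r (gm a b k 0) = 0"
  shows "AE z in mX. r z = 0"
proof (rule AE_zero_if_orthogonal_to_gaussians[OF rm])
  show "integrable mX (\<lambda>z. r z * of_real (exp (- (norm (fst z))\<^sup>2 / 2)))" using ri by (simp add: wX_def)
  fix a b k assume "0 < (a::real)"
  \<comment> \<open>\<open>ip\<close> conjugates its second argument, which turns frequency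
    \<open>- k\<close> into \<open>k\<close>.\<close>
  from r0[OF this, of b "- k"]
  show "(\<integral>z. r z * of_real (exp (- a / 2 * (norm (fst z - b))\<^sup>2)) * exp (\<i> * of_real (of_int k * snd z)) \<partial>mX) = 0"
    unfolding ip_def gm_def gy_0 ek_0 by (simp add: exp_cnj mult_ac)
qed

text \<open>A square-integrable function orthogonal to all coherent states at time 0 vanishes, so
  the projection argument applies to their span.\<close>

lemma comb_dense:
  fixes f :: "'a::euclidean_space \<times> real \<Rightarrow> complex"
  assumes f: "f \<in> l2 mX" and e: "e > 0"
  shows "\<exists>L. valid L \<and> nrm mX (\<lambda>z. f z - comb L 0 z) < e"
proof -
  define V where "V = (\<lambda>L. comb L 0 :: 'a \<times> real \<Rightarrow> complex) ` {L. valid L}"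
  have "\<exists>v\<in>V. nrm mX (\<lambda>z. f z - v z) < e"
  proof (rule l2_dense[OF _ _ _ _ _ wX(1,2,3) f e])
    show "V \<subseteq> l2 mX" by (auto simp: V_def comb_l2)
    show "(\<lambda>x. 0) \<in> V" unfolding V_def by (rule image_eqI[of _ _ "[]"]) (auto simp: comb_Nil)
    show "(\<lambda>x. v x + v' x) \<in> V" if "v \<in> V" "v' \<in> V" for v v'
    proof -
      from that obtain L L' where "valid L" "v = comb L 0" "valid L'" "v' = comb L' 0" by (auto simp: V_def)
      then show ?thesis unfolding V_def by (intro image_eqI[of _ _ "L @ L'"]) (auto simp: comb_append)
    qed
    show "(\<lambda>x. c * v x) \<in> V" if "v \<in> V" for c v
    proof -
      from that obtain L where "valid L" "v = comb L 0" by (auto simp: V_def)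
      then show ?thesis unfolding V_def by (intro image_eqI[of _ _ "map (\<lambda>(c', r). (c * c', r)) L"]) (auto simp: comb_scale)
    qed
    fix r :: "'a \<times> real \<Rightarrow> complex" assume r: "r \<in> l2 mX" and o: "\<And>v. v \<in> V \<Longrightarrow> ip mX r v = 0"
    have "AE z in mX. r z = 0"
    proof (rule orthogonal_gm_imp_zero)
      show "r \<in> borel_measurable borel" using l2_meas[OF r] by (simp cong: measurable_cong_sets)
      show "integrable mX (\<lambda>z. r z * of_real (wX z))" by (rule l2_mult_integrable[OF r wX(4)])
      show "ip mX r (gm a b k 0) = 0" if "0 < a" for a b k
        by (rule o, unfold V_def, rule image_eqI[of _ _ "[(1, a, b, k)]"]) (use that in \<open>auto simp: comb_Cons comb_Nil\<close>)
    qed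
    then have "(\<integral>z. (cmod (r z))\<^sup>2 \<partial>mX) = (\<integral>z. 0 \<partial>(mX :: ('a \<times> real) measure))"
      using l2_meas[OF r] by (intro integral_cong_AE) auto
    then show "nrm mX r = 0" by (simp add: nrm_def)
  qed
  then show ?thesis by (auto simp: V_def)
qed

section \<open>The propagator on test functions\<close>

text \<open>The integral is translation invariant, so every difference quotient of \<open>G\<close>
  along \<open>w\<close> integrates to 0; dominated convergence passes this to the derivative. The
  direction \<open>w\<close> is arbitrary and no coordinates are chosen.\<close>

lemma compact_support_integral_deriv_zero:
  fixes G D :: "'a::euclidean_space \<Rightarrow> complex"
  assumes hd: "has_dpart G w D" and cG: "continuous_on UNIV G" and cD: "continuous_on UNIV D"
    and supp: "\<And>y. norm y > R \<Longrightarrow> G y = 0"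
  shows "(\<integral>y. D y \<partial>lborel) = 0"
proof -
  have [measurable]: "G \<in> borel_measurable borel" "D \<in> borel_measurable borel"
    using cG cD by (auto intro: borel_measurable_continuous_onI)
  \<comment> \<open>Enlarged by one full step along \<open>w\<close>: outside this radius both
    \<open>y\<close> and its translates by at most \<open>w\<close> miss the support.\<close>
  define R' where "R' = R + norm w"
  have "compact (D ` cball 0 (\<bar>R'\<bar> + norm w))"
    using cD by (intro compact_continuous_image) (auto intro: continuous_on_subset)
  then obtain B where B: "\<And>y. norm y \<le> \<bar>R'\<bar> + norm w \<Longrightarrow> norm (D y) \<le> B"
    using compact_imp_bounded bounded_iff by (metis image_eqI mem_cball_0)
  have B0: "B \<ge> 0" using B[of 0] by (auto intro: order_trans[OF norm_ge_zero])
  have deriv: "((\<lambda>s. G (y + s *\<^sub>R w)) has_vector_derivative D (y + s0 *\<^sub>R w)) (at s0 within S)" for y s0 S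
  proof -
    have "((\<lambda>s. G ((y + s0 *\<^sub>R w) + s *\<^sub>R w)) has_vector_derivative D (y + s0 *\<^sub>R w)) (at 0)"
      using hd by (simp add: has_dpart_def)
    then have "((\<lambda>s. G ((y + s0 *\<^sub>R w) + s *\<^sub>R w)) has_vector_derivative D (y + s0 *\<^sub>R w)) (at (s0 - s0))" by simp
    then have "((\<lambda>s. G ((y + s0 *\<^sub>R w) + s *\<^sub>R w)) \<circ> (\<lambda>s. s - s0) has_vector_derivative (1 *\<^sub>R D (y + s0 *\<^sub>R w))) (at s0)"
      by (intro vector_diff_chain_at) (auto intro!: derivative_eq_intros)
    then show ?thesis by (simp add: o_def algebra_simps has_vector_derivative_at_within)
  qed
  define s where "s n = 1 / real (Suc n)" for n
  have s: "0 < s n" "s n \<le> 1" for n by (auto simp: s_def)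
  have s0: "s \<longlonglongrightarrow> 0" unfolding s_def by real_asymp
  define Q where "Q n y = (1 / s n) *\<^sub>R (G (y + s n *\<^sub>R w) - G y)" for n y
  have Gi: "integrable lborel G"
  proof -
    have "compact (G ` cball 0 R)" using cG by (intro compact_continuous_image) (auto intro: continuous_on_subset)
    then obtain K where K: "\<And>y. norm y \<le> R \<Longrightarrow> norm (G y) \<le> K"
      using compact_imp_bounded bounded_iff by (metis image_eqI mem_cball_0)
    have i: "integrable lborel (\<lambda>y. K * indicator (cball 0 R) y :: real)"
      using emeasure_lborel_cball_finite[of 0 R] by (intro integrable_mult_right integrable_real_indicator) auto
    show ?thesis
      by (rule Bochner_Integration.integrable_bound[OF i])
         (use K supp in \<open>fastforce simp: indicator_def not_le intro: order_trans[OF _ abs_ge_self] intro!: AE_I2\<close>)+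
  qed
  have "(\<integral>y. Q n y \<partial>lborel) = 0" for n
  proof -
    have i: "integrable lborel (\<lambda>y. G (y + s n *\<^sub>R w))" and e: "(\<integral>y. G (y + s n *\<^sub>R w) \<partial>lborel) = (\<integral>y. G y \<partial>lborel)"
      using lborel_integral_affine[of 1 G "s n *\<^sub>R w"] Gi by (simp_all add: add.commute)
    show ?thesis unfolding Q_def using i e Gi by simp
  qed
  moreover have "(\<lambda>n. \<integral>y. Q n y \<partial>lborel) \<longlonglongrightarrow> (\<integral>y. D y \<partial>lborel)"
  proof (rule integral_dominated_convergence[where w = "\<lambda>y. B * indicator (cball 0 \<bar>R'\<bar>) y"])
    show "integrable lborel (\<lambda>y::'a. B * indicator (cball 0 \<bar>R'\<bar>) y)"
      using emeasure_lborel_cball_finite[of 0 "\<bar>R'\<bar>"] by (intro integrable_mult_right integrable_real_indicator) auto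
    show "AE y in lborel. (\<lambda>n. Q n y) \<longlonglongrightarrow> D y"
    proof (rule AE_I2)
      fix y
      have "((\<lambda>h. norm (G (y + (0 + h) *\<^sub>R w) - G (y + 0 *\<^sub>R w) - h *\<^sub>R D (y + 0 *\<^sub>R w)) / norm h) \<longlongrightarrow> 0) (at 0)"
        using deriv[of y 0 UNIV] unfolding has_vector_derivative_def has_derivative_at by blast
      moreover have "filterlim s (at 0) sequentially"
        using s0 s by (auto simp: filterlim_at less_imp_neq[symmetric] eventually_sequentially intro!: exI[of _ 0])
      ultimately have "(\<lambda>n. norm (G (y + (0 + s n) *\<^sub>R w) - G (y + 0 *\<^sub>R w) - s n *\<^sub>R D (y + 0 *\<^sub>R w)) / norm (s n)) \<longlonglongrightarrow> 0"
        by (rule filterlim_compose)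
      moreover have "norm (G (y + (0 + s n) *\<^sub>R w) - G (y + 0 *\<^sub>R w) - s n *\<^sub>R D (y + 0 *\<^sub>R w)) / norm (s n) = norm (Q n y - D y)" for n
      proof -
        have "Q n y - D y = (1 / s n) *\<^sub>R (G (y + (0 + s n) *\<^sub>R w) - G (y + 0 *\<^sub>R w) - s n *\<^sub>R D (y + 0 *\<^sub>R w))"
          using s(1)[of n] by (simp add: Q_def scaleR_diff_right)
        then show ?thesis using s(1)[of n] by simp
      qed
      ultimately have "(\<lambda>n. norm (Q n y - D y)) \<longlonglongrightarrow> 0" by simp
      then show "(\<lambda>n. Q n y) \<longlonglongrightarrow> D y" by (metis LIM_zero_cancel tendsto_norm_zero_cancel)
    qed
    show "AE y in lborel. norm (Q n y) \<le> B * indicator (cball 0 \<bar>R'\<bar>) y" for n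
    proof (rule AE_I2)
      fix y
      show "norm (Q n y) \<le> B * indicator (cball 0 \<bar>R'\<bar>) y"
      proof (cases "norm y \<le> \<bar>R'\<bar>")
        case True
        have "norm (G (y + s n *\<^sub>R w) - G (y + 0 *\<^sub>R w)) \<le> B * norm (s n - 0)"
        proof (rule differentiable_bound[of "{0..s n}" "\<lambda>s. G (y + s *\<^sub>R w)" "\<lambda>s0 h. h *\<^sub>R D (y + s0 *\<^sub>R w)"])
          fix x assume x: "x \<in> {0..s n}"
          show "((\<lambda>s. G (y + s *\<^sub>R w)) has_derivative (\<lambda>h. h *\<^sub>R D (y + x *\<^sub>R w))) (at x within {0..s n})"
            using deriv[of y x "{0..s n}"] by (simp add: has_vector_derivative_def)
          have "norm (x *\<^sub>R w) \<le> norm w" using x s[of n] by (auto intro!: mult_left_le_one_le)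
          then have "norm (y + x *\<^sub>R w) \<le> \<bar>R'\<bar> + norm w" using True norm_triangle_ineq[of y "x *\<^sub>R w"] by linarith
          from B[OF this] show "onorm (\<lambda>h. h *\<^sub>R D (y + x *\<^sub>R w)) \<le> B"
            by (intro onorm_le) (simp add: mult.commute[of B] mult_left_mono)
        qed (use s[of n] in auto)
        then show ?thesis using True s[of n] by (simp add: Q_def divide_le_eq mult.commute)
      next
        case False
        then have "norm y > R'" by linarith
        have "norm (s n *\<^sub>R w) \<le> norm w" using s[of n] by (auto intro!: mult_left_le_one_le)
        then have "norm (y + s n *\<^sub>R w) > R" using \<open>norm y > R'\<close> norm_triangle_ineq4[of "y + s n *\<^sub>R w" "s n *\<^sub>R w"] by (simp add: R'_def)
        moreover have "norm y > R" using \<open>norm y > R'\<close> by (simp add: R'_def) (smt (verit) norm_ge_zero)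
        ultimately show ?thesis using supp B0 by (simp add: Q_def)
      qed
    qed
  qed (auto simp: Q_def)
  ultimately show ?thesis by (simp add: LIMSEQ_const_iff)
qed

section \<open>Derivatives and bounds of test functions\<close>

lemma test_fun_supp: "test_fun \<psi> \<Longrightarrow> \<exists>R. \<forall>y x. norm y > R \<longrightarrow> \<psi> (y, x) = 0"
  by (simp add: test_fun_def)

lemma test_fun_dpart: 
  assumes "test_fun \<psi>" shows "test_fun (dpart v \<psi>)"
proof -
  from assms have sm: "smooth_fun \<psi>" and per: "\<And>y x. \<psi> (y, x + 2*pi) = \<psi> (y, x)" by (simp_all add: test_fun_def)
  obtain R where supp: "\<And>y x. norm y > R \<Longrightarrow> \<psi> (y, x) = 0" using test_fun_supp[OF assms] by blast
  have "smooth_fun (dpart v \<psi>)"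
    unfolding smooth_fun_def
  proof
    fix vs
    have "continuous_on UNIV (fold dpart (v # vs) \<psi>) \<and>
           (\<forall>v' z. (\<lambda>s::real. fold dpart (v # vs) \<psi> (z + s *\<^sub>R v')) differentiable (at 0))"
      using sm unfolding smooth_fun_def by (rule spec)
    then show "continuous_on UNIV (fold dpart vs (dpart v \<psi>)) \<and>
           (\<forall>v' z. (\<lambda>s::real. fold dpart vs (dpart v \<psi>) (z + s *\<^sub>R v')) differentiable (at 0))" by simp
  qed
  moreover have "dpart v \<psi> (y, x + 2*pi) = dpart v \<psi> (y, x)" for y x
  proof -
    have "\<psi> ((y, x + 2*pi) + s *\<^sub>R v) = \<psi> ((y, x) + s *\<^sub>R v)" for s :: real
      using per[of "y + s *\<^sub>R fst v" "x + s * snd v"] by (cases v) (simp add: algebra_simps)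
    then show ?thesis by (simp add: dpart_def)
  qed
  moreover have "dpart v \<psi> (y, x) = 0" if "norm y > R" for y x
  proof -
    \<comment> \<open>As long as |s| < e, the shifted point stays outside the ball that contains the
      support; the added 1 covers a vanishing \<open>y\<close>-component of
      \<open>v\<close>.\<close>
    define e where "e = (norm y - R) / (norm (fst v) + 1)"
    have pos: "norm (fst v) + 1 > 0" by (rule add_nonneg_pos) auto
    have e: "e > 0" unfolding e_def using that pos by simp
    have "\<psi> ((y, x) + s *\<^sub>R v) = 0" if s: "\<bar>s\<bar> < e" for s
    proof -
      have "\<bar>s\<bar> * norm (fst v) \<le> \<bar>s\<bar> * (norm (fst v) + 1)" by (simp add: mult_left_mono)
      also have "\<dots> < norm y - R" using s pos by (simp add: e_def pos_less_divide_eq)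
      finally have "norm (y + s *\<^sub>R fst v) > R"
        using norm_triangle_ineq4[of "y + s *\<^sub>R fst v" "s *\<^sub>R fst v"] by simp
      from supp[OF this] show ?thesis by (cases v) simp
    qed
    note zero = this
    have "((\<lambda>s. \<psi> ((y, x) + s *\<^sub>R v)) has_vector_derivative 0) (at 0)"
    proof (rule has_vector_derivative_transform_within_open[OF has_vector_derivative_const, where S = "{-e<..<e}"])
      show "0 = \<psi> ((y, x) + s *\<^sub>R v)" if "s \<in> {-e<..<e}" for s
        using zero[of s] that by (simp add: abs_less_iff del: scaleR_Pair add_Pair)
    qed (use e in auto)
    then show ?thesis unfolding dpart_def by (rule vector_derivative_at)
  qed
  ultimately show ?thesis unfolding test_fun_def by blast
qed

lemma test_fun_continuous: "test_fun \<psi> \<Longrightarrow> continuous_on UNIV \<psi>"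
  unfolding test_fun_def smooth_fun_def by (drule conjunct1, drule spec[of _ "[]"]) simp

lemma test_fun_has_dpart: 
  assumes "test_fun \<psi>" shows "has_dpart \<psi> v (dpart v \<psi>)"
proof -
  have "(\<lambda>s::real. \<psi> (z + s *\<^sub>R v)) differentiable (at 0)" for z
    using assms unfolding test_fun_def smooth_fun_def by - (drule conjunct1, drule spec[of _ "[]"], simp del: scaleR_Pair add_Pair split_paired_All)
  then show ?thesis unfolding has_dpart_def dpart_def by (simp add: vector_derivative_works)
qed

lemma test_fun_measurable [measurable_dest]: "test_fun \<psi> \<Longrightarrow> \<psi> \<in> borel_measurable borel"
  by (rule borel_measurable_continuous_onI[OF test_fun_continuous])

lemma test_fun_bound:
  assumes "test_fun (\<psi> :: (real^'d::finite) \<times> real \<Rightarrow> complex)"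
  shows "\<exists>R B. (\<forall>y x. norm y > R \<longrightarrow> \<psi> (y, x) = 0) \<and> (\<forall>y x. x \<in> {0..<2*pi} \<longrightarrow> cmod (\<psi> (y, x)) \<le> B)"
proof -
  obtain R where supp: "\<And>y x. norm y > R \<Longrightarrow> \<psi> (y, x) = 0" using test_fun_supp[OF assms] by blast
  have "compact (\<psi> ` (cball 0 R \<times> {0..2*pi}))"
    by (intro compact_continuous_image continuous_on_subset[OF test_fun_continuous[OF assms]] compact_Times) auto
  then obtain B where B: "\<And>z. z \<in> cball 0 R \<times> {0..2*pi} \<Longrightarrow> cmod (\<psi> z) \<le> B"
    using compact_imp_bounded bounded_iff by (metis image_eqI)
  have "cmod (\<psi> (y, x)) \<le> max B 0" if "x \<in> {0..<2*pi}" for y x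
    using B[of "(y, x)"] supp[of y x] that by (cases "norm y > R") auto
  then show ?thesis using supp by blast
qed

lemma AE_mX_fund: "AE z in (mX :: ('a::euclidean_space \<times> real) measure). snd z \<in> {0..<2*pi}"
proof -
  have [measurable]: "(UNIV \<times> {0..<2*pi} :: ('a \<times> real) set) \<in> sets borel"
    unfolding borel_prod[symmetric] by (intro pair_measureI) auto
  show ?thesis unfolding mX_density by (subst AE_density) (auto simp: indicator_def split: if_splits)
qed

lemma bounded_compact_support_integrable:
  fixes f :: "'a::euclidean_space \<times> real \<Rightarrow> 'b::{banach,second_countable_topology}"
  assumes [measurable]: "f \<in> borel_measurable borel"
    and "\<And>y x. norm y > R \<Longrightarrow> f (y, x) = 0" "\<And>y x. x \<in> {0..<2*pi} \<Longrightarrow> norm (f (y, x)) \<le> B"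
  shows "integrable mX f"
proof (rule Bochner_Integration.integrable_bound)
  have "integrable (lborel \<Otimes>\<^sub>M mT) (\<lambda>z. (B * indicator (cball (0::'a) R) (fst z)) * (1::real))"
    using emeasure_lborel_cball_finite[of "0::'a" R]
    by (intro integrable_prod_mult(1)[where g = "\<lambda>_. 1"] sigma_finite_lborel sigma_finite_mT integrable_mult_right integrable_real_indicator) auto
  then show "integrable mX (\<lambda>z. B * indicator (cball (0::'a) R) (fst z) :: real)" by (simp add: mX_def)
  show "AE z in mX. norm (f z) \<le> norm (B * indicator (cball (0::'a) R) (fst z) :: real)"
    using AE_mX_fund
  proof eventually_elim
    case (elim z)
    then show ?case using assms(2)[of "fst z" "snd z"] assms(3)[of "snd z" "fst z"]
      by (cases "norm (fst z) > R") (auto simp: indicator_def)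
  qed
qed (simp cong: measurable_cong_sets)

lemma test_fun_integrable: 
  assumes "test_fun \<psi>" shows "integrable mX \<psi>" "\<psi> \<in> l2 mX"
proof -
  obtain R B where R: "\<And>y x. norm y > R \<Longrightarrow> \<psi> (y, x) = 0" and B: "\<And>y x. x \<in> {0..<2*pi} \<Longrightarrow> cmod (\<psi> (y, x)) \<le> B"
    using test_fun_bound[OF assms] by blast
  note [measurable] = test_fun_measurable[OF assms]
  show "integrable mX \<psi>" by (rule bounded_compact_support_integrable[of _ R B]) (use R B in auto)
  show "\<psi> \<in> l2 mX"
  proof (rule l2I)
    show "integrable mX (\<lambda>z. (cmod (\<psi> z))\<^sup>2)"
      by (rule bounded_compact_support_integrable[of _ R "B\<^sup>2"]) (use R B in \<open>auto intro: power_mono\<close>)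
  qed (simp cong: measurable_cong_sets)
qed

section \<open>Fourier coefficients of test functions\<close>

definition kern :: "(real^'d::finite) \<Rightarrow> int \<Rightarrow> (real^'d) \<times> real \<Rightarrow> complex" where
  "kern \<xi> k z = exp (- \<i> * complex_of_real (fst z \<bullet> \<xi> + of_int k * snd z))"

lemma norm_kern [simp]: "cmod (kern \<xi> k z) = 1"
  by (simp add: kern_def)

lemma kern_measurable [measurable]: "kern \<xi> k \<in> borel_measurable borel"
  unfolding kern_def[abs_def] borel_prod[symmetric] by measurable

lemma fourier_mX: "test_fun \<psi> \<Longrightarrow> fourier \<psi> \<xi> k = (\<integral>z. kern \<xi> k z * \<psi> z \<partial>mX)"
  unfolding fourier_def kern_def[symmetric] using test_fun_measurable[of \<psi>] by (intro integral_mX) measurable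

lemma kern_test_integrable: "test_fun \<psi> \<Longrightarrow> integrable mX (\<lambda>z. kern \<xi> k z * \<psi> z)"
  using test_fun_integrable(1)[of \<psi>] by (rule Bochner_Integration.integrable_bound) (auto simp: norm_mult)

lemma fourier_le: "test_fun \<psi> \<Longrightarrow> cmod (fourier \<psi> \<xi> k) \<le> (\<integral>z. cmod (\<psi> z) \<partial>mX)"
  unfolding fourier_mX by (rule order_trans[OF integral_norm_bound]) (simp add: norm_mult)

text \<open>Integration by parts in \<open>y\<close>: for each fixed \<open>x\<close> the derivative
  of \<open>kern * \<psi>\<close> along \<open>w\<close> has integral 0 by compact support.\<close>

lemma fourier_dpart_y:
  assumes t: "test_fun \<psi>"
  shows "fourier (dpart (w, 0) \<psi>) \<xi> k = \<i> * of_real (w \<bullet> \<xi>) * fourier \<psi> \<xi> k"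
proof -
  note t' = test_fun_dpart[OF t, of "(w, 0)"]
  obtain R where supp: "\<And>y x. norm y > R \<Longrightarrow> \<psi> (y, x) = 0" using test_fun_supp[OF t] by blast
  define D where "D z = kern \<xi> k z * dpart (w, 0) \<psi> z + (- \<i> * of_real (w \<bullet> \<xi>)) * (kern \<xi> k z * \<psi> z)" for z
  have Di: "integrable mX D" unfolding D_def
    by (intro Bochner_Integration.integrable_add integrable_mult_right kern_test_integrable t t')
  have z: "(\<integral>y. D (y, x) \<partial>lborel) = 0" for x
  proof (rule compact_support_integral_deriv_zero)
    have k: "has_dpart (\<lambda>y. kern \<xi> k (y, x)) w (\<lambda>y. (- \<i> * of_real (w \<bullet> \<xi>)) * kern \<xi> k (y, x))"
      unfolding has_dpart_def
    proof
      fix y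
      have "((\<lambda>s. exp (- \<i> * (of_real (y \<bullet> \<xi> + of_int k * x) + s * of_real (w \<bullet> \<xi>)))) has_field_derivative
        ((- \<i> * of_real (w \<bullet> \<xi>)) * exp (- \<i> * (of_real (y \<bullet> \<xi> + of_int k * x) + 0 * of_real (w \<bullet> \<xi>))))) (at (of_real 0))"
        by (auto intro!: derivative_eq_intros)
      from has_vector_derivative_real_field[OF this]
      show "((\<lambda>s. kern \<xi> k (y + s *\<^sub>R w, x)) has_vector_derivative (- \<i> * of_real (w \<bullet> \<xi>)) * kern \<xi> k (y, x)) (at 0)"
        by (simp add: kern_def inner_add_left add_ac)
    qed
    have p: "has_dpart (\<lambda>y. \<psi> (y, x)) w (\<lambda>y. dpart (w, 0) \<psi> (y, x))"
      using test_fun_has_dpart[OF t, of "(w, 0)"] by (auto simp: has_dpart_def)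
    show "has_dpart (\<lambda>y. kern \<xi> k (y, x) * \<psi> (y, x)) w (\<lambda>y. D (y, x))"
      using has_dpart_mult[OF k p] by (simp add: D_def mult.assoc)
    have cp: "continuous_on UNIV (\<lambda>y. \<psi> (y, x))" "continuous_on UNIV (\<lambda>y. dpart (w, 0) \<psi> (y, x))"
      by (auto intro!: continuous_on_compose2[OF test_fun_continuous[OF t]] continuous_on_compose2[OF test_fun_continuous[OF t']] continuous_intros)
    show "continuous_on UNIV (\<lambda>y. kern \<xi> k (y, x) * \<psi> (y, x))" "continuous_on UNIV (\<lambda>y. D (y, x))"
      unfolding D_def kern_def by (intro continuous_intros cp)+
    show "kern \<xi> k (y, x) * \<psi> (y, x) = 0" if "norm y > R" for y using supp[OF that] by simp
  qed
  have "(\<integral>z. D z \<partial>mX) = 0"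
    unfolding mX_def using lT.integral_snd[of "\<lambda>y x. D (y, x)"] Di z by (simp add: mX_def)
  moreover have "(\<integral>z. D z \<partial>mX) = fourier (dpart (w, 0) \<psi>) \<xi> k + (- \<i> * of_real (w \<bullet> \<xi>)) * fourier \<psi> \<xi> k"
    unfolding D_def fourier_mX[OF t] fourier_mX[OF t']
    using kern_test_integrable[OF t] kern_test_integrable[OF t'] by (subst Bochner_Integration.integral_add) auto
  ultimately show ?thesis by (simp add: add_eq_0_iff2)
qed

text \<open>Integration by parts on the circle: the boundary terms at 0 and \<open>2 * pi\<close>
  cancel because both \<psi> and the character of integer frequency \<open>k\<close> are
  periodic.\<close>

lemma fourier_dpart_x:
  assumes t: "test_fun \<psi>"
  shows "fourier (dpart (0, 1) \<psi>) \<xi> k = \<i> * of_int k * fourier \<psi> \<xi> k"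
proof -
  note t' = test_fun_dpart[OF t, of "(0, 1)"]
  from t have per: "\<And>y x. \<psi> (y, x + 2*pi) = \<psi> (y, x)" by (auto simp: test_fun_def)
  define D where "D z = kern \<xi> k z * dpart (0, 1) \<psi> z + (- \<i> * of_int k) * (kern \<xi> k z * \<psi> z)" for z
  have Di: "integrable mX D" unfolding D_def
    by (intro Bochner_Integration.integrable_add integrable_mult_right kern_test_integrable t t')
  have z: "(\<integral>x. D (y, x) \<partial>mT) = 0" for y
  proof -
    have cp: "continuous_on S (\<lambda>x. \<psi> (y, x))" "continuous_on S (\<lambda>x. dpart (0, 1) \<psi> (y, x))" for S
      by (auto intro!: continuous_on_compose2[OF test_fun_continuous[OF t]] continuous_on_compose2[OF test_fun_continuous[OF t']] continuous_intros)
    have cD: "continuous_on S (\<lambda>x. D (y, x))" for S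
      unfolding D_def kern_def by (intro continuous_intros cp)
    have [measurable]: "(\<lambda>x. D (y, x)) \<in> borel_measurable borel" using cD by (rule borel_measurable_continuous_onI)
    have "(\<integral>x. D (y, x) \<partial>mT) = (\<integral>x. indicator {0..<2*pi} x *\<^sub>R D (y, x) \<partial>lborel)" by (rule integral_mT) measurable
    also have "\<dots> = (\<integral>x. indicator {0..2*pi} x *\<^sub>R D (y, x) \<partial>lborel)"
    proof (rule integral_cong_AE)
      have "AE x in lborel. x \<noteq> 2 * pi" by (rule AE_lborel_singleton)
      then show "AE x in lborel. indicator {0..<2*pi} x *\<^sub>R D (y, x) = indicator {0..2*pi} x *\<^sub>R D (y, x)"
        by eventually_elim (auto simp: indicator_def)
    qed measurable
    also have "\<dots> = kern \<xi> k (y, 2 * pi) * \<psi> (y, 2 * pi) - kern \<xi> k (y, 0) * \<psi> (y, 0)"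
    proof (rule integral_FTC_Icc)
      fix x :: real
      have "((\<lambda>z. exp (- \<i> * (of_real (y \<bullet> \<xi>) + of_int k * z))) has_field_derivative
         ((- \<i> * of_int k) * exp (- \<i> * (of_real (y \<bullet> \<xi>) + of_int k * of_real x)))) (at (of_real x))"
        by (auto intro!: derivative_eq_intros)
      from has_vector_derivative_real_field[OF this]
      have k: "((\<lambda>x. kern \<xi> k (y, x)) has_vector_derivative (- \<i> * of_int k) * kern \<xi> k (y, x)) (at x)"
        by (simp add: kern_def)
      have "((\<lambda>s. \<psi> ((y, x) + s *\<^sub>R (0, 1))) has_vector_derivative dpart (0, 1) \<psi> (y, x)) (at (x - x))"
        using test_fun_has_dpart[OF t, of "(0, 1)"] by (simp add: has_dpart_def)
      then have "((\<lambda>s. \<psi> ((y, x) + s *\<^sub>R (0, 1))) \<circ> (\<lambda>s. s - x) has_vector_derivative (1 *\<^sub>R dpart (0, 1) \<psi> (y, x))) (at x)"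
        by (intro vector_diff_chain_at) (auto intro!: derivative_eq_intros)
      then have p: "((\<lambda>x. \<psi> (y, x)) has_vector_derivative dpart (0, 1) \<psi> (y, x)) (at x)" by (simp add: o_def)
      show "((\<lambda>x. kern \<xi> k (y, x) * \<psi> (y, x)) has_vector_derivative D (y, x)) (at x within {0..2 * pi})"
        using has_vector_derivative_at_within[OF has_vector_derivative_mult[OF k p]] by (simp only: D_def mult.assoc)
    qed (use cD in auto)
    also have "kern \<xi> k (y, 2 * pi) = kern \<xi> k (y, 0)"
    proof -
      have "kern \<xi> k (y, 2 * pi) = kern \<xi> k (y, 0) * exp (2 * of_int (- k) * pi * \<i>)"
        by (simp add: kern_def exp_add[symmetric] algebra_simps)
      also have "exp (2 * of_int (- k) * pi * \<i>) = 1" by (rule exp_integer_2pi) (rule Ints_of_int)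
      finally show ?thesis by simp
    qed
    finally show ?thesis using per[of y 0] by simp
  qed
  have "(\<integral>z. D z \<partial>mX) = 0"
    unfolding mX_def using lT.integral_fst'[of D] Di z by (simp add: mX_def)
  moreover have "(\<integral>z. D z \<partial>mX) = fourier (dpart (0, 1) \<psi>) \<xi> k + (- \<i> * of_int k) * fourier \<psi> \<xi> k"
    unfolding D_def fourier_mX[OF t] fourier_mX[OF t']
    using kern_test_integrable[OF t] kern_test_integrable[OF t'] by (subst Bochner_Integration.integral_add) auto
  ultimately show ?thesis by (simp add: add_eq_0_iff2)
qed

text \<open>Each direction \<open>b\<close> costs two derivatives: the factor
  \<open>1 + (\<xi> \<bullet> b)^2\<close> splits into the coefficient of \<psi> and that of its
  second derivative. The induction therefore has to range over all test functions.\<close>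

lemma fourier_decay_prod:
  fixes \<psi> :: "(real^'d::finite) \<times> real \<Rightarrow> complex"
  assumes "finite J" "test_fun \<psi>"
  shows "\<exists>C. \<forall>\<xi> k. (\<Prod>b\<in>J. 1 + (\<xi> \<bullet> b)\<^sup>2) * cmod (fourier \<psi> \<xi> k) \<le> C"
  using assms
proof (induction J arbitrary: \<psi> rule: finite_induct)
  case empty
  then show ?case using fourier_le[OF empty] by auto
next
  case (insert b J)
  let ?\<psi> = "dpart (b, 0) (dpart (b, 0) \<psi>)"
  have t2: "test_fun ?\<psi>" by (intro test_fun_dpart insert.prems)
  obtain C1 where C1: "\<And>\<xi> k. (\<Prod>b\<in>J. 1 + (\<xi> \<bullet> b)\<^sup>2) * cmod (fourier \<psi> \<xi> k) \<le> C1" using insert.IH[OF insert.prems] by blast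
  obtain C2 where C2: "\<And>\<xi> k. (\<Prod>b\<in>J. 1 + (\<xi> \<bullet> b)\<^sup>2) * cmod (fourier ?\<psi> \<xi> k) \<le> C2" using insert.IH[OF t2] by blast
  have "(\<Prod>b\<in>insert b J. 1 + (\<xi> \<bullet> b)\<^sup>2) * cmod (fourier \<psi> \<xi> k) \<le> C1 + C2" for \<xi> k
  proof -
    have "cmod (fourier ?\<psi> \<xi> k) = (\<xi> \<bullet> b)\<^sup>2 * cmod (fourier \<psi> \<xi> k)"
      by (simp add: fourier_dpart_y insert.prems test_fun_dpart norm_mult power2_eq_square inner_commute abs_mult_self_eq mult.assoc[symmetric])
    then have "(\<Prod>b\<in>insert b J. 1 + (\<xi> \<bullet> b)\<^sup>2) * cmod (fourier \<psi> \<xi> k)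
      = (\<Prod>b\<in>J. 1 + (\<xi> \<bullet> b)\<^sup>2) * cmod (fourier \<psi> \<xi> k) + (\<Prod>b\<in>J. 1 + (\<xi> \<bullet> b)\<^sup>2) * cmod (fourier ?\<psi> \<xi> k)"
      using insert.hyps by (simp add: algebra_simps)
    then show ?thesis using C1[of \<xi> k] C2[of \<xi> k] by linarith
  qed
  then show ?case by blast
qed

text \<open>A product weight with one factor per coordinate and one for \<open>k\<close> is used
  because its integrability over frequency space splits into one-dimensional statements.\<close>

lemma fourier_decay:
  fixes \<psi> :: "(real^'d::finite) \<times> real \<Rightarrow> complex"
  assumes t: "test_fun \<psi>"
  shows "\<exists>C\<ge>0. \<forall>\<xi> k. cmod (fourier \<psi> \<xi> k) \<le> C * ((\<Prod>b\<in>Basis. inverse (1 + (\<xi> \<bullet> b)\<^sup>2)) * inverse (1 + (of_int k)\<^sup>2))"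
proof -
  let ?\<psi> = "dpart (0, 1) (dpart (0, 1) \<psi>)"
  have t2: "test_fun ?\<psi>" by (intro test_fun_dpart t)
  let ?P = "\<lambda>\<xi>. \<Prod>b\<in>Basis. 1 + (\<xi> \<bullet> b)\<^sup>2"
  obtain C1 where C1: "\<And>\<xi> k. ?P \<xi> * cmod (fourier \<psi> \<xi> k) \<le> C1" using fourier_decay_prod[OF finite_Basis t] by blast
  obtain C2 where C2: "\<And>\<xi> k. ?P \<xi> * cmod (fourier ?\<psi> \<xi> k) \<le> C2" using fourier_decay_prod[OF finite_Basis t2] by blast
  have pos: "?P \<xi> > 0" for \<xi> by (intro prod_pos) (auto intro: add_pos_nonneg)
  have "cmod (fourier \<psi> \<xi> k) \<le> (\<bar>C1\<bar> + \<bar>C2\<bar>) * ((\<Prod>b\<in>Basis. inverse (1 + (\<xi> \<bullet> b)\<^sup>2)) * inverse (1 + (of_int k)\<^sup>2))" for \<xi> k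
  proof -
    have kp: "1 + (real_of_int k)\<^sup>2 > 0" by (rule add_pos_nonneg) auto
    have "cmod (fourier ?\<psi> \<xi> k) = (of_int k)\<^sup>2 * cmod (fourier \<psi> \<xi> k)"
      by (simp add: fourier_dpart_x t test_fun_dpart norm_mult power2_eq_square mult.assoc[symmetric])
    then have "?P \<xi> * (1 + (of_int k)\<^sup>2) * cmod (fourier \<psi> \<xi> k) \<le> \<bar>C1\<bar> + \<bar>C2\<bar>"
      using C1[of \<xi> k] C2[of \<xi> k] by (simp add: algebra_simps)
    then have "cmod (fourier \<psi> \<xi> k) \<le> (\<bar>C1\<bar> + \<bar>C2\<bar>) / (?P \<xi> * (1 + (of_int k)\<^sup>2))"
      using pos[of \<xi>] kp by (simp add: pos_le_divide_eq mult.commute)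
    also have "\<dots> = (\<bar>C1\<bar> + \<bar>C2\<bar>) * ((\<Prod>b\<in>Basis. inverse (1 + (\<xi> \<bullet> b)\<^sup>2)) * inverse (1 + (of_int k)\<^sup>2))"
      by (simp add: divide_inverse prod_inversef[symmetric] o_def)
    finally show ?thesis .
  qed
  then show ?thesis by (intro exI[of _ "\<bar>C1\<bar> + \<bar>C2\<bar>"]) auto
qed

section \<open>The propagator as an integral over frequency space\<close>

definition mF :: "('a::euclidean_space \<times> int) measure" where
  "mF = lborel \<Otimes>\<^sub>M count_space UNIV"

lemma sigma_finite_count_int: "sigma_finite_measure (count_space (UNIV :: int set))"
  by (rule sigma_finite_measure_count_space)

interpretation lC: pair_sigma_finite "lborel :: 'a::euclidean_space measure" "count_space (UNIV :: int set)"
  by (simp add: pair_sigma_finite_def sigma_finite_lborel sigma_finite_count_int)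

lemma sigma_finite_mF: "sigma_finite_measure (mF :: ('a::euclidean_space \<times> int) measure)"
  unfolding mF_def by (rule lC.P.sigma_finite_measure_axioms)

lemma integrable_inverse_one_plus_int_sq: "integrable (count_space UNIV) (\<lambda>k::int. inverse (1 + (real_of_int k)\<^sup>2))"
proof -
  have "summable (\<lambda>n. inverse (1 + (real n)\<^sup>2))"
    by (rule summable_comparison_test'[OF inverse_power_summable[of 2], of 1]) (auto intro!: le_imp_inverse_le)
  then have n: "Infinite_Set_Sum.abs_summable_on (\<lambda>n::nat. inverse (1 + (real n)\<^sup>2)) UNIV"
    by (subst abs_summable_on_nat_iff') (simp add: abs_of_nonneg)
  have "Infinite_Set_Sum.abs_summable_on (\<lambda>k::int. inverse (1 + (real_of_int k)\<^sup>2)) (range int)"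
    using n by (subst abs_summable_on_reindex_iff[symmetric]) (auto simp: inj_on_def)
  moreover have "Infinite_Set_Sum.abs_summable_on (\<lambda>k::int. inverse (1 + (real_of_int k)\<^sup>2)) (range (\<lambda>n. - int n))"
    using n by (subst abs_summable_on_reindex_iff[symmetric]) (auto simp: inj_on_def)
  ultimately have "Infinite_Set_Sum.abs_summable_on (\<lambda>k::int. inverse (1 + (real_of_int k)\<^sup>2)) (range int \<union> range (\<lambda>n. - int n))"
    by (rule abs_summable_on_union)
  also have "range int \<union> range (\<lambda>n. - int n) = UNIV"
    by (auto) (metis int_cases2 rangeI)
  finally show ?thesis by (simp add: Infinite_Set_Sum.abs_summable_on_def)
qed

lemma fourier_weight_integrable:
  "integrable mF (\<lambda>w::'a::euclidean_space \<times> int. (\<Prod>b\<in>Basis. inverse (1 + (fst w \<bullet> b)\<^sup>2)) * inverse (1 + (real_of_int (snd w))\<^sup>2))"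
  unfolding mF_def
proof (rule integrable_prod_mult(1)[OF sigma_finite_lborel sigma_finite_count_int _ integrable_inverse_one_plus_int_sq])
  have "integrable lborel (\<lambda>x::real. inverse (1 + x\<^sup>2))"
    using integrable_inverse_1_plus_square by (simp add: set_integrable_def einterval_eq)
  then show "integrable lborel (\<lambda>\<xi>::'a. \<Prod>b\<in>Basis. inverse (1 + (\<xi> \<bullet> b)\<^sup>2))"
    by (intro lborel_integral_prod(1)[where f = "\<lambda>b x. inverse (1 + x\<^sup>2)"])
qed

lemma fourier_measurable:
  assumes t: "test_fun \<psi>"
  shows "(\<lambda>w. fourier \<psi> (fst w) (snd w)) \<in> borel_measurable mF"
proof -
  interpret X: sigma_finite_measure "mX :: ((real^'d) \<times> real) measure" by (rule sigma_finite_mX)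
  have [measurable]: "\<psi> \<in> borel_measurable (lborel \<Otimes>\<^sub>M mT)"
    using test_fun_measurable[OF t] unfolding mX_def[symmetric] by (simp cong: measurable_cong_sets)
  show ?thesis unfolding fourier_mX[OF t]
  proof (rule X.borel_measurable_lebesgue_integral)
    show "(\<lambda>(w, z). kern (fst w) (snd w) z * \<psi> z) \<in> borel_measurable (mF \<Otimes>\<^sub>M mX)"
      unfolding kern_def mF_def mX_def by measurable
  qed
qed

lemma fourier_integrable:
  assumes t: "test_fun \<psi>"
  shows "integrable mF (\<lambda>w. fourier \<psi> (fst w) (snd w))"
proof -
  obtain C where C: "C \<ge> 0" "\<And>\<xi> k. cmod (fourier \<psi> \<xi> k) \<le> C * ((\<Prod>b\<in>Basis. inverse (1 + (\<xi> \<bullet> b)\<^sup>2)) * inverse (1 + (of_int k)\<^sup>2))"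
    using fourier_decay[OF t] by blast
  show ?thesis
    by (rule Bochner_Integration.integrable_bound[OF integrable_mult_right[OF fourier_weight_integrable, of C]])
       (use C fourier_measurable[OF t] in \<open>auto intro!: AE_I2 order_trans[OF _ abs_ge_self]\<close>)
qed

definition osc :: "real \<Rightarrow> (real^'d::finite) \<times> int \<Rightarrow> (real^'d) \<times> real \<Rightarrow> complex" where
  "osc s w z = exp (\<i> * complex_of_real (fst z \<bullet> fst w + of_int (snd w) * snd z)) *
     exp (- \<i> * complex_of_real (s * ((norm (fst w))\<^sup>2 + (of_int (snd w))\<^sup>2)))"

lemma norm_osc [simp]: "cmod (osc s w z) = 1"
  by (simp add: osc_def norm_mult)

lemma osc_measurable: "(\<lambda>(z, w). osc s w z) \<in> borel_measurable (mX \<Otimes>\<^sub>M mF)"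
  unfolding osc_def mF_def mX_def by measurable

lemma osc_measurable': "osc s w \<in> borel_measurable mX" "(\<lambda>w. osc s w z) \<in> borel_measurable mF"
  unfolding osc_def[abs_def] mF_def mX_def by measurable

text \<open>Absolute convergence merges the sum over \<open>k\<close> and the integral over \<xi>
  into one integral over \<open>mF\<close>, to which Fubini can be applied together with the
  integral in space.\<close>

lemma schrod_test_eq:
  fixes \<psi> :: "(real^'d::finite) \<times> real \<Rightarrow> complex"
  assumes t: "test_fun \<psi>"
  shows "schrod_test s \<psi> z = of_real (1 / (2*pi) ^ (CARD('d) + 1)) * (\<integral>w. osc s w z * fourier \<psi> (fst w) (snd w) \<partial>mF)"
proof -
  have i: "integrable mF (\<lambda>w. osc s w z * fourier \<psi> (fst w) (snd w))"
    using fourier_integrable[OF t] by (rule Bochner_Integration.integrable_bound)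
      (simp_all add: borel_measurable_times[OF osc_measurable'(2) fourier_measurable[OF t]] norm_mult)
  define f where "f k = (LINT \<xi>|lborel. osc s (\<xi>, k) z * fourier \<psi> \<xi> k)" for k
  have i': "integrable (lborel \<Otimes>\<^sub>M count_space UNIV) (\<lambda>(\<xi>, k). osc s (\<xi>, k) z * fourier \<psi> \<xi> k)"
    using i by (simp add: mF_def case_prod_unfold)
  have "Infinite_Set_Sum.abs_summable_on f UNIV"
    unfolding Infinite_Set_Sum.abs_summable_on_def f_def by (rule lC.integrable_snd[OF i'])
  then have "infsum f UNIV = (\<integral>k. f k \<partial>count_space UNIV)"
    by (simp add: infsetsum_infsum[symmetric] infsetsum_def)
  also have "\<dots> = (\<integral>w. osc s w z * fourier \<psi> (fst w) (snd w) \<partial>mF)"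
    unfolding f_def using lC.integral_snd[OF i'] by (simp add: mF_def case_prod_unfold)
  finally show ?thesis
    unfolding schrod_test_def f_def osc_def by simp
qed

lemma schrod_test_measurable:
  assumes t: "test_fun \<psi>" shows "schrod_test s \<psi> \<in> borel_measurable borel"
proof -
  interpret F: sigma_finite_measure "mF :: ((real^'d) \<times> int) measure" by (rule sigma_finite_mF)
  note [measurable] = fourier_measurable[OF t] osc_measurable[of s]
  have "(\<lambda>z. \<integral>w. osc s w z * fourier \<psi> (fst w) (snd w) \<partial>mF) \<in> borel_measurable mX"
  proof (rule F.borel_measurable_lebesgue_integral)
    have "(\<lambda>p. (\<lambda>(z, w). osc s w z) p * (\<lambda>w. fourier \<psi> (fst w) (snd w)) (snd p)) \<in> borel_measurable (mX \<Otimes>\<^sub>M mF)"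
      by measurable
    then show "(\<lambda>(z, w). osc s w z * fourier \<psi> (fst w) (snd w)) \<in> borel_measurable (mX \<Otimes>\<^sub>M mF)"
      by (simp add: split_beta)
  qed
  then show ?thesis unfolding schrod_test_eq[OF t, abs_def] by (simp cong: measurable_cong_sets)
qed

lemma schrod_test_bounded:
  fixes \<psi> :: "(real^'d::finite) \<times> real \<Rightarrow> complex"
  assumes t: "test_fun \<psi>" shows "\<exists>B. \<forall>z. cmod (schrod_test s \<psi> z) \<le> B"
proof (intro exI allI)
  fix z
  have "cmod (\<integral>w. osc s w z * fourier \<psi> (fst w) (snd w) \<partial>mF) \<le> (\<integral>w. cmod (fourier \<psi> (fst w) (snd w)) \<partial>mF)"
    by (rule order_trans[OF integral_norm_bound]) (simp add: norm_mult)
  then show "cmod (schrod_test s \<psi> z) \<le> cmod (of_real (1 / (2*pi) ^ (CARD('d) + 1))) * (\<integral>w. cmod (fourier \<psi> (fst w) (snd w)) \<partial>mF)"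
    unfolding schrod_test_eq[OF t] norm_mult by (rule mult_left_mono) simp
qed

lemma gm_integrable: assumes "0 < a" shows "integrable mX (gm a b k t)"
proof -
  have "integrable (lborel \<Otimes>\<^sub>M mT) (\<lambda>z. gy a b t (fst z) * ek k t (snd z))"
    by (rule integrable_prod_mult(1)[OF sigma_finite_lborel sigma_finite_mT gy_integrable[OF assms]])
       (rule mT.integrable_const_bound[of _ 1], auto)
  then show ?thesis by (simp add: gm_def[abs_def] mX_def)
qed

text \<open>Orthogonality on the circle leaves only the frequency \<open>m\<close>. The kernel
  \<open>osc (- t)\<close> enters conjugated, which restores the forward phase of the free
  flow.\<close>

lemma integral_gm_osc:
  fixes b :: "real^'d::finite"
  assumes a: "0 < a"
  shows "(\<integral>z. gm a b m 0 z * cnj (osc (- t) (\<xi>, k) z) \<partial>mX) =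
    (if m = k then of_real (2 * pi) * of_real (sqrt (2 * pi) ^ CARD('d)) * (exp (- \<i> * of_real (t * (norm \<xi>)\<^sup>2)) * prof a b \<xi> * exp (- \<i> * of_real ((of_int m)\<^sup>2 * t))) else 0)"
proof -
  have i1: "integrable lborel (\<lambda>y. gy a b 0 y * exp (- \<i> * of_real (y \<bullet> \<xi>)))"
    by (rule Bochner_Integration.integrable_bound[OF gy_integrable[OF a, of b 0]]) (auto simp: norm_mult)
  have i2: "integrable mT (\<lambda>x. ek m 0 x * cnj (ek k 0 x))"
    by (rule mT.integrable_const_bound[of _ 1]) (auto simp: norm_mult)
  have "(\<integral>z. gm a b m 0 z * cnj (osc (- t) (\<xi>, k) z) \<partial>mX)
     = (\<integral>z. exp (- \<i> * of_real (t * ((norm \<xi>)\<^sup>2 + (of_int k)\<^sup>2))) * ((gy a b 0 (fst z) * exp (- \<i> * of_real (fst z \<bullet> \<xi>))) * (ek m 0 (snd z) * cnj (ek k 0 (snd z)))) \<partial>(lborel \<Otimes>\<^sub>M mT))"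
    unfolding mX_def
  proof (rule Bochner_Integration.integral_cong[OF refl])
    fix z :: "(real^'d) \<times> real"
    have "cnj (osc (- t) (\<xi>, k) z) = exp (- \<i> * of_real (t * ((norm \<xi>)\<^sup>2 + (of_int k)\<^sup>2))) * exp (- \<i> * of_real (fst z \<bullet> \<xi>)) * cnj (ek k 0 (snd z))"
      by (simp add: osc_def ek_def exp_cnj exp_add[symmetric] algebra_simps)
    then show "gm a b m 0 z * cnj (osc (- t) (\<xi>, k) z) = exp (- \<i> * of_real (t * ((norm \<xi>)\<^sup>2 + (of_int k)\<^sup>2))) * ((gy a b 0 (fst z) * exp (- \<i> * of_real (fst z \<bullet> \<xi>))) * (ek m 0 (snd z) * cnj (ek k 0 (snd z))))"
      unfolding gm_def by (simp only: mult_ac)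
  qed
  also have "\<dots> = exp (- \<i> * of_real (t * ((norm \<xi>)\<^sup>2 + (of_int k)\<^sup>2))) * ((\<integral>y. gy a b 0 y * exp (- \<i> * of_real (y \<bullet> \<xi>)) \<partial>lborel) * (\<integral>x. ek m 0 x * cnj (ek k 0 x) \<partial>mT))"
    by (simp only: integral_mult_right_zero integrable_prod_mult(2)[OF sigma_finite_lborel sigma_finite_mT i1 i2])
  also have "\<dots> = exp (- \<i> * of_real (t * ((norm \<xi>)\<^sup>2 + (of_int k)\<^sup>2))) * ((of_real (sqrt (2 * pi) ^ CARD('d)) * prof a b \<xi>) * (if m = k then of_real (2 * pi) else 0))"
    unfolding gy_fourier[OF a] ek_inner by simp
  also have "exp (- \<i> * of_real (t * ((norm \<xi>)\<^sup>2 + (of_int k)\<^sup>2))) = exp (- \<i> * of_real (t * (norm \<xi>)\<^sup>2)) * exp (- \<i> * of_real ((of_int k)\<^sup>2 * t))"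
    by (simp add: exp_add[symmetric] algebra_simps)
  finally show ?thesis by (simp add: mult_ac)
qed

text \<open>Both pairings are reduced by Fubini to the same frequency integral \<open>I\<close> at
  the single frequency \<open>m\<close>: the left one through the Fourier representation of the
  propagator, the right one through that of the evolved coherent state.\<close>

lemma schrod_test_adjoint:
  fixes \<psi> :: "(real^'d::finite) \<times> real \<Rightarrow> complex"
  assumes ps: "test_fun \<psi>" and a: "0 < a"
  shows "ip mX (gm a b m 0) (schrod_test (- t) \<psi>) = ip mX (gm a b m t) \<psi>"
proof -
  interpret XF: pair_sigma_finite "mX :: ((real^'d) \<times> real) measure" "mF :: ((real^'d) \<times> int) measure"
    by (simp add: pair_sigma_finite_def sigma_finite_mX sigma_finite_mF)
  interpret XL: pair_sigma_finite "mX :: ((real^'d) \<times> real) measure" "lborel :: (real^'d) measure"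
    by (simp add: pair_sigma_finite_def sigma_finite_mX sigma_finite_lborel)
  define c where "c = complex_of_real (1 / (2*pi) ^ (CARD('d) + 1))"
  define S where "S = complex_of_real (sqrt (2 * pi) ^ CARD('d))"
  define P where "P \<xi> = exp (- \<i> * of_real (t * (norm \<xi>)\<^sup>2)) * prof a b \<xi> * exp (- \<i> * of_real ((of_int m)\<^sup>2 * t))" for \<xi> :: "real^'d"
  define I where "I = (\<integral>\<xi>. P \<xi> * cnj (fourier \<psi> \<xi> m) \<partial>lborel)"
  \<comment> \<open>The inversion constant (2 pi)^-(d+1) is compensated by two Gaussian transform
    factors \<open>S = (2 pi)^(d/2)\<close> and the length of the circle.\<close>
  have c: "cnj c = c" "c * S * S * of_real (2 * pi) = 1" "S \<noteq> 0"
  proof -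
    have "S * S = of_real ((2 * pi) ^ CARD('d))"
      unfolding S_def of_real_mult[symmetric] power_mult_distrib[symmetric] by simp
    then show "c * S * S * of_real (2 * pi) = 1" unfolding c_def by (simp add: mult.assoc)
  qed (simp_all add: c_def S_def)
  note fm = fourier_measurable[OF ps] and fi = fourier_integrable[OF ps]
  have cfi: "integrable mF (\<lambda>w. cnj (fourier \<psi> (fst w) (snd w)))" using fi by simp
  have gmm[measurable]: "gm a b m t' \<in> borel_measurable mX" for t' by (simp cong: measurable_cong_sets)
  have prod: "integrable (mX \<Otimes>\<^sub>M mF) (\<lambda>p. gm a b m 0 (fst p) * cnj (fourier \<psi> (fst (snd p)) (snd (snd p))))"
    using integrable_prod_mult(1)[OF sigma_finite_mX sigma_finite_mF gm_integrable[OF a, of b m 0] cfi] by simp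
  have "(\<lambda>p. cnj ((\<lambda>(z, w). osc (- t) w z) p)) \<in> borel_measurable (mX \<Otimes>\<^sub>M mF)"
    using osc_measurable by (rule borel_measurable_cnj)
  note om[measurable] = this[unfolded split_beta]
  have int: "integrable (mX \<Otimes>\<^sub>M mF) (\<lambda>(z, w). gm a b m 0 z * cnj (osc (- t) w z) * cnj (fourier \<psi> (fst w) (snd w)))"
    unfolding split_beta
  proof (rule Bochner_Integration.integrable_bound[OF prod])
    note [measurable] = fm
    show "(\<lambda>p. gm a b m 0 (fst p) * cnj (osc (- t) (snd p) (fst p)) * cnj (fourier \<psi> (fst (snd p)) (snd (snd p)))) \<in> borel_measurable (mX \<Otimes>\<^sub>M mF)"
      using borel_measurable_cnj[OF measurable_compose[OF measurable_snd fm]] by measurable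
  qed (auto simp: norm_mult)
  have "ip mX (gm a b m 0) (schrod_test (- t) \<psi>) = (\<integral>z. c * (\<integral>w. gm a b m 0 z * cnj (osc (- t) w z) * cnj (fourier \<psi> (fst w) (snd w)) \<partial>mF) \<partial>mX)"
    unfolding ip_def schrod_test_eq[OF ps] c_def[symmetric] complex_cnj_mult c Bochner_Integration.integral_cnj[symmetric]
    by (simp only: mult.assoc mult.left_commute[of _ c] integral_mult_right_zero)
  also have "\<dots> = c * (\<integral>z. (\<integral>w. gm a b m 0 z * cnj (osc (- t) w z) * cnj (fourier \<psi> (fst w) (snd w)) \<partial>mF) \<partial>mX)"
    by simp
  also have "\<dots> = c * (\<integral>w. (\<integral>z. gm a b m 0 z * cnj (osc (- t) w z) * cnj (fourier \<psi> (fst w) (snd w)) \<partial>mX) \<partial>mF)"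
    using XF.Fubini_integral[OF int] by simp
  also have "\<dots> = c * (\<integral>w. (if snd w = m then of_real (2 * pi) * S * (P (fst w) * cnj (fourier \<psi> (fst w) m)) else 0) \<partial>mF)"
  proof (intro arg_cong[of _ _ "\<lambda>x. c * x"] Bochner_Integration.integral_cong[OF refl])
    fix w :: "(real^'d) \<times> int"
    have "(\<integral>z. gm a b m 0 z * cnj (osc (- t) w z) * cnj (fourier \<psi> (fst w) (snd w)) \<partial>mX)
      = (\<integral>z. gm a b m 0 z * cnj (osc (- t) (fst w, snd w) z) \<partial>mX) * cnj (fourier \<psi> (fst w) (snd w))"
      by simp
    also have "\<dots> = (if snd w = m then of_real (2 * pi) * S * (P (fst w) * cnj (fourier \<psi> (fst w) m)) else 0)"
      unfolding integral_gm_osc[OF a] S_def P_def by simp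
    finally show "(\<integral>z. gm a b m 0 z * cnj (osc (- t) w z) * cnj (fourier \<psi> (fst w) (snd w)) \<partial>mX) = (if snd w = m then of_real (2 * pi) * S * (P (fst w) * cnj (fourier \<psi> (fst w) m)) else 0)" .
  qed
  also have "(\<integral>w. (if snd w = m then of_real (2 * pi) * S * (P (fst w) * cnj (fourier \<psi> (fst w) m)) else 0) \<partial>mF) = of_real (2 * pi) * S * I"
  proof -
    have Pm[measurable]: "P \<in> borel_measurable borel" unfolding P_def by measurable
    define g where "g w = of_real (2 * pi) * S * (if snd w = m then P (fst w) * cnj (fourier \<psi> (fst w) (snd w)) else 0)" for w :: "(real^'d) \<times> int"
    have gi: "integrable mF g" unfolding g_def
    proof (intro integrable_mult_right Bochner_Integration.integrable_bound[OF integrable_mult_right[OF cfi, of "of_real (inverse (sqrt a) ^ CARD('d))"]])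
      have pb: "cmod (prof a b \<xi>) \<le> inverse (sqrt a) ^ CARD('d)" for \<xi> :: "real^'d"
        using a by (simp add: prof_def norm_mult norm_exp_eq_Re norm_power norm_inverse mult_left_le)
      note [measurable] = fm
      show "(\<lambda>w. if snd w = m then P (fst w) * cnj (fourier \<psi> (fst w) (snd w)) else 0) \<in> borel_measurable mF"
        unfolding mF_def using fm[unfolded mF_def] by measurable
      show "AE w in mF. cmod (if snd w = m then P (fst w) * cnj (fourier \<psi> (fst w) (snd w)) else 0) \<le> cmod (of_real (inverse (sqrt a) ^ CARD('d)) * cnj (fourier \<psi> (fst w) (snd w)))"
        using a by (auto intro!: AE_I2 mult_right_mono pb simp: norm_mult P_def norm_power norm_inverse)
    qed
    then have gi': "integrable (lborel \<Otimes>\<^sub>M count_space UNIV) (\<lambda>(\<xi>, k). g (\<xi>, k))" by (simp add: mF_def)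
    have "(\<integral>w. g w \<partial>mF) = (\<integral>k. (\<integral>\<xi>. g (\<xi>, k) \<partial>lborel) \<partial>count_space UNIV)"
      using lC.integral_snd[OF gi'] by (simp add: mF_def)
    also have "\<dots> = (\<integral>k. (if k = m then of_real (2 * pi) * S * I else 0) \<partial>count_space UNIV)"
      unfolding g_def I_def by (intro Bochner_Integration.integral_cong) auto
    also have "\<dots> = of_real (2 * pi) * S * I"
    proof (cases "of_real (2 * pi) * S * I = 0")
      case False
      then have "{k. (if k = m then of_real (2 * pi) * S * I else 0) \<noteq> 0} = {m}" by auto
      then show ?thesis by (subst lebesgue_integral_count_space_finite_support) auto
    next
      case True
      show ?thesis by (simp only: True if_cancel Bochner_Integration.integral_zero)
    qed
    finally show ?thesis unfolding g_def by (simp add: if_distrib cong: if_cong)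
  qed
  finally have L: "ip mX (gm a b m 0) (schrod_test (- t) \<psi>) = c * (of_real (2 * pi) * S * I)" .
  have pm: "integrable (mX \<Otimes>\<^sub>M lborel) (\<lambda>p. cnj (\<psi> (fst p)) * prof a b (snd p))"
    by (rule integrable_prod_mult(1)[OF sigma_finite_mX sigma_finite_lborel]) (use test_fun_integrable(1)[OF ps] prof_integrable(1)[OF a] in auto)
  define g where "g z \<xi> = P \<xi> * (cnj (kern \<xi> m z) * cnj (\<psi> z))" for z and \<xi> :: "real^'d"
  have int2: "integrable (mX \<Otimes>\<^sub>M lborel) (\<lambda>(z, \<xi>). g z \<xi>)"
    unfolding split_beta
  proof (rule Bochner_Integration.integrable_bound[OF pm])
    have [measurable]: "\<psi> \<in> borel_measurable (lborel \<Otimes>\<^sub>M mT)"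
      using test_fun_measurable[OF ps] unfolding mX_def[symmetric] by (simp cong: measurable_cong_sets)
    show "(\<lambda>p. g (fst p) (snd p)) \<in> borel_measurable (mX \<Otimes>\<^sub>M lborel)"
      unfolding g_def P_def kern_def mX_def by measurable
  qed (auto simp: norm_mult g_def P_def)
  have "S * ip mX (gm a b m t) \<psi> = (\<integral>z. (S * gy a b t (fst z)) * (ek m t (snd z) * cnj (\<psi> z)) \<partial>mX)"
    unfolding ip_def gm_def by (subst integral_mult_right_zero[symmetric]) (simp add: mult_ac)
  also have "\<dots> = (\<integral>z. (\<integral>\<xi>. g z \<xi> \<partial>lborel) \<partial>mX)"
  proof (rule Bochner_Integration.integral_cong[OF refl])
    fix z :: "(real^'d) \<times> real"
    have *: "exp (\<i> * of_real (fst z \<bullet> \<xi>)) * (exp (- \<i> * of_real (t * (norm \<xi>)\<^sup>2)) * prof a b \<xi>) * (ek m t (snd z) * cnj (\<psi> z)) = g z \<xi>" for \<xi>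
    proof -
      have "exp (\<i> * of_real (fst z \<bullet> \<xi>)) * ek m t (snd z) = exp (- \<i> * of_real ((of_int m)\<^sup>2 * t)) * cnj (kern \<xi> m z)"
        by (simp add: kern_def ek_def exp_cnj exp_add[symmetric] algebra_simps)
      then have "(exp (\<i> * of_real (fst z \<bullet> \<xi>)) * ek m t (snd z)) * (exp (- \<i> * of_real (t * (norm \<xi>)\<^sup>2)) * prof a b \<xi> * cnj (\<psi> z)) = g z \<xi>"
        unfolding g_def P_def by (simp only: mult_ac)
      then show ?thesis by (simp only: mult_ac)
    qed
    show "(S * gy a b t (fst z)) * (ek m t (snd z) * cnj (\<psi> z)) = (\<integral>\<xi>. g z \<xi> \<partial>lborel)"
      using gy_inverse_fourier[OF a, of "fst z" t b] unfolding S_def *[symmetric] integral_mult_left_zero by simp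
  qed
  also have "\<dots> = (\<integral>\<xi>. (\<integral>z. g z \<xi> \<partial>mX) \<partial>lborel)"
    by (rule XL.Fubini_integral[symmetric, OF int2])
  also have "\<dots> = I"
    unfolding g_def I_def fourier_mX[OF ps] Bochner_Integration.integral_cnj[symmetric] complex_cnj_mult by simp
  finally have R: "S * ip mX (gm a b m t) \<psi> = I" .
  have "S * ip mX (gm a b m 0) (schrod_test (- t) \<psi>) = (c * S * S * of_real (2 * pi)) * I"
    unfolding L by (simp only: mult_ac)
  also have "\<dots> = S * ip mX (gm a b m t) \<psi>" unfolding c R by simp
  finally show ?thesis using c(3) by simp
qed

lemma comb_single: "comb [(1, a, b, k)] t = gm a b k t"
  by (simp add: comb_Cons comb_Nil)

text \<open>Norms of differences of combinations are conserved, so a sequence that converges at time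
  0 is Cauchy at every time \<open>t\<close>. Its limit \<open>g\<close> is the candidate for the
  free evolution of \<open>h\<close>.\<close>

lemma comb_approx:
  fixes h :: "'a::euclidean_space \<times> real \<Rightarrow> complex"
  assumes h: "h \<in> l2 mX"
  shows "\<exists>L g. (\<forall>n. valid (L n)) \<and> (\<lambda>n. nrm mX (\<lambda>z. comb (L n) 0 z - h z)) \<longlonglongrightarrow> 0 \<and>
    g \<in> l2 mX \<and> (\<lambda>n. nrm mX (\<lambda>z. comb (L n) t z - g z)) \<longlonglongrightarrow> 0"
proof -
  have "\<exists>L. valid L \<and> nrm mX (\<lambda>z. h z - comb L 0 z) < 1 / real (Suc n)" for n
    by (rule comb_dense[OF h]) simp
  then obtain L where L: "\<And>n. valid (L n)" "\<And>n. nrm mX (\<lambda>z. h z - comb (L n) 0 z) < 1 / real (Suc n)" by metis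
  have lim: "(\<lambda>n. nrm mX (\<lambda>z. comb (L n) 0 z - h z)) \<longlonglongrightarrow> 0"
  proof (rule tendsto_sandwich[OF _ _ tendsto_const LIMSEQ_Suc[OF lim_1_over_n]])
    show "\<forall>\<^sub>F n in sequentially. nrm mX (\<lambda>z. comb (L n) 0 z - h z) \<le> 1 / real (Suc n)"
      using L(2) by (intro always_eventually) (simp add: nrm_commute[of mX _ h] less_imp_le)
  qed simp
  have cau: "\<exists>N. \<forall>i\<ge>N. \<forall>j\<ge>N. nrm mX (\<lambda>z. comb (L i) t z - comb (L j) t z) < e" if "e > 0" for e
  proof -
    from order_tendstoD(2)[OF lim, of "e/2"] that obtain N where N: "\<And>n. n \<ge> N \<Longrightarrow> nrm mX (\<lambda>z. comb (L n) 0 z - h z) < e / 2"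
      by (auto simp: eventually_sequentially)
    have "nrm mX (\<lambda>z. comb (L i) t z - comb (L j) t z) < e" if "i \<ge> N" "j \<ge> N" for i j
    proof -
      have "nrm mX (\<lambda>z. comb (L i) t z - comb (L j) t z) = nrm mX (\<lambda>z. comb (L i) 0 z - comb (L j) 0 z)"
        by (rule comb_nrm_diff) (rule L)+
      also have "\<dots> \<le> nrm mX (\<lambda>z. comb (L i) 0 z - h z) + nrm mX (\<lambda>z. h z - comb (L j) 0 z)"
        by (rule nrm_triangle_diff) (intro comb_l2 L h)+
      finally show ?thesis using N[OF that(1)] N[OF that(2)] by (simp add: nrm_commute[of mX h])
    qed
    then show ?thesis by blast
  qed
  from l2_complete[OF comb_l2[OF L(1)] cau wX(1,2,3)] obtain g where "g \<in> l2 mX" "(\<lambda>n. nrm mX (\<lambda>z. comb (L n) t z - g z)) \<longlonglongrightarrow> 0"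
    by blast
  then show ?thesis using L(1) lim by blast
qed

text \<open>A priori \<open>schrod_test (- t) \<psi>\<close> is only bounded and measurable. The
  limit \<open>g\<close> of evolved approximations of \<psi> has the same pairings with all coherent
  states, and the difference, bounded plus L2, is integrable against the Gaussian weight; hence the
  two agree a.e. and square-integrability is inherited from \<open>g\<close>.\<close>

lemma schrod_test_l2:
  fixes \<psi> :: "(real^'d::finite) \<times> real \<Rightarrow> complex"
  assumes ps: "test_fun \<psi>" shows "schrod_test (- t) \<psi> \<in> l2 mX"
proof -
  define F where "F = schrod_test (- t) \<psi>"
  have Fm[measurable]: "F \<in> borel_measurable borel" unfolding F_def by (rule schrod_test_measurable[OF ps])
  obtain B where B: "\<And>z. cmod (F z) \<le> B" using schrod_test_bounded[OF ps] unfolding F_def by blast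
  have Fi: "integrable mX (\<lambda>z. F z * g z)" if "integrable mX g" for g
    by (rule Bochner_Integration.integrable_bound[OF integrable_mult_right[OF that, of "of_real B"]])
       (use that B in \<open>auto simp: norm_mult borel_measurable_integrable intro!: AE_I2 mult_right_mono order_trans[OF B abs_ge_self] cong: measurable_cong_sets\<close>)
  obtain L g where L: "\<And>n. valid (L n)" "(\<lambda>n. nrm mX (\<lambda>z. comb (L n) 0 z - \<psi> z)) \<longlonglongrightarrow> 0"
    and g: "g \<in> l2 mX" "(\<lambda>n. nrm mX (\<lambda>z. comb (L n) (- t) z - g z)) \<longlonglongrightarrow> 0"
    using comb_approx[OF test_fun_integrable(2)[OF ps], of "- t"] by blast
  have gm[measurable]: "g \<in> borel_measurable borel" using l2_meas[OF g(1)] by (simp cong: measurable_cong_sets)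
  have "AE z in mX. F z - g z = 0"
  proof (rule orthogonal_gm_imp_zero)
    have "integrable mX (\<lambda>z::(real^'d) \<times> real. complex_of_real (wX z))"
      using gm_integrable[of 1 0 0 0] by (simp add: gm_def[abs_def] gy_0 ek_0 wX_def)
    then show "integrable mX (\<lambda>z. (F z - g z) * of_real (wX z))"
      unfolding left_diff_distrib by (intro Bochner_Integration.integrable_diff Fi l2_mult_integrable[OF g(1) wX(4)])
    fix a b k assume a: "0 < (a::real)"
    have "(\<lambda>n. ip mX (comb (L n) (- t)) (gm a b k 0)) \<longlonglongrightarrow> ip mX g (gm a b k 0)"
      by (rule ip_tendsto[OF comb_l2[OF L(1)] g(1) gm_l2[OF a] g(2)])
    moreover have "ip mX (comb (L n) (- t)) (gm a b k 0) = ip mX (comb (L n) 0) (gm a b k t)" for n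
      by (rule comb_inner1[OF L(1) a]) simp
    moreover have "(\<lambda>n. ip mX (comb (L n) 0) (gm a b k t)) \<longlonglongrightarrow> ip mX \<psi> (gm a b k t)"
      by (rule ip_tendsto[OF comb_l2[OF L(1)] test_fun_integrable(2)[OF ps] gm_l2[OF a] L(2)])
    ultimately have "ip mX g (gm a b k 0) = ip mX \<psi> (gm a b k t)"
      using LIMSEQ_unique by auto
    also have "\<dots> = ip mX F (gm a b k 0)"
      unfolding F_def ip_cnj[of mX _ "gm a b k _"] schrod_test_adjoint[OF ps a] ..
    finally show "ip mX (\<lambda>z. F z - g z) (gm a b k 0) = 0"
      unfolding ip_def left_diff_distrib
      by (subst Bochner_Integration.integral_diff) (auto intro!: Fi gm_integrable a l2_mult_integrable(2)[OF g(1) gm_l2])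
  qed measurable
  then have eq: "AE z in mX. g z = F z" by eventually_elim simp
  have "integrable mX (\<lambda>z. (cmod (F z))\<^sup>2)"
    by (rule integrable_cong_AE_imp[OF l2_int[OF g(1)]]) (use eq in \<open>auto elim: eventually_mono\<close>)
  then show ?thesis unfolding F_def[symmetric] by (intro l2I) (simp_all cong: measurable_cong_sets)
qed

lemma schrod_test_adjoint_comb:
  assumes ps: "test_fun \<psi>" and L: "valid L"
  shows "ip mX (comb L 0) (schrod_test (- t) \<psi>) = ip mX (comb L t) \<psi>"
  using L
proof (induction L)
  case Nil
  then show ?case by (simp add: comb_Nil ip_def)
next
  case (Cons x L)
  obtain c a b k where x: "x = (c, a, b, k)" by (cases x)
  show ?case using Cons unfolding x comb_Cons
    by (simp add: ip_add_left l2_cmult gm_l2 comb_l2 ip_cmult_left schrod_test_l2[OF ps] test_fun_integrable(2)[OF ps] schrod_test_adjoint[OF ps])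
qed

section \<open>Smoothness and truncation of coherent states\<close>

lemma smc_norm_sq:
  fixes P :: "'z::euclidean_space \<Rightarrow> 'a::euclidean_space"
  assumes "bounded_linear P"
  shows "smc (\<lambda>w. of_real ((norm (P w - b))\<^sup>2))"
proof -
  have eq: "(norm (P w - b))\<^sup>2 = (\<Sum>e\<in>Basis. (P w \<bullet> e + - (b \<bullet> e))\<^sup>2)" for w
    unfolding power2_norm_eq_inner by (subst euclidean_inner) (simp add: power2_eq_square inner_diff_left)
  have "smc (\<lambda>w. complex_of_real (P w \<bullet> e))" for e
    by (intro smc_lin bounded_linear_of_real[THEN bounded_linear_compose] bounded_linear_inner_left[THEN bounded_linear_compose] assms)
  then have "smc (\<lambda>w. \<Sum>e\<in>Basis. (complex_of_real (P w \<bullet> e) + complex_of_real (- (b \<bullet> e)))\<^sup>2)"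
    by (intro smc_sum smc_power smc_add smc_const)
  then show ?thesis unfolding eq by simp
qed

lemma smc_gm:
  fixes P :: "'z::euclidean_space \<Rightarrow> 'a::euclidean_space"
  assumes P: "bounded_linear P" and T: "smc (\<lambda>w. of_real (T w))" and X: "smc (\<lambda>w. of_real (X w))"
  shows "smc (\<lambda>w. gm a b k (T w) (P w, X w))"
proof -
  have s: "smc (\<lambda>w. sg a (T w))"
  proof -
    have "smc (\<lambda>w. 1 + (2 * \<i> * of_real a) * of_real (T w))" by (intro smc_add smc_const smc_mult T)
    then show ?thesis by (simp add: sg_def mult.assoc)
  qed
  have c: "smc (\<lambda>w. inverse (csqrt (sg a (T w))) ^ DIM('a))"
    by (rule smc_power, rule smc_inverse, rule smc_csqrt[OF s]) simp_all
  have e: "smc (\<lambda>w. exp ((- of_real (a / 2)) * of_real ((norm (P w - b))\<^sup>2) * inverse (sg a (T w))))"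
    by (rule smc_exp[OF smc_mult[OF smc_mult[OF smc_const smc_norm_sq[OF P]] smc_inverse[OF s sg_nz]]])
  have x: "smc (\<lambda>w. exp (\<i> * (of_int k * of_real (X w) + (- ((of_int k)\<^sup>2)) * of_real (T w))))"
    by (rule smc_exp[OF smc_cmult[OF smc_add[OF smc_cmult[OF X] smc_cmult[OF T]]]])
  have "gm a b k (T w) (P w, X w) = inverse (csqrt (sg a (T w))) ^ DIM('a)
     * exp ((- of_real (a / 2)) * of_real ((norm (P w - b))\<^sup>2) * inverse (sg a (T w)))
     * exp (\<i> * (of_int k * of_real (X w) + (- ((of_int k)\<^sup>2)) * of_real (T w)))" for w
  proof -
    have 1: "- of_real (a / 2 * N) / r = (- of_real (a / 2)) * of_real N * inverse r" for N :: real and r :: complex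
      by (simp only: divide_inverse[of _ r] of_real_mult mult_minus_left)
    have 2: "\<i> * of_real (of_int k * x - (of_int k)\<^sup>2 * t) = \<i> * (of_int k * of_real x + (- ((of_int k)\<^sup>2)) * of_real t)" for x t :: real
      by simp
    show ?thesis unfolding gm_def gy_def ek_def fst_conv snd_conv 1 2 by (simp only: mult.assoc)
  qed
  then show ?thesis using smc_mult[OF smc_mult[OF c e] x] by (simp only:)
qed

lemma gm_periodic: "gm a b k t (y, x + 2 * pi) = gm a b k t (y, x)"
proof -
  have "ek k t (x + 2 * pi) = exp (\<i> * of_real (of_int k * x - (of_int k)\<^sup>2 * t) + 2 * of_int k * pi * \<i>)"
    unfolding ek_def by (intro arg_cong[of _ _ exp]) (simp add: algebra_simps)
  also have "\<dots> = ek k t x * exp (2 * of_int k * pi * \<i>)"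
    unfolding ek_def exp_add ..
  also have "exp (2 * of_int k * pi * \<i>) = 1" by (rule exp_integer_2pi) simp
  finally show ?thesis by (simp add: gm_def)
qed

text \<open>As \<open>e\<close> tends to 0 the cutoff tends to \<open>bump 0 1 = exp (- 1)\<close>
  rather than to 1. It multiplies both sides of each limiting identity and cancels.\<close>

definition cutoff :: "'a::euclidean_space \<Rightarrow> real \<Rightarrow> 'a \<Rightarrow> real" where
  "cutoff b e y = bump 0 (1 - e * (norm (y - b))\<^sup>2)"

lemma bump_0_le: "bump 0 s \<le> 1" by (simp add: bump_def)

lemma cutoff_le: "\<bar>cutoff b e y\<bar> \<le> 1"
  using bump_nonneg bump_0_le by (simp add: cutoff_def abs_of_nonneg)

lemma cutoff_zero:
  assumes "0 < e" "norm y > norm b + 1 / sqrt e" shows "cutoff b e y = 0"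
proof -
  have "1 / sqrt e < norm (y - b)" using assms(2) norm_triangle_sub[of y b] by linarith
  then have "(1 / sqrt e)\<^sup>2 \<le> (norm (y - b))\<^sup>2" using assms(1) by (intro power_mono) auto
  then have "1 \<le> e * (norm (y - b))\<^sup>2" using assms(1) by (simp add: power_divide divide_le_eq mult.commute)
  then show ?thesis unfolding cutoff_def by (intro bump_zero) simp
qed

lemma cutoff_tendsto:
  assumes "e \<longlonglongrightarrow> 0" shows "(\<lambda>n. cutoff b (e n) y) \<longlonglongrightarrow> exp (- 1)"
proof -
  have "(\<lambda>n. 1 - e n * (norm (y - b))\<^sup>2) \<longlonglongrightarrow> 1 - 0 * (norm (y - b))\<^sup>2" by (intro tendsto_intros assms)
  then have "(\<lambda>n. 1 - e n * (norm (y - b))\<^sup>2) \<longlonglongrightarrow> 1" by simp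
  moreover have "isCont (bump 0) 1" using DERIV_bmp[of 0 1] by (rule DERIV_isCont)
  ultimately have "(\<lambda>n. bump 0 (1 - e n * (norm (y - b))\<^sup>2)) \<longlonglongrightarrow> bump 0 1" by (rule isCont_tendsto_compose[rotated])
  then show ?thesis by (simp add: cutoff_def bump_def)
qed

lemma smc_cutoff:
  fixes P :: "'z::euclidean_space \<Rightarrow> 'a::euclidean_space"
  assumes P: "bounded_linear P" shows "smc (\<lambda>w. of_real (cutoff b e (P w)))"
  unfolding cutoff_def
proof (rule smc_bmp)
  show "smc (\<lambda>w. 1 + (- of_real e) * of_real ((norm (P w - b))\<^sup>2))"
    by (intro smc_add smc_const smc_mult smc_norm_sq P)
qed simp

lemma test_fun_cutoff_gm:
  fixes b :: "real^'d::finite"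
  assumes "0 < e" shows "test_fun (\<lambda>z. of_real (cutoff b e (fst z)) * gm a b k 0 z)"
  unfolding test_fun_def
proof (intro conjI)
  have "smc (\<lambda>z::(real^'d) \<times> real. of_real (cutoff b e (fst z)) * gm a b k 0 (fst z, snd z))"
    by (intro smc_mult smc_cutoff smc_gm bounded_linear_fst smc_const smc_lin
        bounded_linear_of_real[THEN bounded_linear_compose] bounded_linear_snd)
  then show "smooth_fun (\<lambda>z. of_real (cutoff b e (fst z)) * gm a b k 0 z)" by (intro smc_smooth) simp
  show "\<exists>R. \<forall>y x. R < norm y \<longrightarrow> of_real (cutoff b e (fst (y, x))) * gm a b k 0 (y, x) = 0"
    by (intro exI[of _ "norm b + 1 / sqrt e"]) (simp add: cutoff_zero[OF assms])
qed (simp add: gm_periodic)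

text \<open>Coherent states are not compactly supported, but their truncations by
  \<open>cutoff\<close> are test functions. Removing the cutoff by dominated convergence yields
  orthogonality to the coherent states, whose completeness is known.\<close>

lemma orthogonal_test_imp_zero:
  fixes r :: "(real^'d::finite) \<times> real \<Rightarrow> complex"
  assumes r: "r \<in> l2 mX" and o: "\<And>\<psi>. test_fun \<psi> \<Longrightarrow> ip mX r \<psi> = 0"
  shows "AE z in mX. r z = 0"
proof (rule orthogonal_gm_imp_zero)
  show rm: "r \<in> borel_measurable borel" using l2_meas[OF r] by (simp cong: measurable_cong_sets)
  show "integrable mX (\<lambda>z. r z * of_real (wX z))" by (rule l2_mult_integrable[OF r wX(4)])
  fix a :: real and b :: "real^'d" and k assume a: "0 < a"
  define e where "e n = 1 / real (Suc n)" for n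
  have e0: "e \<longlonglongrightarrow> 0" unfolding e_def by real_asymp
  have e: "e n > 0" for n by (simp add: e_def)
  note [measurable] = rm
  have "(\<lambda>n. ip mX r (\<lambda>z. of_real (cutoff b (e n) (fst z)) * gm a b k 0 z)) \<longlonglongrightarrow> (\<integral>z. r z * cnj (of_real (exp (- 1)) * gm a b k 0 z) \<partial>mX)"
    unfolding ip_def
  proof (rule integral_dominated_convergence[where w = "\<lambda>z. cmod (r z) * cmod (gm a b k 0 z)"])
    show "integrable mX (\<lambda>z. cmod (r z) * cmod (gm a b k 0 z))" by (rule l2_mult_integrable[OF r gm_l2[OF a]])
    show "AE z in mX. (\<lambda>n. r z * cnj (of_real (cutoff b (e n) (fst z)) * gm a b k 0 z)) \<longlonglongrightarrow> r z * cnj (of_real (exp (- 1)) * gm a b k 0 z)"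
      by (intro AE_I2 tendsto_intros cutoff_tendsto e0)
    show "AE z in mX. norm (r z * cnj (of_real (cutoff b (e n) (fst z)) * gm a b k 0 z)) \<le> cmod (r z) * cmod (gm a b k 0 z)" for n
      using cutoff_le by (auto intro!: AE_I2 mult_left_mono mult_left_le_one_le simp: norm_mult)
    show "(\<lambda>z. r z * cnj (of_real (cutoff b (e n) (fst z)) * gm a b k 0 z)) \<in> borel_measurable mX" for n
      by (subst measurable_cong_sets[OF sets_mX refl])
         (rule borel_measurable_times[OF rm borel_measurable_cnj[OF test_fun_measurable[OF test_fun_cutoff_gm[OF e]]]])
  qed (simp cong: measurable_cong_sets)
  moreover have "ip mX r (\<lambda>z. of_real (cutoff b (e n) (fst z)) * gm a b k 0 z) = 0" for n
    by (rule o[OF test_fun_cutoff_gm[OF e]])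
  ultimately have "(\<integral>z. r z * cnj (of_real (exp (- 1)) * gm a b k 0 z) \<partial>mX) = 0" by (simp add: LIMSEQ_const_iff)
  moreover have "(\<integral>z. r z * cnj (of_real (exp (- 1)) * gm a b k 0 z) \<partial>mX) = of_real (exp (- 1)) * ip mX r (gm a b k 0)"
    unfolding ip_def by (subst integral_mult_right_zero[symmetric]) (simp add: mult_ac)
  ultimately show "ip mX r (gm a b k 0) = 0" by simp
qed

section \<open>From integrals over the fundamental domain to the product measure\<close>

lemma L2_eq_l2: "(L2 :: ((real^'d::finite) \<times> real \<Rightarrow> complex) set) = l2 mX"
proof -
  have "set_integrable lborel fund_dom (\<lambda>z. (cmod (f z))\<^sup>2) \<longleftrightarrow> integrable mX (\<lambda>z. (cmod (f z))\<^sup>2)"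
    if "f \<in> borel_measurable borel" for f :: "(real^'d) \<times> real \<Rightarrow> complex"
    using that by (intro integral_mX(2)) measurable
  then show ?thesis unfolding L2_def l2_def by (auto cong: measurable_cong_sets)
qed

lemma L2norm_eq_nrm: "f \<in> l2 mX \<Longrightarrow> L2norm f = nrm mX f"
  unfolding L2norm_def nrm_def using l2_meas[of f mX]
  by (subst integral_mX(1)) (auto cong: measurable_cong_sets)

lemma integral_fund_dom_ip:
  fixes f g :: "(real^'d::finite) \<times> real \<Rightarrow> complex"
  assumes "f \<in> l2 mX" "g \<in> l2 mX"
  shows "(LINT z:fund_dom|lborel. f z * cnj (g z)) = ip mX f g"
proof -
  have [measurable]: "f \<in> borel_measurable borel" "g \<in> borel_measurable borel"
    using assms[THEN l2_meas] by (simp_all cong: measurable_cong_sets)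
  show ?thesis unfolding ip_def by (rule integral_mX(1)) measurable
qed

lemma is_free_evol_iff:
  fixes h g :: "(real^'d::finite) \<times> real \<Rightarrow> complex"
  assumes h: "h \<in> l2 mX"
  shows "is_free_evol t h g \<longleftrightarrow> g \<in> l2 mX \<and> (\<forall>\<psi>. test_fun \<psi> \<longrightarrow> ip mX g \<psi> = ip mX h (schrod_test (- t) \<psi>))"
  unfolding is_free_evol_def L2_eq_l2
  by (auto simp: integral_fund_dom_ip h test_fun_integrable(2) schrod_test_l2)

text \<open>The choice in \<open>free_prop\<close> carries information only once some free evolution
  exists; the limit \<open>g\<close> of evolved combinations is one. Test functions determine an L2
  function a.e., so the chosen representative agrees with \<open>g\<close>, and the distance to any
  combination is the same at time \<open>t\<close> as at time 0.\<close>

lemma free_prop_approx: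
  fixes h :: "(real^'d::finite) \<times> real \<Rightarrow> complex"
  assumes h: "h \<in> l2 mX"
  shows "free_prop t h \<in> l2 mX"
    and "valid L \<Longrightarrow> nrm mX (\<lambda>z. free_prop t h z - comb L t z) = nrm mX (\<lambda>z. h z - comb L 0 z)"
proof -
  obtain Ls g where Ls: "\<And>n. valid (Ls n)" "(\<lambda>n. nrm mX (\<lambda>z. comb (Ls n) 0 z - h z)) \<longlonglongrightarrow> 0"
    and g: "g \<in> l2 mX" "(\<lambda>n. nrm mX (\<lambda>z. comb (Ls n) t z - g z)) \<longlonglongrightarrow> 0"
    using comb_approx[OF h, of t] by blast
  have ev: "ip mX g \<psi> = ip mX h (schrod_test (- t) \<psi>)" if ps: "test_fun \<psi>" for \<psi>
  proof -
    have "(\<lambda>n. ip mX (comb (Ls n) t) \<psi>) \<longlonglongrightarrow> ip mX g \<psi>"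
      by (rule ip_tendsto[OF comb_l2[OF Ls(1)] g(1) test_fun_integrable(2)[OF ps] g(2)])
    moreover have "(\<lambda>n. ip mX (comb (Ls n) 0) (schrod_test (- t) \<psi>)) \<longlonglongrightarrow> ip mX h (schrod_test (- t) \<psi>)"
      by (rule ip_tendsto[OF comb_l2[OF Ls(1)] h schrod_test_l2[OF ps] Ls(2)])
    ultimately show ?thesis using LIMSEQ_unique unfolding schrod_test_adjoint_comb[OF ps Ls(1)] by blast
  qed
  then have "is_free_evol t h g" using g(1) by (simp add: is_free_evol_iff[OF h])
  then have fe: "is_free_evol t h (free_prop t h)" unfolding free_prop_def by (rule someI[of "is_free_evol t h"])
  then show l2: "free_prop t h \<in> l2 mX" by (simp add: is_free_evol_iff[OF h])
  have "AE z in mX. free_prop t h z - g z = 0"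
  proof (rule orthogonal_test_imp_zero)
    show "(\<lambda>z. free_prop t h z - g z) \<in> l2 mX" by (rule l2_diff[OF l2 g(1)])
    fix \<psi> :: "(real^'d) \<times> real \<Rightarrow> complex" assume ps: "test_fun \<psi>"
    show "ip mX (\<lambda>z. free_prop t h z - g z) \<psi> = 0"
      using fe ev[OF ps] ps by (simp add: ip_diff_left l2 g(1) test_fun_integrable(2) is_free_evol_iff[OF h])
  qed
  then have eq: "AE z in mX. free_prop t h z = g z" by eventually_elim simp
  assume L: "valid L"
  have [measurable]: "free_prop t h \<in> borel_measurable mX" "g \<in> borel_measurable mX" "comb L t \<in> borel_measurable mX"
    using l2 g(1) comb_l2[OF L] by (auto intro: l2_meas)
  have "(\<integral>z. (cmod (free_prop t h z - comb L t z))\<^sup>2 \<partial>mX) = (\<integral>z. (cmod (g z - comb L t z))\<^sup>2 \<partial>mX)"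
    by (rule integral_cong_AE) (use eq in \<open>auto elim: eventually_mono\<close>)
  then have 1: "nrm mX (\<lambda>z. free_prop t h z - comb L t z) = nrm mX (\<lambda>z. g z - comb L t z)" by (simp add: nrm_def)
  have lim: "(\<lambda>n. nrm mX (\<lambda>z. comb (Ls n) s z - comb L s z)) \<longlonglongrightarrow> nrm mX (\<lambda>z. f z - comb L s z)"
    if f: "f \<in> l2 mX" and c: "(\<lambda>n. nrm mX (\<lambda>z. comb (Ls n) s z - f z)) \<longlonglongrightarrow> 0" for s f
    by (rule nrm_tendsto) (use c in \<open>auto intro!: l2_diff comb_l2 Ls L f\<close>)
  have "(\<lambda>n. nrm mX (\<lambda>z. comb (Ls n) t z - comb L t z)) \<longlonglongrightarrow> nrm mX (\<lambda>z. g z - comb L t z)" by (rule lim[OF g])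
  moreover have "(\<lambda>n. nrm mX (\<lambda>z. comb (Ls n) t z - comb L t z)) \<longlonglongrightarrow> nrm mX (\<lambda>z. h z - comb L 0 z)"
    unfolding comb_nrm_diff[OF Ls(1) L, of _ t] by (rule lim[OF h Ls(2)])
  ultimately show "nrm mX (\<lambda>z. free_prop t h z - comb L t z) = nrm mX (\<lambda>z. h z - comb L 0 z)"
    unfolding 1 by (rule LIMSEQ_unique)
qed

section \<open>The equation tested against coherent states\<close>

lemma cnj_gy: "cnj (gy a b t y) = gy a b (- t) y"
proof -
  have s: "cnj (sg a t) = sg a (- t)" by (simp add: sg_def)
  have "cnj (csqrt (sg a t)) = csqrt (sg a (- t))" using cnj_csqrt[OF sg_not_nonpos[of a t]] by (simp add: s)
  then show ?thesis by (simp add: gy_def exp_cnj s)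
qed

text \<open>Conjugation is time reversal together with \<open>k\<close> replaced by
  \<open>- k\<close>, so derivatives of the conjugate wave are instances of those of
  \<open>gm\<close>.\<close>

lemma cnj_gm: "cnj (gm a b k t z) = gm a b (- k) (- t) z"
proof -
  have "cnj (ek k t x) = ek (- k) (- t) x" for x
    unfolding ek_def exp_cnj by (intro arg_cong[of _ _ exp]) (simp add: algebra_simps)
  then show ?thesis by (simp add: gm_def cnj_gy)
qed

text \<open>Logarithmic derivatives: \<open>l\<close> is the derivative divided by the function. For
  the product of a power and exponentials that makes up a coherent state they simply add.\<close>

definition has_ldpart :: "('a::real_normed_vector \<Rightarrow> complex) \<Rightarrow> 'a \<Rightarrow> ('a \<Rightarrow> complex) \<Rightarrow> bool" where
  "has_ldpart f v l \<longleftrightarrow> has_dpart f v (\<lambda>z. l z * f z)"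

lemma has_ldpart_mult: "has_ldpart f v l \<Longrightarrow> has_ldpart g v m \<Longrightarrow> has_ldpart (\<lambda>z. f z * g z) v (\<lambda>z. l z + m z)"
  unfolding has_ldpart_def by (drule (1) has_dpart_mult) (simp add: algebra_simps)

lemma has_ldpart_power: "has_ldpart f v l \<Longrightarrow> has_ldpart (\<lambda>z. f z ^ n) v (\<lambda>z. of_nat n * l z)"
proof (induction n)
  case 0
  then show ?case using has_dpart_const[of 1 v] by (simp add: has_ldpart_def)
next
  case (Suc n)
  from has_ldpart_mult[OF Suc(2) Suc(1)[OF Suc(2)]] show ?case by (simp add: algebra_simps)
qed

lemma has_ldpart_exp: "has_dpart f v f' \<Longrightarrow> has_ldpart (\<lambda>z. exp (f z)) v f'"
  unfolding has_ldpart_def by (rule has_dpart_exp)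

lemma has_ldpart_inverse_csqrt:
  assumes f: "has_dpart f v f'" and re: "\<And>z. 0 < Re (f z)"
  shows "has_ldpart (\<lambda>z. inverse (csqrt (f z))) v (\<lambda>z. - f' z / (2 * f z))"
proof -
  have nz: "csqrt (f z) \<noteq> 0" for z using re[of z] by auto
  have sq: "f z = csqrt (f z) * csqrt (f z)" for z by (simp flip: power2_eq_square)
  have e: "(f' z * (1/2 * inverse (csqrt (f z)))) * (- inverse (csqrt (f z)) * inverse (csqrt (f z))) = - f' z / (2 * f z) * inverse (csqrt (f z))" for z
  proof -
    have "(d * (1/2 * inverse r)) * (- inverse r * inverse r) = - d / (2 * (r * r)) * inverse r" if "r \<noteq> 0" for d r :: complex
      using that by (simp add: field_simps)
    from this[OF nz[of z], of "f' z"] show ?thesis unfolding sq[symmetric] .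
  qed
  show ?thesis using has_dpart_inverse[OF has_dpart_csqrt[OF f re] nz] unfolding has_ldpart_def e .
qed

lemma has_dpart_of_real_inner:
  fixes P :: "'z::real_normed_vector \<Rightarrow> 'a::euclidean_space"
  assumes "bounded_linear P"
  shows "has_dpart (\<lambda>w. of_real ((P w - b) \<bullet> e)) v (\<lambda>w. of_real (P v \<bullet> e))"
  unfolding has_dpart_def
proof
  interpret bounded_linear P by fact
  fix w
  have "((\<lambda>s. (P w + s *\<^sub>R P v - b) \<bullet> e) has_real_derivative (P v \<bullet> e)) (at 0)"
    unfolding inner_diff_left inner_add_left inner_scaleR_left by (auto intro!: derivative_eq_intros)
  from has_vector_derivative_of_real[OF this]
  show "((\<lambda>s. complex_of_real ((P (w + s *\<^sub>R v) - b) \<bullet> e)) has_vector_derivative of_real (P v \<bullet> e)) (at 0)"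
    by (simp add: add scaleR)
qed

lemma has_dpart_norm_sq:
  fixes P :: "'z::real_normed_vector \<Rightarrow> 'a::euclidean_space"
  assumes "bounded_linear P"
  shows "has_dpart (\<lambda>w. of_real ((norm (P w - b))\<^sup>2)) v (\<lambda>w. of_real (2 * ((P w - b) \<bullet> P v)))"
  unfolding has_dpart_def
proof
  interpret bounded_linear P by fact
  fix w
  have eq: "(norm (P (w + s *\<^sub>R v) - b))\<^sup>2 = (P w - b) \<bullet> (P w - b) + s * (2 * ((P w - b) \<bullet> P v)) + s\<^sup>2 * (P v \<bullet> P v)" for s
  proof -
    have e: "P (w + s *\<^sub>R v) - b = (P w - b) + s *\<^sub>R P v" by (simp add: add scaleR algebra_simps)
    have "(Q + s *\<^sub>R V) \<bullet> (Q + s *\<^sub>R V) = Q \<bullet> Q + s * (2 * (Q \<bullet> V)) + s\<^sup>2 * (V \<bullet> V)" for Q V :: 'a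
      by (simp add: inner_add_left inner_add_right inner_commute[of V Q] power2_eq_square algebra_simps)
    then show ?thesis unfolding power2_norm_eq_inner e .
  qed
  have "((\<lambda>s. (P w - b) \<bullet> (P w - b) + s * (2 * ((P w - b) \<bullet> P v)) + s\<^sup>2 * (P v \<bullet> P v)) has_real_derivative (2 * ((P w - b) \<bullet> P v))) (at 0)"
    by (auto intro!: derivative_eq_intros)
  from has_vector_derivative_of_real[OF this]
  show "((\<lambda>s. complex_of_real ((norm (P (w + s *\<^sub>R v) - b))\<^sup>2)) has_vector_derivative of_real (2 * ((P w - b) \<bullet> P v))) (at 0)"
    unfolding eq .
qed

lemma has_dpart_of_real_lin:
  assumes "bounded_linear (T :: 'z::real_normed_vector \<Rightarrow> real)"
  shows "has_dpart (\<lambda>w. of_real (T w)) v (\<lambda>w. of_real (T v))"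
  using has_dpart_of_real_inner[OF assms, of 0 1] by simp

lemma has_dpart_cmult: "has_dpart f v f' \<Longrightarrow> has_dpart (\<lambda>z. c * f z) v (\<lambda>z. c * f' z)"
  using has_dpart_mult[OF has_dpart_const[of c v]] by force

text \<open>With space, time and circle coordinate replaced by linear maps \<open>P\<close>,
  \<open>T\<close>, \<open>X\<close>, one formula covers every first partial derivative, also after
  the time reversal in the conjugate wave.\<close>

lemma has_ldpart_gm:
  fixes P :: "'z::real_normed_vector \<Rightarrow> 'a::euclidean_space"
  assumes P: "bounded_linear P" and T: "bounded_linear T" and X: "bounded_linear X"
  shows "has_ldpart (\<lambda>w. gm a b k (T w) (P w, X w)) v (\<lambda>w.
    - of_nat DIM('a) * (\<i> * of_real (a * T v) / sg a (T w))
    - of_real (a * ((P w - b) \<bullet> P v)) / sg a (T w)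
    + of_real (a\<^sup>2 * (norm (P w - b))\<^sup>2) * (\<i> * of_real (T v)) / (sg a (T w))\<^sup>2
    + \<i> * of_real (of_int k * X v - (of_int k)\<^sup>2 * T v))"
proof -
  have s: "has_dpart (\<lambda>w. sg a (T w)) v (\<lambda>w. 2 * \<i> * of_real (a * T v))"
    using has_dpart_add[OF has_dpart_const[of 1 v] has_dpart_cmult[OF has_dpart_of_real_lin[OF T, of v], of "2 * \<i> * of_real a"]]
    by (simp add: sg_def mult.assoc)
  have c: "has_ldpart (\<lambda>w. inverse (csqrt (sg a (T w))) ^ DIM('a)) v (\<lambda>w. of_nat DIM('a) * (- (2 * \<i> * of_real (a * T v)) / (2 * sg a (T w))))"
    by (rule has_ldpart_power[OF has_ldpart_inverse_csqrt[OF s]]) simp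
  have "has_dpart (\<lambda>w. (- of_real (a / 2) * of_real ((norm (P w - b))\<^sup>2)) * inverse (sg a (T w))) v
    (\<lambda>w. (- of_real (a / 2) * of_real ((norm (P w - b))\<^sup>2)) * ((2 * \<i> * of_real (a * T v)) * (- inverse (sg a (T w)) * inverse (sg a (T w))))
      + (- of_real (a / 2) * of_real (2 * ((P w - b) \<bullet> P v))) * inverse (sg a (T w)))"
    by (rule has_dpart_mult[OF has_dpart_cmult[OF has_dpart_norm_sq[OF P]] has_dpart_inverse[OF s]]) simp
  from has_ldpart_exp[OF this]
  have e: "has_ldpart (\<lambda>w. exp ((- of_real (a / 2) * of_real ((norm (P w - b))\<^sup>2)) * inverse (sg a (T w)))) v
    (\<lambda>w. (- of_real (a / 2) * of_real ((norm (P w - b))\<^sup>2)) * ((2 * \<i> * of_real (a * T v)) * (- inverse (sg a (T w)) * inverse (sg a (T w))))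
      + (- of_real (a / 2) * of_real (2 * ((P w - b) \<bullet> P v))) * inverse (sg a (T w)))" .
  have x: "has_ldpart (\<lambda>w. exp (\<i> * (of_int k * of_real (X w) + (- ((of_int k)\<^sup>2)) * of_real (T w)))) v
     (\<lambda>w. \<i> * (of_int k * of_real (X v) + (- ((of_int k)\<^sup>2)) * of_real (T v)))"
    by (rule has_ldpart_exp[OF has_dpart_cmult[OF has_dpart_add[OF has_dpart_cmult[OF has_dpart_of_real_lin[OF X]] has_dpart_cmult[OF has_dpart_of_real_lin[OF T]]]]])
  have 1: "- of_real (a / 2 * N) / r = (- of_real (a / 2) * of_real N) * inverse r" for N :: real and r :: complex
    by (simp only: divide_inverse[of _ r] of_real_mult mult_minus_left)
  have 2: "\<i> * of_real (of_int k * x - (of_int k)\<^sup>2 * t) = \<i> * (of_int k * of_real x + (- ((of_int k)\<^sup>2)) * of_real t)" for x t :: real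
    by simp
  have eq: "(\<lambda>w. gm a b k (T w) (P w, X w)) = (\<lambda>w. inverse (csqrt (sg a (T w))) ^ DIM('a) * exp ((- of_real (a / 2) * of_real ((norm (P w - b))\<^sup>2)) * inverse (sg a (T w)))
     * exp (\<i> * (of_int k * of_real (X w) + (- ((of_int k)\<^sup>2)) * of_real (T w))))"
    unfolding gm_def gy_def ek_def fst_conv snd_conv 1 2 ..
  have l: "(\<lambda>w. of_nat DIM('a) * (- (2 * \<i> * of_real (a * T v)) / (2 * sg a (T w)))
     + ((- of_real (a / 2) * of_real ((norm (P w - b))\<^sup>2)) * ((2 * \<i> * of_real (a * T v)) * (- inverse (sg a (T w)) * inverse (sg a (T w))))
      + (- of_real (a / 2) * of_real (2 * ((P w - b) \<bullet> P v))) * inverse (sg a (T w)))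
     + \<i> * (of_int k * of_real (X v) + (- ((of_int k)\<^sup>2)) * of_real (T v)))
   = (\<lambda>w. - of_nat DIM('a) * (\<i> * of_real (a * T v) / sg a (T w))
    - of_real (a * ((P w - b) \<bullet> P v)) / sg a (T w)
    + of_real (a\<^sup>2 * (norm (P w - b))\<^sup>2) * (\<i> * of_real (T v)) / (sg a (T w))\<^sup>2
    + \<i> * of_real (of_int k * X v - (of_int k)\<^sup>2 * T v))"
  proof
    fix w
    have "sg a (T w) \<noteq> 0" by simp
    then show "of_nat DIM('a) * (- (2 * \<i> * of_real (a * T v)) / (2 * sg a (T w)))
     + ((- of_real (a / 2) * of_real ((norm (P w - b))\<^sup>2)) * ((2 * \<i> * of_real (a * T v)) * (- inverse (sg a (T w)) * inverse (sg a (T w))))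
      + (- of_real (a / 2) * of_real (2 * ((P w - b) \<bullet> P v))) * inverse (sg a (T w)))
     + \<i> * (of_int k * of_real (X v) + (- ((of_int k)\<^sup>2)) * of_real (T v))
   = - of_nat DIM('a) * (\<i> * of_real (a * T v) / sg a (T w))
    - of_real (a * ((P w - b) \<bullet> P v)) / sg a (T w)
    + of_real (a\<^sup>2 * (norm (P w - b))\<^sup>2) * (\<i> * of_real (T v)) / (sg a (T w))\<^sup>2
    + \<i> * of_real (of_int k * X v - (of_int k)\<^sup>2 * T v)"
      by (simp add: field_simps power2_eq_square)
  qed
  show ?thesis unfolding eq using has_ldpart_mult[OF has_ldpart_mult[OF c e] x] unfolding l .
qed

lemma has_dpart_const_along: "(\<And>z s. f (z + s *\<^sub>R v) = f z) \<Longrightarrow> has_dpart f v (\<lambda>_. 0)"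
  by (simp add: has_dpart_def)

definition th :: "real \<Rightarrow> real \<Rightarrow> real" where
  "th T t = bump 0 (t / T - 1) * bump 0 (2 - t / T)"

text \<open>The index 2 appears because the derivative of \<open>bump 0\<close> is
  \<open>bump 2\<close>.\<close>

definition th' :: "real \<Rightarrow> real \<Rightarrow> real" where
  "th' T t = (bump 2 (t / T - 1) * bump 0 (2 - t / T) - bump 0 (t / T - 1) * bump 2 (2 - t / T)) / T"

lemma DERIV_th:
  assumes "T > 0" shows "(th T has_real_derivative th' T t) (at t)"
proof -
  have 1: "((\<lambda>t. bump 0 (t / T - 1)) has_real_derivative bump 2 (t / T - 1) * (1 / T)) (at t)"
  proof -
    have d: "((\<lambda>t. t / T - 1) has_real_derivative 1 / T) (at t)" using assms by (auto intro!: derivative_eq_intros)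
    from DERIV_chain2[OF DERIV_bmp[of 0] d] show ?thesis by (simp add: numeral_2_eq_2)
  qed
  have 2: "((\<lambda>t. bump 0 (2 - t / T)) has_real_derivative bump 2 (2 - t / T) * (- 1 / T)) (at t)"
  proof -
    have d: "((\<lambda>t. 2 - t / T) has_real_derivative - 1 / T) (at t)" using assms by (auto intro!: derivative_eq_intros)
    from DERIV_chain2[OF DERIV_bmp[of 0] d] show ?thesis by (simp add: numeral_2_eq_2)
  qed
  show ?thesis unfolding th_def
    using DERIV_mult[OF 1 2] by (rule DERIV_cong) (simp add: th'_def diff_divide_distrib)
qed

lemma th_zero: assumes "T > 0" "t \<notin> {T..2*T}" shows "th T t = 0" "th' T t = 0"
proof -
  have "t / T - 1 \<le> 0 \<or> 2 - t / T \<le> 0" using assms by (auto simp: field_simps not_le)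
  then show "th T t = 0" "th' T t = 0" by (auto simp: th_def th'_def bump_zero)
qed

lemma smc_th:
  assumes "smc (\<lambda>w. of_real (f w))" shows "smc (\<lambda>w. of_real (th T (f w)))"
proof -
  have 1: "smc (\<lambda>w. complex_of_real (bump 0 (f w / T - 1)))"
    by (rule smc_bmp[where f = "\<lambda>w. of_real (1 / T) * of_real (f w) + of_real (- 1)"]) (rule smc_add[OF smc_cmult[OF assms] smc_const], simp)
  have 2: "smc (\<lambda>w. complex_of_real (bump 0 (2 - f w / T)))"
    by (rule smc_bmp[where f = "\<lambda>w. of_real (- 1 / T) * of_real (f w) + of_real 2"]) (rule smc_add[OF smc_cmult[OF assms] smc_const], simp)
  show ?thesis unfolding th_def of_real_mult by (rule smc_mult[OF 1 2])
qed

lemma bump_bounded: "\<exists>B\<ge>0. \<forall>s\<le>1. \<bar>bump n s\<bar> \<le> B"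
proof -
  have "compact (bump n ` {0..1})" by (intro compact_continuous_image continuous_on_subset[OF continuous_bmp]) auto
  then obtain B where B: "\<And>s. s \<in> {0..1} \<Longrightarrow> \<bar>bump n s\<bar> \<le> B" using compact_imp_bounded bounded_iff by (metis image_eqI real_norm_def)
  have "\<bar>bump n s\<bar> \<le> \<bar>B\<bar>" if "s \<le> 1" for s using B[of s] that by (cases "s \<le> 0") (auto simp: bump_zero)
  then show ?thesis by (intro exI[of _ "\<bar>B\<bar>"]) auto
qed

locale wave =
  fixes a :: real and b :: "real^'d::finite" and k :: int
  assumes a: "0 < a"
begin

abbreviation "V t z \<equiv> gm a b k t z"

definition W :: "real \<times> ((real^'d) \<times> real) \<Rightarrow> complex" where "W w = cnj (V (fst w) (snd w))"
definition S :: "real \<times> ((real^'d) \<times> real) \<Rightarrow> complex" where "S w = sg a (- fst w)"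
definition N :: "real \<times> ((real^'d) \<times> real) \<Rightarrow> real" where "N w = (norm (fst (snd w) - b))\<^sup>2"
definition C :: "real \<Rightarrow> real \<times> ((real^'d) \<times> real) \<Rightarrow> complex" where "C e w = of_real (cutoff b e (fst (snd w)))"
text \<open>The commutator of the spatial Laplacian with the cutoff, applied to \<open>W\<close>:
  exactly the terms in which at least one derivative falls on the cutoff.\<close>

definition R :: "real \<Rightarrow> real \<times> ((real^'d) \<times> real) \<Rightarrow> complex" where
  "R e w = (\<Sum>\<beta>\<in>Basis. 2 * (dpart (0, \<beta>) (C e) w * dpart (0, \<beta>) W w) + dpart (0, \<beta>) (dpart (0, \<beta>) (C e)) w * W w)"

lemma bl: "bounded_linear (\<lambda>w::real \<times> ((real^'d) \<times> real). fst (snd w))" "bounded_linear (\<lambda>w::real \<times> ((real^'d) \<times> real). - fst w)"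
  "bounded_linear (\<lambda>w::real \<times> ((real^'d) \<times> real). snd (snd w))" "bounded_linear (\<lambda>w::real \<times> ((real^'d) \<times> real). fst w)"
  by (intro bounded_linear_minus bounded_linear_fst_comp bounded_linear_snd_comp bounded_linear_fst bounded_linear_snd bounded_linear_ident)+

lemma S_nz: "S w \<noteq> 0" by (simp add: S_def)

lemma W_eq: "W = (\<lambda>w. gm a b (- k) (- fst w) (fst (snd w), snd (snd w)))"
  by (simp add: W_def cnj_gm fun_eq_iff)

lemma smc_W: "smc W"
  unfolding W_eq
  by (rule smc_gm[OF bl(1) smc_lin[OF bounded_linear_compose[OF bounded_linear_of_real bl(2)]] smc_lin[OF bounded_linear_compose[OF bounded_linear_of_real bl(3)]]])

lemma smc_C: "smc (C e)"
  unfolding C_def[abs_def] by (rule smc_cutoff[OF bl(1)])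

lemma W_t: "dpart (1, 0) W = (\<lambda>w. (of_nat CARD('d) * (\<i> * of_real a / S w) - \<i> * of_real (a\<^sup>2 * N w) / (S w)\<^sup>2 + \<i> * of_real ((of_int k)\<^sup>2)) * W w)"
  using has_ldpart_gm[OF bl(1,2,3), of a b "- k" "(1, 0)", folded W_eq] unfolding has_ldpart_def
  by (subst has_dpart_dpart, assumption) (simp add: S_def N_def fun_eq_iff)

lemma W_e: "dpart (0, (e, 0)) W = (\<lambda>w. (of_real ((fst (snd w) - b) \<bullet> e) * (- of_real a / S w)) * W w)"
  using has_ldpart_gm[OF bl(1,2,3), of a b "- k" "(0, (e, 0))", folded W_eq] unfolding has_ldpart_def
  by (subst has_dpart_dpart, assumption) (simp add: S_def fun_eq_iff)

lemma W_x: "dpart (0, (0, 1)) W = (\<lambda>w. (- \<i> * of_int k) * W w)"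
  using has_ldpart_gm[OF bl(1,2,3), of a b "- k" "(0, (0, 1))", folded W_eq] unfolding has_ldpart_def
  by (subst has_dpart_dpart, assumption) (simp add: fun_eq_iff)

lemma W_ee:
  assumes "norm e = 1"
  shows "dpart (0, (e, 0)) (dpart (0, (e, 0)) W) = (\<lambda>w. (of_real (((fst (snd w) - b) \<bullet> e)\<^sup>2) * (of_real a / S w)\<^sup>2 - of_real a / S w) * W w)"
proof -
  have 1: "has_dpart (\<lambda>w::real \<times> ((real^'d) \<times> real). of_real ((fst (snd w) - b) \<bullet> e)) (0, (e, 0)) (\<lambda>w. 1)"
    using has_dpart_of_real_inner[OF bl(1), of b e "(0, (e, 0))"] assms by (simp add: norm_eq_1)
  have 2: "has_dpart (\<lambda>w. - of_real a / S w) (0, (e, 0)) (\<lambda>_. 0)"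
    by (rule has_dpart_const_along) (simp add: S_def)
  have "has_dpart (dpart (0, (e, 0)) W) (0, (e, 0)) (\<lambda>w. (of_real ((fst (snd w) - b) \<bullet> e) * (- of_real a / S w)) * dpart (0, (e, 0)) W w
     + (of_real ((fst (snd w) - b) \<bullet> e) * 0 + 1 * (- of_real a / S w)) * W w)"
    by (subst (1) W_e) (rule has_dpart_mult[OF has_dpart_mult[OF 1 2] smc_hd_dpart[OF smc_W]])
  from has_dpart_dpart[OF this] show ?thesis unfolding W_e
    by (simp add: fun_eq_iff power2_eq_square algebra_simps)
qed

lemma W_xx: "dpart (0, (0, 1)) (dpart (0, (0, 1)) W) = (\<lambda>w. - of_real ((of_int k)\<^sup>2) * W w)"
proof -
  have "has_dpart (dpart (0, (0, 1)) W) (0, (0, 1)) (\<lambda>w. (- \<i> * of_int k) * dpart (0, (0, 1)) W w)"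
    by (subst (1) W_x) (rule has_dpart_cmult[OF smc_hd_dpart[OF smc_W]])
  moreover have "(- \<i> * c) * ((- \<i> * c) * z) = - (c\<^sup>2) * z" for c z
    by (simp add: complex_eq_iff algebra_simps power2_eq_square)
  ultimately have "has_dpart (dpart (0, (0, 1)) W) (0, (0, 1)) (\<lambda>w. - (of_int k)\<^sup>2 * W w)"
    unfolding W_x by simp
  from has_dpart_dpart[OF this] show ?thesis by simp
qed

lemma sum_Basis_yx:
  fixes g :: "(real^'d) \<times> real \<Rightarrow> complex"
  shows "(\<Sum>\<beta>\<in>Basis. g \<beta>) = (\<Sum>e\<in>Basis. g (e, 0)) + g (0, 1)"
  unfolding Basis_prod_def by (subst sum.union_disjoint) (auto simp: sum.reindex inj_on_def)

text \<open>The conjugate wave is annihilated by the transposed operator of the weak formulation.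
  Testing with it therefore leaves only the derivative of the time cutoff and the commutator
  \<open>R\<close>.\<close>

lemma W_schrodinger: "- \<i> * dpart (1, 0) W w + (\<Sum>\<beta>\<in>Basis. dpart (0, \<beta>) (dpart (0, \<beta>) W) w) = 0"
proof -
  have n: "N w = (\<Sum>e\<in>Basis. ((fst (snd w) - b) \<bullet> e)\<^sup>2)"
    unfolding N_def power2_norm_eq_inner by (subst euclidean_inner) (simp add: power2_eq_square)
  have "(\<Sum>\<beta>\<in>Basis. dpart (0, \<beta>) (dpart (0, \<beta>) W) w)
     = (\<Sum>e\<in>Basis. (of_real (((fst (snd w) - b) \<bullet> e)\<^sup>2) * (of_real a / S w)\<^sup>2 - of_real a / S w) * W w) - of_real ((of_int k)\<^sup>2) * W w"
    unfolding sum_Basis_yx W_xx by (simp add: W_ee)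
  also have "(\<Sum>e\<in>Basis. (of_real (((fst (snd w) - b) \<bullet> e)\<^sup>2) * (of_real a / S w)\<^sup>2 - of_real a / S w) * W w)
     = (of_real (N w) * (of_real a / S w)\<^sup>2 - of_nat CARD('d) * (of_real a / S w)) * W w"
    unfolding n by (simp add: sum_distrib_right[symmetric] sum_subtractf)
  finally show ?thesis unfolding W_t using S_nz[of w] by (simp add: field_simps power2_eq_square)
qed

definition phi :: "real \<Rightarrow> real \<Rightarrow> real \<times> ((real^'d) \<times> real) \<Rightarrow> complex" where
  "phi T e w = of_real (th T (fst w)) * (C e w * W w)"

lemma st_test_fun_phi:
  assumes "T > 0" "e > 0" shows "st_test_fun (phi T e)"
  unfolding st_test_fun_def
proof (intro conjI)
  have "smc (phi T e)" unfolding phi_def[abs_def]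
    by (intro smc_mult smc_C smc_W smc_th smc_lin bounded_linear_of_real[THEN bounded_linear_compose] bl)
  then show "smooth_fun (phi T e)" by (rule smc_smooth)
  show "\<forall>t y x. phi T e (t, y, x + 2 * pi) = phi T e (t, y, x)"
    by (simp add: phi_def C_def W_def gm_periodic)
  show "\<exists>T0 T1 R. 0 < T0 \<and> (\<forall>t y x. t < T0 \<or> T1 < t \<or> R < norm y \<longrightarrow> phi T e (t, y, x) = 0)"
    by (rule exI[of _ T], rule exI[of _ "2 * T"], rule exI[of _ "norm b + 1 / sqrt e"])
       (use assms in \<open>auto simp: phi_def C_def th_zero cutoff_zero\<close>)
qed

lemma phi_operator:
  assumes T: "T > 0"
  shows "- \<i> * dpart (1, 0) (phi T e) w + (\<Sum>\<beta>\<in>Basis. dpart (0, \<beta>) (dpart (0, \<beta>) (phi T e)) w)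
    = - \<i> * of_real (th' T (fst w)) * (C e w * W w) + of_real (th T (fst w)) * R e w"
proof -
  define H :: "real \<times> ((real^'d) \<times> real) \<Rightarrow> complex" where "H w = of_real (th T (fst w))" for w
  have smH: "smc H" unfolding H_def[abs_def]
    by (intro smc_th smc_lin bounded_linear_of_real[THEN bounded_linear_compose] bl)
  have Hd: "dpart v H = (\<lambda>w. of_real (fst v) * of_real (th' T (fst w)))" for v
    unfolding H_def[abs_def] by (rule has_dpart_dpart[OF has_dpart_real_comp[OF has_dpart_of_real_lin[OF bl(4)] refl DERIV_th[OF T]]])
  have smCW: "smc (\<lambda>w. C e w * W w)" by (rule smc_mult[OF smc_C smc_W])
  have p: "phi T e = (\<lambda>w. H w * (C e w * W w))" by (simp add: phi_def H_def fun_eq_iff)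
  have Ct: "dpart (1, 0) (C e) = (\<lambda>_. 0)"
    by (rule has_dpart_dpart[OF has_dpart_const_along]) (simp add: C_def)
  have t: "dpart (1, 0) (phi T e) w = H w * (C e w * dpart (1, 0) W w) + of_real (th' T (fst w)) * (C e w * W w)"
    unfolding p dpart_mult[OF smH smCW] dpart_mult[OF smc_C smc_W] Ct Hd by simp
  have x: "dpart (0, \<beta>) (dpart (0, \<beta>) (phi T e)) w = H w * (C e w * dpart (0, \<beta>) (dpart (0, \<beta>) W) w)
     + H w * (2 * (dpart (0, \<beta>) (C e) w * dpart (0, \<beta>) W w) + dpart (0, \<beta>) (dpart (0, \<beta>) (C e)) w * W w)" for \<beta>
  proof -
    have z: "dpart (0, \<beta>) (\<lambda>_. 0) = (\<lambda>_. 0::complex)" by (rule has_dpart_dpart[OF has_dpart_const])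
    have H0: "dpart (0, \<beta>) H = (\<lambda>_. 0)" unfolding Hd by simp
    show ?thesis unfolding p dpart2_mult[OF smH smCW] H0 z dpart2_mult[OF smc_C smc_W] by (simp add: algebra_simps)
  qed
  have "- \<i> * dpart (1, 0) (phi T e) w + (\<Sum>\<beta>\<in>Basis. dpart (0, \<beta>) (dpart (0, \<beta>) (phi T e)) w)
    = H w * (C e w * (- \<i> * dpart (1, 0) W w + (\<Sum>\<beta>\<in>Basis. dpart (0, \<beta>) (dpart (0, \<beta>) W) w)))
     + (- \<i> * of_real (th' T (fst w)) * (C e w * W w) + H w * R e w)"
    unfolding t x R_def sum.distrib sum_distrib_left[symmetric] by (simp add: algebra_simps)
  then show ?thesis unfolding W_schrodinger H_def by simp
qed

lemma C_dpart: "dpart v (C e) = (\<lambda>w. of_real (2 * ((fst (snd w) - b) \<bullet> fst (snd v))) * of_real (- e * bump 2 (1 - e * N w)))"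
proof -
  have d: "((\<lambda>s. bump 0 (1 - e * s)) has_real_derivative (- e * bump 2 (1 - e * s))) (at s)" for s
  proof -
    have d: "((\<lambda>s. 1 - e * s) has_real_derivative - e) (at s)" by (auto intro!: derivative_eq_intros)
    from DERIV_chain2[OF DERIV_bmp[of 0] d] show ?thesis by (simp add: numeral_2_eq_2 mult.commute)
  qed
  show ?thesis unfolding C_def[abs_def] cutoff_def N_def
    by (rule has_dpart_dpart[OF has_dpart_real_comp[OF has_dpart_norm_sq[OF bl(1)] refl d]])
qed

lemma C_dpart2: "dpart v (dpart v (C e)) = (\<lambda>w.
    of_real (2 * ((fst (snd w) - b) \<bullet> fst (snd v))) * (of_real (2 * ((fst (snd w) - b) \<bullet> fst (snd v))) * of_real (e * e * (bump 4 (1 - e * N w) - 2 * bump 3 (1 - e * N w))))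
    + of_real (2 * (fst (snd v) \<bullet> fst (snd v))) * of_real (- e * bump 2 (1 - e * N w)))"
proof -
  have d: "((\<lambda>s. - e * bump 2 (1 - e * s)) has_real_derivative (e * e * (bump 4 (1 - e * s) - 2 * bump 3 (1 - e * s)))) (at s)" for s
  proof -
    have d: "((\<lambda>s. 1 - e * s) has_real_derivative - e) (at s)" by (auto intro!: derivative_eq_intros)
    from DERIV_cmult[OF DERIV_chain2[OF DERIV_bmp[of 2] d], of "- e"]
    show ?thesis by (rule DERIV_cong) (simp add: algebra_simps eval_nat_numeral)
  qed
  have 1: "has_dpart (\<lambda>w::real \<times> ((real^'d) \<times> real). of_real (2 * ((fst (snd w) - b) \<bullet> fst (snd v)))) v (\<lambda>w. of_real (2 * (fst (snd v) \<bullet> fst (snd v))))"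
    using has_dpart_cmult[OF has_dpart_of_real_inner[OF bl(1)], of 2 b "fst (snd v)" v] by simp
  have 2: "has_dpart (\<lambda>w. complex_of_real (- e * bump 2 (1 - e * N w))) v (\<lambda>w. of_real (2 * ((fst (snd w) - b) \<bullet> fst (snd v))) * of_real (e * e * (bump 4 (1 - e * N w) - 2 * bump 3 (1 - e * N w))))"
    unfolding N_def by (rule has_dpart_real_comp[OF has_dpart_norm_sq[OF bl(1)] refl d])
  show ?thesis unfolding C_dpart by (rule has_dpart_dpart[OF has_dpart_mult[OF 1 2]])
qed

lemma N_nonneg: "0 \<le> N w" by (simp add: N_def)

lemma cmod_S_ge: "1 \<le> cmod (S w)"
  using abs_Re_le_cmod[of "S w"] by (simp add: S_def)

text \<open>Every term of the commutator contains a derivative of the cutoff and hence a factor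
  \<open>e\<close>, uniformly for e <= 1. The quadratic growth in \<open>N\<close> comes from the
  inner derivatives of the squared distance and is left to the Gaussian decay of
  \<open>W\<close>.\<close>

lemma R_bound: "\<exists>K\<ge>0. \<forall>e w. 0 \<le> e \<longrightarrow> e \<le> 1 \<longrightarrow> cmod (R e w) \<le> e * K * ((1 + N w) * cmod (W w))"
proof -
  obtain B2 where B2: "B2 \<ge> 0" "\<And>s. s \<le> 1 \<Longrightarrow> \<bar>bump 2 s\<bar> \<le> B2" using bump_bounded[of 2] by blast
  obtain B3 where B3: "B3 \<ge> 0" "\<And>s. s \<le> 1 \<Longrightarrow> \<bar>bump 3 s\<bar> \<le> B3" using bump_bounded[of 3] by blast
  obtain B4 where B4: "B4 \<ge> 0" "\<And>s. s \<le> 1 \<Longrightarrow> \<bar>bump 4 s\<bar> \<le> B4" using bump_bounded[of 4] by blast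
  define L where "L = 4 * a * B2 + 4 * (B4 + 2 * B3) + 2 * B2"
  have L0: "L \<ge> 0" using B2(1) B3(1) B4(1) a by (simp add: L_def)
  have "cmod (R e w) \<le> e * (real CARD('d) * L) * ((1 + N w) * cmod (W w))" if e: "0 \<le> e" "e \<le> 1" for e w
  proof -
    define r where "r = 1 - e * N w"
    have r: "r \<le> 1" using e N_nonneg[of w] by (simp add: r_def)
    \<comment> \<open>The cutoff does not depend on the circle variable, so the last basis direction
      contributes nothing.\<close>
    have x0: "2 * (dpart (0, (0, 1)) (C e) w * dpart (0, (0, 1)) W w) + dpart (0, (0, 1)) (dpart (0, (0, 1)) (C e)) w * W w = 0"
      unfolding C_dpart2 unfolding C_dpart by simp
    have "cmod (2 * (dpart (0, (f, 0)) (C e) w * dpart (0, (f, 0)) W w) + dpart (0, (f, 0)) (dpart (0, (f, 0)) (C e)) w * W w)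
        \<le> e * L * ((1 + N w) * cmod (W w))" if f: "f \<in> Basis" for f :: "real^'d"
    proof -
      define j where "j = (fst (snd w) - b) \<bullet> f"
      have j2: "j\<^sup>2 \<le> N w"
      proof -
        have "\<bar>j\<bar> \<le> norm (fst (snd w) - b)" unfolding j_def by (rule Basis_le_norm[OF f])
        then have "\<bar>j\<bar>\<^sup>2 \<le> (norm (fst (snd w) - b))\<^sup>2" by (intro power_mono) auto
        then show ?thesis by (simp add: N_def)
      qed
      have ff: "f \<bullet> f = 1" using f by (simp add: inner_same_Basis)
      have "2 * (dpart (0, (f, 0)) (C e) w * dpart (0, (f, 0)) W w) + dpart (0, (f, 0)) (dpart (0, (f, 0)) (C e)) w * W w
        = (of_real (4 * e * a * j\<^sup>2 * bump 2 r) / S w + of_real (4 * j\<^sup>2 * (e * e) * (bump 4 r - 2 * bump 3 r)) + of_real (- 2 * e * bump 2 r)) * W w"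
        unfolding C_dpart2 unfolding C_dpart W_e fst_conv snd_conv ff j_def[symmetric] r_def[symmetric]
        by (simp add: algebra_simps power2_eq_square)
      also have "cmod \<dots> \<le> (e * L * (1 + N w)) * cmod (W w)"
        unfolding norm_mult
      proof (rule mult_right_mono)
        have "cmod (of_real (4 * e * a * j\<^sup>2 * bump 2 r) / S w) \<le> cmod (of_real (4 * e * a * j\<^sup>2 * bump 2 r)) / 1"
          unfolding norm_divide using cmod_S_ge[of w] by (intro divide_left_mono) auto
        also have "\<dots> = 4 * e * a * j\<^sup>2 * \<bar>bump 2 r\<bar>" unfolding norm_of_real using e a by (simp add: abs_mult)
        also have "\<dots> \<le> 4 * e * a * N w * B2"
          using e a j2 B2(2)[OF r] N_nonneg[of w] by (intro mult_mono) auto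
        finally have 1: "cmod (of_real (4 * e * a * j\<^sup>2 * bump 2 r) / S w) \<le> e * (4 * a * B2) * N w" by (simp add: mult_ac)
        have "\<bar>4 * j\<^sup>2 * (e * e) * (bump 4 r - 2 * bump 3 r)\<bar> = 4 * j\<^sup>2 * (e * e) * \<bar>bump 4 r - 2 * bump 3 r\<bar>"
          by (simp add: abs_mult)
        also have "\<dots> \<le> 4 * N w * (e * 1) * (B4 + 2 * B3)"
          using e j2 B3(2)[OF r] B4(2)[OF r] N_nonneg[of w] by (intro mult_mono) auto
        finally have 2: "cmod (of_real (4 * j\<^sup>2 * (e * e) * (bump 4 r - 2 * bump 3 r))) \<le> e * (4 * (B4 + 2 * B3)) * N w"
          unfolding norm_of_real by (simp add: mult_ac)
        have "\<bar>- 2 * e * bump 2 r\<bar> = 2 * e * \<bar>bump 2 r\<bar>" using e by (simp add: abs_mult)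
        also have "\<dots> \<le> 2 * e * B2" using e B2(2)[OF r] by (intro mult_left_mono) auto
        finally have 3: "cmod (of_real (- 2 * e * bump 2 r)) \<le> e * (2 * B2)" unfolding norm_of_real by simp
        have "cmod (of_real (4 * e * a * j\<^sup>2 * bump 2 r) / S w + of_real (4 * j\<^sup>2 * (e * e) * (bump 4 r - 2 * bump 3 r)) + of_real (- 2 * e * bump 2 r))
          \<le> e * (4 * a * B2) * N w + e * (4 * (B4 + 2 * B3)) * N w + e * (2 * B2)"
          by (rule norm_triangle_le[OF add_mono[OF norm_triangle_le[OF add_mono[OF 1 2]] 3]])
        also have "\<dots> \<le> e * L * (1 + N w)"
        proof -
          have "0 \<le> e * (4 * a * B2 + 4 * (B4 + 2 * B3))" "0 \<le> e * (2 * B2) * N w"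
            using e a B2(1) B3(1) B4(1) N_nonneg[of w] by auto
          then show ?thesis unfolding L_def by (simp add: algebra_simps)
        qed
        finally show "cmod (of_real (4 * e * a * j\<^sup>2 * bump 2 r) / S w + of_real (4 * j\<^sup>2 * (e * e) * (bump 4 r - 2 * bump 3 r)) + of_real (- 2 * e * bump 2 r)) \<le> e * L * (1 + N w)" .
      qed simp
      finally show ?thesis by (simp add: mult.assoc)
    qed
    then have "cmod (R e w) \<le> (\<Sum>f\<in>(Basis::(real^'d) set). e * L * ((1 + N w) * cmod (W w)))"
      unfolding R_def sum_Basis_yx x0 add_0_right by (intro sum_norm_le)
    then show ?thesis by (simp add: mult_ac)
  qed
  then show ?thesis using L0 by (intro exI[of _ "real CARD('d) * L"]) auto
qed

lemma cmod_W: "cmod (W w) = cmod (gy a b (fst w) (fst (snd w)))"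
  by (simp add: W_def gm_def norm_mult)

lemma W_bound:
  assumes T: "T > 0"
  shows "\<exists>\<kappa>>0. \<exists>K\<ge>0. \<forall>w. fst w \<in> {T..2*T} \<longrightarrow> (1 + N w) * cmod (W w) \<le> K * exp (- \<kappa> * N w)"
proof -
  \<comment> \<open>On [T, 2T] the width factor 1 + 4 a^2 t^2 is at most 1 + 16 a^2 T^2, so
    \<open>W\<close> decays at rate \<open>2 * \<kappa>\<close> in \<open>N\<close>; one half of the
    rate pays for the factor \<open>1 + N\<close>.\<close>
  define \<kappa> where "\<kappa> = a / (4 * (1 + 16 * a\<^sup>2 * T\<^sup>2))"
  have pos: "1 + 16 * a\<^sup>2 * T\<^sup>2 > 0" by (intro add_pos_nonneg) auto
  have \<kappa>: "\<kappa> > 0" using a pos by (simp add: \<kappa>_def)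
  have "(1 + N w) * cmod (W w) \<le> (1 + 1 / \<kappa>) * exp (- \<kappa> * N w)" if w: "fst w \<in> {T..2*T}" for w
  proof -
    have t2: "(fst w)\<^sup>2 \<le> (2 * T)\<^sup>2" using w T by (intro power_mono) auto
    have "a\<^sup>2 * (fst w)\<^sup>2 \<le> a\<^sup>2 * (2 * T)\<^sup>2" using t2 by (intro mult_left_mono) auto
    then have le: "1 + 4 * a\<^sup>2 * (fst w)\<^sup>2 \<le> 1 + 16 * a\<^sup>2 * T\<^sup>2" by (simp add: power_mult_distrib mult_ac)
    have k2: "2 * \<kappa> \<le> a / (2 * (1 + 4 * a\<^sup>2 * (fst w)\<^sup>2))"
    proof -
      have "2 * (a / (4 * X)) = a / (2 * X)" for X by simp
      then have "2 * \<kappa> = a / (2 * (1 + 16 * a\<^sup>2 * T\<^sup>2))" unfolding \<kappa>_def .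
      also have "\<dots> \<le> a / (2 * (1 + 4 * a\<^sup>2 * (fst w)\<^sup>2))"
        using le sg_pos[of a "fst w"] pos a by (intro divide_left_mono mult_left_mono mult_pos_pos) auto
      finally show ?thesis .
    qed
    have "inverse (sqrt (cmod (sg a (fst w)))) ^ CARD('d) \<le> 1"
    proof -
      have "1 \<le> cmod (sg a (fst w))" using abs_Re_le_cmod[of "sg a (fst w)"] by simp
      then have "1 \<le> sqrt (cmod (sg a (fst w)))" by simp
      then show ?thesis by (intro power_le_one) (auto simp: inverse_le_1_iff)
    qed
    then have "cmod (W w) \<le> 1 * exp (- (a / (2 * (1 + 4 * a\<^sup>2 * (fst w)\<^sup>2))) * N w)"
      unfolding cmod_W norm_gy N_def DIM_cart by (intro mult_right_mono) auto
    also have "\<dots> \<le> exp (- (2 * \<kappa>) * N w)"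
      using mult_right_mono[OF k2 N_nonneg[of w]] by simp
    finally have 1: "cmod (W w) \<le> exp (- \<kappa> * N w) * exp (- \<kappa> * N w)" by (simp add: exp_add[symmetric] mult.assoc)
    have "\<kappa> * N w \<le> exp (\<kappa> * N w)" using exp_ge_add_one_self[of "\<kappa> * N w"] by linarith
    then have "N w \<le> 1 / \<kappa> * exp (\<kappa> * N w)" using \<kappa> by (simp add: field_simps)
    moreover have "1 \<le> exp (\<kappa> * N w)" using \<kappa> N_nonneg[of w] by simp
    ultimately have "1 + N w \<le> (1 + 1 / \<kappa>) * exp (\<kappa> * N w)" unfolding distrib_right by linarith
    then have "(1 + N w) * cmod (W w) \<le> ((1 + 1 / \<kappa>) * exp (\<kappa> * N w)) * (exp (- \<kappa> * N w) * exp (- \<kappa> * N w))"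
      using 1 N_nonneg[of w] \<kappa> by (intro mult_mono) auto
    also have "\<dots> = (1 + 1 / \<kappa>) * exp (- \<kappa> * N w)" by (simp add: exp_minus)
    finally show ?thesis .
  qed
  then show ?thesis using \<kappa> by (intro exI[of _ \<kappa>] conjI exI[of _ "1 + 1 / \<kappa>"]) auto
qed

end

section \<open>Space-time integrals and the nonlinearity\<close>

definition mS :: "(real \<times> ('a::euclidean_space \<times> real)) measure" where
  "mS = lborel \<Otimes>\<^sub>M mX"

lemma sets_mS [measurable_cong, simp]: "sets (mS :: (real \<times> ('a::euclidean_space \<times> real)) measure) = sets borel"
proof -
  have "sets (lborel \<Otimes>\<^sub>M mX) = sets (borel \<Otimes>\<^sub>M borel :: (real \<times> ('a \<times> real)) measure)"
    by (intro sets_pair_measure_cong) simp_all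
  then show ?thesis unfolding mS_def borel_prod .
qed

lemma space_mS [simp]: "space (mS :: (real \<times> ('a::euclidean_space \<times> real)) measure) = UNIV"
  by (simp add: mS_def space_pair_measure)

interpretation lX: pair_sigma_finite "lborel :: real measure" "mX :: ('a::euclidean_space \<times> real) measure"
  by (simp add: pair_sigma_finite_def sigma_finite_lborel sigma_finite_mX)

lemma mS_density: "(mS :: (real \<times> ('a::euclidean_space \<times> real)) measure) = density lborel (indicator (UNIV \<times> (UNIV \<times> {0..<2*pi})))"
proof -
  have [measurable]: "(UNIV \<times> {0..<2*pi} :: ('a \<times> real) set) \<in> sets borel"
    unfolding borel_prod[symmetric] by (intro pair_measureI) auto
  have "(mS :: (real \<times> ('a \<times> real)) measure) = density lborel (\<lambda>_. 1) \<Otimes>\<^sub>M density lborel (indicator (UNIV \<times> {0..<2*pi}))"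
    by (simp add: mS_def mX_density[symmetric] density_1)
  also have "\<dots> = density (lborel \<Otimes>\<^sub>M lborel) (\<lambda>(x, y). 1 * indicator (UNIV \<times> {0..<2*pi}) y)"
    by (rule pair_measure_density) (auto simp: sigma_finite_lborel mX_density[symmetric] sigma_finite_mX)
  also have "(\<lambda>(x, y). 1 * indicator (UNIV \<times> {0..<2*pi}) y) = (indicator (UNIV \<times> (UNIV \<times> {0..<2*pi})) :: real \<times> ('a \<times> real) \<Rightarrow> ennreal)"
    by (auto simp: indicator_def fun_eq_iff)
  finally show ?thesis by (simp add: lborel_prod)
qed

lemma integral_mS:
  fixes f :: "real \<times> ((real^'d::finite) \<times> real) \<Rightarrow> complex"
  assumes f[measurable]: "f \<in> borel_measurable borel" and z: "\<And>w. fst w \<le> 0 \<Longrightarrow> f w = 0"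
  shows "(LINT w:({0<..} \<times> fund_dom)|lborel. f w) = (\<integral>w. f w \<partial>mS)"
proof -
  have [measurable]: "(UNIV \<times> (UNIV \<times> {0..<2*pi}) :: (real \<times> ((real^'d) \<times> real)) set) \<in> sets borel"
    unfolding borel_prod[symmetric] by (intro pair_measureI) auto
  have eq: "(mS :: (real \<times> ((real^'d) \<times> real)) measure) = density lborel (\<lambda>w. ennreal (indicator (UNIV \<times> (UNIV \<times> {0..<2*pi})) w))"
    by (simp add: mS_density ennreal_indicator)
  have "(\<integral>w. f w \<partial>mS) = (\<integral>w. indicator (UNIV \<times> (UNIV \<times> {0..<2*pi})) w *\<^sub>R f w \<partial>lborel)"
    unfolding eq by (subst integral_density) auto
  also have "\<dots> = (LINT w:({0<..} \<times> fund_dom)|lborel. f w)"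
    unfolding set_lebesgue_integral_def
  proof (rule Bochner_Integration.integral_cong[OF refl])
    fix w :: "real \<times> ((real^'d) \<times> real)"
    show "indicator (UNIV \<times> (UNIV \<times> {0..<2*pi})) w *\<^sub>R f w = indicator ({0<..} \<times> fund_dom) w *\<^sub>R f w"
      using z[of w] by (cases w) (auto simp: indicator_def fund_dom_def)
  qed
  finally show ?thesis ..
qed

definition fnl :: "real \<Rightarrow> complex \<Rightarrow> complex" where
  "fnl q z = of_real (cmod z powr q) * z"

text \<open>With q = p - 1 this is where p <= 2 first enters: the nonlinearity of an L2 function is
  integrable against every function that is bounded and integrable.\<close>

lemma fnl_bound:
  assumes "0 \<le> q" "q \<le> 1" shows "cmod (fnl q z) \<le> 1 + (cmod z)\<^sup>2"
proof -
  have "cmod (fnl q z) = cmod z powr q * cmod z" by (simp add: fnl_def norm_mult)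
  also have "\<dots> \<le> 1 + (cmod z)\<^sup>2"
  proof (cases "cmod z \<le> 1")
    case True
    have "cmod z powr q \<le> 1" using True assms by (simp add: powr_le1)
    then have "cmod z powr q * cmod z \<le> 1 * 1" using True by (intro mult_mono) auto
    then show ?thesis by (simp add: add_increasing2)
  next
    case False
    then have "cmod z powr q \<le> cmod z powr 1" using assms by (intro powr_mono) auto
    then have "cmod z powr q * cmod z \<le> cmod z * cmod z" using False by (intro mult_right_mono) auto
    then show ?thesis by (simp add: power2_eq_square)
  qed
  finally show ?thesis .
qed

lemma fnl_measurable [measurable]: "fnl q \<in> borel_measurable borel"
  unfolding fnl_def[abs_def] by measurable

context wave
begin

lemma W_measurable [measurable]: "W \<in> borel_measurable borel"
  by (rule borel_measurable_continuous_onI[OF smc_continuous[OF smc_W]])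

lemma C_measurable [measurable]: "C e \<in> borel_measurable borel"
  by (rule borel_measurable_continuous_onI[OF smc_continuous[OF smc_C]])

lemma R_measurable [measurable]: "R e \<in> borel_measurable borel"
proof -
  have "smc (R e)" unfolding R_def[abs_def]
    by (intro smc_sum smc_add smc_cmult smc_mult smc_dpart smc_C smc_W)
  then show ?thesis by (intro borel_measurable_continuous_onI smc_continuous)
qed

lemma N_measurable [measurable]: "N \<in> borel_measurable borel"
  unfolding N_def[abs_def] borel_prod[symmetric] by measurable

lemma th_measurable [measurable]: "th T \<in> borel_measurable borel" "th' T \<in> borel_measurable borel"
proof -
  have [measurable]: "bump n \<in> borel_measurable borel" for n by (rule borel_measurable_continuous_onI[OF continuous_bmp])
  show "th T \<in> borel_measurable borel" "th' T \<in> borel_measurable borel"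
    unfolding th_def[abs_def] th'_def[abs_def] by measurable
qed

end

lemma th_bounded: "T > 0 \<Longrightarrow> \<exists>B\<ge>0. \<forall>t. \<bar>th T t\<bar> \<le> B \<and> \<bar>th' T t\<bar> \<le> B"
proof -
  assume T: "T > 0"
  obtain B0 where B0: "B0 \<ge> 0" "\<And>s. s \<le> 1 \<Longrightarrow> \<bar>bump 0 s\<bar> \<le> B0" using bump_bounded[of 0] by blast
  obtain B2 where B2: "B2 \<ge> 0" "\<And>s. s \<le> 1 \<Longrightarrow> \<bar>bump 2 s\<bar> \<le> B2" using bump_bounded[of 2] by blast
  have "\<bar>th T t\<bar> \<le> B0 * B0 + (2 * B2 * B0) / T \<and> \<bar>th' T t\<bar> \<le> B0 * B0 + (2 * B2 * B0) / T" for t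
  proof (cases "t \<in> {T..2*T}")
    case True
    then have s: "t / T - 1 \<le> 1" "2 - t / T \<le> 1" using T by (auto simp: field_simps)
    have 1: "\<bar>th T t\<bar> \<le> B0 * B0" unfolding th_def abs_mult using B0 s by (intro mult_mono) auto
    have "\<bar>bump 2 (t / T - 1) * bump 0 (2 - t / T)\<bar> \<le> B2 * B0" "\<bar>bump 0 (t / T - 1) * bump 2 (2 - t / T)\<bar> \<le> B0 * B2"
      unfolding abs_mult using B0 B2 s by (auto intro!: mult_mono)
    then have "\<bar>bump 2 (t / T - 1) * bump 0 (2 - t / T) - bump 0 (t / T - 1) * bump 2 (2 - t / T)\<bar> \<le> 2 * B2 * B0"
      by (intro order_trans[OF abs_triangle_ineq4]) (simp add: mult.commute)
    then have 2: "\<bar>th' T t\<bar> \<le> (2 * B2 * B0) / T" unfolding th'_def using T by (simp add: abs_divide divide_right_mono)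
    have "0 \<le> (2 * B2 * B0) / T" "0 \<le> B0 * B0" using B0(1) B2(1) T by auto
    with 1 2 show ?thesis by linarith
  next
    case False
    then show ?thesis using th_zero[OF T False] B0(1) B2(1) T by auto
  qed
  then show ?thesis using B0(1) B2(1) T by (intro exI[of _ "B0 * B0 + (2 * B2 * B0) / T"]) auto
qed

text \<open>A coherent state has no compact support in \<open>y\<close>, so the equation is tested
  with its truncation \<open>phi T e\<close>. As \<open>e\<close> tends to 0 the commutator
  disappears at rate \<open>e\<close>, and the remaining terms converge under one common
  majorant.\<close>

lemma (in wave) weak_equation:
  fixes u :: "real \<Rightarrow> (real^'d) \<times> real \<Rightarrow> complex"
  assumes sol: "global_solution (q + 1) u" and q: "0 < q" "q \<le> 1" and T: "T > 0"
    and M: "\<And>t. t \<in> {T..2*T} \<Longrightarrow> nrm mX (u t) \<le> M"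
  shows "integrable mS (\<lambda>w. of_real (th' T (fst w)) * (u (fst w) (snd w) * W w))"
    and "integrable mS (\<lambda>w. of_real (th T (fst w)) * (fnl q (u (fst w) (snd w)) * W w))"
    and "- \<i> * (\<integral>w. of_real (th' T (fst w)) * (u (fst w) (snd w) * W w) \<partial>mS)
      = (\<integral>w. of_real (th T (fst w)) * (fnl q (u (fst w) (snd w)) * W w) \<partial>mS)"
proof -
  define U where "U w = u (fst w) (snd w)" for w
  have Um[measurable]: "U \<in> borel_measurable borel" using sol unfolding global_solution_def U_def[abs_def] by simp
  have ul2: "u t \<in> l2 mX" if "t \<ge> 0" for t using sol that unfolding global_solution_def L2_eq_l2 by blast
  obtain \<kappa> K where \<kappa>: "\<kappa> > 0" "K \<ge> 0" and WK: "\<And>w. fst w \<in> {T..2*T} \<Longrightarrow> (1 + N w) * cmod (W w) \<le> K * exp (- \<kappa> * N w)"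
    using W_bound[OF T] by blast
  obtain K' where K': "K' \<ge> 0" and RK: "\<And>e w. 0 \<le> e \<Longrightarrow> e \<le> 1 \<Longrightarrow> cmod (R e w) \<le> e * K' * ((1 + N w) * cmod (W w))"
    using R_bound by blast
  obtain B where B: "B \<ge> 0" "\<And>t. \<bar>th T t\<bar> \<le> B" "\<And>t. \<bar>th' T t\<bar> \<le> B" using th_bounded[OF T] by blast
  define I where "I w = (indicator {T..2*T} (fst w) :: real)" for w :: "real \<times> ((real^'d) \<times> real)"
  have Im[measurable]: "I \<in> borel_measurable borel" unfolding I_def[abs_def] borel_prod[symmetric] by measurable
  \<comment> \<open>A common majorant for all integrands: on the slab over [T, 2T], |u|^2 plus a
    Gaussian. It is integrable because the L2 norms of \<open>u t\<close> stay below
    \<open>M\<close> there.\<close>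
  define D where "D w = I w * ((cmod (U w))\<^sup>2 + exp (- \<kappa> * N w))" for w
  have Di: "integrable mS D"
  proof -
    have ii: "integrable lborel (\<lambda>t. indicator {T..2*T} t :: real)" by (intro integrable_real_indicator) (auto simp: emeasure_lborel_Icc_eq)
    have "integrable mS (\<lambda>w. I w * (cmod (U w))\<^sup>2)"
      unfolding mS_def
    proof (rule lX.Fubini_integrable)
      show m: "(\<lambda>w. I w * (cmod (U w))\<^sup>2) \<in> borel_measurable (lborel \<Otimes>\<^sub>M mX)"
        unfolding mS_def[symmetric] by measurable
      have sq: "(\<integral>z. norm (I (t, z) * (cmod (U (t, z)))\<^sup>2) \<partial>mX) = indicator {T..2*T} t * (nrm mX (u t))\<^sup>2" for t
        by (simp add: I_def U_def nrm_sq indicator_def)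
      show "integrable lborel (\<lambda>t. \<integral>z. norm (I (t, z) * (cmod (U (t, z)))\<^sup>2) \<partial>mX)"
      proof (rule Bochner_Integration.integrable_bound[OF integrable_mult_left[OF ii, of "M\<^sup>2"]])
        have "(\<lambda>(t, z). norm (I (t, z) * (cmod (U (t, z)))\<^sup>2)) \<in> borel_measurable (lborel \<Otimes>\<^sub>M mX)"
          using measurable_compose[OF m borel_measurable_norm] by (simp add: split_beta)
        then show "(\<lambda>t. \<integral>z. norm (I (t, z) * (cmod (U (t, z)))\<^sup>2) \<partial>mX) \<in> borel_measurable lborel"
          by (rule sigma_finite_measure.borel_measurable_lebesgue_integral[OF sigma_finite_mX])
        show "AE t in lborel. norm (\<integral>z. norm (I (t, z) * (cmod (U (t, z)))\<^sup>2) \<partial>mX) \<le> norm (indicator {T..2*T} t * M\<^sup>2)"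
          unfolding sq using M by (intro AE_I2) (auto simp: indicator_def intro!: power_mono)
      qed
      show "AE t in lborel. integrable mX (\<lambda>z. I (t, z) * (cmod (U (t, z)))\<^sup>2)"
        using T by (intro AE_I2) (auto simp: I_def U_def indicator_def intro!: l2_int ul2)
    qed
    moreover have "integrable mS (\<lambda>w. I w * exp (- \<kappa> * N w))"
    proof -
      have "integrable (lborel \<Otimes>\<^sub>M mT) (\<lambda>z. exp (- \<kappa> * (norm (fst z - b))\<^sup>2) * 1)"
        by (rule integrable_prod_mult(1)[OF sigma_finite_lborel sigma_finite_mT gaussian_shift_integrable[OF \<kappa>(1)]]) simp
      then have "integrable mX (\<lambda>z. exp (- \<kappa> * (norm (fst z - b))\<^sup>2))" by (simp add: mX_def)
      from integrable_prod_mult(1)[OF sigma_finite_lborel sigma_finite_mX ii this]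
      show ?thesis by (simp add: mS_def I_def N_def)
    qed
    ultimately show ?thesis unfolding D_def distrib_left by (rule Bochner_Integration.integrable_add)
  qed
  have D0: "0 \<le> D w" for w by (simp add: D_def I_def)
  \<comment> \<open>A product of |u| with a Gaussian factor below 1 is at most |u|^2 plus that
    factor, according to whether |u| exceeds 1.\<close>
  have WD1: "I w * (cmod (U w) * ((1 + N w) * cmod (W w))) \<le> K * D w" for w
  proof (cases "fst w \<in> {T..2*T}")
    case True
    have E: "exp (- \<kappa> * N w) \<le> 1" using \<kappa> N_nonneg[of w] by simp
    have x1: "cmod (U w) * exp (- \<kappa> * N w) \<le> (cmod (U w))\<^sup>2 + exp (- \<kappa> * N w)"
    proof (cases "cmod (U w) \<le> 1")
      case True
      then have "cmod (U w) * exp (- \<kappa> * N w) \<le> 1 * exp (- \<kappa> * N w)" by (intro mult_right_mono) auto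
      then show ?thesis by (simp add: add_increasing)
    next
      case False
      then have "cmod (U w) * exp (- \<kappa> * N w) \<le> cmod (U w) * cmod (U w)"
        using order_trans[OF E, of "cmod (U w)"] by (intro mult_left_mono) linarith+
      then show ?thesis by (simp add: power2_eq_square add_increasing2)
    qed
    have "cmod (U w) * ((1 + N w) * cmod (W w)) \<le> cmod (U w) * (K * exp (- \<kappa> * N w))"
      by (rule mult_left_mono[OF WK[OF True]]) simp
    also have "\<dots> = K * (cmod (U w) * exp (- \<kappa> * N w))" by (rule mult.left_commute)
    also have "\<dots> \<le> K * ((cmod (U w))\<^sup>2 + exp (- \<kappa> * N w))" by (rule mult_left_mono[OF x1 \<kappa>(2)])
    finally have "cmod (U w) * ((1 + N w) * cmod (W w)) \<le> K * ((cmod (U w))\<^sup>2 + exp (- \<kappa> * N w))" .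
    then show ?thesis using True by (simp add: I_def D_def)
  qed (use D0[of w] \<kappa> in \<open>simp add: I_def\<close>)
  have W1: "cmod (W w) \<le> (1 + N w) * cmod (W w)" for w
    using mult_right_mono[of 1 "1 + N w" "cmod (W w)"] N_nonneg[of w] by simp
  have WD2: "I w * (cmod (fnl q (U w)) * cmod (W w)) \<le> K * D w" for w
  proof (cases "fst w \<in> {T..2*T}")
    case True
    have E: "exp (- \<kappa> * N w) \<le> 1" using \<kappa> N_nonneg[of w] by simp
    have "cmod (fnl q (U w)) * cmod (W w) \<le> (1 + (cmod (U w))\<^sup>2) * (K * exp (- \<kappa> * N w))"
      using order_trans[OF W1 WK[OF True]] q by (intro mult_mono fnl_bound) auto
    also have "\<dots> = K * (exp (- \<kappa> * N w) + (cmod (U w))\<^sup>2 * exp (- \<kappa> * N w))" by (simp add: algebra_simps)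
    also have "\<dots> \<le> K * ((cmod (U w))\<^sup>2 + exp (- \<kappa> * N w))"
      using E \<kappa> by (intro mult_left_mono) (auto simp: mult_left_le)
    finally show ?thesis using True by (simp add: I_def D_def)
  qed (use D0[of w] \<kappa> in \<open>simp add: I_def\<close>)
  have thI: "th T (fst w) = th T (fst w) * I w" "th' T (fst w) = th' T (fst w) * I w" for w
    using th_zero[OF T, of "fst w"] by (auto simp: I_def indicator_def)
  have b1: "cmod (of_real (th' T (fst w)) * (U w * W w)) \<le> B * (K * D w)" for w
  proof -
    have "cmod (of_real (th' T (fst w)) * (U w * W w)) = \<bar>th' T (fst w)\<bar> * (I w * (cmod (U w) * cmod (W w)))"
      by (subst thI(2)) (simp add: norm_mult abs_mult I_def mult.assoc)
    also have "\<dots> \<le> B * (K * D w)"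
    proof (rule mult_mono[OF B(3)])
      have "I w * (cmod (U w) * cmod (W w)) \<le> I w * (cmod (U w) * ((1 + N w) * cmod (W w)))"
        using W1 by (intro mult_left_mono) (auto simp: I_def)
      then show "I w * (cmod (U w) * cmod (W w)) \<le> K * D w" using WD1[of w] by linarith
    qed (use B in \<open>auto simp: I_def\<close>)
    finally show ?thesis .
  qed
  have b2: "cmod (of_real (th T (fst w)) * (fnl q (U w) * W w)) \<le> B * (K * D w)" for w
  proof -
    have "cmod (of_real (th T (fst w)) * (fnl q (U w) * W w)) = \<bar>th T (fst w)\<bar> * (I w * (cmod (fnl q (U w)) * cmod (W w)))"
      by (subst thI(1)) (simp add: norm_mult abs_mult I_def mult.assoc)
    also have "\<dots> \<le> B * (K * D w)" by (rule mult_mono[OF B(2) WD2]) (use B in \<open>auto simp: I_def\<close>)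
    finally show ?thesis .
  qed
  have b3: "cmod (of_real (th T (fst w)) * (U w * R e w)) \<le> e * (B * (K' * (K * D w)))" if "0 \<le> e" "e \<le> 1" for e w
  proof -
    have "cmod (of_real (th T (fst w)) * (U w * R e w)) = \<bar>th T (fst w)\<bar> * (I w * (cmod (U w) * cmod (R e w)))"
      by (subst thI(1)) (simp add: norm_mult abs_mult I_def mult.assoc)
    also have "\<dots> \<le> B * (e * (K' * (K * D w)))"
    proof (rule mult_mono[OF B(2)])
      have "I w * (cmod (U w) * cmod (R e w)) \<le> I w * (cmod (U w) * (e * K' * ((1 + N w) * cmod (W w))))"
        using RK[OF that] by (intro mult_left_mono) (auto simp: I_def)
      also have "\<dots> = (e * K') * (I w * (cmod (U w) * ((1 + N w) * cmod (W w))))" by (simp only: mult_ac)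
      also have "\<dots> \<le> (e * K') * (K * D w)" using WD1[of w] that K' by (intro mult_left_mono) auto
      finally show "I w * (cmod (U w) * cmod (R e w)) \<le> e * (K' * (K * D w))" by (simp add: mult.assoc)
    qed (use B in \<open>auto simp: I_def\<close>)
    finally show ?thesis by (simp add: mult.left_commute)
  qed
  have BD: "integrable mS (\<lambda>w. B * (K * D w))" using Di by (intro integrable_mult_right)
  have BD3: "integrable mS (\<lambda>w. B * (K' * (K * D w)))" using Di by (intro integrable_mult_right)
  have thm1[measurable]: "(\<lambda>w. th T (fst w)) \<in> borel_measurable (borel :: (real \<times> ((real^'d) \<times> real)) measure)"
    "(\<lambda>w. th' T (fst w)) \<in> borel_measurable (borel :: (real \<times> ((real^'d) \<times> real)) measure)"
    unfolding borel_prod[symmetric] by measurable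
  have i1: "integrable mS (\<lambda>w. of_real (th' T (fst w)) * (U w * W w))"
    by (rule Bochner_Integration.integrable_bound[OF BD])
       (use b1 in \<open>auto intro!: AE_I2 order_trans[OF _ abs_ge_self] simp del: of_real_mult cong: measurable_cong_sets\<close>)
  have i2: "integrable mS (\<lambda>w. of_real (th T (fst w)) * (fnl q (U w) * W w))"
    by (rule Bochner_Integration.integrable_bound[OF BD])
       (use b2 in \<open>auto intro!: AE_I2 order_trans[OF _ abs_ge_self] simp del: of_real_mult cong: measurable_cong_sets\<close>)
  from i1 show "integrable mS (\<lambda>w. of_real (th' T (fst w)) * (u (fst w) (snd w) * W w))" by (simp add: U_def)
  from i2 show "integrable mS (\<lambda>w. of_real (th T (fst w)) * (fnl q (u (fst w) (snd w)) * W w))" by (simp add: U_def)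
  define e where "e n = 1 / real (Suc n)" for n
  have e0: "e \<longlonglongrightarrow> 0" unfolding e_def by real_asymp
  have e: "0 < e n" "0 \<le> e n" "e n \<le> 1" for n by (auto simp: e_def)
  have Cle: "cmod (C (e n) w) \<le> 1" for n w using cutoff_le by (simp add: C_def)
  have Clim: "(\<lambda>n. C (e n) w) \<longlonglongrightarrow> of_real (exp (- 1))" for w
    unfolding C_def by (intro tendsto_of_real cutoff_tendsto e0)
  define F where "F n w = - \<i> * (C (e n) w * (of_real (th' T (fst w)) * (U w * W w))) + of_real (th T (fst w)) * (U w * R (e n) w)" for n w
  define G where "G n w = C (e n) w * (of_real (th T (fst w)) * (fnl q (U w) * W w))" for n w
  have eqn: "(\<integral>w. F n w \<partial>mS) = (\<integral>w. G n w \<partial>mS)" for n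
  proof -
    have "(LINT w:({0<..} \<times> fund_dom)|lborel. F n w) = (LINT w:({0<..} \<times> fund_dom)|lborel.
           u (fst w) (snd w) * (- \<i> * dpart (1, 0) (phi T (e n)) w + (\<Sum>b\<in>Basis. dpart (0, b) (dpart (0, b) (phi T (e n))) w)))"
      unfolding phi_operator[OF T] F_def U_def by (simp add: algebra_simps)
    also have "\<dots> = (LINT w:({0<..} \<times> fund_dom)|lborel. complex_of_real (cmod (u (fst w) (snd w)) powr (q + 1 - 1)) * u (fst w) (snd w) * phi T (e n) w)"
      using sol st_test_fun_phi[OF T e(1)[of n]] unfolding global_solution_def by blast
    also have "\<dots> = (LINT w:({0<..} \<times> fund_dom)|lborel. G n w)"
      unfolding G_def phi_def fnl_def U_def by (simp add: algebra_simps)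
    finally have l: "(LINT w:({0<..} \<times> fund_dom)|lborel. F n w) = (LINT w:({0<..} \<times> fund_dom)|lborel. G n w)" .
    have z: "th T (fst w) = 0" "th' T (fst w) = 0" if "fst w \<le> 0" for w :: "real \<times> ((real^'d) \<times> real)"
      using th_zero[OF T, of "fst w"] that T by auto
    have "(LINT w:({0<..} \<times> fund_dom)|lborel. F n w) = (\<integral>w. F n w \<partial>mS)"
      by (rule integral_mS) (unfold F_def, measurable, simp add: z)
    moreover have "(LINT w:({0<..} \<times> fund_dom)|lborel. G n w) = (\<integral>w. G n w \<partial>mS)"
      by (rule integral_mS) (unfold G_def, measurable, simp add: z)
    ultimately show ?thesis using l by simp
  qed
  have "(\<lambda>n. \<integral>w. F n w \<partial>mS) \<longlonglongrightarrow> (\<integral>w. - \<i> * (of_real (exp (- 1)) * (of_real (th' T (fst w)) * (U w * W w))) + 0 \<partial>mS)"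
  proof (rule integral_dominated_convergence[where w = "\<lambda>w. B * (K * D w) + B * (K' * (K * D w))"])
    show "integrable mS (\<lambda>w. B * (K * D w) + B * (K' * (K * D w)))" using BD BD3 by (rule Bochner_Integration.integrable_add)
    show "AE w in mS. (\<lambda>n. F n w) \<longlonglongrightarrow> - \<i> * (of_real (exp (- 1)) * (of_real (th' T (fst w)) * (U w * W w))) + 0"
      unfolding F_def
    proof (intro AE_I2 tendsto_add tendsto_mult tendsto_const Clim)
      fix w
      have "(\<lambda>n. e n * (B * (K' * (K * D w)))) \<longlonglongrightarrow> 0" using tendsto_mult[OF e0 tendsto_const] by simp
      then show "(\<lambda>n. of_real (th T (fst w)) * (U w * R (e n) w)) \<longlonglongrightarrow> 0"
        by (rule Lim_null_comparison[rotated]) (simp add: b3 e)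
    qed
    show "AE w in mS. norm (F n w) \<le> B * (K * D w) + B * (K' * (K * D w))" for n
    proof (rule AE_I2)
      fix w
      have 1: "cmod (- \<i> * (C (e n) w * (of_real (th' T (fst w)) * (U w * W w)))) \<le> B * (K * D w)"
        unfolding norm_mult[of "- \<i>"] norm_mult[of "C (e n) w"]
        using mult_mono[OF Cle[of n w] b1[of w]] by simp
      have "0 \<le> B * (K' * (K * D w))" using B K' \<kappa> D0[of w] by auto
      then have "e n * (B * (K' * (K * D w))) \<le> 1 * (B * (K' * (K * D w)))" using e(3)[of n] by (intro mult_right_mono) auto
      then have 2: "cmod (of_real (th T (fst w)) * (U w * R (e n) w)) \<le> B * (K' * (K * D w))"
        using b3[OF e(2,3), of w n] by linarith
      show "norm (F n w) \<le> B * (K * D w) + B * (K' * (K * D w))" unfolding F_def by (rule norm_triangle_le[OF add_mono[OF 1 2]])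
    qed
  qed (unfold F_def, measurable)
  then have FL: "(\<lambda>n. \<integral>w. F n w \<partial>mS) \<longlonglongrightarrow> of_real (exp (- 1)) * (- \<i> * (\<integral>w. of_real (th' T (fst w)) * (U w * W w) \<partial>mS))"
    by (simp only: add_0_right integral_mult_right_zero mult.left_commute[of "- \<i>" "of_real (exp (- 1))"])
  have "(\<lambda>n. \<integral>w. G n w \<partial>mS) \<longlonglongrightarrow> (\<integral>w. of_real (exp (- 1)) * (of_real (th T (fst w)) * (fnl q (U w) * W w)) \<partial>mS)"
  proof (rule integral_dominated_convergence[OF _ _ BD])
    show "AE w in mS. (\<lambda>n. G n w) \<longlonglongrightarrow> of_real (exp (- 1)) * (of_real (th T (fst w)) * (fnl q (U w) * W w))"
      unfolding G_def by (intro AE_I2 tendsto_mult tendsto_const Clim)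
    show "AE w in mS. norm (G n w) \<le> B * (K * D w)" for n
      unfolding G_def norm_mult[of "C (e n) _"] using mult_mono[OF Cle b2] by (intro AE_I2) simp
  qed (unfold G_def, measurable)
  then have GL: "(\<lambda>n. \<integral>w. G n w \<partial>mS) \<longlonglongrightarrow> of_real (exp (- 1)) * (\<integral>w. of_real (th T (fst w)) * (fnl q (U w) * W w) \<partial>mS)"
    by simp
  \<comment> \<open>Both limits carry the limiting value \<open>exp (- 1)\<close> of the cutoff,
    which is nonzero and cancels.\<close>
  have "of_real (exp (- 1)) * (- \<i> * (\<integral>w. of_real (th' T (fst w)) * (U w * W w) \<partial>mS)) = of_real (exp (- 1)) * (\<integral>w. of_real (th T (fst w)) * (fnl q (U w) * W w) \<partial>mS)"
    using LIMSEQ_unique[OF FL[unfolded eqn] GL] .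
  then show "- \<i> * (\<integral>w. of_real (th' T (fst w)) * (u (fst w) (snd w) * W w) \<partial>mS)
      = (\<integral>w. of_real (th T (fst w)) * (fnl q (u (fst w) (snd w)) * W w) \<partial>mS)"
    unfolding U_def mult_cancel_left by simp
qed

section \<open>The nonlinearity and the two-dimensional torus\<close>

text \<open>For q <= 1 the function r^(q - 1) is nonincreasing, so
  \<open>r powr q * s <= s powr q * r\<close>; the increment of the power is thereby traded for the
  increment of \<open>r\<close>.\<close>

lemma powr_diff_le:
  fixes r s q :: real
  assumes "0 \<le> s" "s \<le> r" "0 < q" "q \<le> 1"
  shows "(r powr q - s powr q) * s \<le> (r - s) * r powr q"
proof (cases "s = 0")
  case True
  then show ?thesis using assms by simp
next
  case False
  then have s: "0 < s" "0 < r" using assms by auto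
  have "r powr (q - 1) \<le> s powr (q - 1)" using assms s by (intro powr_mono2') auto
  then have "r powr q / r \<le> s powr q / s" using s by (simp add: powr_diff)
  then have 1: "r powr q * s \<le> s powr q * r" using s by (simp add: field_simps)
  have 2: "s powr q \<le> r powr q" using assms by (intro powr_mono2) auto
  have "(r powr q - s powr q) * s \<le> (r - s) * s powr q" using 1 by (simp add: algebra_simps)
  also have "\<dots> \<le> (r - s) * r powr q" using 2 assms by (intro mult_left_mono) auto
  finally show ?thesis .
qed

text \<open>Writing the difference as |z|^q (z - w) + (|z|^q - |w|^q) w puts the difference of
  powers next to the smaller number, where \<open>powr_diff_le\<close> applies.\<close>

lemma fnl_diff_aux:
  assumes q: "0 < q" "q \<le> 1" and le: "cmod w \<le> cmod z"
  shows "cmod (fnl q z - fnl q w) \<le> 2 * cmod (z - w) * (cmod z powr q)"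
proof -
  have "fnl q z - fnl q w = of_real (cmod z powr q) * (z - w) + of_real (cmod z powr q - cmod w powr q) * w"
    by (simp add: fnl_def algebra_simps)
  then have "cmod (fnl q z - fnl q w) \<le> cmod z powr q * cmod (z - w) + \<bar>cmod z powr q - cmod w powr q\<bar> * cmod w"
    by (metis norm_triangle_ineq norm_mult norm_of_real abs_of_nonneg powr_ge_zero)
  also have "\<bar>cmod z powr q - cmod w powr q\<bar> = cmod z powr q - cmod w powr q"
    using le q by (intro abs_of_nonneg) (simp add: powr_mono2)
  also have "(cmod z powr q - cmod w powr q) * cmod w \<le> (cmod z - cmod w) * cmod z powr q"
    by (rule powr_diff_le) (use le q in auto)
  also have "\<dots> \<le> cmod (z - w) * cmod z powr q"
    by (intro mult_right_mono norm_triangle_ineq2) auto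
  finally show ?thesis by (simp add: mult_ac)
qed

text \<open>The free scale \<open>A\<close> splits the power by (A r)^q <= 1 + A r. It is later
  taken to be the inverse of the sup norm of the test state, up to a constant, which converts decay
  of that state into the gain \<open>A powr q\<close>.\<close>

lemma fnl_diff:
  assumes q: "0 < q" "q \<le> 1" and A: "A > 0"
  shows "A powr q * cmod (fnl q z - fnl q w) \<le> 2 * cmod (z - w) * (1 + A * (cmod z + cmod w))"
proof -
  have main: "A powr q * cmod (fnl q z - fnl q w) \<le> 2 * cmod (z - w) * (1 + A * (cmod z + cmod w))"
    if "cmod w \<le> cmod z" for z w
  proof -
    have "A powr q * cmod (fnl q z - fnl q w) \<le> A powr q * (2 * cmod (z - w) * (cmod z powr q))"
      by (intro mult_left_mono fnl_diff_aux q that) simp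
    also have "\<dots> = 2 * cmod (z - w) * ((A * cmod z) powr q)" using A by (simp add: powr_mult mult_ac)
    also have "(A * cmod z) powr q \<le> 1 + A * cmod z"
    proof (cases "A * cmod z \<le> 1")
      case True
      then have "(A * cmod z) powr q \<le> 1" using A q by (intro powr_le1) auto
      moreover have "0 \<le> A * cmod z" using A by simp
      ultimately show ?thesis by linarith
    next
      case False
      then have "(A * cmod z) powr q \<le> (A * cmod z) powr 1" using q by (intro powr_mono) auto
      then show ?thesis using False by simp
    qed
    also have "\<dots> \<le> 1 + A * (cmod z + cmod w)" using A by (simp add: distrib_left)
    finally show ?thesis by (simp add: mult_left_mono)
  qed
  show ?thesis
  proof (cases "cmod w \<le> cmod z")
    case False
    then show ?thesis using main[of z w] by (simp add: norm_minus_commute add.commute)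
  qed (rule main)
qed

lemma fnl_mult_integrable:
  assumes "u \<in> l2 M" "v \<in> borel_measurable M" "integrable M v" "\<And>z. cmod (v z) \<le> B" "0 \<le> q" "q \<le> 1"
  shows "integrable M (\<lambda>z. fnl q (u z) * cnj (v z))"
proof (rule Bochner_Integration.integrable_bound)
  note [measurable] = l2_meas[OF assms(1)] assms(2)
  have "0 \<le> B" using assms(4)[of undefined] norm_ge_zero order_trans by blast
  show "integrable M (\<lambda>z. cmod (v z) + B * (cmod (u z))\<^sup>2)"
    using assms(3) l2_int[OF assms(1)] by simp
  show "AE z in M. norm (fnl q (u z) * cnj (v z)) \<le> norm (cmod (v z) + B * (cmod (u z))\<^sup>2)"
  proof (rule AE_I2)
    fix z
    have "cmod (fnl q (u z)) * cmod (v z) \<le> (1 + (cmod (u z))\<^sup>2) * cmod (v z)" by (intro mult_right_mono fnl_bound assms) auto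
    also have "\<dots> \<le> cmod (v z) + B * (cmod (u z))\<^sup>2" using mult_right_mono[OF assms(4)[of z], of "(cmod (u z))\<^sup>2"] by (simp add: algebra_simps)
    finally show "norm (fnl q (u z) * cnj (v z)) \<le> norm (cmod (v z) + B * (cmod (u z))\<^sup>2)" by (simp add: norm_mult)
  qed
  show "(\<lambda>z. fnl q (u z) * cnj (v z)) \<in> borel_measurable M" by measurable
qed

text \<open>The right-hand side contains L2 norms and the product of \<open>A\<close> with the sup
  norm of \<open>v\<close>, and nothing else about \<open>u\<close> and \<open>w\<close>. At A =
  t^(d/2) it gives the error t^(- d q / 2) along the flow; at A = 1 it gives continuity of the
  nonlinear pairing of profiles.\<close>

lemma fnl_ip_diff:
  assumes q: "0 < q" "q \<le> 1" and A: "A > 0" and u: "u \<in> l2 M" "w \<in> l2 M" and v: "v \<in> l2 M" "integrable M v"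
    and vb: "\<And>z. A * cmod (v z) \<le> B"
  shows "A powr q * cmod ((\<integral>z. fnl q (u z) * cnj (v z) \<partial>M) - (\<integral>z. fnl q (w z) * cnj (v z) \<partial>M))
    \<le> 2 * nrm M (\<lambda>z. u z - w z) * (nrm M v + B * (nrm M u + nrm M w))"
proof -
  note [measurable] = l2_meas[OF u(1)] l2_meas[OF u(2)] l2_meas[OF v(1)]
  have B0: "0 \<le> B" using vb[of undefined] A by (metis mult_nonneg_nonneg norm_ge_zero less_imp_le order_trans)
  have vb': "cmod (v z) \<le> B / A" for z using vb[of z] A by (simp add: field_simps)
  have i: "integrable M (\<lambda>z. fnl q (u z) * cnj (v z))" "integrable M (\<lambda>z. fnl q (w z) * cnj (v z))"
    by (rule fnl_mult_integrable[OF u(1) _ v(2) vb'], use q in auto)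
       (rule fnl_mult_integrable[OF u(2) _ v(2) vb'], use q in auto)
  note d = l2_diff[OF u]
  note I1 = l2_mult_integrable(1)[OF d v(1)] and I2 = l2_mult_integrable(1)[OF d u(1)] and I3 = l2_mult_integrable(1)[OF d u(2)]
  have "A powr q * cmod ((\<integral>z. fnl q (u z) * cnj (v z) \<partial>M) - (\<integral>z. fnl q (w z) * cnj (v z) \<partial>M))
     = A powr q * cmod (\<integral>z. fnl q (u z) * cnj (v z) - fnl q (w z) * cnj (v z) \<partial>M)"
    using i by simp
  also have "\<dots> \<le> A powr q * (\<integral>z. cmod (fnl q (u z) * cnj (v z) - fnl q (w z) * cnj (v z)) \<partial>M)"
    by (intro mult_left_mono integral_norm_bound) simp
  also have "\<dots> = (\<integral>z. A powr q * cmod (fnl q (u z) * cnj (v z) - fnl q (w z) * cnj (v z)) \<partial>M)" by simp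
  also have "\<dots> \<le> (\<integral>z. 2 * (cmod (u z - w z) * cmod (v z) + B * (cmod (u z - w z) * cmod (u z) + cmod (u z - w z) * cmod (w z))) \<partial>M)"
  proof (rule integral_mono)
    show "integrable M (\<lambda>z. A powr q * cmod (fnl q (u z) * cnj (v z) - fnl q (w z) * cnj (v z)))"
      using i by (intro integrable_mult_right integrable_norm Bochner_Integration.integrable_diff)
    show "integrable M (\<lambda>z. 2 * (cmod (u z - w z) * cmod (v z) + B * (cmod (u z - w z) * cmod (u z) + cmod (u z - w z) * cmod (w z))))"
      using I1 I2 I3 by (intro integrable_mult_right Bochner_Integration.integrable_add)
    fix z
    have "A powr q * cmod (fnl q (u z) * cnj (v z) - fnl q (w z) * cnj (v z)) = (A powr q * cmod (fnl q (u z) - fnl q (w z))) * cmod (v z)"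
      by (simp add: left_diff_distrib[symmetric] norm_mult mult.assoc)
    also have "\<dots> \<le> (2 * cmod (u z - w z) * (1 + A * (cmod (u z) + cmod (w z)))) * cmod (v z)"
      by (intro mult_right_mono fnl_diff q A) simp
    also have "\<dots> = 2 * (cmod (u z - w z) * cmod (v z) + cmod (u z - w z) * (cmod (u z) + cmod (w z)) * (A * cmod (v z)))"
      by (simp add: algebra_simps)
    also have "\<dots> \<le> 2 * (cmod (u z - w z) * cmod (v z) + cmod (u z - w z) * (cmod (u z) + cmod (w z)) * B)"
      by (intro mult_left_mono add_left_mono vb) auto
    finally show "A powr q * cmod (fnl q (u z) * cnj (v z) - fnl q (w z) * cnj (v z)) \<le> 2 * (cmod (u z - w z) * cmod (v z) + B * (cmod (u z - w z) * cmod (u z) + cmod (u z - w z) * cmod (w z)))"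
      by (simp add: algebra_simps)
  qed
  also have "\<dots> = 2 * ((\<integral>z. cmod (u z - w z) * cmod (v z) \<partial>M) + B * ((\<integral>z. cmod (u z - w z) * cmod (u z) \<partial>M) + (\<integral>z. cmod (u z - w z) * cmod (w z) \<partial>M)))"
    using I1 I2 I3 by simp
  also have "\<dots> \<le> 2 * (nrm M (\<lambda>z. u z - w z) * nrm M v + B * (nrm M (\<lambda>z. u z - w z) * nrm M u + nrm M (\<lambda>z. u z - w z) * nrm M w))"
    using B0 by (intro mult_left_mono add_mono l2_CS d u v) auto
  finally show ?thesis by (simp add: algebra_simps)
qed

section \<open>Trigonometric sums on the two-dimensional torus\<close>

definition mTT :: "(real \<times> real) measure" where
  "mTT = mT \<Otimes>\<^sub>M mT"

lemma sets_mTT [measurable_cong, simp]: "sets mTT = sets borel"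
proof -
  have "sets (mT \<Otimes>\<^sub>M mT) = sets (borel \<Otimes>\<^sub>M borel :: (real \<times> real) measure)"
    by (intro sets_pair_measure_cong) simp_all
  then show ?thesis unfolding mTT_def borel_prod .
qed

lemma space_mTT [simp]: "space mTT = UNIV"
  by (simp add: mTT_def space_pair_measure)

interpretation TT: pair_sigma_finite mT mT
  by (simp add: pair_sigma_finite_def sigma_finite_mT)

lemma finite_measure_mTT: "finite_measure mTT"
  unfolding mTT_def by (rule finite_measure_pair_measure) (rule finite_measure_mT)+

interpretation mTT: finite_measure mTT by (rule finite_measure_mTT)

lemma sigma_finite_mTT: "sigma_finite_measure mTT"
  by (rule mTT.sigma_finite_measure_axioms)

text \<open>The index is ordered as (space, time) frequency while the argument is (time, space), so
  \<open>ee (k, k^2)\<close> at (t, x) is the free wave exp (i (k x - k^2 t)).\<close>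

definition ee :: "int \<times> int \<Rightarrow> real \<times> real \<Rightarrow> complex" where
  "ee m w = exp (\<i> * of_real (of_int (fst m) * snd w - of_int (snd m) * fst w))"

lemma norm_ee [simp]: "cmod (ee m w) = 1" by (simp add: ee_def)

lemma ee_measurable [measurable]: "ee m \<in> borel_measurable borel"
  unfolding ee_def[abs_def] borel_prod[symmetric] by measurable

lemma ee_integrable: "integrable mTT (\<lambda>w. ee m w * cnj (ee n w))"
  by (rule mTT.integrable_const_bound[of _ 1]) (auto simp: norm_mult cong: measurable_cong_sets)

lemma ee_orth: "(\<integral>w. ee m w * cnj (ee n w) \<partial>mTT) = (if m = n then of_real ((2 * pi)\<^sup>2) else 0)"
proof -
  have i: "integrable mT (\<lambda>x. exp (\<i> * of_real (of_int j * x)))" for j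
    by (rule mT.integrable_const_bound[of _ 1]) (auto cong: measurable_cong_sets)
  have "(\<integral>w. ee m w * cnj (ee n w) \<partial>mTT) = (\<integral>w. exp (\<i> * of_real (of_int (snd n - snd m) * fst w)) * exp (\<i> * of_real (of_int (fst m - fst n) * snd w)) \<partial>(mT \<Otimes>\<^sub>M mT))"
    unfolding mTT_def
    by (intro Bochner_Integration.integral_cong refl) (simp add: ee_def exp_cnj exp_add[symmetric] algebra_simps)
  also have "\<dots> = (\<integral>x. exp (\<i> * of_real (of_int (snd n - snd m) * x)) \<partial>mT) * (\<integral>x. exp (\<i> * of_real (of_int (fst m - fst n) * x)) \<partial>mT)"
    by (rule integrable_prod_mult(2)[OF sigma_finite_mT sigma_finite_mT i i])
  also have "\<dots> = (if m = n then of_real ((2 * pi)\<^sup>2) else 0)"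
    unfolding integral_ek by (cases m, cases n) (auto simp: power2_eq_square)
  finally show ?thesis .
qed

text \<open>Stated for an injective labelling \<phi> so that it covers both the free waves, labelled
  by (k, k^2), and the off-diagonal frequency differences in the square of their sum.\<close>

lemma ee_parseval:
  assumes "finite I" "inj_on \<phi> I"
  shows "(\<integral>w. (cmod (\<Sum>i\<in>I. d i * ee (\<phi> i) w))\<^sup>2 \<partial>mTT) = (2 * pi)\<^sup>2 * (\<Sum>i\<in>I. (cmod (d i))\<^sup>2)"
proof -
  have "complex_of_real (\<integral>w. (cmod (\<Sum>i\<in>I. d i * ee (\<phi> i) w))\<^sup>2 \<partial>mTT)
     = (\<integral>w. (\<Sum>i\<in>I. \<Sum>j\<in>I. (d i * cnj (d j)) * (ee (\<phi> i) w * cnj (ee (\<phi> j) w))) \<partial>mTT)"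
    unfolding integral_complex_of_real[symmetric] complex_norm_square cnj_sum sum_product
    by (intro Bochner_Integration.integral_cong refl sum.cong) (simp add: mult_ac)
  also have "\<dots> = (\<Sum>i\<in>I. \<Sum>j\<in>I. (d i * cnj (d j)) * (if \<phi> i = \<phi> j then of_real ((2 * pi)\<^sup>2) else 0))"
    by (simp add: Bochner_Integration.integral_sum ee_integrable ee_orth Bochner_Integration.integrable_sum del: of_real_power)
  also have "\<dots> = (\<Sum>i\<in>I. of_real ((2 * pi)\<^sup>2) * of_real ((cmod (d i))\<^sup>2))"
  proof (rule sum.cong[OF refl])
    fix i assume i: "i \<in> I"
    have "(\<Sum>j\<in>I. (d i * cnj (d j)) * (if \<phi> i = \<phi> j then of_real ((2 * pi)\<^sup>2) else 0)) = (\<Sum>j\<in>I. if i = j then (d i * cnj (d i)) * of_real ((2 * pi)\<^sup>2) else 0)"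
      using assms(2) i by (intro sum.cong) (auto simp: inj_on_def)
    also have "\<dots> = of_real ((2 * pi)\<^sup>2) * of_real ((cmod (d i))\<^sup>2)"
      using assms(1) i by (simp add: complex_norm_square del: of_real_power)
    finally show "(\<Sum>j\<in>I. (d i * cnj (d j)) * (if \<phi> i = \<phi> j then of_real ((2 * pi)\<^sup>2) else 0)) = of_real ((2 * pi)\<^sup>2) * of_real ((cmod (d i))\<^sup>2)" .
  qed
  also have "\<dots> = of_real ((2 * pi)\<^sup>2 * (\<Sum>i\<in>I. (cmod (d i))\<^sup>2))"
    by (simp add: sum_distrib_left)
  finally show ?thesis unfolding of_real_eq_iff .
qed

definition trig :: "int set \<Rightarrow> (int \<Rightarrow> complex) \<Rightarrow> real \<times> real \<Rightarrow> complex" where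
  "trig K c w = (\<Sum>k\<in>K. c k * ee (k, k\<^sup>2) w)"

lemma trig_measurable [measurable]: "trig K c \<in> borel_measurable borel"
  unfolding trig_def[abs_def] by measurable

lemma trig_bounded: "cmod (trig K c w) \<le> (\<Sum>k\<in>K. cmod (c k))"
  unfolding trig_def by (rule sum_norm_le) (simp add: norm_mult)

lemma trig_l2: "trig K c \<in> l2 mTT"
  by (rule l2I, simp cong: measurable_cong_sets, rule mTT.integrable_const_bound[of _ "(\<Sum>k\<in>K. cmod (c k))\<^sup>2"])
     (auto intro!: AE_I2 power_mono trig_bounded cong: measurable_cong_sets)

text \<open>Zygmund's periodic Strichartz estimate: for \<open>k \<noteq> l\<close> the pair \<open>(k - l, k\<^sup>2 - l\<^sup>2)\<close>
  determines \<open>(k, l)\<close>, so the off-diagonal part of \<open>|F|\<^sup>2\<close> is an orthogonal sum.\<close>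

lemma trig_L4:
  assumes K: "finite K"
  shows "(\<integral>w. (cmod (trig K c w))^4 \<partial>mTT) \<le> 4 / (2 * pi)\<^sup>2 * ((nrm mTT (trig K c))\<^sup>2)\<^sup>2"
proof -
  define A where "A = (\<Sum>k\<in>K. (cmod (c k))\<^sup>2)"
  define I where "I = {p \<in> K \<times> K. fst p \<noteq> snd p}"
  define \<phi> where "\<phi> p = (fst p - snd p, (fst p)\<^sup>2 - (snd p)\<^sup>2)" for p :: "int \<times> int"
  have fI: "finite I" using K by (auto simp: I_def)
  have inj: "inj_on \<phi> I"
  proof (rule inj_onI)
    fix p r assume p: "p \<in> I" and r: "r \<in> I" and eq: "\<phi> p = \<phi> r"
    obtain k l where pk: "p = (k, l)" by (cases p)
    obtain k' l' where rk: "r = (k', l')" by (cases r)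
    have d: "k - l = k' - l'" "k \<noteq> l" using eq p by (auto simp: pk rk \<phi>_def I_def)
    have "(k - l) * (k + l) = (k' - l') * (k' + l')" using eq by (simp add: pk rk \<phi>_def power2_eq_square algebra_simps)
    then have "k + l = k' + l'" using d by simp
    then show "p = r" using d by (simp add: pk rk)
  qed
  define Q where "Q w = (\<Sum>p\<in>I. (c (fst p) * cnj (c (snd p))) * ee (\<phi> p) w)" for w
  have n2: "(nrm mTT (trig K c))\<^sup>2 = (2 * pi)\<^sup>2 * A"
    unfolding nrm_sq trig_def A_def by (rule ee_parseval[OF K]) (auto simp: inj_on_def)
  have eq: "complex_of_real ((cmod (trig K c w))\<^sup>2) = of_real A + Q w" for w
  proof -
    have "complex_of_real ((cmod (trig K c w))\<^sup>2) = (\<Sum>p\<in>K \<times> K. (c (fst p) * cnj (c (snd p))) * ee (\<phi> p) w)"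
      unfolding complex_norm_square trig_def cnj_sum sum_product sum.cartesian_product
      by (intro sum.cong refl) (auto simp: \<phi>_def ee_def exp_cnj exp_add[symmetric] algebra_simps)
    also have "K \<times> K = I \<union> (\<lambda>k. (k, k)) ` K" by (auto simp: I_def)
    also have "(\<Sum>p\<in>I \<union> (\<lambda>k. (k, k)) ` K. (c (fst p) * cnj (c (snd p))) * ee (\<phi> p) w)
       = Q w + (\<Sum>p\<in>(\<lambda>k. (k, k)) ` K. (c (fst p) * cnj (c (snd p))) * ee (\<phi> p) w)"
      unfolding Q_def using fI K by (intro sum.union_disjoint) (auto simp: I_def)
    also have "(\<Sum>p\<in>(\<lambda>k. (k, k)) ` K. (c (fst p) * cnj (c (snd p))) * ee (\<phi> p) w) = of_real A"
      by (subst sum.reindex) (auto simp: inj_on_def \<phi>_def ee_def A_def complex_norm_square simp del: of_real_power)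
    finally show ?thesis by simp
  qed
  have Qm[measurable]: "Q \<in> borel_measurable borel" unfolding Q_def by measurable
  have Qb: "cmod (Q w) \<le> (\<Sum>p\<in>I. cmod (c (fst p) * cnj (c (snd p))))" for w
    unfolding Q_def by (rule sum_norm_le) (simp add: norm_mult)
  have Qi: "integrable mTT (\<lambda>w. (cmod (Q w))\<^sup>2)"
    by (rule mTT.integrable_const_bound[of _ "(\<Sum>p\<in>I. cmod (c (fst p) * cnj (c (snd p))))\<^sup>2"])
       (auto intro!: AE_I2 power_mono Qb cong: measurable_cong_sets)
  have Q2: "(\<integral>w. (cmod (Q w))\<^sup>2 \<partial>mTT) \<le> (2 * pi)\<^sup>2 * A\<^sup>2"
  proof -
    have "(\<integral>w. (cmod (Q w))\<^sup>2 \<partial>mTT) = (2 * pi)\<^sup>2 * (\<Sum>p\<in>I. (cmod (c (fst p) * cnj (c (snd p))))\<^sup>2)"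
      unfolding Q_def by (rule ee_parseval[OF fI inj])
    also have "(\<Sum>p\<in>I. (cmod (c (fst p) * cnj (c (snd p))))\<^sup>2) \<le> (\<Sum>p\<in>K \<times> K. (cmod (c (fst p) * cnj (c (snd p))))\<^sup>2)"
      using K by (intro sum_mono2) (auto simp: I_def)
    also have "\<dots> = A\<^sup>2"
      unfolding A_def power2_eq_square[of "sum _ _"] sum_product sum.cartesian_product
      by (intro sum.cong) (auto simp: norm_mult power_mult_distrib)
    finally show ?thesis by simp
  qed
  have four: "(cmod (trig K c w))^4 \<le> 2 * A\<^sup>2 + 2 * (cmod (Q w))\<^sup>2" for w
  proof -
    have "(cmod (trig K c w))\<^sup>2 = cmod (of_real A + Q w)" unfolding eq[symmetric] by (simp del: of_real_power)
    then have "(cmod (trig K c w))^4 = (cmod (of_real A + Q w))\<^sup>2" by (metis power_mult mult_2_right numeral_Bit0 power_even_eq)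
    also have "\<dots> \<le> 2 * (cmod (of_real A))\<^sup>2 + 2 * (cmod (Q w))\<^sup>2" by (rule norm_add_sq_le)
    finally show ?thesis by simp
  qed
  \<comment> \<open>The total mass is read off from \<open>ee_orth\<close> at frequency
    zero.\<close>
  have m: "measure mTT (space mTT) = (2 * pi)\<^sup>2"
  proof -
    have "complex_of_real (measure mTT (space mTT)) = (\<integral>w. ee (0, 0) w * cnj (ee (0, 0) w) \<partial>mTT)" by (simp add: ee_def scaleR_conv_of_real)
    then show ?thesis unfolding ee_orth by (simp only: of_real_eq_iff simp_thms if_True)
  qed
  have "(\<integral>w. (cmod (trig K c w))^4 \<partial>mTT) \<le> (\<integral>w. 2 * A\<^sup>2 + 2 * (cmod (Q w))\<^sup>2 \<partial>mTT)"
    by (rule integral_mono', rule Bochner_Integration.integrable_add) (use Qi four in auto)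
  also have "\<dots> = 2 * A\<^sup>2 * (2 * pi)\<^sup>2 + 2 * (\<integral>w. (cmod (Q w))\<^sup>2 \<partial>mTT)"
    using Qi m by (subst Bochner_Integration.integral_add) auto
  also have "\<dots> \<le> 2 * A\<^sup>2 * (2 * pi)\<^sup>2 + 2 * ((2 * pi)\<^sup>2 * A\<^sup>2)"
    by (intro add_left_mono mult_left_mono Q2) simp
  also have "\<dots> = 4 * (2 * pi)\<^sup>2 * A\<^sup>2" by (simp add: mult_ac)
  also have "\<dots> = 4 / (2 * pi)\<^sup>2 * ((nrm mTT (trig K c))\<^sup>2)\<^sup>2" unfolding n2 by (simp add: power2_eq_square)
  finally show ?thesis .
qed

text \<open>The L^4 bound depends on the finite sums only through their L2 norms, so Fatou transfers
  it to \<open>H\<close> along an a.e. convergent subsequence. Since |z|^q |z| <= 1 + |z|^2, the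
  nonlinearity of \<open>H\<close> is then square-integrable, and orthogonality to the finite sums
  survives their L2 limit \<open>H\<close>. What remains is that |H|^(q + 2) has integral 0.\<close>

lemma torus_unique:
  fixes H :: "real \<times> real \<Rightarrow> complex"
  assumes q: "0 < q" "q \<le> 1" and H: "H \<in> l2 mTT"
    and K: "\<And>n. finite (K n)" and lim: "(\<lambda>n. nrm mTT (\<lambda>w. trig (K n) (c n) w - H w)) \<longlonglongrightarrow> 0"
    and orth: "\<And>k. (\<integral>w. fnl q (H w) * cnj (ee (k, k\<^sup>2) w) \<partial>mTT) = 0"
  shows "AE w in mTT. H w = 0"
proof -
  note [measurable] = l2_meas[OF H]
  define P where "P n = trig (K n) (c n)" for n
  have Pl: "P n \<in> l2 mTT" for n by (simp add: P_def trig_l2)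
  have "(\<lambda>n. nrm mTT (P n)) \<longlonglongrightarrow> nrm mTT H" by (rule nrm_tendsto[OF Pl H]) (use lim in \<open>simp add: P_def\<close>)
  then obtain B where B: "\<And>n. nrm mTT (P n) \<le> B" using convergent_imp_Bseq[OF convergentI] by (metis BseqE nrm_nonneg abs_of_nonneg real_norm_def)
  have L4: "(\<integral>w. (cmod (P n w))^4 \<partial>mTT) \<le> 4 / (2 * pi)\<^sup>2 * (B\<^sup>2)\<^sup>2" for n
    unfolding P_def by (rule order_trans[OF trig_L4[OF K]], intro mult_left_mono power_mono) (use B in \<open>auto simp: P_def\<close>)
  have cau: "\<exists>N. \<forall>i\<ge>N. \<forall>j\<ge>N. nrm mTT (\<lambda>w. P i w - P j w) < e" if "e > 0" for e
  proof -
    from order_tendstoD(2)[OF lim, of "e/2"] that obtain N where N: "\<And>n. n \<ge> N \<Longrightarrow> nrm mTT (\<lambda>w. P n w - H w) < e / 2"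
      by (auto simp: eventually_sequentially P_def)
    have "nrm mTT (\<lambda>w. P i w - P j w) < e" if "i \<ge> N" "j \<ge> N" for i j
      using nrm_triangle_diff[OF Pl[of i] H Pl[of j]] N[OF that(1)] N[OF that(2)] by (simp add: nrm_commute[of mTT H])
    then show ?thesis by blast
  qed
  \<comment> \<open>Completeness is invoked for the a.e. convergent subsequence; its limit
    \<open>g\<close> coincides with the given \<open>H\<close> a.e. because both are L2 limits of
    \<open>P\<close>. The constant weight 1 is admissible on a finite measure.\<close>
  obtain g r where g: "g \<in> l2 mTT" "(\<lambda>n. nrm mTT (\<lambda>w. P n w - g w)) \<longlonglongrightarrow> 0" and r: "strict_mono r"
    and ae: "AE w in mTT. (\<lambda>n. P (r n) w) \<longlonglongrightarrow> g w"
    using l2_complete[OF Pl cau, of "\<lambda>_. 1"] by auto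
  have gH: "AE w in mTT. g w - H w = 0"
  proof (rule nrm_eq_0_AE[OF l2_diff[OF g(1) H]])
    have "(\<lambda>n. nrm mTT (\<lambda>w. P n w - g w) + nrm mTT (\<lambda>w. P n w - H w)) \<longlonglongrightarrow> 0 + 0"
      by (rule tendsto_add[OF g(2)]) (use lim in \<open>simp add: P_def\<close>)
    then have "nrm mTT (\<lambda>w. g w - H w) \<le> 0 + 0"
      by (rule LIMSEQ_le_const) (use nrm_triangle_diff[OF g(1) Pl H] in \<open>auto simp: nrm_commute[of mTT g]\<close>)
    then show "nrm mTT (\<lambda>w. g w - H w) = 0" by (simp add: antisym)
  qed
  have aeH: "AE w in mTT. (\<lambda>n. P (r n) w) \<longlonglongrightarrow> H w" using ae gH by eventually_elim simp
  have H4: "integrable mTT (\<lambda>w. (cmod (H w))^4)"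
  proof (rule integrableI_bounded)
    have "(\<integral>\<^sup>+w. ennreal (norm ((cmod (H w))^4)) \<partial>mTT) = (\<integral>\<^sup>+w. liminf (\<lambda>n. ennreal ((cmod (P (r n) w))^4)) \<partial>mTT)"
    proof (rule nn_integral_cong_AE)
      show "AE w in mTT. ennreal (norm ((cmod (H w))^4)) = liminf (\<lambda>n. ennreal ((cmod (P (r n) w))^4))"
        using aeH
      proof eventually_elim
        case (elim w)
        have "(\<lambda>n. ennreal ((cmod (P (r n) w))^4)) \<longlonglongrightarrow> ennreal ((cmod (H w))^4)"
          by (intro tendsto_ennrealI tendsto_intros elim)
        then show ?case by (subst lim_imp_Liminf) auto
      qed
    qed
    also have "\<dots> \<le> liminf (\<lambda>n. \<integral>\<^sup>+w. ennreal ((cmod (P (r n) w))^4) \<partial>mTT)"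
      by (rule nn_integral_liminf) (simp add: P_def cong: measurable_cong_sets)
    also have "\<dots> \<le> ennreal (4 / (2 * pi)\<^sup>2 * (B\<^sup>2)\<^sup>2)"
    proof (rule Liminf_le[OF sequentially_bot], rule always_eventually, rule allI)
      fix n
      have "integrable mTT (\<lambda>w. (cmod (P (r n) w))^4)"
        by (rule mTT.integrable_const_bound[of _ "(\<Sum>k\<in>K (r n). cmod (c (r n) k))^4"])
           (auto simp: P_def intro!: AE_I2 power_mono trig_bounded cong: measurable_cong_sets)
      then have "(\<integral>\<^sup>+w. ennreal ((cmod (P (r n) w))^4) \<partial>mTT) = ennreal (\<integral>w. (cmod (P (r n) w))^4 \<partial>mTT)"
        by (rule nn_integral_eq_integral) simp
      then show "(\<integral>\<^sup>+w. ennreal ((cmod (P (r n) w))^4) \<partial>mTT) \<le> ennreal (4 / (2 * pi)\<^sup>2 * (B\<^sup>2)\<^sup>2)"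
        using ennreal_leI[OF L4[of "r n"]] by (simp only:)
    qed
    finally show "(\<integral>\<^sup>+w. ennreal (norm ((cmod (H w))^4)) \<partial>mTT) < \<infinity>" 
      unfolding infinity_ennreal_def by (rule le_less_trans) (rule ennreal_less_top)
  qed measurable
  have fl: "(\<lambda>w. fnl q (H w)) \<in> l2 mTT"
  proof (rule l2I)
    show "integrable mTT (\<lambda>w. (cmod (fnl q (H w)))\<^sup>2)"
    proof (rule Bochner_Integration.integrable_bound)
      show "integrable mTT (\<lambda>w. 2 + 2 * (cmod (H w))^4)" using H4 by simp
      have "(cmod (fnl q (H w)))\<^sup>2 \<le> 2 + 2 * (cmod (H w))^4" for w
      proof -
        have "(cmod (fnl q (H w)))\<^sup>2 \<le> (1 + (cmod (H w))\<^sup>2)\<^sup>2" using q by (intro power_mono fnl_bound) auto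
        also have "\<dots> \<le> 2 * 1\<^sup>2 + 2 * ((cmod (H w))\<^sup>2)\<^sup>2" using norm_add_sq_le[of "1::real" "(cmod (H w))\<^sup>2"] by simp
        finally show ?thesis by (simp add: power_mult[symmetric])
      qed
      then show "AE w in mTT. norm ((cmod (fnl q (H w)))\<^sup>2) \<le> norm (2 + 2 * (cmod (H w))^4)"
        by (intro AE_I2) (simp add: abs_of_nonneg)
    qed measurable
  qed measurable
  have eel: "ee m \<in> l2 mTT" for m
    by (rule l2I) (auto cong: measurable_cong_sets)
  have ipP: "ip mTT (\<lambda>w. fnl q (H w)) (P n) = 0" for n
  proof -
    have "ip mTT (\<lambda>w. fnl q (H w)) (P n) = (\<integral>w. (\<Sum>k\<in>K n. cnj (c n k) * (fnl q (H w) * cnj (ee (k, k\<^sup>2) w))) \<partial>mTT)"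
      unfolding ip_def P_def trig_def cnj_sum sum_distrib_left by (simp add: mult_ac)
    also have "\<dots> = (\<Sum>k\<in>K n. cnj (c n k) * (\<integral>w. fnl q (H w) * cnj (ee (k, k\<^sup>2) w) \<partial>mTT))"
      by (subst Bochner_Integration.integral_sum) (auto intro!: integrable_mult_right l2_mult_integrable(2)[OF fl eel])
    finally show ?thesis unfolding orth by simp
  qed
  have "(\<lambda>n. ip mTT (P n) (\<lambda>w. fnl q (H w))) \<longlonglongrightarrow> ip mTT H (\<lambda>w. fnl q (H w))"
    by (rule ip_tendsto[OF Pl H fl]) (use lim in \<open>simp add: P_def\<close>)
  then have "ip mTT H (\<lambda>w. fnl q (H w)) = 0"
    unfolding ip_cnj[of mTT "P _" "\<lambda>w. fnl q (H w)"] ipP by (simp add: LIMSEQ_const_iff)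
  moreover have "ip mTT H (\<lambda>w. fnl q (H w)) = of_real (\<integral>w. cmod (H w) powr q * (cmod (H w))\<^sup>2 \<partial>mTT)"
    unfolding ip_def integral_complex_of_real[symmetric] of_real_mult complex_norm_square fnl_def
    by (simp add: mult_ac)
  ultimately have z: "(\<integral>w. cmod (H w) powr q * (cmod (H w))\<^sup>2 \<partial>mTT) = 0" by simp
  have "integrable mTT (\<lambda>w. cmod (H w) * cmod (fnl q (H w)))" by (rule l2_mult_integrable[OF H fl])
  then have "integrable mTT (\<lambda>w. cmod (H w) powr q * (cmod (H w))\<^sup>2)"
    by (simp add: fnl_def norm_mult power2_eq_square mult_ac)
  then have "AE w in mTT. cmod (H w) powr q * (cmod (H w))\<^sup>2 = 0"
    using z integral_nonneg_eq_0_iff_AE[of mTT "\<lambda>w. cmod (H w) powr q * (cmod (H w))\<^sup>2"] by simp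
  then show ?thesis by eventually_elim auto
qed

section \<open>Averages of rapidly oscillating periodic functions\<close>

lemma periodic_int:
  assumes per: "\<And>t. N (t + 2 * pi) = N t" shows "N (t + 2 * pi * of_int k) = N t"
proof (induction k rule: int_induct[of _ 0])
  case (step1 i)
  then show ?case using per[of "t + 2 * pi * of_int i"] by (simp add: algebra_simps)
next
  case (step2 i)
  then show ?case using per[of "t + 2 * pi * of_int (i - 1)"] by (simp add: algebra_simps)
qed simp

text \<open>After reducing the shift modulo a period, the part of the shifted window beyond
  \<open>2 * pi\<close> is moved back by one period.\<close>

lemma periodic_integral_shift:
  fixes N :: "real \<Rightarrow> complex"
  assumes m[measurable]: "N \<in> borel_measurable borel" and b: "\<And>t. cmod (N t) \<le> B" and per: "\<And>t. N (t + 2 * pi) = N t"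
  shows "(\<integral>s. N (c + s) \<partial>mT) = (\<integral>s. N s \<partial>mT)"
proof -
  define k where "k = \<lfloor>c / (2 * pi)\<rfloor>"
  define r where "r = c - 2 * pi * of_int k"
  have r: "0 \<le> r" "r < 2 * pi"
  proof -
    have "of_int k \<le> c / (2 * pi)" "c / (2 * pi) < of_int k + 1" unfolding k_def by linarith+
    then show "0 \<le> r" "r < 2 * pi" by (simp_all add: r_def field_simps)
  qed
  have cr: "N (c + s) = N (r + s)" for s
    using periodic_int[of N "r + s" k, OF per] by (simp add: r_def algebra_simps)
  have i: "integrable lborel (\<lambda>x. indicator {l..<u} x *\<^sub>R N x)" for l u
  proof (rule Bochner_Integration.integrable_bound)
    show "integrable lborel (\<lambda>x. B * indicator {l..<u} x :: real)"
    proof (intro integrable_mult_right integrable_real_indicator)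
      show "emeasure lborel {l..<u} < \<infinity>" by (cases "l \<le> u") auto
    qed simp
  qed (auto simp: indicator_def intro!: AE_I2 order_trans[OF b abs_ge_self])
  have "(\<integral>s. N (c + s) \<partial>mT) = (\<integral>s. indicator {0..<2*pi} s *\<^sub>R N (r + s) \<partial>lborel)"
    unfolding cr by (rule integral_mT) measurable
  also have "\<dots> = (\<integral>x. indicator {r..<r + 2*pi} x *\<^sub>R N x \<partial>lborel)"
    by (subst (2) lborel_integral_real_affine[of 1 _ r]) (auto simp: indicator_def intro!: Bochner_Integration.integral_cong)
  also have "\<dots> = (\<integral>x. indicator {r..<2*pi} x *\<^sub>R N x + indicator {2*pi..<r + 2*pi} x *\<^sub>R N x \<partial>lborel)"
    using r by (intro Bochner_Integration.integral_cong) (auto simp: indicator_def)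
  also have "\<dots> = (\<integral>x. indicator {r..<2*pi} x *\<^sub>R N x \<partial>lborel) + (\<integral>x. indicator {2*pi..<r + 2*pi} x *\<^sub>R N x \<partial>lborel)"
    by (rule Bochner_Integration.integral_add[OF i i])
  also have "(\<integral>x. indicator {2*pi..<r + 2*pi} x *\<^sub>R N x \<partial>lborel) = (\<integral>x. indicator {0..<r} x *\<^sub>R N x \<partial>lborel)"
    by (subst lborel_integral_real_affine[of 1 _ "2 * pi"]) (auto simp: indicator_def per add.commute[of "2 * pi"] intro!: Bochner_Integration.integral_cong)
  also have "(\<integral>x. indicator {r..<2*pi} x *\<^sub>R N x \<partial>lborel) + (\<integral>x. indicator {0..<r} x *\<^sub>R N x \<partial>lborel) = (\<integral>x. indicator {r..<2*pi} x *\<^sub>R N x + indicator {0..<r} x *\<^sub>R N x \<partial>lborel)"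
    by (rule Bochner_Integration.integral_add[OF i i, symmetric])
  also have "\<dots> = (\<integral>x. indicator {0..<2*pi} x *\<^sub>R N x \<partial>lborel)"
    using r by (intro Bochner_Integration.integral_cong) (auto simp: indicator_def)
  also have "\<dots> = (\<integral>s. N s \<partial>mT)" by (rule integral_mT(1)[symmetric]) measurable
  finally show ?thesis .
qed

interpretation TL: pair_sigma_finite mT "lborel :: real measure"
  by (simp add: pair_sigma_finite_def sigma_finite_mT sigma_finite_lborel)

text \<open>Replacing \<open>t\<close> by \<open>t + s / T\<close> does not change the integral, so
  it may be averaged over \<open>s\<close> in one period. With \<rho> frozen at \<open>t\<close> the
  average in \<open>s\<close> is exactly the mean of \<open>N\<close>; the error comes from \<rho>(t
  + s / T) - \<rho>(t), which tends to 0 by continuity of \<rho>. No regularity of \<open>N\<close>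
  enters beyond measurability and boundedness.\<close>

lemma periodic_averaging:
  fixes N :: "real \<Rightarrow> complex" and \<rho> :: "real \<Rightarrow> real"
  assumes m[measurable]: "N \<in> borel_measurable borel" and b: "\<And>t. cmod (N t) \<le> B" and per: "\<And>t. N (t + 2 * pi) = N t"
    and c: "continuous_on UNIV \<rho>" and supp: "\<And>t. t \<notin> {1..2} \<Longrightarrow> \<rho> t = 0"
  shows "(\<lambda>n. \<integral>t. of_real (\<rho> t) * N (real (Suc n) * t) \<partial>lborel) \<longlonglongrightarrow> of_real (\<integral>t. \<rho> t \<partial>lborel) * (\<integral>s. N s \<partial>mT) / of_real (2 * pi)"
proof -
  have [measurable]: "\<rho> \<in> borel_measurable borel" using c by (rule borel_measurable_continuous_onI)
  have "compact (\<rho> ` {1..2})" using c by (intro compact_continuous_image) (auto intro: continuous_on_subset)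
  then obtain P0 where P0: "\<And>t. t \<in> {1..2} \<Longrightarrow> \<bar>\<rho> t\<bar> \<le> P0" using compact_imp_bounded bounded_iff by (metis image_eqI real_norm_def)
  define P where "P = \<bar>P0\<bar>"
  have P: "\<bar>\<rho> t\<bar> \<le> P" for t using P0[of t] supp[of t] by (cases "t \<in> {1..2}") (auto simp: P_def)
  define T where "T n = real (Suc n)" for n
  have T: "T n \<ge> 1" for n by (simp add: T_def)
  \<comment> \<open>Contains the supports of \<rho> and of all its shifts to the left by at most 2
    pi < 8, since \<open>T n >= 1\<close>.\<close>
  define J where "J t = (indicator {-8..2} t :: real)" for t :: real
  have Ji: "integrable lborel (\<lambda>t. (P * B) * J t)" unfolding J_def
    by (intro integrable_mult_right integrable_real_indicator) auto
  have c1: "integrable mT (\<lambda>_. 1::real)" by simp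
  have dom: "integrable (mT \<Otimes>\<^sub>M lborel) (\<lambda>p. (P * B) * J (snd p))"
    using integrable_prod_mult(1)[OF sigma_finite_mT sigma_finite_lborel c1 Ji] by simp
  have aeT: "AE p in mT \<Otimes>\<^sub>M (lborel :: real measure). fst p \<in> {0..<2*pi}"
  proof (rule TL.AE_pair_measure)
    show "{p \<in> space (mT \<Otimes>\<^sub>M lborel). fst p \<in> {0..<2*pi}} \<in> sets (mT \<Otimes>\<^sub>M (lborel :: real measure))" by measurable
    show "AE x in mT. AE y in lborel. fst (x, y :: real) \<in> {0..<2*pi}" by (auto simp: AE_mT)
  qed
  define f where "f n p = of_real (\<rho> (snd p + fst p / T n)) * N (T n * snd p + fst p)" for n and p :: "real \<times> real"
  define g where "g n p = of_real (\<rho> (snd p)) * N (T n * snd p + fst p)" for n and p :: "real \<times> real"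
  have fm[measurable]: "f n \<in> borel_measurable (mT \<Otimes>\<^sub>M lborel)" "g n \<in> borel_measurable (mT \<Otimes>\<^sub>M lborel)" for n
    unfolding f_def g_def by measurable
  have fb: "AE p in mT \<Otimes>\<^sub>M lborel. cmod (f n p) \<le> (P * B) * J (snd p)" for n
    using aeT
  proof eventually_elim
    case (elim p)
    have "\<bar>\<rho> (snd p + fst p / T n)\<bar> \<le> P * J (snd p)"
    proof (cases "snd p \<in> {-8..2}")
      case False
      have "0 \<le> fst p / T n" using elim T[of n] by auto
      moreover have "fst p / T n \<le> 2 * pi" using elim T[of n] divide_left_mono[of 1 "T n" "fst p"] by auto
      moreover have "2 * pi < 8" using pi_less_4 by linarith
      ultimately have "snd p + fst p / T n \<notin> {1..2}" using False by auto
      then show ?thesis using supp False by (simp add: J_def)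
    qed (use P in \<open>simp add: J_def\<close>)
    then have "\<bar>\<rho> (snd p + fst p / T n)\<bar> * cmod (N (T n * snd p + fst p)) \<le> (P * J (snd p)) * B"
      using b by (intro mult_mono) (auto simp: P_def J_def)
    then show ?case by (simp add: f_def norm_mult mult_ac)
  qed
  have gb: "cmod (g n p) \<le> (P * B) * J (snd p)" for n p
  proof -
    have "\<bar>\<rho> (snd p)\<bar> \<le> P * J (snd p)" using P supp[of "snd p"] by (cases "snd p \<in> {1..2}") (auto simp: J_def P_def)
    then have "\<bar>\<rho> (snd p)\<bar> * cmod (N (T n * snd p + fst p)) \<le> (P * J (snd p)) * B"
      using b by (intro mult_mono) (auto simp: P_def J_def)
    then show ?thesis by (simp add: g_def norm_mult mult_ac)
  qed
  have fi: "integrable (mT \<Otimes>\<^sub>M lborel) (f n)" for n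
    by (rule Bochner_Integration.integrable_bound[OF dom fm(1)]) (use fb[of n] in \<open>auto elim!: eventually_mono intro: order_trans[OF _ abs_ge_self]\<close>)
  have gi: "integrable (mT \<Otimes>\<^sub>M lborel) (g n)" for n
    by (rule Bochner_Integration.integrable_bound[OF dom fm(2)]) (use gb[of n] in \<open>auto intro!: AE_I2 intro: order_trans[OF _ abs_ge_self]\<close>)
  define I where "I n = (\<integral>t. of_real (\<rho> t) * N (T n * t) \<partial>lborel)" for n
  have If: "(\<integral>p. f n p \<partial>(mT \<Otimes>\<^sub>M lborel)) = of_real (2 * pi) * I n" for n
  proof -
    have "(\<integral>t. f n (s, t) \<partial>lborel) = I n" for s
      unfolding I_def f_def using T[of n]
      by (subst (2) lborel_integral_real_affine[of 1 _ "s / T n"]) (auto simp: algebra_simps intro!: Bochner_Integration.integral_cong)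
    then have "(\<integral>p. f n p \<partial>(mT \<Otimes>\<^sub>M lborel)) = (\<integral>s. I n \<partial>mT)"
      using TL.integral_fst'[OF fi[of n]] by simp
    then show ?thesis by (simp add: measure_def emeasure_mT scaleR_conv_of_real)
  qed
  have Ig: "(\<integral>p. g n p \<partial>(mT \<Otimes>\<^sub>M lborel)) = of_real (\<integral>t. \<rho> t \<partial>lborel) * (\<integral>s. N s \<partial>mT)" for n
  proof -
    have "(\<integral>p. g n p \<partial>(mT \<Otimes>\<^sub>M lborel)) = (\<integral>t. (\<integral>s. g n (s, t) \<partial>mT) \<partial>lborel)"
      using TL.integral_snd[of "\<lambda>s t. g n (s, t)"] gi[of n] by simp
    also have "\<dots> = (\<integral>t. of_real (\<rho> t) * (\<integral>s. N s \<partial>mT) \<partial>lborel)"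
      unfolding g_def fst_conv snd_conv integral_mult_right_zero periodic_integral_shift[OF m b per] ..
    finally show ?thesis by simp
  qed
  have "(\<lambda>n. \<integral>p. f n p - g n p \<partial>(mT \<Otimes>\<^sub>M lborel)) \<longlonglongrightarrow> (\<integral>p. 0 \<partial>(mT \<Otimes>\<^sub>M (lborel :: real measure)))"
  proof (rule integral_dominated_convergence)
    show "integrable (mT \<Otimes>\<^sub>M lborel) (\<lambda>p. (P * B) * J (snd p) + (P * B) * J (snd p))" by (intro Bochner_Integration.integrable_add dom)
    show "AE p in mT \<Otimes>\<^sub>M lborel. norm (f n p - g n p) \<le> (P * B) * J (snd p) + (P * B) * J (snd p)" for n
      using fb[of n] by eventually_elim (rule order_trans[OF norm_triangle_ineq4 add_mono[OF _ gb]])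
    show "AE p in mT \<Otimes>\<^sub>M lborel. (\<lambda>n. f n p - g n p) \<longlonglongrightarrow> 0"
    proof (rule AE_I2)
      fix p :: "real \<times> real"
      have "(\<lambda>n. snd p + fst p / T n) \<longlonglongrightarrow> snd p" unfolding T_def by real_asymp
      moreover have "isCont \<rho> (snd p)" using c by (simp add: continuous_on_eq_continuous_at)
      ultimately have "(\<lambda>n. \<rho> (snd p + fst p / T n)) \<longlonglongrightarrow> \<rho> (snd p)" by (rule isCont_tendsto_compose[rotated])
      then have "(\<lambda>n. \<bar>\<rho> (snd p + fst p / T n) - \<rho> (snd p)\<bar> * B) \<longlonglongrightarrow> \<bar>\<rho> (snd p) - \<rho> (snd p)\<bar> * B" by (intro tendsto_intros)
      then have l: "(\<lambda>n. \<bar>\<rho> (snd p + fst p / T n) - \<rho> (snd p)\<bar> * B) \<longlonglongrightarrow> 0" by simp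
      show "(\<lambda>n. f n p - g n p) \<longlonglongrightarrow> 0"
      proof (rule Lim_null_comparison[OF _ l], rule always_eventually, rule allI)
        fix n
        have "f n p - g n p = of_real (\<rho> (snd p + fst p / T n) - \<rho> (snd p)) * N (T n * snd p + fst p)"
          by (simp add: f_def g_def algebra_simps)
        then show "norm (f n p - g n p) \<le> \<bar>\<rho> (snd p + fst p / T n) - \<rho> (snd p)\<bar> * B"
          using b by (simp add: norm_mult mult_left_mono del: of_real_diff)
      qed
    qed
  qed measurable
  then have "(\<lambda>n. of_real (2 * pi) * I n - of_real (\<integral>t. \<rho> t \<partial>lborel) * (\<integral>s. N s \<partial>mT)) \<longlonglongrightarrow> 0"
    using fi gi by (simp add: If Ig del: of_real_mult)
  then have "(\<lambda>n. of_real (2 * pi) * I n) \<longlonglongrightarrow> of_real (\<integral>t. \<rho> t \<partial>lborel) * (\<integral>s. N s \<partial>mT)" by (rule LIM_zero_cancel)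
  then have "(\<lambda>n. of_real (2 * pi) * I n / of_real (2 * pi)) \<longlonglongrightarrow> of_real (\<integral>t. \<rho> t \<partial>lborel) * (\<integral>s. N s \<partial>mT) / of_real (2 * pi)"
    by (rule tendsto_divide[OF _ tendsto_const]) simp
  then show ?thesis by (simp add: I_def T_def)
qed

section \<open>Asymptotic profiles\<close>

text \<open>The coherent state in the variable \<open>\<xi> = y/2t\<close>, unitarily rescaled and stripped of the phase
  \<open>exp (i|y|\<^sup>2/4t)\<close>; the nonlinearity commutes with this phase.\<close>

definition rescaled :: "real \<Rightarrow> real \<Rightarrow> 'a::euclidean_space \<Rightarrow> 'a \<Rightarrow> complex" where
  "rescaled t a b \<xi> = (of_real (sqrt (2 * t)) * csqrt \<i>) ^ DIM('a) * exp (- \<i> * of_real (t * (norm \<xi>)\<^sup>2)) * gy a b t ((2 * t) *\<^sub>R \<xi>)"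

text \<open>A majorant of the rescaled states that does not depend on \<open>t\<close> for t >= 1,
  and hence also of their limit.\<close>

definition gauss_bound :: "real \<Rightarrow> 'a::euclidean_space \<Rightarrow> 'a \<Rightarrow> real" where
  "gauss_bound a b \<xi> = inverse (sqrt a) ^ DIM('a) * exp (a / 2 * (norm b)\<^sup>2) * exp (- (a / (1 + 4 * a\<^sup>2)) * (norm \<xi>)\<^sup>2)"

lemma csqrt_ii_scale: assumes "0 < a" shows "csqrt (\<i> * of_real a) = of_real (sqrt a) * csqrt \<i>"
proof (rule csqrt_unique)
  show "(of_real (sqrt a) * csqrt \<i>)\<^sup>2 = \<i> * of_real a" using assms
    by (simp add: power_mult_distrib power2_csqrt of_real_power[symmetric] del: of_real_power csqrt_ii)
  show "0 < Re (of_real (sqrt a) * csqrt \<i>) \<or> Re (of_real (sqrt a) * csqrt \<i>) = 0 \<and> 0 \<le> Im (of_real (sqrt a) * csqrt \<i>)"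
    using assms by (simp add: csqrt_ii)
qed

lemma mult_interchange: "x * y * (z * w) = (x * z) * (y * (w::'a::comm_semiring_1))"
  by (simp only: mult_ac)

lemma mult_inverse_cancel: "s \<noteq> 0 \<Longrightarrow> s * i * inverse (s * c) = i / (c::complex)"
  by (cases "c = 0") (simp_all add: field_simps)

text \<open>In the rescaled variable everything depends on \<open>t\<close> through
  \<open>inverse t\<close>, and the quadratic phase of the evolved Gaussian has cancelled against
  the stripped one. The limit at infinity becomes continuity at
  \<open>inverse t = 0\<close>.\<close>

lemma rescaled_eq:
  fixes b \<xi> :: "'a::euclidean_space"
  assumes a: "0 < a" and t: "0 < t"
  shows "rescaled t a b \<xi> = (csqrt \<i> / csqrt (\<i> * of_real a + of_real (inverse t / 2))) ^ DIM('a)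
    * exp (- (\<i> * of_real ((norm \<xi>)\<^sup>2) - of_real (2 * a * (b \<bullet> \<xi>)) + of_real (a / 2 * (norm b)\<^sup>2 * inverse t)) / (of_real (inverse t) + 2 * \<i> * of_real a))"
proof -
  define r where "r = inverse t"
  have r: "0 < r" "t = inverse r" using t by (auto simp: r_def)
  define D where "D = of_real r + 2 * \<i> * of_real a"
  have D0: "D \<noteq> 0" using a by (auto simp: D_def complex_eq_iff)
  have s: "sg a t = of_real t * D" using r by (simp add: sg_def D_def distrib_left)
  have "sg a t = of_real (2 * t) * (\<i> * of_real a + of_real (inverse t / 2))" using t by (simp add: sg_def field_simps)
  then have c: "csqrt (sg a t) = of_real (sqrt (2 * t)) * csqrt (\<i> * of_real a + of_real (inverse t / 2))"
    using inverse_csqrt_scale[of "2 * t" "\<i> * of_real a + of_real (inverse t / 2)"] t by simp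
  have n: "(norm ((2 * t) *\<^sub>R \<xi> - b))\<^sup>2 = 4 * t\<^sup>2 * (norm \<xi>)\<^sup>2 - 4 * t * (b \<bullet> \<xi>) + (norm b)\<^sup>2"
    unfolding power2_norm_eq_inner by (simp add: inner_diff inner_commute algebra_simps power2_eq_square)
  have "- \<i> * of_real (t * (norm \<xi>)\<^sup>2) + (- of_real (a / 2 * (norm ((2 * t) *\<^sub>R \<xi> - b))\<^sup>2) / sg a t)
    = - (\<i> * of_real ((norm \<xi>)\<^sup>2) - of_real (2 * a * (b \<bullet> \<xi>)) + of_real (a / 2 * (norm b)\<^sup>2 * inverse t)) / D"
  proof -
    have "of_real t * D \<noteq> 0" using D0 t by simp
    then have "- \<i> * of_real (t * (norm \<xi>)\<^sup>2) + (- of_real (a / 2 * (norm ((2 * t) *\<^sub>R \<xi> - b))\<^sup>2) / (of_real t * D))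
      = (- \<i> * of_real (t * (norm \<xi>)\<^sup>2) * (of_real t * D) - of_real (a / 2 * (norm ((2 * t) *\<^sub>R \<xi> - b))\<^sup>2)) / (of_real t * D)"
      by (simp add: add_divide_distrib diff_divide_distrib)
    also have "- \<i> * of_real (t * (norm \<xi>)\<^sup>2) * (of_real t * D) - of_real (a / 2 * (norm ((2 * t) *\<^sub>R \<xi> - b))\<^sup>2)
      = of_real t * - (\<i> * of_real ((norm \<xi>)\<^sup>2) - of_real (2 * a * (b \<bullet> \<xi>)) + of_real (a / 2 * (norm b)\<^sup>2 * inverse t))"
      unfolding n D_def r_def using t by (simp add: complex_eq_iff algebra_simps power2_eq_square)
    finally show ?thesis using t s by simp
  qed
  then have "exp (- \<i> * of_real (t * (norm \<xi>)\<^sup>2)) * exp (- of_real (a / 2 * (norm ((2 * t) *\<^sub>R \<xi> - b))\<^sup>2) / sg a t)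
    = exp (- (\<i> * of_real ((norm \<xi>)\<^sup>2) - of_real (2 * a * (b \<bullet> \<xi>)) + of_real (a / 2 * (norm b)\<^sup>2 * inverse t)) / D)"
    unfolding exp_add[symmetric] by simp
  moreover have "(of_real (sqrt (2 * t)) * csqrt \<i>) ^ DIM('a) * inverse (csqrt (sg a t)) ^ DIM('a)
    = (csqrt \<i> / csqrt (\<i> * of_real a + of_real (inverse t / 2))) ^ DIM('a)"
    unfolding power_mult_distrib[symmetric] power_inverse[symmetric] c using t by (subst mult_inverse_cancel) simp_all
  ultimately show ?thesis unfolding rescaled_def gy_def D_def r_def by (subst mult_interchange) (simp only:)
qed

lemma rescaled_tendsto:
  fixes b \<xi> :: "'a::euclidean_space"
  assumes a: "0 < a"
  shows "((\<lambda>t. rescaled t a b \<xi>) \<longlongrightarrow> prof a b \<xi>) at_top"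
proof -
  define F where "F r = (csqrt \<i> / csqrt (\<i> * of_real a + of_real (r / 2))) ^ DIM('a)
    * exp (- (\<i> * of_real ((norm \<xi>)\<^sup>2) - of_real (2 * a * (b \<bullet> \<xi>)) + of_real (a / 2 * (norm b)\<^sup>2 * r)) / (of_real r + 2 * \<i> * of_real a))" for r
  have nn: "\<i> * of_real a + of_real (0 / 2) \<notin> \<real>\<^sub>\<le>\<^sub>0" using a by (simp add: complex_nonpos_Reals_iff)
  have "(\<lambda>r::real. csqrt (\<i> * of_real a + of_real (r / 2))) \<midarrow>0\<rightarrow> csqrt (\<i> * of_real a + of_real (0 / 2))"
    by (rule isCont_tendsto_compose[OF continuous_at_csqrt[OF nn]]) (intro tendsto_intros, simp)
  then have "F \<midarrow>0\<rightarrow> F 0" unfolding F_def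
    by (intro tendsto_intros) (use a in \<open>auto simp: csqrt_ii_scale complex_eq_iff\<close>)
  then have cF: "isCont F 0" by (simp add: isCont_def)
  \<comment> \<open>At r = 0 the root of i a factors into sqrt a and the root of i; the latter is
    cancelled by the normalising factor built into \<open>rescaled\<close>.\<close>
  have F0: "F 0 = prof a b \<xi>"
  proof -
    have "(csqrt \<i> / csqrt (\<i> * of_real a + of_real (0 / 2))) ^ DIM('a) = of_real (inverse (sqrt a) ^ DIM('a))"
    proof -
      have "csqrt \<i> / (of_real (sqrt a) * csqrt \<i>) = inverse (of_real (sqrt a))"
        by (simp add: field_simps del: csqrt_ii)
      then show ?thesis using a by (simp add: csqrt_ii_scale power_inverse del: csqrt_ii)
    qed
    moreover have "- (\<i> * of_real ((norm \<xi>)\<^sup>2) - of_real (2 * a * (b \<bullet> \<xi>)) + of_real (a / 2 * (norm b)\<^sup>2 * 0)) / (of_real 0 + 2 * \<i> * of_real a)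
      = - of_real ((norm \<xi>)\<^sup>2 / (2 * a)) - \<i> * of_real (b \<bullet> \<xi>)"
      using a by (simp add: field_simps)
    ultimately show ?thesis unfolding F_def prof_def by simp
  qed
  have "((\<lambda>t. F (inverse t)) \<longlongrightarrow> prof a b \<xi>) at_top"
    unfolding F0[symmetric] by (rule isCont_tendsto_compose[OF cF tendsto_inverse_0_at_top[OF filterlim_ident]])
  moreover have "\<forall>\<^sub>F t in at_top. F (inverse t) = rescaled t a b \<xi>"
    using eventually_gt_at_top[of 0] by eventually_elim (simp add: F_def rescaled_eq[OF a])
  ultimately show ?thesis by (rule Lim_transform_eventually)
qed

text \<open>The amplitude is controlled by |sg a t| >= 2 a t. In the exponent, |2 t \<xi>|^2 <= 2 |2
  t \<xi> - b|^2 + 2 |b|^2 moves the centre into a constant, and the rate \<open>g\<close> satisfies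
  g <= a / 2 and 2 t^2 g >= a / (1 + 4 a^2), the latter because t >= 1.\<close>

lemma rescaled_bound:
  fixes b \<xi> :: "'a::euclidean_space"
  assumes a: "0 < a" and t: "1 \<le> t"
  shows "cmod (rescaled t a b \<xi>) \<le> gauss_bound a b \<xi>"
proof -
  have "2 * a * t \<le> cmod (sg a t)" using abs_Im_le_cmod[of "sg a t"] by simp
  moreover have "0 < 2 * a * t" using a t by simp
  ultimately have "sqrt (2 * t) * inverse (sqrt (cmod (sg a t))) \<le> sqrt (2 * t) * inverse (sqrt (2 * a * t))"
    using t by (intro mult_left_mono le_imp_inverse_le real_sqrt_le_mono) auto
  also have "\<dots> = inverse (sqrt a)" using a t by (simp add: real_sqrt_mult field_simps)
  finally have 1: "(sqrt (2 * t) * inverse (sqrt (cmod (sg a t)))) ^ DIM('a) \<le> inverse (sqrt a) ^ DIM('a)"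
    using t by (intro power_mono) auto
  define g where "g = a / (2 * (1 + 4 * a\<^sup>2 * t\<^sup>2))"
  have g0: "0 \<le> g" using a by (simp add: g_def)
  have p: "0 < 1 + 4 * a\<^sup>2" "0 < 1 + 4 * a\<^sup>2 * t\<^sup>2" "0 < 1 + a\<^sup>2 * 4" "0 < 1 + a\<^sup>2 * t\<^sup>2 * 4"
    by (simp_all add: add_pos_nonneg)
  have ga: "g \<le> a / 2" unfolding g_def using a p(2) by (intro divide_left_mono) auto
  have gt: "a / (1 + 4 * a\<^sup>2) \<le> 2 * t\<^sup>2 * g"
  proof -
    have "a * (1 + 4 * a\<^sup>2 * t\<^sup>2) \<le> (a * t\<^sup>2) * (1 + 4 * a\<^sup>2)"
      using mult_left_mono[of 1 "t\<^sup>2" a] a t by (simp add: algebra_simps)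
    then have "a / (1 + 4 * a\<^sup>2) \<le> (a * t\<^sup>2) / (1 + 4 * a\<^sup>2 * t\<^sup>2)"
      using p by (simp only: pos_divide_le_eq pos_le_divide_eq times_divide_eq_left)
    also have "\<dots> = 2 * t\<^sup>2 * g" unfolding g_def times_divide_eq_right using p(2) by (subst frac_eq_eq) auto
    finally show ?thesis .
  qed
  have "(norm ((2 * t) *\<^sub>R \<xi>))\<^sup>2 \<le> 2 * (norm ((2 * t) *\<^sub>R \<xi> - b))\<^sup>2 + 2 * (norm b)\<^sup>2"
    using norm_add_sq_le[of "(2 * t) *\<^sub>R \<xi> - b" b] by simp
  then have "2 * t\<^sup>2 * (norm \<xi>)\<^sup>2 - (norm b)\<^sup>2 \<le> (norm ((2 * t) *\<^sub>R \<xi> - b))\<^sup>2"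
    using t by (simp add: power_mult_distrib)
  then have "g * (2 * t\<^sup>2 * (norm \<xi>)\<^sup>2 - (norm b)\<^sup>2) \<le> g * (norm ((2 * t) *\<^sub>R \<xi> - b))\<^sup>2" by (rule mult_left_mono[OF _ g0])
  moreover have "a / (1 + 4 * a\<^sup>2) * (norm \<xi>)\<^sup>2 \<le> 2 * t\<^sup>2 * g * (norm \<xi>)\<^sup>2" by (intro mult_right_mono gt) simp
  moreover have "g * (norm b)\<^sup>2 \<le> a / 2 * (norm b)\<^sup>2" by (intro mult_right_mono ga) simp
  moreover have "g * (2 * t\<^sup>2 * (norm \<xi>)\<^sup>2 - (norm b)\<^sup>2) = 2 * t\<^sup>2 * g * (norm \<xi>)\<^sup>2 - g * (norm b)\<^sup>2"
    by (simp add: right_diff_distrib)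
  moreover have "- g * (norm ((2 * t) *\<^sub>R \<xi> - b))\<^sup>2 = - (g * (norm ((2 * t) *\<^sub>R \<xi> - b))\<^sup>2)"
    "- (a / (1 + 4 * a\<^sup>2)) * (norm \<xi>)\<^sup>2 = - (a / (1 + 4 * a\<^sup>2) * (norm \<xi>)\<^sup>2)" by simp_all
  ultimately have "- g * (norm ((2 * t) *\<^sub>R \<xi> - b))\<^sup>2 \<le> a / 2 * (norm b)\<^sup>2 + - (a / (1 + 4 * a\<^sup>2)) * (norm \<xi>)\<^sup>2"
    by linarith
  then have 2: "exp (- g * (norm ((2 * t) *\<^sub>R \<xi> - b))\<^sup>2) \<le> exp (a / 2 * (norm b)\<^sup>2) * exp (- (a / (1 + 4 * a\<^sup>2)) * (norm \<xi>)\<^sup>2)"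
    unfolding exp_add[symmetric] by (simp only: exp_le_cancel_iff)
  have "cmod (csqrt \<i>) = 1" by (simp add: norm_csqrt del: csqrt_ii)
  then have "cmod (rescaled t a b \<xi>) = (sqrt (2 * t) * inverse (sqrt (cmod (sg a t)))) ^ DIM('a) * exp (- g * (norm ((2 * t) *\<^sub>R \<xi> - b))\<^sup>2)"
    unfolding rescaled_def norm_mult norm_gy norm_power g_def using t
    by (simp only: norm_of_real norm_exp_eq_Re) (simp add: power_mult_distrib)
  also have "\<dots> \<le> inverse (sqrt a) ^ DIM('a) * (exp (a / 2 * (norm b)\<^sup>2) * exp (- (a / (1 + 4 * a\<^sup>2)) * (norm \<xi>)\<^sup>2))"
    using a by (intro mult_mono 1 2) auto
  finally show ?thesis by (simp add: gauss_bound_def mult.assoc)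
qed

lemma prof_bound:
  fixes b \<xi> :: "'a::euclidean_space"
  assumes a: "0 < a"
  shows "cmod (prof a b \<xi>) \<le> gauss_bound a b \<xi>"
proof -
  have "((\<lambda>t. cmod (rescaled t a b \<xi>)) \<longlongrightarrow> cmod (prof a b \<xi>)) at_top" by (intro tendsto_norm rescaled_tendsto a)
  then show ?thesis
    by (rule tendsto_upperbound) (auto intro!: eventually_mono[OF eventually_ge_at_top[of 1]] rescaled_bound[OF a])
qed

lemma rescaled_measurable [measurable]: "rescaled t a b \<in> borel_measurable borel"
  unfolding rescaled_def[abs_def] by measurable

text \<open>The family \<open>P\<close> stands for either \<open>rescaled t\<close> or
  \<open>prof\<close>, so bounds and measurability are proved once for the evolved combination and
  for its limit.\<close>

definition mode_sum :: "(real \<Rightarrow> 'a::euclidean_space \<Rightarrow> 'a \<Rightarrow> complex) \<Rightarrow> 'a modes \<Rightarrow> real \<Rightarrow> 'a \<times> real \<Rightarrow> complex" where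
  "mode_sum P L t z = (\<Sum>(c, a, b, k)\<leftarrow>L. c * (P a b (fst z) * ek k t (snd z)))"

lemma mode_sum_simps: "mode_sum P [] t z = 0" "mode_sum P ((c, a, b, k) # L) t z = c * (P a b (fst z) * ek k t (snd z)) + mode_sum P L t z"
  by (simp_all add: mode_sum_def)

text \<open>The common requirement met by \<open>prof\<close> and by \<open>rescaled t\<close> for
  every t >= 1.\<close>

definition dominated :: "(real \<Rightarrow> 'a::euclidean_space \<Rightarrow> 'a \<Rightarrow> complex) \<Rightarrow> bool" where
  "dominated P \<longleftrightarrow> (\<forall>a b. P a b \<in> borel_measurable borel) \<and> (\<forall>a b \<xi>. 0 < a \<longrightarrow> cmod (P a b \<xi>) \<le> gauss_bound a b \<xi>)"

lemma dominated_prof: "dominated prof" by (simp add: dominated_def prof_bound)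

lemma dominated_mm: "1 \<le> t \<Longrightarrow> dominated (rescaled t)" by (simp add: dominated_def rescaled_bound)

lemma ek_measurable2 [measurable]: "(\<lambda>w. ek k (f w) (g w)) \<in> borel_measurable M"
  if [measurable]: "f \<in> borel_measurable M" "g \<in> borel_measurable M"
  unfolding ek_def by measurable

lemma mode_sum_measurable2:
  assumes "dominated P" and [measurable]: "f \<in> borel_measurable M" "g \<in> borel_measurable M" "h \<in> borel_measurable M"
  shows "(\<lambda>w. mode_sum P L (f w) (g w, h w)) \<in> borel_measurable M"
proof (induction L)
  case Nil
  then show ?case by (simp add: mode_sum_simps)
next
  case (Cons x L)
  obtain c a b k where x: "x = (c, a, b, k)" by (cases x)
  note [measurable] = Cons
  have [measurable]: "P a b \<in> borel_measurable borel" using assms(1) by (simp add: dominated_def)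
  show ?case unfolding x mode_sum_simps fst_conv snd_conv by measurable
qed

text \<open>The constants are chosen before \<open>P\<close> and \<open>t\<close>: this uniformity
  over all times is what dominated convergence and the averaging argument use. Along the list the
  smaller of two Gaussian rates is kept.\<close>

lemma mode_sum_bound:
  fixes L :: "'a::euclidean_space modes"
  assumes "valid L"
  shows "\<exists>C c. 0 \<le> C \<and> 0 < c \<and> (\<forall>P t z. dominated P \<longrightarrow> cmod (mode_sum P L t z) \<le> C * exp (- c * (norm (fst z))\<^sup>2))"
  using assms
proof (induction L)
  case Nil
  then show ?case by (intro exI[of _ 0] exI[of _ 1]) (simp add: mode_sum_simps)
next
  case (Cons x L)
  obtain e a b k where x: "x = (e, a, b, k)" by (cases x)
  have a: "0 < a" "valid L" using Cons.prems by (simp_all add: x)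
  obtain C c where C: "0 \<le> C" "0 < c" "\<And>P t z. dominated P \<Longrightarrow> cmod (mode_sum P L t z) \<le> C * exp (- c * (norm (fst z))\<^sup>2)"
    using Cons.IH[OF a(2)] by blast
  define c1 where "c1 = a / (1 + 4 * a\<^sup>2)"
  define C1 where "C1 = cmod e * (inverse (sqrt a) ^ DIM('a) * exp (a / 2 * (norm b)\<^sup>2))"
  have c1: "0 < c1" using a by (simp add: c1_def add_pos_nonneg)
  have C1: "0 \<le> C1" using a by (simp add: C1_def)
  have "cmod (mode_sum P (x # L) t z) \<le> (C1 + C) * exp (- min c c1 * (norm (fst z))\<^sup>2)" if P: "dominated P" for P t z
  proof -
    have "cmod (mode_sum P (x # L) t z) \<le> cmod e * cmod (P a b (fst z)) + cmod (mode_sum P L t z)"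
      unfolding x mode_sum_simps by (rule norm_triangle_ineq[THEN order_trans]) (simp add: norm_mult)
    also have "\<dots> \<le> cmod e * gauss_bound a b (fst z) + C * exp (- c * (norm (fst z))\<^sup>2)"
      using P a by (intro add_mono mult_left_mono C) (auto simp: dominated_def)
    also have "\<dots> = C1 * exp (- c1 * (norm (fst z))\<^sup>2) + C * exp (- c * (norm (fst z))\<^sup>2)"
      by (simp add: gauss_bound_def C1_def c1_def mult.assoc)
    also have "\<dots> \<le> C1 * exp (- min c c1 * (norm (fst z))\<^sup>2) + C * exp (- min c c1 * (norm (fst z))\<^sup>2)"
      by (intro add_mono mult_left_mono C1 C) (auto intro: mult_right_mono)
    finally show ?thesis by (simp add: distrib_right)
  qed
  moreover have "0 < min c c1" using C c1 by simp
  ultimately show ?case using C(1) C1 by (intro exI[of _ "C1 + C"] exI[of _ "min c c1"]) simp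
qed

lemma mode_sum_tendsto:
  fixes L :: "'a::euclidean_space modes"
  assumes "valid L"
  shows "((\<lambda>t. mode_sum (rescaled t) L t z - mode_sum prof L t z) \<longlongrightarrow> 0) at_top"
  using assms
proof (induction L)
  case Nil
  then show ?case by (simp add: mode_sum_simps)
next
  case (Cons x L)
  obtain e a b k where x: "x = (e, a, b, k)" by (cases x)
  have a: "0 < a" "valid L" using Cons.prems by (simp_all add: x)
  have "((\<lambda>t. rescaled t a b (fst z) - prof a b (fst z)) \<longlongrightarrow> 0) at_top"
    using tendsto_diff[OF rescaled_tendsto[OF a(1), of b "fst z"] tendsto_const[of "prof a b (fst z)"]] by simp
  then have "((\<lambda>t. cmod (rescaled t a b (fst z) - prof a b (fst z)) * 1) \<longlongrightarrow> 0) at_top" by (simp add: tendsto_norm_zero)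
  then have "((\<lambda>t. cmod ((rescaled t a b (fst z) - prof a b (fst z)) * ek k t (snd z))) \<longlongrightarrow> 0) at_top"
    unfolding norm_mult norm_ek .
  then have "((\<lambda>t. e * ((rescaled t a b (fst z) - prof a b (fst z)) * ek k t (snd z))) \<longlongrightarrow> 0) at_top"
    by (rule tendsto_mult_right_zero[OF tendsto_norm_zero_cancel])
  from tendsto_add[OF this Cons.IH[OF a(2)]]
  have *: "((\<lambda>t. e * ((rescaled t a b (fst z) - prof a b (fst z)) * ek k t (snd z)) + (mode_sum (rescaled t) L t z - mode_sum prof L t z)) \<longlongrightarrow> 0) at_top"
    by (simp only: add_0_left)
  have "e * (p * s) + A - (e * (r * s) + B) = e * ((p - r) * s) + (A - B)" for p r s A B :: complex
    by (simp only: left_diff_distrib right_diff_distrib add_diff_add)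
  then have eq: "(\<lambda>t. mode_sum (rescaled t) (x # L) t z - mode_sum prof (x # L) t z) = (\<lambda>t. e * ((rescaled t a b (fst z) - prof a b (fst z)) * ek k t (snd z)) + (mode_sum (rescaled t) L t z - mode_sum prof L t z))"
    unfolding x mode_sum_simps by (intro ext)
  show ?case unfolding eq by (rule *)
qed

lemma mX_integrable_exp:
  assumes "0 < c" shows "integrable mX (\<lambda>z::'a::euclidean_space \<times> real. C * exp (- c * (norm (fst z))\<^sup>2))"
proof -
  have "integrable mT (\<lambda>_. 1::real)" by simp
  from integrable_prod_mult(1)[OF sigma_finite_lborel sigma_finite_mT gaussian_integrable[OF assms] this]
  show ?thesis unfolding mX_def by (intro integrable_mult_right) simp
qed

lemma fnl_mode_sum_bound:
  fixes L L' :: "'a::euclidean_space modes"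
  assumes L: "valid L" "valid L'" and q: "0 \<le> q" "q \<le> 1"
  shows "\<exists>C c. 0 \<le> C \<and> 0 < c \<and> (\<forall>P t z. dominated P \<longrightarrow> cmod (fnl q (mode_sum P L t z) * cnj (mode_sum P L' t z)) \<le> C * exp (- c * (norm (fst z))\<^sup>2))"
proof -
  obtain C c where C: "0 \<le> C" "0 < c" "\<And>P t z. dominated P \<Longrightarrow> cmod (mode_sum P L t z) \<le> C * exp (- c * (norm (fst z))\<^sup>2)"
    using mode_sum_bound[OF L(1)] by blast
  obtain C' c' where C': "0 \<le> C'" "0 < c'" "\<And>P t z. dominated P \<Longrightarrow> cmod (mode_sum P L' t z) \<le> C' * exp (- c' * (norm (fst z))\<^sup>2)"
    using mode_sum_bound[OF L(2)] by blast
  have "cmod (fnl q (mode_sum P L t z) * cnj (mode_sum P L' t z)) \<le> ((1 + C\<^sup>2) * C') * exp (- c' * (norm (fst z))\<^sup>2)" if P: "dominated P" for P t z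
  proof -
    have "C * exp (- c * (norm (fst z))\<^sup>2) \<le> C * 1" using C by (intro mult_left_mono) auto
    then have "cmod (mode_sum P L t z) \<le> C" using C(3)[OF P, of t z] by simp
    then have "1 + (cmod (mode_sum P L t z))\<^sup>2 \<le> 1 + C\<^sup>2" by (intro add_left_mono power_mono) auto
    then have "cmod (fnl q (mode_sum P L t z)) \<le> 1 + C\<^sup>2" using fnl_bound[OF q, of "mode_sum P L t z"] by simp
    then have "cmod (fnl q (mode_sum P L t z)) * cmod (mode_sum P L' t z) \<le> (1 + C\<^sup>2) * (C' * exp (- c' * (norm (fst z))\<^sup>2))"
      by (intro mult_mono C' P) auto
    then show ?thesis by (simp add: norm_mult mult.assoc)
  qed
  then show ?thesis using C' by (intro exI[of _ "(1 + C\<^sup>2) * C'"] exI[of _ c']) auto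
qed

definition pairing :: "real \<Rightarrow> (real \<Rightarrow> 'a::euclidean_space \<Rightarrow> 'a \<Rightarrow> complex) \<Rightarrow> 'a modes \<Rightarrow> 'a modes \<Rightarrow> real \<Rightarrow> complex" where
  "pairing q P L L' t = (\<integral>z. fnl q (mode_sum P L t z) * cnj (mode_sum P L' t z) \<partial>mX)"

lemma mode_sum_mX_measurable: "dominated P \<Longrightarrow> mode_sum P L t \<in> borel_measurable borel"
  unfolding borel_prod[symmetric]
  using mode_sum_measurable2[of P "\<lambda>_. t" "borel \<Otimes>\<^sub>M borel" fst snd L] by simp

lemma fnl_mode_sum_measurable: "dominated P \<Longrightarrow> (\<lambda>z. fnl q (mode_sum P L t z) * cnj (mode_sum P L' t z)) \<in> borel_measurable borel"
  using mode_sum_mX_measurable[of P L t] mode_sum_mX_measurable[of P L' t] by measurable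

lemma fnl_mode_sum_integrable:
  assumes "valid L" "valid L'" "0 \<le> q" "q \<le> 1" "dominated P"
  shows "integrable mX (\<lambda>z. fnl q (mode_sum P L t z) * cnj (mode_sum P L' t z))"
proof -
  obtain C c where C: "0 < c" "\<And>P t z. dominated P \<Longrightarrow> cmod (fnl q (mode_sum P L t z) * cnj (mode_sum P L' t z)) \<le> C * exp (- c * (norm (fst z))\<^sup>2)"
    using fnl_mode_sum_bound[OF assms(1-4)] by blast
  show ?thesis
    by (rule Bochner_Integration.integrable_bound[OF mX_integrable_exp[OF C(1), of C]])
       (use fnl_mode_sum_measurable[OF assms(5)] C(2)[OF assms(5)] in \<open>auto intro!: AE_I2 intro: order_trans[OF _ abs_ge_self] cong: measurable_cong_sets\<close>)
qed

text \<open>For each \<xi> the two mode sums approach each other although neither converges in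
  \<open>t\<close>, since the periodic factors are common to both; the common Gaussian majorant then
  passes the limit under the integral.\<close>

lemma pairing_tendsto:
  fixes L L' :: "'a::euclidean_space modes"
  assumes L: "valid L" "valid L'" and q: "0 < q" "q \<le> 1"
  shows "((\<lambda>t. pairing q (rescaled t) L L' t - pairing q prof L L' t) \<longlongrightarrow> 0) at_top"
proof -
  obtain C c where C: "0 \<le> C" "0 < c" "\<And>P t z. dominated P \<Longrightarrow> cmod (fnl q (mode_sum P L t z) * cnj (mode_sum P L' t z)) \<le> C * exp (- c * (norm (fst z))\<^sup>2)"
    using fnl_mode_sum_bound[OF L] q by (metis less_imp_le)
  define D where "D t z = fnl q (mode_sum (rescaled t) L t z) * cnj (mode_sum (rescaled t) L' t z) - fnl q (mode_sum prof L t z) * cnj (mode_sum prof L' t z)" for t z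
  note [measurable] = fnl_mode_sum_measurable[OF dominated_prof] fnl_mode_sum_measurable[OF dominated_mm]
  have i: "integrable mX (\<lambda>z. fnl q (mode_sum P L t z) * cnj (mode_sum P L' t z))" if "dominated P" for P t
    by (rule fnl_mode_sum_integrable[OF L less_imp_le[OF q(1)] q(2) that])
  \<comment> \<open>The truncation \<open>max 1 t\<close> keeps the time in the range where
    \<open>rescaled\<close> is dominated, so the integrand is controlled for every
    \<open>t\<close>.\<close>
  have "((\<lambda>t. \<integral>z. D (max 1 t) z \<partial>mX) \<longlongrightarrow> (\<integral>z. 0 \<partial>(mX :: ('a \<times> real) measure))) at_top"
  proof (rule integral_dominated_convergence_at_top)
    show "integrable mX (\<lambda>z::'a \<times> real. (C + C) * exp (- c * (norm (fst z))\<^sup>2))" by (rule mX_integrable_exp[OF C(2)])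
    show "\<forall>\<^sub>F t in at_top. AE z in mX. norm (D (max 1 t) z) \<le> (C + C) * exp (- c * (norm (fst z))\<^sup>2)"
      unfolding D_def distrib_right
      by (intro always_eventually allI AE_I2 norm_triangle_ineq4[THEN order_trans] add_mono C(3) dominated_mm dominated_prof) simp
    show "D (max 1 t) \<in> borel_measurable mX" for t
      using fnl_mode_sum_measurable[OF dominated_mm[of "max 1 t"], of q L "max 1 t" L'] unfolding D_def[abs_def] by (simp cong: measurable_cong_sets)
    show "AE z in mX. ((\<lambda>t. D (max 1 t) z) \<longlongrightarrow> 0) at_top"
    proof (rule AE_I2)
      fix z :: "'a \<times> real"
      obtain B where B: "\<And>P t. dominated P \<Longrightarrow> cmod (mode_sum P L t z) \<le> B"
        using mode_sum_bound[OF L(1)] by blast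
      obtain B' where B': "\<And>P t. dominated P \<Longrightarrow> cmod (mode_sum P L' t z) \<le> B'"
        using mode_sum_bound[OF L(2)] by blast
      have B0: "0 \<le> B" using B[OF dominated_prof, of 0] norm_ge_zero order_trans by blast
      define d where "d t = cmod (mode_sum (rescaled t) L t z - mode_sum prof L t z)" for t
      define d' where "d' t = cmod (mode_sum (rescaled t) L' t z - mode_sum prof L' t z)" for t
      have d0: "(d \<longlongrightarrow> 0) at_top" "(d' \<longlongrightarrow> 0) at_top"
        unfolding d_def d'_def using mode_sum_tendsto[OF L(1), of z] mode_sum_tendsto[OF L(2), of z] by (simp_all add: tendsto_norm_zero)
      have "((\<lambda>t. 2 * d t * (1 + 2 * B) * B' + (1 + B\<^sup>2) * d' t) \<longlongrightarrow> 2 * 0 * (1 + 2 * B) * B' + (1 + B\<^sup>2) * 0) at_top"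
        by (intro tendsto_intros d0)
      moreover have "cmod (D t z) \<le> 2 * d t * (1 + 2 * B) * B' + (1 + B\<^sup>2) * d' t" if t: "1 \<le> t" for t
      proof -
        note b = B[OF dominated_mm[OF t], of t] B[OF dominated_prof, of t] B'[OF dominated_mm[OF t], of t]
        have "D t z = (fnl q (mode_sum (rescaled t) L t z) - fnl q (mode_sum prof L t z)) * cnj (mode_sum (rescaled t) L' t z)
           + fnl q (mode_sum prof L t z) * cnj (mode_sum (rescaled t) L' t z - mode_sum prof L' t z)"
          by (simp add: D_def algebra_simps)
        then have "cmod (D t z) \<le> cmod (fnl q (mode_sum (rescaled t) L t z) - fnl q (mode_sum prof L t z)) * cmod (mode_sum (rescaled t) L' t z)
           + cmod (fnl q (mode_sum prof L t z)) * d' t"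
          unfolding d'_def by (metis norm_triangle_ineq norm_mult complex_mod_cnj)
        also have "\<dots> \<le> (2 * d t * (1 + 2 * B)) * B' + (1 + B\<^sup>2) * d' t"
        proof (intro add_mono mult_mono)
          have "cmod (fnl q (mode_sum (rescaled t) L t z) - fnl q (mode_sum prof L t z)) \<le> 2 * d t * (1 + (cmod (mode_sum (rescaled t) L t z) + cmod (mode_sum prof L t z)))"
            using fnl_diff[OF q, of 1 "mode_sum (rescaled t) L t z" "mode_sum prof L t z"] by (simp add: d_def)
          also have "\<dots> \<le> 2 * d t * (1 + 2 * B)" using b by (intro mult_left_mono) (auto simp: d_def)
          finally show "cmod (fnl q (mode_sum (rescaled t) L t z) - fnl q (mode_sum prof L t z)) \<le> 2 * d t * (1 + 2 * B)" .
          have "(cmod (mode_sum prof L t z))\<^sup>2 \<le> B\<^sup>2" using b by (intro power_mono) auto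
          then show "cmod (fnl q (mode_sum prof L t z)) \<le> 1 + B\<^sup>2" using fnl_bound[of q "mode_sum prof L t z"] q by linarith
        qed (use b B0 in \<open>auto simp: d_def d'_def\<close>)
        finally show ?thesis .
      qed
      ultimately have "((\<lambda>t. D t z) \<longlongrightarrow> 0) at_top"
        by (intro Lim_null_comparison[of "\<lambda>t. D t z" _ at_top]) (auto intro!: eventually_mono[OF eventually_ge_at_top[of 1]])
      moreover have "\<forall>\<^sub>F t in at_top. D t z = D (max 1 t) z"
        using eventually_ge_at_top[of 1] by eventually_elim (simp add: max_def)
      ultimately show "((\<lambda>t. D (max 1 t) z) \<longlongrightarrow> 0) at_top" by (rule Lim_transform_eventually)
    qed
  qed simp
  moreover have "\<forall>\<^sub>F t in at_top. (\<integral>z. D (max 1 t) z \<partial>mX) = pairing q (rescaled t) L L' t - pairing q prof L L' t"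
    using eventually_ge_at_top[of 1]
  proof eventually_elim
    case (elim t)
    then show ?case unfolding pairing_def D_def
      by (subst Bochner_Integration.integral_diff) (auto intro!: i dominated_mm dominated_prof simp: max_def)
  qed
  ultimately show ?thesis using Lim_transform_eventually by force
qed

lemma mode_sum_mm_eq:
  "mode_sum (rescaled t) L t z = (of_real (sqrt (2 * t)) * csqrt \<i>) ^ DIM('a) * exp (- \<i> * of_real (t * (norm (fst z))\<^sup>2))
     * comb L t ((2 * t) *\<^sub>R fst (z :: 'a::euclidean_space \<times> real), snd z)"
proof (induction L)
  case Nil
  then show ?case by (simp add: mode_sum_simps comb_Nil)
next
  case (Cons x L)
  obtain e a b k where x: "x = (e, a, b, k)" by (cases x)
  show ?case unfolding x mode_sum_simps comb_Cons Cons.IH by (simp add: rescaled_def gm_def distrib_left mult_ac)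
qed

lemma fnl_scale: "fnl q (c * z) = of_real (cmod c powr q) * c * fnl q z"
  by (simp add: fnl_def norm_mult powr_mult)

lemma mX_scale:
  fixes F :: "'a::euclidean_space \<times> real \<Rightarrow> complex"
  assumes c: "0 < c" and F: "integrable mX F" "integrable mX (\<lambda>z. F (c *\<^sub>R fst z, snd z))" and m: "F \<in> borel_measurable borel"
  shows "(\<integral>z. F z \<partial>mX) = of_real (c ^ DIM('a)) * (\<integral>z. F (c *\<^sub>R fst z, snd z) \<partial>mX)"
proof -
  have [measurable]: "(\<lambda>y. F (y, x)) \<in> borel_measurable borel" for x
    using measurable_Pair2[of F borel borel] m[unfolded borel_prod[symmetric]]
    by (intro measurable_compose[OF _ m]) (simp add: borel_prod[symmetric])
  have "(\<integral>z. F z \<partial>mX) = (\<integral>x. (\<integral>y. F (y, x) \<partial>lborel) \<partial>mT)"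
    using lT.integral_snd[of "\<lambda>y x. F (y, x)"] F(1) by (simp add: mX_def)
  also have "\<dots> = (\<integral>x. c ^ DIM('a) *\<^sub>R (\<integral>y. F (c *\<^sub>R y, x) \<partial>lborel) \<partial>mT)"
    using lborel_integral_affine(1)[of c _ 0] c by (intro Bochner_Integration.integral_cong refl) (subst lborel_integral_affine(1)[of c _ 0], auto)
  also have "\<dots> = of_real (c ^ DIM('a)) * (\<integral>x. (\<integral>y. F (c *\<^sub>R y, x) \<partial>lborel) \<partial>mT)"
    by (simp add: scaleR_conv_of_real)
  also have "(\<integral>x. (\<integral>y. F (c *\<^sub>R y, x) \<partial>lborel) \<partial>mT) = (\<integral>z. F (c *\<^sub>R fst z, snd z) \<partial>mX)"
    using lT.integral_snd[of "\<lambda>y x. F (c *\<^sub>R y, x)"] F(2) by (simp add: mX_def case_prod_unfold)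
  finally show ?thesis .
qed

lemma comb_measurable [measurable]: "comb L t \<in> borel_measurable borel"
  by (induction L) (auto simp: comb_Nil comb_Cons)

text \<open>The source of \<delta>. Both arguments are multiplied by a scalar \<kappa> with
  |\<kappa>| = (2t)^(d/2) and a phase depending on \<xi>. The nonlinear pairing is homogeneous of
  degree q + 2 and blind to the phase, which gives (2t)^(d q / 2) (2t)^d; the Jacobian of y = 2 t
  \<xi> absorbs the second power.\<close>

lemma pairing_scaling:
  fixes L L' :: "'a::euclidean_space modes"
  assumes L: "valid L" "valid L'" and q: "0 < q" "q \<le> 1" and t: "1 \<le> t"
  shows "pairing q (rescaled t) L L' t = of_real ((2 * t) powr (real DIM('a) * q / 2)) * (\<integral>z. fnl q (comb L t z) * cnj (comb L' t z) \<partial>mX)"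
    and "integrable mX (\<lambda>z. fnl q (comb L t z) * cnj (comb L' t z))"
proof -
  define F where "F z = fnl q (comb L t z) * cnj (comb L' t z)" for z
  have Fm[measurable]: "F \<in> borel_measurable borel" unfolding F_def[abs_def] by measurable
  define s where "s = sqrt (2 * t)"
  have s0: "0 < s" using t by (simp add: s_def)
  have key: "fnl q (mode_sum (rescaled t) L t z) * cnj (mode_sum (rescaled t) L' t z)
    = of_real ((2 * t) powr (real DIM('a) * q / 2)) * (of_real ((2 * t) ^ DIM('a)) * F ((2 * t) *\<^sub>R fst z, snd z))" for z
  proof -
    define \<kappa> where "\<kappa> = (of_real s * csqrt \<i>) ^ DIM('a) * exp (- \<i> * of_real (t * (norm (fst z))\<^sup>2))"
    have n: "cmod \<kappa> = s ^ DIM('a)"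
      unfolding \<kappa>_def using s0 by (simp add: norm_mult norm_power norm_csqrt power_mult_distrib del: csqrt_ii)
    have "\<kappa> * cnj \<kappa> = of_real ((s ^ DIM('a))\<^sup>2)" unfolding n[symmetric] by (rule complex_norm_square[symmetric])
    also have "(s ^ DIM('a))\<^sup>2 = (s\<^sup>2) ^ DIM('a)" by (simp only: power_mult[symmetric] mult.commute)
    also have "s\<^sup>2 = 2 * t" using t by (simp add: s_def)
    finally have k2: "\<kappa> * cnj \<kappa> = of_real ((2 * t) ^ DIM('a))" .
    have "(s ^ DIM('a)) powr q = (2 * t) powr (real DIM('a) * q / 2)"
      using t s0 by (simp add: powr_realpow[symmetric] powr_powr s_def powr_half_sqrt[symmetric] del: powr_half_sqrt)
    then have "fnl q (\<kappa> * w) * cnj (\<kappa> * w') = of_real ((2 * t) powr (real DIM('a) * q / 2)) * ((\<kappa> * cnj \<kappa>) * (fnl q w * cnj w'))" for w w'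
      unfolding fnl_scale n by (simp add: mult_ac)
    then show ?thesis unfolding mode_sum_mm_eq F_def k2 unfolding \<kappa>_def s_def .
  qed
  have p0: "complex_of_real ((2 * t) powr (real DIM('a) * q / 2)) \<noteq> 0" "complex_of_real ((2 * t) ^ DIM('a)) \<noteq> 0" using t by auto
  have i: "integrable mX (\<lambda>z. F ((2 * t) *\<^sub>R fst z, snd z))"
  proof -
    have "A \<noteq> 0 \<Longrightarrow> B \<noteq> 0 \<Longrightarrow> integrable mX (\<lambda>z. A * (B * G z)) \<Longrightarrow> integrable mX G" for A B and G :: "'a \<times> real \<Rightarrow> complex"
    proof -
      assume nz: "A \<noteq> 0" "B \<noteq> 0" and i: "integrable mX (\<lambda>z. A * (B * G z))"
      have eq: "inverse (A * B) * (A * (B * G z)) = G z" for z using nz by (simp add: field_simps)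
      have "integrable mX (\<lambda>z. inverse (A * B) * (A * (B * G z)))" by (intro integrable_mult_right i)
      then show "integrable mX G" unfolding eq .
    qed
    from this[OF p0] show ?thesis using fnl_mode_sum_integrable[OF L less_imp_le[OF q(1)] q(2) dominated_mm[OF t], of t] unfolding key .
  qed
  obtain C c where C: "0 < c" "\<And>P t z. dominated P \<Longrightarrow> cmod (fnl q (mode_sum P L t z) * cnj (mode_sum P L' t z)) \<le> C * exp (- c * (norm (fst z))\<^sup>2)"
    using fnl_mode_sum_bound[OF L _ q(2)] q by (metis less_imp_le)
  \<comment> \<open>Integrability in the original variable is read back from the Gaussian bound in
    the rescaled one; \<open>A\<close> is the factor between the two integrands.\<close>
  define A where "A = (2 * t) powr (real DIM('a) * q / 2) * (2 * t) ^ DIM('a)"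
  have A0: "0 < A" using t by (simp add: A_def)
  show iF: "integrable mX (\<lambda>z. fnl q (comb L t z) * cnj (comb L' t z))"
  proof (rule Bochner_Integration.integrable_bound)
    show "integrable mX (\<lambda>z :: 'a \<times> real. (C / A) * exp (- (c / (2 * t)\<^sup>2) * (norm (fst z))\<^sup>2))"
      using C t by (intro mX_integrable_exp) auto
    have "cmod (F z) \<le> (C / A) * exp (- (c / (2 * t)\<^sup>2) * (norm (fst z))\<^sup>2)" for z
    proof -
      have "A * cmod (F z) = cmod (of_real ((2 * t) powr (real DIM('a) * q / 2)) * (of_real ((2 * t) ^ DIM('a)) * F z))"
        using t by (simp add: A_def norm_mult norm_power power_mult_distrib)
      also have "\<dots> \<le> C * exp (- c * (norm (inverse (2 * t) *\<^sub>R fst z))\<^sup>2)"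
        using C(2)[OF dominated_mm[OF t], of t "(inverse (2 * t) *\<^sub>R fst z, snd z)"] t unfolding key by simp
      also have "(norm (inverse (2 * t) *\<^sub>R fst z))\<^sup>2 = (norm (fst z))\<^sup>2 / (2 * t)\<^sup>2"
        using t by (simp add: power_mult_distrib power_divide divide_simps)
      finally show ?thesis using A0 by (simp add: field_simps)
    qed
    then show "AE z in mX. norm (fnl q (comb L t z) * cnj (comb L' t z)) \<le> norm ((C / A) * exp (- (c / (2 * t)\<^sup>2) * (norm (fst z))\<^sup>2))"
      unfolding F_def real_norm_def by (intro AE_I2 order_trans[OF _ abs_ge_self])
    show "(\<lambda>z. fnl q (comb L t z) * cnj (comb L' t z)) \<in> borel_measurable mX"
      using Fm by (simp add: F_def[abs_def] cong: measurable_cong_sets)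
  qed
  have "(\<integral>z. F z \<partial>mX) = of_real ((2 * t) ^ DIM('a)) * (\<integral>z. F ((2 * t) *\<^sub>R fst z, snd z) \<partial>mX)"
    using t iF i by (intro mX_scale Fm) (simp_all add: F_def[abs_def])
  then show "pairing q (rescaled t) L L' t = of_real ((2 * t) powr (real DIM('a) * q / 2)) * (\<integral>z. fnl q (comb L t z) * cnj (comb L' t z) \<partial>mX)"
    unfolding pairing_def key F_def by simp
qed

text \<open>The time frequencies k^2 are integers. This common period of all modes is what replaces
  convergence of the rescaled solution by convergence to a periodic function.\<close>

lemma ek_periodic: "ek k (t + 2 * pi) x = ek k t x"
proof -
  have "\<i> * of_real (of_int k * x - (of_int k)\<^sup>2 * (t + 2 * pi)) = \<i> * of_real (of_int k * x - (of_int k)\<^sup>2 * t) + of_real (2 * of_int (- (k\<^sup>2)) * pi) * \<i>"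
    by (simp add: algebra_simps)
  moreover have "exp (complex_of_real (2 * of_int (- (k\<^sup>2)) * pi) * \<i>) = 1" by (rule exp_integer_2pi[OF Ints_of_int])
  ultimately show ?thesis unfolding ek_def by (simp only: exp_add mult_1_right)
qed

lemma mode_sum_periodic: "mode_sum P L (t + 2 * pi) z = mode_sum P L t z"
  by (simp add: mode_sum_def ek_periodic)

lemma pairing_periodic: "pairing q P L L' (t + 2 * pi) = pairing q P L L' t"
  by (simp add: pairing_def mode_sum_periodic)

lemma pairing_measurable:
  assumes P: "dominated P"
  shows "pairing q P L (L' :: 'a::euclidean_space modes) \<in> borel_measurable borel"
proof -
  have 1: "(\<lambda>w. mode_sum P J (fst w) (snd w)) \<in> borel_measurable (borel \<Otimes>\<^sub>M (mX :: ('a \<times> real) measure))" for J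
    using mode_sum_measurable2[OF P, of fst "borel \<Otimes>\<^sub>M (mX :: ('a \<times> real) measure)" "\<lambda>w. fst (snd w)" "\<lambda>w. snd (snd w)" J]
    by (simp cong: measurable_cong_sets add: borel_prod[symmetric])
  note [measurable] = 1[of L] 1[of L']
  show ?thesis unfolding pairing_def[abs_def]
    by (rule sigma_finite_measure.borel_measurable_lebesgue_integral[OF sigma_finite_mX]) (simp add: case_prod_unfold)
qed

lemma pairing_bounded:
  fixes L :: "'a::euclidean_space modes"
  assumes L: "valid L" "valid L'" and q: "0 \<le> q" "q \<le> 1"
  shows "\<exists>B. \<forall>P t. dominated P \<longrightarrow> cmod (pairing q P L L' t) \<le> B"
proof -
  obtain C c where C: "0 < c" "\<And>P t z. dominated P \<Longrightarrow> cmod (fnl q (mode_sum P L t z) * cnj (mode_sum P L' t z)) \<le> C * exp (- c * (norm (fst z))\<^sup>2)"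
    using fnl_mode_sum_bound[OF assms] by blast
  have "cmod (pairing q P L L' t) \<le> (\<integral>z. C * exp (- c * (norm (fst z))\<^sup>2) \<partial>(mX :: ('a \<times> real) measure))" if "dominated P" for P t
    unfolding pairing_def
    by (rule Bochner_Integration.integral_norm_bound_integral[OF fnl_mode_sum_integrable[OF L q that] mX_integrable_exp[OF C(1)] C(2)[OF that]])
  then show ?thesis by blast
qed

section \<open>Profiles with decoupled periodic time\<close>

definition mO :: "('a::euclidean_space \<times> (real \<times> real)) measure" where
  "mO = lborel \<Otimes>\<^sub>M mTT"

interpretation lTT: pair_sigma_finite "lborel :: 'a::euclidean_space measure" mTT
  by (simp add: pair_sigma_finite_def sigma_finite_lborel sigma_finite_mTT)

lemma sets_mO [measurable_cong, simp]: "sets (mO :: ('a::euclidean_space \<times> (real \<times> real)) measure) = sets borel"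
proof -
  have "sets (lborel \<Otimes>\<^sub>M mTT) = sets (borel \<Otimes>\<^sub>M borel :: ('a \<times> (real \<times> real)) measure)"
    by (intro sets_pair_measure_cong) simp_all
  then show ?thesis unfolding mO_def borel_prod .
qed

lemma space_mO [simp]: "space (mO :: ('a::euclidean_space \<times> (real \<times> real)) measure) = UNIV"
  by (simp add: mO_def space_pair_measure)

lemma mO_integrable_exp:
  assumes "0 < c" shows "integrable mO (\<lambda>z::'a::euclidean_space \<times> (real \<times> real). C * exp (- c * (norm (fst z))\<^sup>2))"
proof -
  have "integrable mTT (\<lambda>_. 1::real)" by simp
  from integrable_prod_mult(1)[OF sigma_finite_lborel sigma_finite_mTT gaussian_integrable[OF assms] this]
  show ?thesis unfolding mO_def by (intro integrable_mult_right) simp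
qed

text \<open>The profile as a function of \<open>(\<xi>, (t, x))\<close>, with the periodic time decoupled from \<open>\<xi>\<close>.\<close>

definition profile :: "'a::euclidean_space modes \<Rightarrow> 'a \<times> (real \<times> real) \<Rightarrow> complex" where
  "profile L z = mode_sum prof L (fst (snd z)) (fst z, snd (snd z))"

lemma profile_measurable [measurable]: "profile L \<in> borel_measurable borel"
  unfolding profile_def[abs_def] borel_prod[symmetric]
  by (rule mode_sum_measurable2[OF dominated_prof]) measurable

lemma profile_bound:
  assumes "valid L" shows "\<exists>C c. 0 \<le> C \<and> 0 < c \<and> (\<forall>z. cmod (profile L z) \<le> C * exp (- c * (norm (fst z))\<^sup>2))"
proof -
  obtain C c where C: "0 \<le> C" "0 < c" "\<And>P t z. dominated P \<Longrightarrow> cmod (mode_sum P L t z) \<le> C * exp (- c * (norm (fst z))\<^sup>2)"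
    using mode_sum_bound[OF assms] by blast
  have "cmod (profile L z) \<le> C * exp (- c * (norm (fst z))\<^sup>2)" for z
    using C(3)[OF dominated_prof, of "fst (snd z)" "(fst z, snd (snd z))"] by (simp add: profile_def)
  then show ?thesis using C(1,2) by blast
qed

lemma fnl_profile_integrable:
  fixes L L' :: "'a::euclidean_space modes"
  assumes "valid L" "valid L'" "0 \<le> q" "q \<le> 1"
  shows "integrable mO (\<lambda>z. fnl q (profile L z) * cnj (profile L' z))"
proof -
  obtain C c where C: "0 < c" "\<And>P t z. dominated P \<Longrightarrow> cmod (fnl q (mode_sum P L t z) * cnj (mode_sum P L' t z)) \<le> C * exp (- c * (norm (fst z))\<^sup>2)"
    using fnl_mode_sum_bound[OF assms] by blast
  have b: "cmod (fnl q (profile L z) * cnj (profile L' z)) \<le> C * exp (- c * (norm (fst z))\<^sup>2)" for z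
    using C(2)[OF dominated_prof, of "fst (snd z)" "(fst z, snd (snd z))"] by (simp add: profile_def)
  have m: "(\<lambda>z. fnl q (profile L z) * cnj (profile L' z)) \<in> borel_measurable borel" by measurable
  show ?thesis
    by (rule Bochner_Integration.integrable_bound[OF mO_integrable_exp[OF C(1), of C]])
       (use m b in \<open>auto intro!: AE_I2 intro: order_trans[OF _ abs_ge_self] cong: measurable_cong_sets\<close>)
qed

lemma pairing_mean:
  fixes L L' :: "'a::euclidean_space modes"
  assumes L: "valid L" "valid L'" and q: "0 \<le> q" "q \<le> 1"
  shows "(\<integral>s. pairing q prof L L' s \<partial>mT) = (\<integral>z. fnl q (profile L z) * cnj (profile L' z) \<partial>mO)"
proof -
  define F where "F z = fnl q (profile L z) * cnj (profile L' z)" for z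
  have i: "integrable (lborel \<Otimes>\<^sub>M mTT) (case_prod (\<lambda>\<xi> w. F (\<xi>, w)))"
    using fnl_profile_integrable[OF assms] by (simp add: F_def[abs_def] mO_def case_prod_unfold)
  have "(\<integral>z. F z \<partial>mO) = (\<integral>w. (\<integral>\<xi>. F (\<xi>, w) \<partial>lborel) \<partial>mTT)"
    using lTT.integral_snd[OF i] by (simp add: mO_def case_prod_unfold)
  also have "\<dots> = (\<integral>s. (\<integral>x. (\<integral>\<xi>. F (\<xi>, (s, x)) \<partial>lborel) \<partial>mT) \<partial>mT)"
    unfolding mTT_def by (rule TT.integral_fst'[symmetric]) (use lTT.integrable_snd[OF i] in \<open>simp add: mTT_def\<close>)
  also have "\<dots> = (\<integral>s. pairing q prof L L' s \<partial>mT)"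
  proof (intro Bochner_Integration.integral_cong refl)
    fix s
    have "integrable (lborel \<Otimes>\<^sub>M mT) (case_prod (\<lambda>\<xi> x. F (\<xi>, (s, x))))"
      using fnl_mode_sum_integrable[OF assms dominated_prof, of s] unfolding F_def profile_def mX_def by (simp add: case_prod_unfold)
    from lT.integral_snd[OF this]
    show "(\<integral>x. (\<integral>\<xi>. F (\<xi>, (s, x)) \<partial>lborel) \<partial>mT) = pairing q prof L L' s"
      by (simp add: pairing_def F_def profile_def mX_def case_prod_unfold)
  qed
  finally show ?thesis by (simp add: F_def)
qed

section \<open>Long-time averages\<close>

lemma compact_support_integral:
  fixes f :: "real \<Rightarrow> 'b::{banach,second_countable_topology}"
  assumes m: "f \<in> borel_measurable borel" and T: "0 < T"
    and b: "\<And>t. t \<in> {T..2*T} \<Longrightarrow> norm (f t) \<le> C" and z: "\<And>t. t \<notin> {T..2*T} \<Longrightarrow> f t = 0"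
  shows "integrable lborel f" "norm (\<integral>t. f t \<partial>lborel) \<le> C * T"
proof -
  have i: "integrable lborel (\<lambda>t. C * indicator {T..2*T} t :: real)"
    using T by (intro integrable_mult_right integrable_real_indicator) auto
  have le: "norm (f t) \<le> C * indicator {T..2*T} t" for t
    using b[of t] z[of t] by (cases "t \<in> {T..2*T}") auto
  show fi: "integrable lborel f"
    by (rule Bochner_Integration.integrable_bound[OF i]) (use m le in \<open>auto intro!: AE_I2 intro: order_trans[OF _ abs_ge_self]\<close>)
  have "norm (\<integral>t. f t \<partial>lborel) \<le> (\<integral>t. C * indicator {T..2*T} t \<partial>lborel)"
    by (rule Bochner_Integration.integral_norm_bound_integral[OF fi i le])
  also have "\<dots> = C * T" using T by simp
  finally show "norm (\<integral>t. f t \<partial>lborel) \<le> C * T" .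
qed

lemma th_scale: "th T t = th 1 (t / T)" and th'_scale: "th' T t = th' 1 (t / T) / T"
  by (simp_all add: th_def th'_def)

lemma continuous_th: "continuous_on UNIV (th 1)" "continuous_on UNIV (th' 1)"
  unfolding th_def[abs_def] th'_def[abs_def]
  by (auto intro!: continuous_intros continuous_on_compose2[OF continuous_bmp])

text \<open>Makes quantities constant in time drop out of the tested equation.\<close>

lemma integral_th': assumes "0 < T" shows "(\<integral>t. th' T t \<partial>lborel) = 0"
proof -
  have "isCont (th' T) x" for x
  proof -
    have "continuous_on UNIV (\<lambda>t. th' 1 (t / T) / T)"
      using assms by (auto intro!: continuous_intros continuous_on_compose2[OF continuous_th(2)])
    then show ?thesis unfolding th'_scale[of T, abs_def, symmetric] by (simp add: continuous_on_eq_continuous_at)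
  qed
  \<comment> \<open>The interval exceeds [T, 2T] on both sides, so \<open>th T\<close> vanishes at
    its ends.\<close>
  then have "(\<integral>t. th' T t * indicator {T/2..3*T} t \<partial>lborel) = th T (3 * T) - th T (T / 2)"
    using assms by (intro integral_FTC_Icc_real DERIV_th) auto
  moreover have "th' T t * indicator {T/2..3*T} t = th' T t" for t
    using th_zero(2)[OF assms, of t] assms by (cases "t \<in> {T..2*T}") auto
  ultimately show ?thesis using th_zero(1)[OF assms, of "3 * T"] th_zero(1)[OF assms, of "T / 2"] assms by simp
qed

text \<open>The time cutoff together with the factor (2t)^(- \<delta>) of the rescaling. Inside the
  power \<open>max 1 t\<close> changes nothing on the support [1, 2] and makes the function
  continuous on the whole line.\<close>

definition rho :: "real \<Rightarrow> real \<Rightarrow> real" where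
  "rho \<delta> t = th 1 t * (2 * max 1 t) powr - \<delta>"

lemma rho_continuous: "continuous_on UNIV (rho \<delta>)"
  unfolding rho_def[abs_def]
  by (intro continuous_intros continuous_th(1)) (auto simp: max_def)

lemma rho_zero: "t \<notin> {1..2} \<Longrightarrow> rho \<delta> t = 0"
  using th_zero(1)[of 1 t] by (simp add: rho_def)

lemma rho_nonneg: "0 \<le> rho \<delta> t"
  by (simp add: rho_def th_def bump_nonneg)

lemma rho_bounded: "\<exists>B\<ge>0. \<forall>t. \<bar>rho \<delta> t\<bar> \<le> B"
proof -
  have "compact (rho \<delta> ` {1..2})" by (intro compact_continuous_image) (auto intro: continuous_on_subset[OF rho_continuous])
  then obtain B where B: "\<And>t. t \<in> {1..2} \<Longrightarrow> \<bar>rho \<delta> t\<bar> \<le> B" using compact_imp_bounded bounded_iff by (metis image_eqI real_norm_def)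
  have "\<bar>rho \<delta> t\<bar> \<le> \<bar>B\<bar>" for t using B[of t] rho_zero[of t \<delta>] by (cases "t \<in> {1..2}") auto
  then show ?thesis by (intro exI[of _ "\<bar>B\<bar>"]) auto
qed

lemma rho_measurable [measurable]: "rho \<delta> \<in> borel_measurable borel"
  by (rule borel_measurable_continuous_onI[OF rho_continuous])

text \<open>The weight is nonnegative and strictly positive on (1, 2). Its integral is the factor by
  which the limiting mean is later divided.\<close>

lemma rho_integral_pos: "0 < (\<integral>t. rho \<delta> t \<partial>lborel)"
proof -
  obtain B where B: "\<And>t. \<bar>rho \<delta> t\<bar> \<le> B" using rho_bounded by blast
  have i: "integrable lborel (rho \<delta>)"
    by (rule compact_support_integral(1)[of _ 1 B]) (use B rho_zero in auto)
  have "(\<integral>t. rho \<delta> t \<partial>lborel) \<noteq> 0"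
  proof
    assume "(\<integral>t. rho \<delta> t \<partial>lborel) = 0"
    then have "AE t in lborel. rho \<delta> t = 0"
      using integral_nonneg_eq_0_iff_AE[OF i] rho_nonneg by auto
    then have "AE t in lborel. t \<notin> {1<..<2::real}"
    proof eventually_elim
      case (elim t)
      show ?case
      proof
        assume "t \<in> {1<..<2}"
        then have "0 < rho \<delta> t" by (simp add: rho_def th_def bump_pos)
        then show False using elim by simp
      qed
    qed
    then have "emeasure lborel {1<..<2::real} = 0" by (subst (asm) AE_iff_measurable[of "{1<..<2}"]) auto
    then show False by simp
  qed
  moreover have "0 \<le> (\<integral>t. rho \<delta> t \<partial>lborel)" by (intro Bochner_Integration.integral_nonneg rho_nonneg)
  ultimately show ?thesis by linarith
qed

text \<open>The dispersive estimate with a constant independent of \<open>b\<close>,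
  \<open>k\<close> and the point, from |sg a t| >= 2 a t.\<close>

lemma gm_decay:
  fixes b :: "'a::euclidean_space"
  assumes "0 < a" "0 < t"
  shows "sqrt t ^ DIM('a) * cmod (gm a b k t z) \<le> inverse (sqrt (2 * a)) ^ DIM('a)"
proof -
  have "2 * a * t \<le> cmod (sg a t)" using abs_Im_le_cmod[of "sg a t"] by simp
  then have "inverse (sqrt (cmod (sg a t))) \<le> inverse (sqrt (2 * a * t))"
    using assms by (intro le_imp_inverse_le real_sqrt_le_mono) auto
  then have 1: "inverse (sqrt (cmod (sg a t))) ^ DIM('a) \<le> inverse (sqrt (2 * a * t)) ^ DIM('a)" by (intro power_mono) auto
  have "0 \<le> a / (2 * (1 + 4 * a\<^sup>2 * t\<^sup>2))" using assms by (intro divide_nonneg_nonneg) (auto intro: add_nonneg_nonneg)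
  then have "- (a / (2 * (1 + 4 * a\<^sup>2 * t\<^sup>2))) * (norm (fst z - b))\<^sup>2 \<le> 0"
    by (intro mult_nonpos_nonneg) simp_all
  then have 2: "exp (- (a / (2 * (1 + 4 * a\<^sup>2 * t\<^sup>2))) * (norm (fst z - b))\<^sup>2) \<le> 1" by (simp only: exp_le_one_iff)
  have "cmod (gm a b k t z) \<le> inverse (sqrt (2 * a * t)) ^ DIM('a) * 1"
    unfolding gm_def norm_mult norm_ek norm_gy mult_1_right[of "_ * _"]
    using assms by (intro mult_mono 1 2) auto
  then have "sqrt t ^ DIM('a) * cmod (gm a b k t z) \<le> sqrt t ^ DIM('a) * inverse (sqrt (2 * a * t)) ^ DIM('a)"
    using assms by (intro mult_left_mono) auto
  also have "\<dots> = inverse (sqrt (2 * a)) ^ DIM('a)"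
  proof -
    have "sqrt t * inverse (sqrt (2 * a * t)) = inverse (sqrt (2 * a))" using assms by (simp add: real_sqrt_mult)
    then show ?thesis unfolding power_mult_distrib[symmetric] by (simp only:)
  qed
  finally show ?thesis .
qed

lemma global_solution_l2:
  assumes "global_solution p u" "0 \<le> t" shows "u t \<in> l2 mX"
  using assms unfolding global_solution_def L2_eq_l2 by blast

lemma comb_joint_measurable:
  fixes L :: "(real^'d::finite) modes"
  assumes "valid L"
  shows "(\<lambda>w. comb L (fst w) (snd w)) \<in> borel_measurable (lborel \<Otimes>\<^sub>M (mX :: ((real^'d) \<times> real) measure))"
  using assms
proof (induction L)
  case Nil
  then show ?case by (simp add: comb_Nil)
next
  case (Cons x L)
  obtain c a b k where x: "x = (c, a, b, k)" by (cases x)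
  interpret wave a b k by standard (use Cons.prems x in simp)
  have "(\<lambda>w. cnj (W w)) \<in> borel_measurable borel" by measurable
  then have [measurable]: "(\<lambda>w. gm a b k (fst w) (snd w)) \<in> borel_measurable (lborel \<Otimes>\<^sub>M (mX :: ((real^'d) \<times> real) measure))"
    unfolding W_def by (simp cong: measurable_cong_sets add: borel_prod[symmetric])
  have [measurable]: "(\<lambda>w. comb L (fst w) (snd w)) \<in> borel_measurable (lborel \<Otimes>\<^sub>M (mX :: ((real^'d) \<times> real) measure))"
    using Cons x by simp
  show ?case unfolding x comb_Cons by measurable
qed

lemma fnl_comb_integral_measurable:
  fixes L L' :: "(real^'d::finite) modes"
  assumes "valid L" "valid L'"
  shows "(\<lambda>t. \<integral>z. fnl q (comb L t z) * cnj (comb L' t z) \<partial>mX) \<in> borel_measurable borel"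
proof -
  note [measurable] = comb_joint_measurable[OF assms(1)] comb_joint_measurable[OF assms(2)]
  have "(\<lambda>t. \<integral>z. fnl q (comb L t z) * cnj (comb L' t z) \<partial>mX) \<in> borel_measurable lborel"
    by (rule sigma_finite_measure.borel_measurable_lebesgue_integral[OF sigma_finite_mX]) (simp add: case_prod_beta)
  then show ?thesis by simp
qed

text \<open>First the rescaled pairing is exchanged for the periodic one, uniformly on the support
  of \<open>rho\<close>, where the actual time is at least \<open>Suc n\<close>; then the periodic
  averaging applies.\<close>

lemma rho_pairing_limit:
  fixes L L' :: "(real^'d::finite) modes"
  assumes L: "valid L" "valid L'" and q: "0 < q" "q \<le> 1"
  shows "(\<lambda>n. \<integral>t. of_real (rho \<delta> t) * pairing q (rescaled (max 1 (real (Suc n) * t))) L L' (max 1 (real (Suc n) * t)) \<partial>lborel)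
    \<longlonglongrightarrow> of_real (\<integral>t. rho \<delta> t \<partial>lborel) * (\<integral>s. pairing q prof L L' s \<partial>mT) / of_real (2 * pi)"
proof -
  obtain B where B: "\<And>P t. dominated P \<Longrightarrow> cmod (pairing q P L L' t) \<le> B" using pairing_bounded[OF L, of q] q by auto
  obtain R where R: "0 \<le> R" "\<And>t. \<bar>rho \<delta> t\<bar> \<le> R" using rho_bounded by blast
  define N where "N t = pairing q (rescaled (max 1 t)) L L' (max 1 t)" for t
  define N' where "N' t = pairing q prof L L' t" for t
  have [measurable]: "N \<in> borel_measurable borel"
  proof -
    \<comment> \<open>Measurability in time is obtained through \<open>pairing_scaling\<close>,
      because combinations are jointly measurable in time and space.\<close>
    have eq: "N = (\<lambda>t. of_real ((2 * max 1 t) powr (real DIM(real^'d) * q / 2)) * (\<lambda>t. \<integral>z. fnl q (comb L t z) * cnj (comb L' t z) \<partial>mX) (max 1 t))"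
      unfolding N_def by (intro ext pairing_scaling L q) simp
    note [measurable] = fnl_comb_integral_measurable[OF L, of q]
    show ?thesis unfolding eq by measurable
  qed
  have [measurable]: "N' \<in> borel_measurable borel" unfolding N'_def[abs_def] by (rule pairing_measurable[OF dominated_prof])
  have i: "integrable lborel (\<lambda>t. of_real (rho \<delta> t) * N (real (Suc n) * t))" "integrable lborel (\<lambda>t. of_real (rho \<delta> t) * N' (real (Suc n) * t))" for n
  proof -
    have b: "cmod (N t) \<le> B" "cmod (N' t) \<le> B" for t by (simp_all add: N_def N'_def B dominated_mm dominated_prof)
    show "integrable lborel (\<lambda>t. of_real (rho \<delta> t) * N (real (Suc n) * t))"
      by (rule compact_support_integral(1)[of _ 1 "R * B"]) (use R b rho_zero in \<open>auto simp: norm_mult intro!: mult_mono\<close>)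
    show "integrable lborel (\<lambda>t. of_real (rho \<delta> t) * N' (real (Suc n) * t))"
      by (rule compact_support_integral(1)[of _ 1 "R * B"]) (use R b rho_zero in \<open>auto simp: norm_mult intro!: mult_mono\<close>)
  qed
  have lim: "(\<lambda>n. \<integral>t. of_real (rho \<delta> t) * N' (real (Suc n) * t) \<partial>lborel) \<longlonglongrightarrow> of_real (\<integral>t. rho \<delta> t \<partial>lborel) * (\<integral>s. N' s \<partial>mT) / of_real (2 * pi)"
    by (rule periodic_averaging[of N' B]) (auto simp: N'_def B dominated_prof pairing_periodic rho_continuous rho_zero pairing_measurable)
  have "(\<lambda>n. (\<integral>t. of_real (rho \<delta> t) * N (real (Suc n) * t) \<partial>lborel) - (\<integral>t. of_real (rho \<delta> t) * N' (real (Suc n) * t) \<partial>lborel)) \<longlonglongrightarrow> 0"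
  proof (rule LIMSEQ_I)
    fix e :: real assume e: "0 < e"
    define e' where "e' = e / (2 * (R + 1))"
    have e': "0 < e'" using e R by (simp add: e'_def)
    have "\<forall>\<^sub>F t in at_top. dist (pairing q (rescaled t) L L' t - pairing q prof L L' t) 0 < e'"
      by (rule tendstoD[OF pairing_tendsto[OF L q] e'])
    then obtain S where S: "\<And>t. t \<ge> S \<Longrightarrow> cmod (pairing q (rescaled t) L L' t - pairing q prof L L' t) < e'"
      by (auto simp: eventually_at_top_linorder)
    have "cmod ((\<integral>t. of_real (rho \<delta> t) * N (real (Suc n) * t) \<partial>lborel) - (\<integral>t. of_real (rho \<delta> t) * N' (real (Suc n) * t) \<partial>lborel)) < e"
      if n: "n \<ge> nat \<lceil>S\<rceil>" for n
    proof -
      have nS: "S \<le> real (Suc n)" using n by linarith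
      have "(\<integral>t. of_real (rho \<delta> t) * N (real (Suc n) * t) \<partial>lborel) - (\<integral>t. of_real (rho \<delta> t) * N' (real (Suc n) * t) \<partial>lborel)
        = (\<integral>t. of_real (rho \<delta> t) * (N (real (Suc n) * t) - N' (real (Suc n) * t)) \<partial>lborel)"
        using i[of n] by (simp add: right_diff_distrib)
      also have "cmod \<dots> \<le> (R * e') * 1"
      proof (rule compact_support_integral(2))
        show "norm (of_real (rho \<delta> t) * (N (real (Suc n) * t) - N' (real (Suc n) * t))) \<le> R * e'" if t: "t \<in> {1..2*1}" for t
        proof -
          have le: "real (Suc n) \<le> real (Suc n) * t" using mult_left_mono[of 1 t "real (Suc n)"] t by simp
          have s: "S \<le> real (Suc n) * t" "1 \<le> real (Suc n) * t"
            by (rule order_trans[OF nS le]) (rule order_trans[OF _ le], simp)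
          have "max 1 (real (Suc n) * t) = real (Suc n) * t" using s(2) by (rule max_absorb2)
          then have "cmod (N (real (Suc n) * t) - N' (real (Suc n) * t)) \<le> e'" unfolding N_def N'_def using S[OF s(1)] by simp
          then show ?thesis unfolding norm_mult using R by (intro mult_mono) auto
        qed
      qed (use rho_zero in auto)
      also have "\<dots> < e" using e R mult_strict_right_mono[of R "2 * (R + 1)" e] by (simp add: e'_def pos_divide_less_eq mult_ac)
      finally show ?thesis .
    qed
    then show "\<exists>n0. \<forall>n\<ge>n0. norm ((\<integral>t. of_real (rho \<delta> t) * N (real (Suc n) * t) \<partial>lborel) - (\<integral>t. of_real (rho \<delta> t) * N' (real (Suc n) * t) \<partial>lborel) - 0) < e"
      unfolding diff_0_right by blast
  qed
  from tendsto_add[OF this lim] show ?thesis by (simp add: N_def N'_def)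
qed

text \<open>The constant \<open>K\<close> may depend on \<open>M\<close> and on the test state but
  not on \<open>L\<close>, \<epsilon> or \<open>T\<close>, because the combination will change with
  the accuracy. On the linear side the deviation of the pairing from a constant is at most
  \<epsilon> times the norm of the test state, and |th'| is of size 1/T on an interval of length T,
  giving O(\<epsilon>). On the nonlinear side passing from \<open>u\<close> to the combination costs
  O(\<epsilon>) times T^(1 - \<delta>). The main term is T^(1 - \<delta>) times the integral to be
  bounded.\<close>

lemma time_integral_bound:
  fixes u :: "real \<Rightarrow> (real^'d::finite) \<times> real \<Rightarrow> complex" and b :: "real^'d" and q :: real
  defines "\<delta> \<equiv> real DIM(real^'d) * q / 2"
  assumes sol: "global_solution (q + 1) u" and q: "0 < q" "q \<le> 1" and d: "\<delta> \<le> 1" and a: "0 < a"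
  shows "\<exists>K\<ge>0. \<forall>L \<epsilon> T. valid L \<longrightarrow> nrm mX (comb L 0) \<le> M \<longrightarrow> 0 \<le> \<epsilon> \<longrightarrow> \<epsilon> \<le> 1 \<longrightarrow> 1 \<le> T
    \<longrightarrow> (\<forall>t\<ge>T. nrm mX (\<lambda>z. u t z - comb L t z) \<le> \<epsilon>)
    \<longrightarrow> cmod (\<integral>t. of_real (rho \<delta> t) * pairing q (rescaled (max 1 (T * t))) L [(1, a, b, k)] (max 1 (T * t)) \<partial>lborel) \<le> K * \<epsilon>"
proof -
  interpret wave a b k by standard (rule a)
  define v where "v = gm a b k"
  have vl: "v t \<in> l2 mX" for t unfolding v_def by (rule gm_l2[OF a])
  have vi: "integrable mX (v t)" for t unfolding v_def by (rule gm_integrable[OF a])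
  define nv where "nv = nrm mX (v 0)"
  have nv: "nrm mX (v t) = nv" for t
    using comb_nrm[of "[(1, a, b, k)]" t] a by (simp add: nv_def v_def comb_single)
  define Ca where "Ca = inverse (sqrt (2 * a)) ^ DIM(real^'d)"
  obtain B0 where B0: "0 \<le> B0" "\<And>t. \<bar>th 1 t\<bar> \<le> B0" "\<And>t. \<bar>th' 1 t\<bar> \<le> B0"
    using th_bounded[of 1] by auto
  \<comment> \<open>The factor of the L2 error in \<open>fnl_ip_diff\<close>: the norms of
    \<open>u t\<close>, at most \<open>M + 1\<close>, and of the combination, at most
    \<open>M\<close>, add up to at most \<open>2 * |M| + 1\<close>.\<close>
  define K1 where "K1 = 2 * (nv + Ca * (2 * \<bar>M\<bar> + 1))"
  have Ca0: "0 \<le> Ca" unfolding Ca_def using a by simp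
  have K10: "0 \<le> K1" "0 \<le> nv" using Ca0 by (simp_all add: K1_def nv_def)
  define K where "K = B0 * nv + B0 * K1"
  have main: "cmod (\<integral>t. of_real (rho \<delta> t) * pairing q (rescaled (max 1 (T * t))) L [(1, a, b, k)] (max 1 (T * t)) \<partial>lborel) \<le> K * \<epsilon>"
    if L: "valid L" and M: "nrm mX (comb L 0) \<le> M" and e: "0 \<le> \<epsilon>" "\<epsilon> \<le> 1" and T: "1 \<le> T"
      and app: "\<And>t. t \<ge> T \<Longrightarrow> nrm mX (\<lambda>z. u t z - comb L t z) \<le> \<epsilon>" for L \<epsilon> T
  proof -
    have T0: "0 < T" using T by simp
    note cl = comb_l2[OF L]
    have ul: "u t \<in> l2 mX" if "t \<ge> T" for t using global_solution_l2[OF sol] that T by simp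
    have nc: "nrm mX (comb L t) \<le> M" for t using comb_nrm[OF L, of t] M by simp
    have nu: "nrm mX (u t) \<le> M + 1" if "t \<ge> T" for t
      using nrm_le_diff[OF ul[OF that] cl[of t]] nc[of t] app[OF that] e by simp
    have "t \<in> {T..2 * T} \<Longrightarrow> nrm mX (u t) \<le> M + 1" for t using nu by simp
    note weq = weak_equation[OF sol q T0 this]
    define p where "p t = ip mX (u t) (v t)" for t
    define r where "r t = (\<integral>z. fnl q (u t z) * cnj (v t z) \<partial>mX)" for t
    define g where "g t = (\<integral>z. fnl q (comb L t z) * cnj (v t z) \<partial>mX)" for t
    \<comment> \<open>The pairing of the two free waves, the same at all times; its product with
      \<open>th' T\<close> integrates to 0 and may be subtracted.\<close>
    define c0 where "c0 = ip mX (comb L 0) (v 0)"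
    have lhs: "integrable lborel (\<lambda>t. of_real (th' T t) * p t)" "(\<integral>w. of_real (th' T (fst w)) * (u (fst w) (snd w) * W w) \<partial>mS) = (\<integral>t. of_real (th' T t) * p t \<partial>lborel)"
      using lX.integrable_fst'[OF weq(1)[unfolded mS_def]] lX.integral_fst'[OF weq(1)[unfolded mS_def]]
      by (simp_all add: p_def ip_def W_def v_def mS_def)
    have rhs: "integrable lborel (\<lambda>t. of_real (th T t) * r t)" "(\<integral>w. of_real (th T (fst w)) * (fnl q (u (fst w) (snd w)) * W w) \<partial>mS) = (\<integral>t. of_real (th T t) * r t \<partial>lborel)"
      using lX.integrable_fst'[OF weq(2)[unfolded mS_def]] lX.integral_fst'[OF weq(2)[unfolded mS_def]]
      by (simp_all add: r_def W_def v_def mS_def)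
    have gm: "g \<in> borel_measurable borel"
      using fnl_comb_integral_measurable[OF L, of "[(1, a, b, k)]" q] a unfolding g_def[abs_def] comb_single v_def by simp
    have pe: "cmod (p t - c0) \<le> \<epsilon> * nv" if "t \<ge> T" for t
    proof -
      have "p t - c0 = ip mX (\<lambda>z. u t z - comb L t z) (v t)"
        using comb_inner1[OF L a, of t t 0 0 b k] unfolding ip_diff_left[OF ul[OF that] cl vl] p_def c0_def by (simp add: v_def)
      also have "cmod \<dots> \<le> nrm mX (\<lambda>z. u t z - comb L t z) * nrm mX (v t)" by (rule ip_le[OF l2_diff[OF ul[OF that] cl] vl])
      also have "\<dots> \<le> \<epsilon> * nv" unfolding nv using K10 by (intro mult_right_mono app that) auto
      finally show ?thesis .
    qed
    have thb: "cmod (of_real (th' T t)) \<le> B0 / T" for t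
      unfolding norm_of_real th'_scale[of T] using B0(3)[of "t / T"] T0 by (simp add: divide_right_mono)
    have c0i: "integrable lborel (\<lambda>t. of_real (th' T t) * c0)"
    proof (rule compact_support_integral(1)[OF _ T0, of _ "B0 / T * cmod c0"])
      show "norm (of_real (th' T t) * c0) \<le> B0 / T * cmod c0" for t
        unfolding norm_mult by (intro mult_right_mono thb) auto
    qed (use th_zero[OF T0] in auto)
    have "(\<integral>t. of_real (th' T t) * p t \<partial>lborel) = (\<integral>t. of_real (th' T t) * p t \<partial>lborel) - (\<integral>t. of_real (th' T t) * c0 \<partial>lborel)"
      using integral_th'[OF T0] integral_complex_of_real[of lborel "th' T"] by simp
    also have "\<dots> = (\<integral>t. of_real (th' T t) * (p t - c0) \<partial>lborel)"
      using lhs(1) c0i by (simp add: right_diff_distrib)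
    finally have e1: "(\<integral>t. of_real (th' T t) * p t \<partial>lborel) = (\<integral>t. of_real (th' T t) * (p t - c0) \<partial>lborel)" .
    have "cmod (\<integral>t. of_real (th' T t) * (p t - c0) \<partial>lborel) \<le> (B0 / T * (\<epsilon> * nv)) * T"
    proof (rule compact_support_integral(2)[OF _ T0])
      have "integrable lborel (\<lambda>t. of_real (th' T t) * (p t - c0))" using lhs(1) c0i by (simp add: right_diff_distrib)
      then show "(\<lambda>t. of_real (th' T t) * (p t - c0)) \<in> borel_measurable borel" by (auto dest: borel_measurable_integrable)
      show "norm (of_real (th' T t) * (p t - c0)) \<le> B0 / T * (\<epsilon> * nv)" if "t \<in> {T..2*T}" for t
        unfolding norm_mult using B0(1) T0 that by (intro mult_mono thb pe) auto
    qed (use th_zero[OF T0] in auto)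
    then have E1: "cmod (\<integral>t. of_real (th' T t) * p t \<partial>lborel) \<le> B0 * nv * \<epsilon>" unfolding e1 using T0 by (simp add: mult_ac)
    \<comment> \<open>\<open>fnl_ip_diff\<close> at the scale A = t^(d/2), matched to the decay of
      the test state in \<open>gm_decay\<close>, so that A^q = t^\<delta>.\<close>
    have rg: "t powr \<delta> * cmod (r t - g t) \<le> K1 * \<epsilon>" if t: "t \<ge> T" for t
    proof -
      have t0: "0 < t" using T0 t by simp
      have vb: "sqrt t ^ DIM(real^'d) * cmod (v t z) \<le> Ca" for z
        unfolding v_def Ca_def by (rule gm_decay[OF a t0])
      have "(sqrt t ^ DIM(real^'d)) powr q * cmod (r t - g t) \<le> 2 * nrm mX (\<lambda>z. u t z - comb L t z) * (nrm mX (v t) + Ca * (nrm mX (u t) + nrm mX (comb L t)))"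
        unfolding r_def g_def
        by (rule fnl_ip_diff[OF q _ ul[OF t] cl vl vi vb]) (use t0 in simp)
      also have "\<dots> \<le> 2 * \<epsilon> * (nv + Ca * (2 * \<bar>M\<bar> + 1))"
        unfolding nv using app[OF t] nu[OF t] nc[of t] Ca0 K10 e by (intro mult_mono add_left_mono mult_left_mono) (auto intro!: add_nonneg_nonneg mult_nonneg_nonneg)
      also have "(sqrt t ^ DIM(real^'d)) powr q = t powr \<delta>"
        using t0 by (simp add: powr_realpow[symmetric] powr_powr powr_half_sqrt[symmetric] \<delta>_def del: powr_half_sqrt)
      finally show ?thesis by (simp add: K1_def mult_ac)
    qed
    have Nfg: "pairing q (rescaled (max 1 t)) L [(1, a, b, k)] (max 1 t) = of_real ((2 * t) powr \<delta>) * g t" if "t \<ge> T" for t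
      using pairing_scaling(1)[OF L _ q, of "[(1, a, b, k)]" t] a that T
      by (simp add: g_def comb_single v_def \<delta>_def max_def)
    define h where "h t = of_real (th T t) * g t" for t
    have "\<exists>G. \<forall>t\<in>{T..2*T}. cmod (g t) \<le> G"
    proof -
      obtain B where B: "\<And>P t. dominated P \<Longrightarrow> cmod (pairing q P L [(1, a, b, k)] t) \<le> B"
        using pairing_bounded[OF L, of "[(1, a, b, k)]" q] a q by auto
      have "cmod (g t) \<le> B * (2 * T) powr - \<delta>" if t: "t \<in> {T..2*T}" for t
      proof -
        have d0: "0 \<le> \<delta>" using q by (simp add: \<delta>_def)
        have t0: "0 < t" "1 \<le> t" using t T by auto
        have "(2 * t) powr \<delta> * cmod (g t) \<le> B"
          using B[OF dominated_mm[of "max 1 t"], of "max 1 t"] Nfg[of t] t by (simp add: norm_mult)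
        then have "cmod (g t) \<le> B * (2 * t) powr - \<delta>" using t0 by (simp add: powr_minus field_simps)
        also have "\<dots> \<le> B * (2 * T) powr - \<delta>"
          using t T d0 order_trans[OF norm_ge_zero B[OF dominated_prof, of 0]] by (intro mult_left_mono powr_mono2') auto
        finally show ?thesis .
      qed
      then show ?thesis by blast
    qed
    then obtain G where G: "\<And>t. t \<in> {T..2*T} \<Longrightarrow> cmod (g t) \<le> G" by blast
    have hm: "h \<in> borel_measurable borel" unfolding h_def[abs_def] using gm by measurable
    have hi: "integrable lborel h"
    proof (rule compact_support_integral(1)[OF hm T0, of "B0 * G"])
      show "norm (h t) \<le> B0 * G" if "t \<in> {T..2*T}" for t
        unfolding h_def norm_mult using B0(1,2) G[OF that] by (intro mult_mono) (auto simp: th_scale[of T])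
    qed (use th_zero[OF T0] in \<open>auto simp: h_def\<close>)
    have d0: "0 \<le> \<delta>" using q by (simp add: \<delta>_def)
    have E2: "cmod ((\<integral>t. of_real (th T t) * r t \<partial>lborel) - (\<integral>t. h t \<partial>lborel)) \<le> (B0 * (K1 * \<epsilon> * T powr - \<delta>)) * T"
    proof -
      have "(\<integral>t. of_real (th T t) * r t \<partial>lborel) - (\<integral>t. h t \<partial>lborel) = (\<integral>t. of_real (th T t) * (r t - g t) \<partial>lborel)"
        using rhs(1) hi[unfolded h_def[abs_def]] by (simp add: h_def right_diff_distrib)
      also have "cmod \<dots> \<le> (B0 * (K1 * \<epsilon> * T powr - \<delta>)) * T"
      proof (rule compact_support_integral(2)[OF _ T0])
        have "integrable lborel (\<lambda>t. of_real (th T t) * (r t - g t))" using rhs(1) hi[unfolded h_def[abs_def]] by (simp add: h_def right_diff_distrib)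
        then show "(\<lambda>t. of_real (th T t) * (r t - g t)) \<in> borel_measurable borel" by (auto dest: borel_measurable_integrable)
        show "norm (of_real (th T t) * (r t - g t)) \<le> B0 * (K1 * \<epsilon> * T powr - \<delta>)" if t: "t \<in> {T..2*T}" for t
        proof -
          have "cmod (r t - g t) \<le> K1 * \<epsilon> * t powr - \<delta>" using rg[of t] t T0 by (simp add: powr_minus field_simps)
          also have "\<dots> \<le> K1 * \<epsilon> * T powr - \<delta>" using t T0 d0 K10 e by (intro mult_left_mono powr_mono2') auto
          finally show ?thesis unfolding norm_mult using B0(1,2) by (intro mult_mono) (auto simp: th_scale[of T])
        qed
      qed (use th_zero[OF T0] in auto)
      finally show ?thesis .
    qed
    define J where "J = (\<integral>t. of_real (rho \<delta> t) * pairing q (rescaled (max 1 (T * t))) L [(1, a, b, k)] (max 1 (T * t)) \<partial>lborel)"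
    \<comment> \<open>The substitution t = T s brings the time window to [1, 2] and collects the
      powers of T into T^(1 - \<delta>).\<close>
    have hJ: "(\<integral>t. h t \<partial>lborel) = of_real (T powr (1 - \<delta>)) * J"
    proof -
      have "(\<integral>t. h t \<partial>lborel) = T *\<^sub>R (\<integral>t. h (0 + T * t) \<partial>lborel)"
        using lborel_integral_real_affine[of T h 0] T0 by simp
      also have "(\<lambda>t. h (0 + T * t)) = (\<lambda>t. of_real (T powr - \<delta>) * (of_real (rho \<delta> t) * pairing q (rescaled (max 1 (T * t))) L [(1, a, b, k)] (max 1 (T * t))))"
      proof
        fix t
        show "h (0 + T * t) = of_real (T powr - \<delta>) * (of_real (rho \<delta> t) * pairing q (rescaled (max 1 (T * t))) L [(1, a, b, k)] (max 1 (T * t)))"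
        proof (cases "t \<in> {1..2}")
          case True
          then have t: "T * t \<ge> T" "1 \<le> t" using T0 by auto
          have "T powr - \<delta> * ((2 * t) powr - \<delta> * (2 * (T * t)) powr \<delta>) = 1"
            using t T0 by (simp add: powr_mult powr_minus field_simps)
          then have *: "complex_of_real (T powr - \<delta>) * (of_real ((2 * t) powr - \<delta>) * of_real ((2 * (T * t)) powr \<delta>)) = 1"
            by (metis of_real_1 of_real_mult)
          have m1: "max 1 t = t" using t by simp
          have "of_real (T powr - \<delta>) * (of_real (rho \<delta> t) * (of_real ((2 * (T * t)) powr \<delta>) * g (T * t)))
             = (of_real (T powr - \<delta>) * (of_real ((2 * t) powr - \<delta>) * of_real ((2 * (T * t)) powr \<delta>))) * (of_real (th 1 t) * g (T * t))"
            unfolding rho_def m1 of_real_mult by (simp only: mult_ac)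
          then have "of_real (T powr - \<delta>) * (of_real (rho \<delta> t) * (of_real ((2 * (T * t)) powr \<delta>) * g (T * t))) = of_real (th 1 t) * g (T * t)"
            unfolding * by simp
          moreover have "h (0 + T * t) = of_real (th 1 t) * g (T * t)" using T0 by (simp add: h_def th_scale[of T])
          ultimately show ?thesis unfolding Nfg[OF t(1)] by (rule trans[OF _ sym, rotated])
        next
          case False
          then have "th 1 t = 0" using th_zero(1)[of 1 t] by simp
          then show ?thesis using T0 by (simp add: h_def th_scale[of T] rho_def)
        qed
      qed
      also have "T *\<^sub>R (\<integral>t. of_real (T powr - \<delta>) * (of_real (rho \<delta> t) * pairing q (rescaled (max 1 (T * t))) L [(1, a, b, k)] (max 1 (T * t))) \<partial>lborel)
        = of_real (T * T powr - \<delta>) * J"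
        unfolding J_def by (simp add: scaleR_conv_of_real)
      also have "T * T powr - \<delta> = T powr (1 - \<delta>)" using T0 by (simp add: powr_diff powr_minus field_simps)
      finally show ?thesis .
    qed
    \<comment> \<open>The decisive use of \<delta> <= 1: the linear error, of order \<epsilon>, is
      dominated after multiplication by T^(1 - \<delta>), a factor that the other terms already
      carry and that is then cancelled.\<close>
    have T1: "1 \<le> T powr (1 - \<delta>)" using T d by (simp add: ge_one_powr_ge_zero)
    have "T powr (1 - \<delta>) * cmod J = cmod (\<integral>t. h t \<partial>lborel)" unfolding hJ norm_mult by simp
    also have "\<dots> \<le> cmod (\<integral>t. of_real (th T t) * r t \<partial>lborel) + cmod ((\<integral>t. of_real (th T t) * r t \<partial>lborel) - (\<integral>t. h t \<partial>lborel))"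
      by (metis norm_minus_commute norm_triangle_sub)
    also have "cmod (\<integral>t. of_real (th T t) * r t \<partial>lborel) = cmod (\<integral>t. of_real (th' T t) * p t \<partial>lborel)"
      using weq(3) unfolding lhs(2) rhs(2) by (metis norm_mult norm_minus_cancel norm_ii mult_1_left)
    also have "cmod (\<integral>t. of_real (th' T t) * p t \<partial>lborel) + cmod ((\<integral>t. of_real (th T t) * r t \<partial>lborel) - (\<integral>t. h t \<partial>lborel))
      \<le> B0 * nv * \<epsilon> + (B0 * (K1 * \<epsilon> * T powr - \<delta>)) * T" by (rule add_mono[OF E1 E2])
    also have "(B0 * (K1 * \<epsilon> * T powr - \<delta>)) * T = T powr (1 - \<delta>) * (B0 * K1 * \<epsilon>)"
      using T0 by (simp add: powr_diff powr_minus field_simps)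
    also have "B0 * nv * \<epsilon> \<le> T powr (1 - \<delta>) * (B0 * nv * \<epsilon>)"
      using mult_right_mono[OF T1, of "B0 * nv * \<epsilon>"] B0(1) K10 e by simp
    finally have "T powr (1 - \<delta>) * cmod J \<le> T powr (1 - \<delta>) * (K * \<epsilon>)"
      by (simp add: K_def distrib_left distrib_right mult_ac)
    then show ?thesis unfolding J_def[symmetric] using T0 by simp
  qed
  have "0 \<le> K" unfolding K_def using B0(1) K10 by simp
  then show ?thesis using main by blast
qed

text \<open>For a fixed combination, T tends to infinity through the integers: the time integral
  tends to \<open>I / (2 * pi)\<close> times the integral over one period, while the bound
  \<open>K * \<epsilon>\<close> stays put. Division by \<open>I > 0\<close> finishes.\<close>

lemma mean_bound:
  fixes u :: "real \<Rightarrow> (real^'d::finite) \<times> real \<Rightarrow> complex" and b :: "real^'d" and q :: real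
  assumes sol: "global_solution (q + 1) u" and q: "0 < q" "q \<le> 1" and d: "real DIM(real^'d) * q / 2 \<le> 1" and a: "0 < a"
  shows "\<exists>K. \<forall>L \<epsilon>. valid L \<longrightarrow> nrm mX (comb L 0) \<le> M \<longrightarrow> 0 \<le> \<epsilon> \<longrightarrow> \<epsilon> \<le> 1
    \<longrightarrow> (\<forall>\<^sub>F t in at_top. nrm mX (\<lambda>z. u t z - comb L t z) \<le> \<epsilon>)
    \<longrightarrow> cmod (\<integral>s. pairing q prof L [(1, a, b, k)] s \<partial>mT) \<le> K * \<epsilon>"
proof -
  define \<delta> where "\<delta> = real DIM(real^'d) * q / 2"
  obtain K where K: "0 \<le> K" "\<And>L \<epsilon> T. valid L \<Longrightarrow> nrm mX (comb L 0) \<le> M \<Longrightarrow> 0 \<le> \<epsilon> \<Longrightarrow> \<epsilon> \<le> 1 \<Longrightarrow> 1 \<le> T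
    \<Longrightarrow> (\<forall>t\<ge>T. nrm mX (\<lambda>z. u t z - comb L t z) \<le> \<epsilon>)
    \<Longrightarrow> cmod (\<integral>t. of_real (rho \<delta> t) * pairing q (rescaled (max 1 (T * t))) L [(1, a, b, k)] (max 1 (T * t)) \<partial>lborel) \<le> K * \<epsilon>"
    using time_integral_bound[OF sol q d a, of M b k] unfolding \<delta>_def[symmetric] by blast
  define I where "I = (\<integral>t. rho \<delta> t \<partial>lborel)"
  have I: "0 < I" unfolding I_def by (rule rho_integral_pos)
  have "cmod (\<integral>s. pairing q prof L [(1, a, b, k)] s \<partial>mT) \<le> (2 * pi / I * K) * \<epsilon>"
    if L: "valid L" and M: "nrm mX (comb L 0) \<le> M" and e: "0 \<le> \<epsilon>" "\<epsilon> \<le> 1"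
      and ev: "\<forall>\<^sub>F t in at_top. nrm mX (\<lambda>z. u t z - comb L t z) \<le> \<epsilon>" for L \<epsilon>
  proof -
    obtain T where T: "\<And>t. t \<ge> T \<Longrightarrow> nrm mX (\<lambda>z. u t z - comb L t z) \<le> \<epsilon>"
      using ev by (auto simp: eventually_at_top_linorder)
    have "valid [(1, a, b, k)]" using a by simp
    note lim = tendsto_norm[OF rho_pairing_limit[OF L this q, of \<delta>]]
    have "cmod (of_real I * (\<integral>s. pairing q prof L [(1, a, b, k)] s \<partial>mT) / of_real (2 * pi)) \<le> K * \<epsilon>"
      unfolding I_def
    proof (rule LIMSEQ_le_const2[OF lim], intro exI allI impI)
      fix n assume n: "nat \<lceil>T\<rceil> \<le> n"
      have "T \<le> real (Suc n)" using n by linarith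
      then show "cmod (\<integral>t. of_real (rho \<delta> t) * pairing q (rescaled (max 1 (real (Suc n) * t))) L [(1, a, b, k)] (max 1 (real (Suc n) * t)) \<partial>lborel) \<le> K * \<epsilon>"
        using T by (intro K L M e) auto
    qed
    then have "I * cmod (\<integral>s. pairing q prof L [(1, a, b, k)] s \<partial>mT) / (2 * pi) \<le> K * \<epsilon>"
      using I by (simp add: norm_mult norm_divide)
    then show ?thesis using I by (simp add: field_simps)
  qed
  then show ?thesis by blast
qed

section \<open>The limiting profile vanishes\<close>

lemma profile_Cons: "profile ((c, a, b, k) # L) = (\<lambda>z. c * profile [(1, a, b, k)] z + profile L z)"
  by (simp add: profile_def mode_sum_simps fun_eq_iff)

lemma profile_Nil: "profile [] = (\<lambda>z. 0)"
  by (simp add: profile_def mode_sum_simps fun_eq_iff)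

lemma profile_single: "profile [(1, a, b, k)] z = prof a b (fst z) * ee (k, k\<^sup>2) (snd z)"
  by (simp add: profile_def mode_sum_simps ek_def ee_def)

lemma profile_diff: "profile L z - profile L' z = profile (L @ map (\<lambda>(c, r). (- 1 * c, r)) L') z"
proof -
  have "profile (map (\<lambda>(c, r). (- 1 * c, r)) L') z = - profile L' z"
    by (induction L') (auto simp: profile_def mode_sum_simps algebra_simps)
  moreover have "profile (L @ L'') z = profile L z + profile L'' z" for L''
    by (induction L) (auto simp: profile_def mode_sum_simps)
  ultimately show ?thesis by simp
qed

lemma profile_l2_integrable:
  fixes L :: "'a::euclidean_space modes"
  assumes "valid L" shows "profile L \<in> l2 mO" "integrable mO (profile L)"
proof -
  obtain C c where C: "0 \<le> C" "0 < c" "\<And>z. cmod (profile L z) \<le> C * exp (- c * (norm (fst z))\<^sup>2)"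
    using profile_bound[OF assms] by blast
  have Cb: "cmod (profile L z) \<le> C" for z
    using order_trans[OF C(3)[of z] mult_left_mono[of "exp (- c * (norm (fst z))\<^sup>2)" 1 C]] C(1,2) by simp
  show i: "integrable mO (profile L)"
    by (rule Bochner_Integration.integrable_bound[OF mO_integrable_exp[OF C(2), of C]])
       (use C(3) in \<open>auto intro!: AE_I2 intro: order_trans[OF _ abs_ge_self] cong: measurable_cong_sets\<close>)
  show "profile L \<in> l2 mO"
  proof (rule l2I)
    show "integrable mO (\<lambda>z. (cmod (profile L z))\<^sup>2)"
    proof (rule Bochner_Integration.integrable_bound)
      show "integrable mO (\<lambda>z. C * cmod (profile L z))" by (intro integrable_mult_right integrable_norm i)
      show "AE z in mO. norm ((cmod (profile L z))\<^sup>2) \<le> norm (C * cmod (profile L z))"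
        using C(1) Cb by (intro AE_I2) (simp add: power2_eq_square mult_right_mono abs_mult)
    qed (simp cong: measurable_cong_sets)
  qed (simp cong: measurable_cong_sets)
qed

text \<open>Both pairings contain the same integral of Gaussian profiles; the torus contributes (2
  pi)^2 where the circle contributes 2 pi.\<close>

lemma profile_inner1:
  fixes b b' :: "'a::euclidean_space"
  assumes "0 < a" "0 < a'"
  shows "ip mO (profile [(1, a, b, k)]) (profile [(1, a', b', k')]) = of_real (2 * pi) * ip mX (gm a b k 0) (gm a' b' k' 0)"
proof -
  have l: "prof a b \<in> l2 lborel" "prof a' b' \<in> l2 lborel"
    using prof_integrable(2) assms by (auto intro!: l2I)
  have i1: "integrable lborel (\<lambda>\<xi>. prof a b \<xi> * cnj (prof a' b' \<xi>))" by (rule l2_mult_integrable(2)[OF l])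
  have "ip mO (profile [(1, a, b, k)]) (profile [(1, a', b', k')])
    = (\<integral>z. (prof a b (fst z) * cnj (prof a' b' (fst z))) * (ee (k, k\<^sup>2) (snd z) * cnj (ee (k', k'\<^sup>2) (snd z))) \<partial>(lborel \<Otimes>\<^sub>M mTT))"
    unfolding ip_def profile_single mO_def by (simp add: mult_ac)
  also have "\<dots> = (\<integral>\<xi>. prof a b \<xi> * cnj (prof a' b' \<xi>) \<partial>lborel) * (\<integral>w. ee (k, k\<^sup>2) w * cnj (ee (k', k'\<^sup>2) w) \<partial>mTT)"
    by (rule integrable_prod_mult(2)[OF sigma_finite_lborel sigma_finite_mTT i1 ee_integrable])
  also have "(\<integral>w. ee (k, k\<^sup>2) w * cnj (ee (k', k'\<^sup>2) w) \<partial>mTT) = (if k = k' then of_real ((2 * pi)\<^sup>2) else 0)"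
    unfolding ee_orth by simp
  finally show ?thesis unfolding gm_inner[OF assms] by (simp add: power2_eq_square)
qed

lemma profile_inner:
  fixes L L' :: "'a::euclidean_space modes"
  assumes "valid L" "valid L'"
  shows "ip mO (profile L) (profile L') = of_real (2 * pi) * ip mX (comb L 0) (comb L' 0)"
proof -
  have one: "ip mO (profile L) (profile [(1, a, b, k)]) = of_real (2 * pi) * ip mX (comb L 0) (gm a b k 0)"
    if "0 < a" for a k and b :: 'a
    using assms(1)
  proof (induction L)
    case Nil
    then show ?case by (simp add: profile_Nil comb_Nil ip_def)
  next
    case (Cons x L)
    obtain c a' b' k' where x: "x = (c, a', b', k')" by (cases x)
    have v: "0 < a'" "valid L" using Cons.prems by (simp_all add: x)
    have "valid [(1, a', b', k')]" "valid [(1, a, b, k)]" using v that by simp_all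
    note l = profile_l2_integrable(1)[OF this(1)] profile_l2_integrable(1)[OF this(2)] profile_l2_integrable(1)[OF v(2)]
    show ?case unfolding x profile_Cons[of c a' b' k' L] comb_Cons
      using Cons.IH[OF v(2)] profile_inner1[OF v(1) that, of b' k' b k]
      by (simp add: ip_add_left[OF l2_cmult[OF l(1)] l(3) l(2)] ip_add_left[OF l2_cmult[OF gm_l2[OF v(1)]] comb_l2[OF v(2)] gm_l2[OF that]] ip_cmult_left distrib_left)
  qed
  show ?thesis using assms(2)
  proof (induction L')
    case Nil
    then show ?case by (simp add: profile_Nil comb_Nil ip_def)
  next
    case (Cons x L')
    obtain c a b k where x: "x = (c, a, b, k)" by (cases x)
    have v: "0 < a" "valid L'" using Cons.prems by (simp_all add: x)
    have "valid [(1, a, b, k)]" using v by simp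
    note l = profile_l2_integrable(1)[OF this] profile_l2_integrable(1)[OF v(2)] profile_l2_integrable(1)[OF assms(1)]
    show ?case unfolding x profile_Cons[of c a b k L'] comb_Cons
      using Cons.IH[OF v(2)] one[OF v(1), of b k]
      by (simp add: ip_add_right[OF l2_cmult[OF l(1)] l(2) l(3)] ip_add_right[OF l2_cmult[OF gm_l2[OF v(1)]] comb_l2[OF v(2)] comb_l2[OF assms(1)]] ip_cmult_right distrib_left)
  qed
qed

text \<open>Passing to the profile is an isometry up to the factor from the additional time circle.
  Hence limits of profiles exist, and a vanishing limiting profile forces vanishing data.\<close>

lemma profile_nrm: assumes "valid L" shows "nrm mO (profile L) = sqrt (2 * pi) * nrm mX (comb L 0)"
proof -
  have "complex_of_real ((nrm mO (profile L))\<^sup>2) = of_real (2 * pi) * of_real ((nrm mX (comb L 0))\<^sup>2)"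
    using profile_inner[OF assms assms] unfolding ip_self[OF profile_l2_integrable(1)[OF assms]] ip_self[OF comb_l2[OF assms]] .
  then have "(nrm mO (profile L))\<^sup>2 = (sqrt (2 * pi) * nrm mX (comb L 0))\<^sup>2"
    unfolding of_real_mult[symmetric] of_real_eq_iff by (simp add: power_mult_distrib)
  then show ?thesis by (rule power2_eq_imp_eq) simp_all
qed

lemma profile_nrm_diff:
  assumes "valid L" "valid L'"
  shows "nrm mO (\<lambda>z. profile L z - profile L' z) = sqrt (2 * pi) * nrm mX (\<lambda>z. comb L 0 z - comb L' 0 z)"
  unfolding profile_diff comb_diff using assms by (intro profile_nrm) (simp only: valid_simps simp_thms)

text \<open>At fixed \<xi> a profile is a finite sum of free waves on the torus, the form required
  by the L^4 estimate; modes with equal \<open>k\<close> must be merged.\<close>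

lemma profile_trig: "\<exists>K c. finite K \<and> (\<forall>w. profile L (\<xi>, w) = trig K c w)"
proof (induction L)
  case Nil
  then show ?case by (intro exI[of _ "{}"]) (simp add: profile_Nil trig_def)
next
  case (Cons x L)
  obtain e a b k where x: "x = (e, a, b, k)" by (cases x)
  obtain K c where K: "finite K" "\<And>w. profile L (\<xi>, w) = trig K c w" using Cons by blast
  \<comment> \<open>Adds the new coefficient to an old one when \<open>k\<close> already occurs, and
    reads coefficients outside \<open>K\<close> as 0.\<close>
  define c' where "c' j = (if j = k then e * prof a b \<xi> else 0) + (if j \<in> K then c j else 0)" for j
  have "profile (x # L) (\<xi>, w) = trig (insert k K) c' w" for w
  proof -
    have "trig (insert k K) c' w = (\<Sum>j\<in>insert k K. if j = k then e * prof a b \<xi> * ee (j, j\<^sup>2) w else 0) + (\<Sum>j\<in>insert k K. if j \<in> K then c j * ee (j, j\<^sup>2) w else 0)"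
      unfolding trig_def c'_def sum.distrib[symmetric] by (intro sum.cong) (auto simp: algebra_simps)
    also have "(\<Sum>j\<in>insert k K. if j = k then e * prof a b \<xi> * ee (j, j\<^sup>2) w else 0) = e * prof a b \<xi> * ee (k, k\<^sup>2) w"
      using K(1) by simp
    also have "(\<Sum>j\<in>insert k K. if j \<in> K then c j * ee (j, j\<^sup>2) w else 0) = trig K c w"
    proof -
      have "insert k K \<inter> K = K" by blast
      then show ?thesis using K(1) by (simp add: sum.inter_restrict[symmetric] trig_def)
    qed
    finally show ?thesis unfolding x profile_Cons[of e a b k L] profile_single K(2) by simp
  qed
  then show ?case using K(1) by (intro exI[of _ "insert k K"] exI[of _ c']) simp
qed

lemma mO_slice_measurable:
  fixes H :: "'a::euclidean_space \<times> (real \<times> real) \<Rightarrow> complex"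
  assumes "H \<in> borel_measurable mO" shows "(\<lambda>w. H (\<xi>, w)) \<in> borel_measurable mTT"
  using measurable_Pair2[of H lborel mTT borel \<xi>] assms by (simp add: mO_def)

text \<open>Orthogonality in all variables is first localised in \<xi>: the centres \<open>b\<close>
  supply all characters in \<xi>, so for a.e. \<xi> the slice of the nonlinearity is orthogonal to
  every free wave on the torus. Slices of the approximating profiles converge in L2 for a.e. \<xi>
  along a subsequence, and the torus argument applies slice by slice.\<close>

lemma profile_zero:
  fixes H :: "'a::euclidean_space \<times> (real \<times> real) \<Rightarrow> complex"
  assumes q: "0 < q" "q \<le> 1" and H: "H \<in> l2 mO" and L: "\<And>n. valid (Ls n)"
    and lim: "(\<lambda>n. nrm mO (\<lambda>z. profile (Ls n) z - H z)) \<longlonglongrightarrow> 0"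
    and orth: "\<And>b k. (\<integral>z. fnl q (H z) * cnj (profile [(1, 1, b, k)] z) \<partial>mO) = 0"
  shows "nrm mO H = 0"
proof -
  note [measurable] = l2_meas[OF H]
  note Hs[measurable] = mO_slice_measurable[OF l2_meas[OF H]]
  define F where "F k \<xi> = (\<integral>w. fnl q (H (\<xi>, w)) * cnj (ee (k, k\<^sup>2) w) \<partial>mTT)" for k \<xi>
  have "AE \<xi> in lborel. F k \<xi> = 0" for k
  proof -
    have ii: "integrable lborel (\<lambda>\<xi>. cnj (prof 1 b \<xi>) * F k \<xi>) \<and> (\<integral>\<xi>. cnj (prof 1 b \<xi>) * F k \<xi> \<partial>lborel) = 0" for b
    proof -
      have v: "valid [(1, 1, b, k)]" by simp
      note l = profile_l2_integrable[OF v]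
      obtain C c where C: "0 \<le> C" "0 < c" "\<And>z. cmod (profile [(1, 1, b, k)] z) \<le> C * exp (- c * (norm (fst z))\<^sup>2)"
        using profile_bound[OF v] by blast
      have Cb: "cmod (profile [(1, 1, b, k)] z) \<le> C" for z
        using order_trans[OF C(3)[of z] mult_left_mono[of "exp (- c * (norm (fst z))\<^sup>2)" 1 C]] C(1,2) by simp
      have i: "integrable mO (\<lambda>z. fnl q (H z) * cnj (profile [(1, 1, b, k)] z))"
        by (rule fnl_mult_integrable[OF H l2_meas[OF l(1)] l(2) Cb]) (use q in auto)
      have eq: "(\<integral>w. fnl q (H (\<xi>, w)) * cnj (profile [(1, 1, b, k)] (\<xi>, w)) \<partial>mTT) = cnj (prof 1 b \<xi>) * F k \<xi>" for \<xi>
        unfolding F_def integral_mult_right_zero[symmetric] profile_single by (simp add: mult_ac)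
      show ?thesis
        using lTT.integrable_fst'[OF i[unfolded mO_def]] lTT.integral_fst'[OF i[unfolded mO_def]] orth[of b k]
        unfolding eq mO_def by simp
    qed
    \<comment> \<open>For \<open>a = 1\<close> the conjugate profile is a fixed Gaussian times the
      character with frequency \<open>b\<close>; varying \<open>b\<close> alone gives a vanishing
      Fourier transform.\<close>
    have p: "cnj (prof 1 b \<xi>) = of_real (exp (- (norm \<xi>)\<^sup>2 / 2)) * exp (\<i> * of_real (b \<bullet> \<xi>))" for b \<xi> :: 'a
    proof -
      have "of_real (exp (- (norm \<xi>)\<^sup>2 / 2)) * exp (\<i> * of_real (b \<bullet> \<xi>)) = exp (of_real (- (norm \<xi>)\<^sup>2 / 2) + \<i> * of_real (b \<bullet> \<xi>))"
        by (simp only: exp_add exp_of_real)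
      then show ?thesis by (simp add: prof_def exp_cnj)
    qed
    have "AE \<xi> in lborel. of_real (exp (- (norm \<xi>)\<^sup>2 / 2)) * F k \<xi> = 0"
    proof (rule AE_zero_if_fourier_zero)
      show "integrable lborel (\<lambda>\<xi>. of_real (exp (- (norm \<xi>)\<^sup>2 / 2)) * F k \<xi>)"
        using conjunct1[OF ii[of 0]] unfolding p by simp
      show "(\<integral>\<xi>. of_real (exp (- (norm \<xi>)\<^sup>2 / 2)) * F k \<xi> * exp (\<i> * of_real (b \<bullet> \<xi>)) \<partial>lborel) = 0" for b
        using conjunct2[OF ii[of b]] unfolding p by (simp add: mult_ac)
    qed
    then show ?thesis by eventually_elim simp
  qed
  then have F0: "AE \<xi> in lborel. \<forall>k. F k \<xi> = 0" by (subst AE_all_countable) blast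
  define d where "d n \<xi> = (\<integral>w. (cmod (profile (Ls n) (\<xi>, w) - H (\<xi>, w)))\<^sup>2 \<partial>mTT)" for n \<xi>
  have di: "integrable (lborel \<Otimes>\<^sub>M mTT) (\<lambda>z. (cmod (profile (Ls n) z - H z))\<^sup>2)" for n
    using l2_int[OF l2_diff[OF profile_l2_integrable(1)[OF L[of n]] H]] by (simp add: mO_def)
  have d: "integrable lborel (d n)" "(\<integral>\<xi>. norm (d n \<xi>) \<partial>lborel) = (nrm mO (\<lambda>z. profile (Ls n) z - H z))\<^sup>2" for n
  proof -
    show "integrable lborel (d n)" unfolding d_def[abs_def] by (rule lTT.integrable_fst'[OF di])
    have "norm (d n \<xi>) = d n \<xi>" for \<xi> by (simp add: d_def)
    then show "(\<integral>\<xi>. norm (d n \<xi>) \<partial>lborel) = (nrm mO (\<lambda>z. profile (Ls n) z - H z))\<^sup>2"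
      unfolding nrm_sq using lTT.integral_fst'[OF di[of n]] by (simp add: d_def mO_def)
  qed
  \<comment> \<open>By Fubini the squared L2 distance on the product is the L1 norm of the squared
    distances of slices, so a subsequence of the latter tends to 0 a.e.\<close>
  have "(\<lambda>n. \<integral>\<xi>. norm (d n \<xi>) \<partial>lborel) \<longlonglongrightarrow> 0"
    unfolding d(2) using tendsto_power[OF lim, of 2] by simp
  from tendsto_L1_AE_subseq[OF d(1) this] obtain r :: "nat \<Rightarrow> nat" where r: "AE \<xi> in lborel. (\<lambda>n. d (r n) \<xi>) \<longlonglongrightarrow> 0" by blast
  have Hi: "integrable (lborel \<Otimes>\<^sub>M mTT) (\<lambda>z. (cmod (H z))\<^sup>2)" using l2_int[OF H] by (simp add: mO_def)
  have "AE \<xi> in lborel. (\<integral>w. (cmod (H (\<xi>, w)))\<^sup>2 \<partial>mTT) = 0"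
    using F0 r lTT.AE_integrable_fst'[OF Hi]
  proof eventually_elim
    case (elim \<xi>)
    have Hl: "(\<lambda>w. H (\<xi>, w)) \<in> l2 mTT" by (rule l2I[OF Hs elim(3)])
    obtain K c where K: "\<And>n. finite (K n)" "\<And>n w. profile (Ls (r n)) (\<xi>, w) = trig (K n) (c n) w"
      using profile_trig[of "Ls (r _)" \<xi>] by metis
    have "AE w in mTT. H (\<xi>, w) = 0"
    proof (rule torus_unique[OF q Hl])
      show "(\<lambda>n. nrm mTT (\<lambda>w. trig (K n) (c n) w - H (\<xi>, w))) \<longlonglongrightarrow> 0"
        using tendsto_real_sqrt[OF elim(2)] by (simp add: nrm_def d_def K(2))
      show "(\<integral>w. fnl q (H (\<xi>, w)) * cnj (ee (k, k\<^sup>2) w) \<partial>mTT) = 0" for k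
        using elim(1) by (simp add: F_def)
    qed (rule K(1))
    then have "(\<integral>w. (cmod (H (\<xi>, w)))\<^sup>2 \<partial>mTT) = (\<integral>w. 0 \<partial>mTT)"
      by (intro integral_cong_AE) (auto elim!: eventually_mono)
    then show ?case by simp
  qed
  then have "(\<integral>\<xi>. (\<integral>w. (cmod (H (\<xi>, w)))\<^sup>2 \<partial>mTT) \<partial>lborel) = (\<integral>\<xi>. 0 \<partial>(lborel :: 'a measure))"
    using lTT.integrable_fst'[OF Hi] by (intro integral_cong_AE) (auto dest: borel_measurable_integrable)
  then have "(nrm mO H)\<^sup>2 = 0" unfolding nrm_sq using lTT.integral_fst'[OF Hi] by (simp add: mO_def)
  then show ?thesis by simp
qed

text \<open>The profile map carries the Cauchy sequence of initial data to a Cauchy sequence with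
  norms multiplied by \<open>sqrt (2 * pi)\<close>. The norm identity is what finally contradicts a
  vanishing limit.\<close>

lemma profile_limit_exists:
  fixes h :: "'a::euclidean_space \<times> real \<Rightarrow> complex"
  assumes h: "h \<in> l2 mX" and L: "\<And>n. valid (Ls n)" and lim: "(\<lambda>n. nrm mX (\<lambda>z. comb (Ls n) 0 z - h z)) \<longlonglongrightarrow> 0"
  shows "\<exists>H\<in>l2 mO. (\<lambda>n. nrm mO (\<lambda>z. profile (Ls n) z - H z)) \<longlonglongrightarrow> 0 \<and> nrm mO H = sqrt (2 * pi) * nrm mX h"
proof -
  have cau: "\<exists>N. \<forall>i\<ge>N. \<forall>j\<ge>N. nrm mO (\<lambda>z. profile (Ls i) z - profile (Ls j) z) < e" if e: "e > 0" for e
  proof -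
    define e' where "e' = e / sqrt (2 * pi) / 2"
    have "0 < e'" using e by (simp add: e'_def)
    from order_tendstoD(2)[OF lim this] obtain N where N: "\<And>n. n \<ge> N \<Longrightarrow> nrm mX (\<lambda>z. comb (Ls n) 0 z - h z) < e'"
      by (auto simp: eventually_sequentially)
    have "nrm mO (\<lambda>z. profile (Ls i) z - profile (Ls j) z) < e" if "i \<ge> N" "j \<ge> N" for i j
    proof -
      have "nrm mX (\<lambda>z. comb (Ls i) 0 z - comb (Ls j) 0 z) < 2 * e'"
        using nrm_triangle_diff[OF comb_l2[OF L[of i]] h comb_l2[OF L[of j]], of 0 0] N[OF that(1)] N[OF that(2)]
        by (simp add: nrm_commute[of mX h])
      then have "sqrt (2 * pi) * nrm mX (\<lambda>z. comb (Ls i) 0 z - comb (Ls j) 0 z) < sqrt (2 * pi) * (2 * e')"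
        by (intro mult_strict_left_mono) simp_all
      then show ?thesis unfolding profile_nrm_diff[OF L L] by (simp add: e'_def)
    qed
    then show ?thesis by blast
  qed
  define w where "w z = exp (- (1 / 2) * (norm (fst z))\<^sup>2)" for z :: "'a \<times> (real \<times> real)"
  have wm: "w \<in> borel_measurable borel" unfolding w_def[abs_def] borel_prod[symmetric] by measurable
  have w2: "(w z)\<^sup>2 = 1 * exp (- 1 * (norm (fst z))\<^sup>2)" for z
    unfolding w_def power2_eq_square[of "exp _"] exp_add[symmetric] by simp
  have "integrable mO (\<lambda>z. (w z)\<^sup>2)" unfolding w2 by (rule mO_integrable_exp) simp
  then obtain H where H: "H \<in> l2 mO" "(\<lambda>n. nrm mO (\<lambda>z. profile (Ls n) z - H z)) \<longlonglongrightarrow> 0"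
    using l2_complete[OF profile_l2_integrable(1)[OF L] cau, of w] wm by (auto simp: w_def cong: measurable_cong_sets)
  have "(\<lambda>n. nrm mO (profile (Ls n))) \<longlonglongrightarrow> nrm mO H" by (rule nrm_tendsto[OF profile_l2_integrable(1)[OF L] H])
  moreover have "(\<lambda>n. nrm mO (profile (Ls n))) \<longlonglongrightarrow> sqrt (2 * pi) * nrm mX h"
    unfolding profile_nrm[OF L] by (intro tendsto_mult_left nrm_tendsto comb_l2 L h lim)
  ultimately have "nrm mO H = sqrt (2 * pi) * nrm mX h" by (rule LIMSEQ_unique)
  then show ?thesis using H by blast
qed

theorem theorem2p1:
  fixes u :: "real \<Rightarrow> (real^'d::finite) \<times> real \<Rightarrow> complex"
    and h :: "(real^'d) \<times> real \<Rightarrow> complex"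
    and p :: real
  assumes "1 < p" and "p \<le> 2" and "p \<le> 1 + 2 / real CARD('d)"
    and "global_solution p u"
    and "h \<in> L2" and "L2norm h \<noteq> 0"
  shows "\<not> ((\<lambda>t. L2norm (\<lambda>z. u t z - free_prop t h z)) \<longlongrightarrow> 0) at_top"
proof
  assume lim: "((\<lambda>t. L2norm (\<lambda>z. u t z - free_prop t h z)) \<longlongrightarrow> 0) at_top"
  define q where "q = p - 1"
  have q: "0 < q" "q \<le> 1" and sol: "global_solution (q + 1) u" using assms by (simp_all add: q_def)
  have d: "real DIM(real^'d) * q / 2 \<le> 1"
    using assms(3) by (simp add: q_def field_simps)
  have h: "h \<in> l2 mX" using assms(5) by (simp add: L2_eq_l2)
  have h0: "nrm mX h \<noteq> 0" using assms(6) L2norm_eq_nrm[OF h] by simp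
  note ul = global_solution_l2[OF sol]
  have "\<forall>n. \<exists>L. valid L \<and> nrm mX (\<lambda>z. h z - comb L 0 z) < inverse (real (Suc n))"
    by (intro allI comb_dense[OF h]) simp
  then obtain Ls where Ls: "\<And>n. valid (Ls n)" "\<And>n. nrm mX (\<lambda>z. h z - comb (Ls n) 0 z) < inverse (real (Suc n))" by metis
  have Llim: "(\<lambda>n. nrm mX (\<lambda>z. comb (Ls n) 0 z - h z)) \<longlonglongrightarrow> 0"
    by (rule Lim_null_comparison[OF _ LIMSEQ_inverse_real_of_nat])
       (use Ls(2) in \<open>auto simp: nrm_commute[of mX _ h] intro!: always_eventually less_imp_le\<close>)
  obtain H where H: "H \<in> l2 mO" "(\<lambda>n. nrm mO (\<lambda>z. profile (Ls n) z - H z)) \<longlonglongrightarrow> 0" "nrm mO H = sqrt (2 * pi) * nrm mX h"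
    using profile_limit_exists[OF h Ls(1) Llim] by blast
  \<comment> \<open>One error comes from the assumed scattering; the other is the approximation
    error of the data, carried unchanged from time 0 to time \<open>t\<close> by
    \<open>free_prop_approx\<close>.\<close>
  have app: "\<forall>\<^sub>F t in at_top. nrm mX (\<lambda>z. u t z - comb (Ls n) t z) \<le> 2 * inverse (real (Suc n))" for n
  proof -
    have "0 < inverse (real (Suc n))" by simp
    from order_tendstoD(2)[OF lim this] eventually_ge_at_top[of 0] show ?thesis
    proof eventually_elim
      case (elim t)
      note f = free_prop_approx[OF h, where t=t]
      have "nrm mX (\<lambda>z. u t z - free_prop t h z) < inverse (real (Suc n))"
        using elim(1) L2norm_eq_nrm[OF l2_diff[OF ul[OF elim(2)] f(1)]] by simp
      moreover have "nrm mX (\<lambda>z. free_prop t h z - comb (Ls n) t z) < inverse (real (Suc n))"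
        unfolding f(2)[OF Ls(1)] by (rule Ls(2))
      ultimately show ?case
        using nrm_triangle_diff[OF ul[OF elim(2)] f(1) comb_l2[OF Ls(1)[of n]], of t] by simp
    qed
  qed
  \<comment> \<open>A norm bound shared by all \<open>Ls n\<close>, so that
    \<open>mean_bound\<close> supplies a single constant for the whole sequence.\<close>
  have nb: "nrm mX (comb (Ls n) 0) \<le> nrm mX h + 1" for n
  proof -
    have "inverse (real (Suc n)) \<le> 1" by (simp add: inverse_le_1_iff)
    then show ?thesis using nrm_le_diff[OF comb_l2[OF Ls(1)[of n]] h, of 0] Ls(2)[of n] by (simp add: nrm_commute[of mX h])
  qed
  have orth: "(\<integral>z. fnl q (H z) * cnj (profile [(1, 1, b, k)] z) \<partial>mO) = 0" for b :: "real^'d" and k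
  proof -
    have v: "valid [(1, 1, b, k)]" by simp
    note l = profile_l2_integrable[OF v]
    define V where "V = profile [(1, 1, b, k)]"
    obtain C c where C: "0 \<le> C" "0 < c" "\<And>z. cmod (V z) \<le> C * exp (- c * (norm (fst z))\<^sup>2)"
      unfolding V_def using profile_bound[OF v] by blast
    have Cb: "1 * cmod (V z) \<le> C" for z
      using order_trans[OF C(3)[of z] mult_left_mono[of "exp (- c * (norm (fst z))\<^sup>2)" 1 C]] C(1,2) by simp
    define \<Lambda> where "\<Lambda> n = (\<integral>z. fnl q (profile (Ls n) z) * cnj (V z) \<partial>mO)" for n
    obtain K where K: "\<And>L \<epsilon>. valid L \<Longrightarrow> nrm mX (comb L 0) \<le> nrm mX h + 1 \<Longrightarrow> 0 \<le> \<epsilon> \<Longrightarrow> \<epsilon> \<le> 1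
      \<Longrightarrow> (\<forall>\<^sub>F t in at_top. nrm mX (\<lambda>z. u t z - comb L t z) \<le> \<epsilon>)
      \<Longrightarrow> cmod (\<integral>s. pairing q prof L [(1, 1, b, k)] s \<partial>mT) \<le> K * \<epsilon>"
      using mean_bound[OF sol q d zero_less_one, of "nrm mX h + 1" b k] by blast
    \<comment> \<open>The restriction \<open>1 <= n\<close> makes the accuracy 2 / (n + 1) at most
      1, as \<open>mean_bound\<close> demands.\<close>
    have "cmod (\<Lambda> n) \<le> K * (2 * inverse (real (Suc n)))" if n: "1 \<le> n" for n
      unfolding \<Lambda>_def V_def pairing_mean[OF Ls(1) v less_imp_le[OF q(1)] q(2), symmetric]
      by (rule K[OF Ls(1) nb _ _ app]) (use n in \<open>auto simp: field_simps\<close>)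
    moreover have "(\<lambda>n. K * (2 * inverse (real (Suc n)))) \<longlonglongrightarrow> K * (2 * 0)"
      by (intro tendsto_mult_left LIMSEQ_inverse_real_of_nat)
    ultimately have l0: "\<Lambda> \<longlonglongrightarrow> 0"
      by (intro Lim_null_comparison[of \<Lambda>]) (auto intro!: eventually_mono[OF eventually_ge_at_top[of 1]])
    define D where "D n = nrm mO (\<lambda>z. profile (Ls n) z - H z)" for n
    \<comment> \<open>The nonlinear pairing with the bounded test profile is continuous in L2, by
      \<open>fnl_ip_diff\<close> at scale 1; the vanishing of \<Lambda> thus passes to the limiting
      profile.\<close>
    have "(\<lambda>n. \<Lambda> n - (\<integral>z. fnl q (H z) * cnj (V z) \<partial>mO)) \<longlonglongrightarrow> 0"
    proof (rule Lim_null_comparison)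
      show "\<forall>\<^sub>F n in sequentially. norm (\<Lambda> n - (\<integral>z. fnl q (H z) * cnj (V z) \<partial>mO)) \<le> 2 * D n * (nrm mO V + C * (nrm mO (profile (Ls n)) + nrm mO H))"
        unfolding \<Lambda>_def D_def
        using fnl_ip_diff[OF q zero_less_one profile_l2_integrable(1)[OF Ls(1)] H(1) l[folded V_def] Cb]
        by (intro always_eventually allI) simp
      have "(\<lambda>n. 2 * D n * (nrm mO V + C * (nrm mO (profile (Ls n)) + nrm mO H))) \<longlonglongrightarrow> 2 * 0 * (nrm mO V + C * (nrm mO H + nrm mO H))"
        unfolding D_def by (intro tendsto_intros H(2) nrm_tendsto profile_l2_integrable(1) Ls(1) H(1))
      then show "(\<lambda>n. 2 * D n * (nrm mO V + C * (nrm mO (profile (Ls n)) + nrm mO H))) \<longlonglongrightarrow> 0" by simp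
    qed
    from tendsto_diff[OF l0 this] show ?thesis by (simp add: V_def LIMSEQ_const_iff)
  qed
  have "nrm mO H = 0" by (rule profile_zero[OF q H(1) Ls(1) H(2) orth])
  then show False using H(3) h0 by simp
qed

end
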